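(* Let $g:X\to\mathbb{R}^d$ and $f:X\to\mathbb{R}^p$ be measurable. Suppose that: (i) each $\Pi_k$ ($k=1,\dots,K$) is $\pi$-stationary; (ii) there is a probability measure $\psi$ on $(X,\mathscr{X})$ such that for each $k=1,\dots,K$, each $A\in\mathscr{X}$ with $\psi(A)>0$ and each $x\in X$ there is a positive integer $t$ with $P_k^{Kt}(x,A)>0$; (iii) for $k=1,\dots,K$ there are sets $D_k\in\mathscr{X}$ that are small with respect to $P_k^K$, constants $\lambda_k<1$ and $b_k<\infty$, and measurable functions $W_k:X\to[1,\infty)$ with $P_k^KW_k(x)\le \lambda_kW_k(x)+b_kI_{D_k}(x)$ for all $x\in X$; (iv) each composition kernel $P_k^K$ is aperiodic; (v) $\int\pi(dx)W_k^2(x)<\infty$ for each $k$; (vi) $|a^Tg(x)|\le W_k(x)$ for all $x\in X$, all $k$ and all $a\in\mathbb{R}^d$ with $\|a\|_2\le 1$; (vii) $\int\pi(dx)g(x)=0$; (viii) $\int\pi(dx)f^Tf<\infty$. Let $C$ be a $p\times d$ real matrix and let $\Sigma_C$ be the asymptotic variance of the fixed weight control variate sums $S_M=\sum_{t=0}^{M-1}\big[g(X_t)-C^T\{f(X_t)-\Pi_{\sigma^t(1)}f(X_t)\}\big]$ along the deterministic sweep chain $\{X_t\}$ with arbitrary initial law. Then $$\Sigma_C=\int\pi(dx)gg^T+K^{-1}\sum_{k=1}^K\sum_{t=1}^\infty\int\pi(dx)\{g(P_k^tg)^T+(P_k^tg)g^T\}+C^TUC-C^TV-V^TC,$$ and $\Sigma_C$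 is minimized (in the positive semidefinite order, over $p\times d$ matrices $C$) at $C=\tilde C:=U^\dagger V$. If in addition each $\Pi_k$ is a Gibbs kernel with respect to $(h_k,\pi)$ for some measurable $h_k:X\to\mathbb{R}^{m_k}$, $m_k\ge1$, then $V=\int\pi(dx)fg^T$.
   Context: $X$ is a complete separable metric space with Borel $\sigma$-algebra $\mathscr{X}$, $\pi$ is a probability measure on $(X,\mathscr{X})$, $K\ge1$ is an integer and $\Pi_1,\dots,\Pi_K:X\times\mathscr{X}\to[0,1]$ are probability kernels. A kernel $\Pi$ is $\pi$-stationary if $\pi(A)=\int\pi(dx)\Pi(x,A)$ for all $A\in\mathscr{X}$. A kernel $\Pi$ is a Gibbs kernel with respect to $(h,\pi)$ if it is a regular conditional distribution given $\sigma(h)$ under $\pi$: for each $A\in\mathscr{X}$, $\Pi(\cdot,A)=E_\pi\{I_A\mid\sigma(h)\}$ $\pi$-a.e. For a function $u$, $\Pi u(x)=\int\Pi(x,dy)u(y)$ (elementwise for vector or matrix valued $u$; for real-valued $\pi$-integrable $u$ the integral converges absolutely for $\pi$-a.e. $x$, and we set $\Pi u(x)=0$ where it does not). $I_A$ is the indicator function of $A$. $\sigma:\{1,\dots,K\}\to\{1,\dots,K\}$ is the cyclic permutation $\sigma(k)=k+1$ for $k<K$, $\sigma(K)=1$; $\sigma^t$ is its $t$-fold iterate. $P_k^0u=u$, $P_k^tu=\Pi_{\sigma^0(k)}\Pi_{\sigma^1(k)}\cdots\Pi_{\sigma^{t-1}(k)}u$ for $t\ge1$, and $P_k^t(x,A)=P_k^tI_A(x)$.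 A set $D\in\mathscr{X}$ is small with respect to a probability kernel $P$ if there are an integer $m>0$ and a non-trivial measure $\nu_m$ on $(X,\mathscr{X})$ with $P^m(x,B)\ge\nu_m(B)$ for all $x\in D$, $B\in\mathscr{X}$. The kernel $P_k^K$ is aperiodic if $d=1$ is the largest integer for which there exist disjoint sets $E_1,\dots,E_d\in\mathscr{X}$ with $P_k^K(x,E_{i+1})=1$ for $x\in E_i$ (indices mod $d$) and $\psi\{(\cup_iE_i)^c\}=0$, where $\psi$ is the irreducibility measure. The deterministic sweep chain with initial law $\nu$ is the Markov chain with $X_0\sim\nu$ and, given $X_0,\dots,X_t$, $X_{t+1}\sim\Pi_{\sigma^t(1)}(X_t,\cdot)$. The asymptotic variance of $S_M$ is the $d\times d$ positive semidefinite matrix $\Sigma$ such that $M^{-1/2}S_M$ converges in distribution, as $M\to\infty$, to a random vector with characteristic function $t\mapsto\exp\{-t^T\Sigma t/2\}$. Under hypotheses (i)–(vii), the functions $\hat g_k=\sum_{t=0}^\infty P_k^tg$ are well defined $\pi$-a.e. and square integrable with respect to $\pi$. Define $$U_k=\int\pi(dx)\{ff^T-(\Pi_kf)(\Pi_kf)^T\},\qquad V_k=\int\pi(dx)\{f\hat g_{\sigma(k)}^T-(\Pi_kf)(\Pi_k\hat g_{\sigma(k)})^T\},$$ $U=K^{-1}\sum_{k=1}^KU_k$ and $V=K^{-1}\sum_{k=1}^KV_k$. $A^\dagger$ is the Moore–Penrose pseudoinverse. For symmetric matrices, $A\ge B$ means $A-B$ is positive semidefinite. *)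

theory Defs
  imports "HOL-Probability.Probability"
begin

section \<open>Kernels on a Polish space\<close>

definition prob_kernel :: "('x::polish_space \<Rightarrow> 'x measure) \<Rightarrow> bool" where
  "prob_kernel P \<longleftrightarrow> P \<in> borel \<rightarrow>\<^sub>M prob_algebra borel"

definition stationary_kernel :: "'x::polish_space measure \<Rightarrow> ('x \<Rightarrow> 'x measure) \<Rightarrow> bool" where
  "stationary_kernel \<pi> P \<longleftrightarrow>
     (\<forall>A\<in>sets borel. emeasure \<pi> A = (\<integral>\<^sup>+ x. emeasure (P x) A \<partial>\<pi>))"

text \<open>The target space of h is a parameter, so that the dimension of the range of h may be
  given by a natural number.\<close>

definition gibbs_kernel ::
  "'x::polish_space measure \<Rightarrow> 'y measure \<Rightarrow> ('x \<Rightarrow> 'y) \<Rightarrow> ('x \<Rightarrow> 'x measure) \<Rightarrow> bool" where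
  "gibbs_kernel \<pi> N h P \<longleftrightarrow>
     (\<forall>A\<in>sets borel. AE x in \<pi>.
        measure (P x) A = real_cond_exp \<pi> (vimage_algebra (space \<pi>) h N) (indicat_real A) x)"

definition kernel_comp :: "('x::polish_space \<Rightarrow> 'x measure) \<Rightarrow> ('x \<Rightarrow> 'x measure) \<Rightarrow> 'x \<Rightarrow> 'x measure" where
  "kernel_comp P R x = P x \<bind> R"

definition kernel_power :: "('x::polish_space \<Rightarrow> 'x measure) \<Rightarrow> nat \<Rightarrow> 'x \<Rightarrow> 'x measure" where
  "kernel_power P m = (kernel_comp P ^^ m) (return borel)"

definition small_set :: "('x::polish_space \<Rightarrow> 'x measure) \<Rightarrow> 'x set \<Rightarrow> bool" where
  "small_set P D \<longleftrightarrow> D \<in> sets borel \<and>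
     (\<exists>m>0. \<exists>\<nu>. sets \<nu> = sets borel \<and> emeasure \<nu> UNIV > 0 \<and>
        (\<forall>x\<in>D. \<forall>B\<in>sets borel. emeasure (kernel_power P m x) B \<ge> emeasure \<nu> B))"

definition kernel_cycle :: "'x::polish_space measure \<Rightarrow> ('x \<Rightarrow> 'x measure) \<Rightarrow> nat \<Rightarrow> bool" where
  "kernel_cycle \<psi> P d \<longleftrightarrow> d \<ge> 1 \<and>
     (\<exists>E :: nat \<Rightarrow> 'x set.
        (\<forall>i<d. E i \<in> sets borel) \<and> disjoint_family_on E {..<d} \<and>
        (\<forall>i<d. \<forall>x\<in>E i. emeasure (P x) (E (Suc i mod d)) = 1) \<and>
        emeasure \<psi> (- (\<Union>i<d. E i)) = 0)"

definition aperiodic_kernel :: "'x::polish_space measure \<Rightarrow> ('x \<Rightarrow> 'x measure) \<Rightarrow> bool" where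
  "aperiodic_kernel \<psi> P \<longleftrightarrow> kernel_cycle \<psi> P 1 \<and> (\<forall>d. kernel_cycle \<psi> P d \<longrightarrow> d \<le> 1)"

text \<open>The Bochner integral is 0 by convention where it does not converge absolutely.\<close>

definition kernel_op :: "('x::polish_space \<Rightarrow> 'x measure) \<Rightarrow> ('x \<Rightarrow> real) \<Rightarrow> 'x \<Rightarrow> real" where
  "kernel_op P u x = (\<integral>y. u y \<partial>P x)"

definition kernel_op_vec ::
  "('x::polish_space \<Rightarrow> 'x measure) \<Rightarrow> ('x \<Rightarrow> real^'n) \<Rightarrow> 'x \<Rightarrow> real^'n" where
  "kernel_op_vec P u x = (\<chi> i. kernel_op P (\<lambda>y. u y $ i) x)"

section \<open>Cyclic sweeps through the kernels Q 1, ..., Q K\<close>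

definition cyc :: "nat \<Rightarrow> nat \<Rightarrow> nat" where
  "cyc K k = (if k < K then k + 1 else 1)"

definition sweep_op ::
  "nat \<Rightarrow> (nat \<Rightarrow> 'x::polish_space \<Rightarrow> 'x measure) \<Rightarrow> nat \<Rightarrow> nat \<Rightarrow> ('x \<Rightarrow> real) \<Rightarrow> 'x \<Rightarrow> real" where
  "sweep_op K Q k t = foldr (\<lambda>s. kernel_op (Q ((cyc K ^^ s) k))) [0..<t]"

definition sweep_op_vec ::
  "nat \<Rightarrow> (nat \<Rightarrow> 'x::polish_space \<Rightarrow> 'x measure) \<Rightarrow> nat \<Rightarrow> nat \<Rightarrow> ('x \<Rightarrow> real^'n) \<Rightarrow> 'x \<Rightarrow> real^'n" where
  "sweep_op_vec K Q k t = foldr (\<lambda>s. kernel_op_vec (Q ((cyc K ^^ s) k))) [0..<t]"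

definition sweep_kernel ::
  "nat \<Rightarrow> (nat \<Rightarrow> 'x::polish_space \<Rightarrow> 'x measure) \<Rightarrow> nat \<Rightarrow> nat \<Rightarrow> 'x \<Rightarrow> 'x measure" where
  "sweep_kernel K Q k t = foldr (\<lambda>s. kernel_comp (Q ((cyc K ^^ s) k))) [0..<t] (return borel)"

lemma cyc_funpow_range:
  assumes "K \<ge> 1" "k \<in> {1..K}"
  shows "(cyc K ^^ s) k \<in> {1..K}"
  using assms by (induction s) (auto simp: cyc_def)

lemma prob_kernel_foldr:
  assumes "\<And>s. s \<in> set ts \<Longrightarrow> prob_kernel (R s)"
  shows "prob_kernel (foldr (\<lambda>s. kernel_comp (R s)) ts (return borel))"
  using assms
proof (induction ts)
  case Nil
  show ?case by (simp add: prob_kernel_def)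
next
  case (Cons s ts)
  then have "R s \<in> borel \<rightarrow>\<^sub>M prob_algebra borel"
    "foldr (\<lambda>s. kernel_comp (R s)) ts (return borel) \<in> borel \<rightarrow>\<^sub>M prob_algebra borel"
    by (auto simp: prob_kernel_def)
  then show ?case
    unfolding prob_kernel_def kernel_comp_def[abs_def] foldr_Cons o_def by measurable
qed

lemma measure_foldr_kernel_comp:
  assumes "\<And>s. s \<in> set ts \<Longrightarrow> prob_kernel (R s)" and "A \<in> sets borel"
  shows "measure (foldr (\<lambda>s. kernel_comp (R s)) ts (return borel) x) A
    = foldr (\<lambda>s. kernel_op (R s)) ts (indicat_real A) x"
  using assms(1)
proof (induction ts arbitrary: x)
  case Nil
  show ?case using assms(2) by (simp add: measure_return)
next
  case (Cons s ts)
  let ?F = "foldr (\<lambda>s. kernel_comp (R s)) ts (return borel)"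
  have s: "prob_kernel (R s)" and F: "prob_kernel ?F"
    using Cons.prems prob_kernel_foldr[of ts R] by auto
  have in_pa: "R s x \<in> space (prob_algebra borel)"
    using s by (auto simp: prob_kernel_def intro: measurable_space)
  then have sp: "subprob_space (R s x)" and sets: "sets (R s x) = sets borel"
    by (auto simp: space_prob_algebra intro: prob_space_imp_subprob_space)
  have "measure (R s x \<bind> ?F) A = (\<integral>y. measure (?F y) A \<partial>R s x)"
  proof (rule subprob_space.measure_bind[OF sp])
    have "?F \<in> borel \<rightarrow>\<^sub>M subprob_algebra borel"
      using F by (auto simp: prob_kernel_def intro: measurable_prob_algebraD)
    then show "?F \<in> R s x \<rightarrow>\<^sub>M subprob_algebra borel"
      by (simp add: measurable_cong_sets[OF sets refl])
  qed (use assms(2) in auto)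
  also have "\<dots> = kernel_op (R s) (foldr (\<lambda>s. kernel_op (R s)) ts (indicat_real A)) x"
    using Cons by (simp add: kernel_op_def[of "R s"])
  finally show ?case
    by (simp only: foldr_Cons o_def kernel_comp_def[of "R s"])
qed

text \<open>P(x,A) is P applied to the indicator of A, for each of the composite kernels.\<close>

lemma measure_sweep_kernel:
  assumes "K \<ge> 1" "k \<in> {1..K}" "\<And>j. j \<in> {1..K} \<Longrightarrow> prob_kernel (Q j)" "A \<in> sets borel"
  shows "measure (sweep_kernel K Q k t x) A = sweep_op K Q k t (indicat_real A) x"
  unfolding sweep_kernel_def sweep_op_def
  by (rule measure_foldr_kernel_comp)
     (use assms(3,4) cyc_funpow_range[OF assms(1,2)] in auto)

lemma sweep_op_vec_nth:
  fixes Q :: "nat \<Rightarrow> 'x::polish_space \<Rightarrow> 'x measure" and u :: "'x \<Rightarrow> real^'n"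
  shows "sweep_op_vec K Q k t u x $ i = sweep_op K Q k t (\<lambda>y. u y $ i) x"
proof -
  have "foldr (\<lambda>s. kernel_op_vec (R s)) ts u x $ i
      = foldr (\<lambda>s. kernel_op (R s)) ts (\<lambda>y. u y $ i) x"
    for R :: "nat \<Rightarrow> 'x \<Rightarrow> 'x measure" and ts
  proof (induction ts arbitrary: x)
    case (Cons s ts)
    then show ?case
      by (simp only: foldr_Cons o_def kernel_op_vec_def[of "R s"] vec_lambda_beta)
  qed simp
  then show ?thesis by (simp add: sweep_op_vec_def sweep_op_def)
qed

text \<open>The conditioning \<open>\<sigma>\<close>-algebra is the one generated by X 0, ..., X t.\<close>

definition sweep_chain ::
  "nat \<Rightarrow> (nat \<Rightarrow> 'x::polish_space \<Rightarrow> 'x measure) \<Rightarrow> 'x measure \<Rightarrow> 'w measure \<Rightarrow> (nat \<Rightarrow> 'w \<Rightarrow> 'x) \<Rightarrow> bool" where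
  "sweep_chain K Q \<nu> M X \<longleftrightarrow>
     prob_space M \<and> (\<forall>t. X t \<in> M \<rightarrow>\<^sub>M borel) \<and> distr M borel (X 0) = \<nu> \<and>
     (\<forall>t. \<forall>A\<in>sets borel. AE w in M.
        real_cond_exp M
          (vimage_algebra (space M) (\<lambda>w. \<lambda>s\<in>{..t}. X s w) (\<Pi>\<^sub>M s\<in>{..t}. borel))
          (indicat_real (X (Suc t) -` A \<inter> space M)) w
        = measure (Q ((cyc K ^^ t) 1) (X t w)) A)"

section \<open>Matrices\<close>

definition outer :: "real^'m \<Rightarrow> real^'n \<Rightarrow> real^'n^'m" where
  "outer u v = (\<chi> i j. u $ i * v $ j)"

definition psd :: "real^'n^'n \<Rightarrow> bool" where
  "psd A \<longleftrightarrow> transpose A = A \<and> (\<forall>x. x \<bullet> (A *v x) \<ge> 0)"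

text \<open>The four Penrose equations.\<close>

definition is_pinv :: "real^'n^'m \<Rightarrow> real^'m^'n \<Rightarrow> bool" where
  "is_pinv A B \<longleftrightarrow> A ** B ** A = A \<and> B ** A ** B = B \<and>
     transpose (A ** B) = A ** B \<and> transpose (B ** A) = B ** A"

definition pinv :: "real^'n^'m \<Rightarrow> real^'m^'n" where
  "pinv A = (THE B. is_pinv A B)"

section \<open>Asymptotic variance and control variates\<close>

definition converges_in_distribution ::
  "'w measure \<Rightarrow> (nat \<Rightarrow> 'w \<Rightarrow> real^'n) \<Rightarrow> (real^'n) measure \<Rightarrow> bool" where
  "converges_in_distribution M Y \<mu> \<longleftrightarrow>
     (\<forall>\<phi> :: real^'n \<Rightarrow> real. continuous_on UNIV \<phi> \<longrightarrow> bounded (range \<phi>) \<longrightarrow>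
        (\<lambda>n. \<integral>w. \<phi> (Y n w) \<partial>M) \<longlonglongrightarrow> (\<integral>y. \<phi> y \<partial>\<mu>))"

definition has_asymptotic_variance ::
  "'w measure \<Rightarrow> (nat \<Rightarrow> 'w \<Rightarrow> real^'n) \<Rightarrow> real^'n^'n \<Rightarrow> bool" where
  "has_asymptotic_variance M S V \<longleftrightarrow> psd V \<and>
     (\<exists>\<mu>. prob_space \<mu> \<and> sets \<mu> = sets borel \<and>
        (\<forall>t. (CLINT y|\<mu>. iexp (t \<bullet> y)) = exp (- complex_of_real (t \<bullet> (V *v t)) / 2)) \<and>
        converges_in_distribution M (\<lambda>n w. (1 / sqrt (real n)) *\<^sub>R S n w) \<mu>)"

definition cv_sum ::
  "nat \<Rightarrow> (nat \<Rightarrow> 'x::polish_space \<Rightarrow> 'x measure) \<Rightarrow> ('x \<Rightarrow> real^'d) \<Rightarrow> ('x \<Rightarrow> real^'p) \<Rightarrow> real^'d^'p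
    \<Rightarrow> (nat \<Rightarrow> 'w \<Rightarrow> 'x) \<Rightarrow> nat \<Rightarrow> 'w \<Rightarrow> real^'d" where
  "cv_sum K Q g f C X n w =
     (\<Sum>t<n. g (X t w)
        - transpose C *v (f (X t w) - kernel_op_vec (Q ((cyc K ^^ t) 1)) f (X t w)))"

definition g_hat ::
  "nat \<Rightarrow> (nat \<Rightarrow> 'x::polish_space \<Rightarrow> 'x measure) \<Rightarrow> ('x \<Rightarrow> real^'d) \<Rightarrow> nat \<Rightarrow> 'x \<Rightarrow> real^'d" where
  "g_hat K Q g k x = (\<Sum>t. sweep_op_vec K Q k t g x)"

definition U_comp ::
  "'x::polish_space measure \<Rightarrow> (nat \<Rightarrow> 'x \<Rightarrow> 'x measure) \<Rightarrow> ('x \<Rightarrow> real^'p) \<Rightarrow> nat \<Rightarrow> real^'p^'p" where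
  "U_comp \<pi> Q f k =
     (\<integral>x. outer (f x) (f x) - outer (kernel_op_vec (Q k) f x) (kernel_op_vec (Q k) f x) \<partial>\<pi>)"

definition V_comp ::
  "'x::polish_space measure \<Rightarrow> nat \<Rightarrow> (nat \<Rightarrow> 'x \<Rightarrow> 'x measure) \<Rightarrow> ('x \<Rightarrow> real^'d) \<Rightarrow> ('x \<Rightarrow> real^'p)
    \<Rightarrow> nat \<Rightarrow> real^'d^'p" where
  "V_comp \<pi> K Q g f k =
     (\<integral>x. outer (f x) (g_hat K Q g (cyc K k) x)
         - outer (kernel_op_vec (Q k) f x) (kernel_op_vec (Q k) (g_hat K Q g (cyc K k)) x) \<partial>\<pi>)"

definition U_mat ::
  "'x::polish_space measure \<Rightarrow> nat \<Rightarrow> (nat \<Rightarrow> 'x \<Rightarrow> 'x measure) \<Rightarrow> ('x \<Rightarrow> real^'p) \<Rightarrow> real^'p^'p" where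
  "U_mat \<pi> K Q f = (1 / real K) *\<^sub>R (\<Sum>k=1..K. U_comp \<pi> Q f k)"

definition V_mat ::
  "'x::polish_space measure \<Rightarrow> nat \<Rightarrow> (nat \<Rightarrow> 'x \<Rightarrow> 'x measure) \<Rightarrow> ('x \<Rightarrow> real^'d) \<Rightarrow> ('x \<Rightarrow> real^'p)
    \<Rightarrow> real^'d^'p" where
  "V_mat \<pi> K Q g f = (1 / real K) *\<^sub>R (\<Sum>k=1..K. V_comp \<pi> K Q g f k)"

definition lag_cov ::
  "'x::polish_space measure \<Rightarrow> nat \<Rightarrow> (nat \<Rightarrow> 'x \<Rightarrow> 'x measure) \<Rightarrow> ('x \<Rightarrow> real^'d) \<Rightarrow> nat \<Rightarrow> nat
    \<Rightarrow> real^'d^'d" where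
  "lag_cov \<pi> K Q g k t =
     (\<integral>x. outer (g x) (sweep_op_vec K Q k t g x) + outer (sweep_op_vec K Q k t g x) (g x) \<partial>\<pi>)"

end

(* A small set of an aperiodic irreducible kernel makes all sublevel sets of the drift function
   small, so the contraction argument of Hairer and Mattingly applies to every full sweep.  Hence
   g_hat converges geometrically fast in L2 and solves the Poisson equation
   Q k (g_hat (cyc k)) = g_hat k - g.  For fixed a, the sum a . S_M therefore differs by a
   coboundary from a martingale whose increments u_t (X_{t+1}) - (Q u_t) (X_t) have
   u_t = a . g_hat - (C a) . f.  The central limit theorem for it is proved under pi, by estimating
   products of twisted transition operators in L1(pi); ergodicity then removes the dependence on the
   initial law, and Levy continuity assembles the directions a.  The limiting variance is the average over k
   of the conditional covariances of u_t, a nonnegative quadratic function of C; expanding it with the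
   Poisson equation gives the formula, and its minimizer is the pseudoinverse solution.  For a Gibbs
   kernel, Q k is a self-adjoint projection, so the terms of V telescope along the sweep. *)
theory Submission
  imports Defs
begin

subsection \<open>Positive semidefinite matrices and the pseudoinverse\<close>

text \<open>The obstacle is a mismatch of null sets. The functions \<open>g_hat\<close> and the
  kernel integrals of \<open>f\<close> are controlled only \<pi>-almost everywhere, while the
  initial law is arbitrary and may be singular to \<pi>. Hence the martingale approximation is never
  carried out along the given chain. The characteristic function of the sum is written as the
  initial integral of a product of operators, and only functions bounded by 1 pass from one initial
  law to the other; for these the convergence of full sweeps holds at every starting point. The
  second difficulty is that the increments are merely square integrable. Dominated convergence,
  under a kernel and then under \<pi>, takes the place of a Lindeberg condition, and the mean zero
  fluctuation of the conditional variance is averaged out by mixing in L1 instead of a law of large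
  numbers. Finally, the stability hypotheses concern full sweeps only, so decay is first obtained at
  multiples of \<open>K\<close> and the incomplete sweep left over is absorbed by stationarity.
  Matrix identities are tested with vectors, which turns them into statements about real functions
  in L2.\<close>

lemma outer_mult_vec: "outer u v *v x = (v \<bullet> x) *\<^sub>R u"
  by (simp add: vec_eq_iff outer_def matrix_vector_mult_def inner_vec_def sum_distrib_left
      sum_distrib_right mult_ac)

lemma transpose_outer: "transpose (outer u v) = outer v u"
  by (simp add: vec_eq_iff outer_def transpose_def mult.commute)

lemma matrix_distrib:
  fixes A :: "real^'n^'m"
  shows "A ** (B - C) = A ** B - A ** C" "(A - A') ** B = A ** B - A' ** B"
    "(A + A') ** B = A ** B + A' ** B"
  by (simp_all add: vec_eq_iff matrix_matrix_mult_def sum.distrib sum_subtractf algebra_simps)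

lemma transpose_zero: "transpose (0 :: real^'n^'m) = 0"
  by (simp add: vec_eq_iff transpose_def)

lemma inner_transpose_mult: "x \<bullet> (transpose A *v y) = (A *v x) \<bullet> (y :: real^'n)"
  by (metis dot_lmul_matrix inner_commute transpose_matrix_vector)

lemma inner_symmetric_mult:
  fixes A :: "real^'n^'n"
  assumes "transpose A = A"
  shows "x \<bullet> (A *v y) = y \<bullet> (A *v x)"
  by (metis assms inner_commute inner_transpose_mult)

lemma psd_form_add:
  fixes A :: "real^'n^'n"
  assumes "psd A"
  shows "(x + s *\<^sub>R y) \<bullet> (A *v (x + s *\<^sub>R y))
    = x \<bullet> (A *v x) + 2 * s * (x \<bullet> (A *v y)) + s\<^sup>2 * (y \<bullet> (A *v y))"
  using inner_symmetric_mult[of A y x] assms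
  by (simp add: psd_def matrix_vector_right_distrib matrix_vector_mult_scaleR inner_add_left
      inner_add_right power2_eq_square algebra_simps)

lemma affine_nonneg_imp_slope_zero:
  fixes a b :: real
  assumes "\<And>s. a + s * b \<ge> 0"
  shows "b = 0"
proof (rule ccontr)
  assume "b \<noteq> 0"
  then show False using assms[of "-(a+1)/b"] by (simp add: field_simps)
qed

text \<open>Along the line \<open>x + s *\<^sub>R y\<close> the form is affine in \<open>s\<close>,
  and an affine function that stays nonnegative has slope zero.\<close>

lemma psd_null_vector:
  fixes A :: "real^'n^'n"
  assumes "psd A" "y \<bullet> (A *v y) = 0"
  shows "A *v y = 0"
proof -
  have "x \<bullet> (A *v y) = 0" for x
  proof -
    have "x \<bullet> (A *v x) + s * (2 * (x \<bullet> (A *v y))) \<ge> 0" for s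
      using psd_form_add[OF assms(1), of x s y] assms
      by (metis (no_types, opaque_lifting) add.right_neutral mult.assoc mult.left_commute mult_zero_right psd_def)
    from affine_nonneg_imp_slope_zero[OF this] show ?thesis by simp
  qed
  then show ?thesis by (metis inner_eq_zero_iff)
qed

text \<open>One step of symmetric elimination. The reduced form at \<open>x\<close> is the minimum
  over \<open>s\<close> of the form of \<open>A\<close> at \<open>x + s *\<^sub>R y\<close>,
  attained at \<open>s = - b / c\<close> with \<open>b = x \<bullet> (A *v y)\<close> and
  \<open>c = y \<bullet> (A *v y)\<close>.\<close>

lemma psd_schur_complement:
  fixes A :: "real^'n^'n"
  assumes "psd A" "0 < y \<bullet> (A *v y)"
  shows "psd (A - (1 / (y \<bullet> (A *v y))) *\<^sub>R outer (A *v y) (A *v y))" (is "psd ?A'")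
proof -
  let ?c = "y \<bullet> (A *v y)"
  have "transpose ?A' = ?A'"
    using assms(1) by (simp add: psd_def vec_eq_iff transpose_def outer_def mult.commute)
  moreover have "x \<bullet> (?A' *v x) \<ge> 0" for x
  proof -
    let ?b = "x \<bullet> (A *v y)"
    have "0 \<le> x \<bullet> (A *v x) + 2 * (- ?b / ?c) * ?b + (- ?b / ?c)\<^sup>2 * ?c"
      using psd_form_add[OF assms(1), of x "- ?b / ?c" y] assms(1) unfolding psd_def by metis
    also have "\<dots> = x \<bullet> (A *v x) - ?b\<^sup>2 / ?c"
      using assms(2) by (simp add: field_simps power2_eq_square)
    also have "\<dots> = x \<bullet> (?A' *v x)"
      by (simp add: matrix_vector_mult_diff_rdistrib scaleR_matrix_vector_assoc[symmetric] outer_mult_vec inner_diff_right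
          inner_commute power2_eq_square)
    finally show ?thesis .
  qed
  ultimately show ?thesis by (simp add: psd_def)
qed

lemma axis_form: "axis i 1 \<bullet> (A *v axis i 1) = (A :: real^'n^'n) $ i $ i"
  by (simp add: inner_axis' matrix_vector_mult_basis column_def)

lemma mult_axis_nth: "(A *v axis i 1) $ j = (A :: real^'n^'m) $ j $ i"
  by (simp add: matrix_vector_mult_basis column_def)

text \<open>Elimination splits \<open>A\<close> into \<open>A'\<close> plus a rank one matrix, and
  adding an independent standard normal multiple of \<open>v\<close> to a vector with covariance
  \<open>A'\<close> realizes the split. Each step clears one diagonal entry and revives none, so the
  induction is on the number of nonzero diagonal entries.\<close>

lemma gaussian_measure_exists:
  fixes A :: "real^'n^'n"
  assumes "psd A"
  shows "\<exists>\<mu>. prob_space \<mu> \<and> sets \<mu> = sets borel \<and>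
    (\<forall>t. (CLINT y|\<mu>. iexp (t \<bullet> y)) = exp (- complex_of_real (t \<bullet> (A *v t)) / 2))"
  using assms
proof (induction "card {i. A $ i $ i \<noteq> 0}" arbitrary: A rule: less_induct)
  case less
  show ?case
  proof (cases "{i. A $ i $ i \<noteq> 0} = {}")
    case True
    \<comment> \<open>A positive semidefinite matrix with zero diagonal vanishes, so the point mass
      at 0 serves.\<close>
    have "A *v axis i 1 = 0" for i
      using True axis_form[of i A] by (intro psd_null_vector less.prems) auto
    then have "A = 0" using mult_axis_nth[of A] by (simp add: vec_eq_iff)
    then show ?thesis
      by (intro exI[of _ "return borel 0"]) (auto intro: prob_space_return simp: integral_return)
  next
    case False
    then obtain i where i: "A $ i $ i \<noteq> 0" by auto
    let ?y = "axis i 1 :: real^'n"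
    let ?c = "A $ i $ i"
    define w where "w = A *v ?y"
    define A' where "A' = A - (1 / ?c) *\<^sub>R outer w w"
    have c: "?c > 0" using i less.prems axis_form[of i A] unfolding psd_def
      by (metis less_eq_real_def)
    have psd': "psd A'"
      using psd_schur_complement[OF less.prems, of ?y] c unfolding A'_def w_def axis_form by simp
    have A'_diag: "A' $ j $ j = A $ j $ j - (A $ j $ i)\<^sup>2 / ?c" for j
      by (simp add: A'_def outer_def w_def mult_axis_nth power2_eq_square)
    have "A' $ i $ i = 0" using c by (simp add: A'_diag power2_eq_square)
    \<comment> \<open>A zero diagonal entry of \<open>A\<close> kills its whole row and column, so
      subtracting the rank one term leaves it zero.\<close>
    moreover have "A' $ j $ j = 0" if "A $ j $ j = 0" for j
    proof -
      have "A *v axis j 1 = 0" using that axis_form[of j A] by (intro psd_null_vector less.prems) auto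
      then have "A $ i $ j = 0" by (metis mult_axis_nth zero_index)
      then have "A $ j $ i = 0" using less.prems unfolding psd_def
        by (metis transpose_def vec_lambda_beta)
      then show ?thesis using that by (simp add: A'_diag)
    qed
    ultimately have "{j. A' $ j $ j \<noteq> 0} \<subset> {j. A $ j $ j \<noteq> 0}" using i by auto
    then have "card {j. A' $ j $ j \<noteq> 0} < card {j. A $ j $ j \<noteq> 0}"
      by (intro psubset_card_mono) auto
    from less.hyps[OF this psd'] obtain \<mu> where \<mu>: "prob_space \<mu>" "sets \<mu> = sets borel"
      "\<And>t. (CLINT y|\<mu>. iexp (t \<bullet> y)) = exp (- complex_of_real (t \<bullet> (A' *v t)) / 2)" by blast
    define v where "v = (1 / sqrt ?c) *\<^sub>R w"
    have A: "t \<bullet> (A *v t) = t \<bullet> (A' *v t) + (t \<bullet> v)\<^sup>2" for t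
      using c by (simp add: A'_def v_def matrix_vector_mult_diff_rdistrib
          scaleR_matrix_vector_assoc[symmetric] outer_mult_vec inner_diff_right
          inner_commute power2_eq_square)
    let ?N = "std_normal_distribution"
    interpret \<mu>: prob_space \<mu> by fact
    interpret N: prob_space ?N by (rule prob_space_normal_density) simp
    interpret P: pair_prob_space \<mu> ?N ..
    note [measurable_cong] = \<mu>(2)
    let ?f = "\<lambda>p. fst p + snd p *\<^sub>R v"
    let ?M = "distr (\<mu> \<Otimes>\<^sub>M ?N) borel ?f"
    have [measurable]: "?f \<in> borel_measurable (\<mu> \<Otimes>\<^sub>M ?N)" by measurable
    have "(CLINT y|?M. iexp (t \<bullet> y)) = exp (- complex_of_real (t \<bullet> (A *v t)) / 2)" for t
    proof -
      have "(CLINT y|?M. iexp (t \<bullet> y)) = (CLINT p|(\<mu> \<Otimes>\<^sub>M ?N). iexp (t \<bullet> ?f p))"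
        by (intro integral_distr) measurable
      also have "\<dots> = (CLINT p|(\<mu> \<Otimes>\<^sub>M ?N). iexp (t \<bullet> fst p) * iexp ((t \<bullet> v) * snd p))"
        by (simp add: inner_add_right exp_add[symmetric] algebra_simps)
      also have "\<dots> = (CLINT y|\<mu>. CLINT z|?N. iexp (t \<bullet> y) * iexp ((t \<bullet> v) * z))"
        by (subst P.integral_fst'[symmetric])
           (auto intro!: P.integrable_const_bound[where B=1] simp: norm_mult)
      also have "\<dots> = (CLINT y|\<mu>. iexp (t \<bullet> y)) * char ?N (t \<bullet> v)"
        by (simp add: char_def)
      also have "\<dots> = exp (- complex_of_real (t \<bullet> (A *v t)) / 2)"
        by (simp only: \<mu>(3) char_std_normal_distribution A)
           (simp add: exp_of_real[symmetric] exp_add[symmetric] add_divide_distrib diff_divide_distrib)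
      finally show ?thesis .
    qed
    moreover have "prob_space ?M" by (rule P.prob_space_distr) measurable
    ultimately show ?thesis by (intro exI[of _ ?M]) auto
  qed
qed

text \<open>Two pseudoinverses share the projections \<open>A ** B\<close> and
  \<open>B ** A\<close>, and \<open>B = B ** A ** B\<close> recovers \<open>B\<close> from
  these.\<close>

lemma is_pinv_unique:
  assumes "is_pinv A B" "is_pinv A B'"
  shows "B = B'"
proof -
  note a = assms[unfolded is_pinv_def]
  have "A ** B = A ** B'"
  proof -
    have "A ** B = transpose (A ** B)" using a by simp
    also have "\<dots> = transpose ((A ** B' ** A) ** B)" using a by simp
    also have "\<dots> = transpose ((A ** B') ** (A ** B))" by (simp add: matrix_mul_assoc)
    also have "\<dots> = (A ** B) ** (A ** B')" using a by (simp add: matrix_transpose_mul)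
    also have "\<dots> = A ** B'" using a by (simp add: matrix_mul_assoc)
    finally show ?thesis .
  qed
  moreover have "B ** A = B' ** A"
  proof -
    have "B ** A = transpose (B ** A)" using a by simp
    also have "\<dots> = transpose (B ** (A ** B' ** A))" using a by simp
    also have "\<dots> = transpose ((B ** A) ** (B' ** A))" by (simp add: matrix_mul_assoc)
    also have "\<dots> = (B' ** A) ** (B ** A)" using a by (simp add: matrix_transpose_mul)
    also have "\<dots> = B' ** (A ** B ** A)" by (simp add: matrix_mul_assoc)
    also have "\<dots> = B' ** A" using a by simp
    finally show ?thesis .
  qed
  ultimately show ?thesis using a by (metis matrix_mul_assoc)
qed

lemma projection_matrix_exists:
  fixes S :: "(real^'n) set"
  assumes "subspace S"
  shows "\<exists>P :: real^'n^'n. transpose P = P \<and> (\<forall>x. P *v x \<in> S) \<and> (\<forall>x\<in>S. P *v x = x)"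
proof -
  from orthonormal_basis_subspace[OF assms] obtain B where
    B: "B \<subseteq> S" "pairwise orthogonal B" "\<And>x. x \<in> B \<Longrightarrow> norm x = 1" "independent B" "span B = S"
    by metis
  have fin: "finite B" using B(4) by (rule independent_imp_finite)
  define P where "P = (\<Sum>b\<in>B. outer b b)"
  have P: "P *v x = (\<Sum>b\<in>B. (b \<bullet> x) *\<^sub>R b)" for x
    unfolding P_def using fin
    by (induction B rule: finite_induct) (auto simp: matrix_vector_mult_add_rdistrib outer_mult_vec)
  have "transpose P = P" by (simp add: P_def vec_eq_iff transpose_def outer_def mult.commute)
  moreover have "P *v x \<in> S" for x
    unfolding P using B(1) assms by (auto intro!: subspace_sum subspace_scale)
  moreover have "P *v x = x" if "x \<in> S" for x
  proof -
    have "x \<in> span B" using that B(5) by simp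
    then show ?thesis
    proof (induction rule: span_induct_alt)
      case base then show ?case by simp
    next
      case (step c b y)
      have "P *v b = (\<Sum>a\<in>B. if a = b then b else 0)"
        unfolding P using step B(2,3)
        by (intro sum.cong) (auto simp: pairwise_def orthogonal_def dot_square_norm)
      also have "\<dots> = b" using fin step by simp
      finally show ?case using step
        by (simp add: matrix_vector_right_distrib matrix_vector_mult_scaleR)
    qed
  qed
  ultimately show ?thesis by blast
qed

text \<open>Adding the orthogonal projection \<open>P\<close> onto the kernel makes \<open>U\<close>
  invertible. The inverse \<open>M\<close> of \<open>U + P\<close> acts as the identity on the
  kernel, and removing \<open>P\<close> again gives the pseudoinverse.\<close>

lemma is_pinv_symmetric_exists:
  fixes U :: "real^'n^'n"
  assumes sym: "transpose U = U"
  shows "\<exists>B. is_pinv U B"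
proof -
  let ?S = "{x. U *v x = 0}"
  have "subspace ?S"
    by (auto simp: subspace_def matrix_vector_right_distrib matrix_vector_mult_scaleR)
  then obtain P where P: "transpose P = P" "\<And>x. U *v (P *v x) = 0" "\<And>x. U *v x = 0 \<Longrightarrow> P *v x = x"
    using projection_matrix_exists by blast
  have UP: "U ** P = 0"
    unfolding matrix_eq by (simp add: matrix_vector_mul_assoc[symmetric] P(2))
  have "P ** U = transpose (U ** P)" using P(1) sym by (simp add: matrix_transpose_mul)
  then have PU: "P ** U = 0" by (simp add: UP transpose_zero)
  have PP: "P ** P = P"
    unfolding matrix_eq by (simp add: matrix_vector_mul_assoc[symmetric] P)
  have inj: "x = 0" if "(U + P) *v x = 0" for x
  proof -
    have "U *v x + P *v x = 0" using that by (simp add: matrix_vector_mult_add_rdistrib)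
    then have e: "U *v x = - (P *v x)" by (simp add: eq_neg_iff_add_eq_0)
    then have "U *v (U *v x) = 0" using P(2) by (simp add: linear_neg[OF matrix_vector_mul_linear])
    then have "(U *v x) \<bullet> (U *v x) = 0" using inner_transpose_mult[of x U "U *v x"] sym by simp
    then have "U *v x = 0" by simp
    then show ?thesis using P(3)[of x] e by simp
  qed
  obtain M where M: "M ** (U + P) = mat 1"
    using inj by (metis matrix_left_invertible_ker)
  then have M': "(U + P) ** M = mat 1" by (simp add: matrix_left_right_inverse)
  have "M ** P = M ** (U + P) ** P" by (simp add: matrix_distrib UP PP flip: matrix_mul_assoc)
  then have MP: "M ** P = P" using M by simp
  have "P ** M = P ** ((U + P) ** M)" by (simp add: matrix_mul_assoc matrix_add_ldistrib PU PP)
  then have PM: "P ** M = P" using M' by simp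
  define B where "B = M - P"
  have UB: "U ** B = mat 1 - P"
    using M' by (simp add: B_def matrix_distrib UP matrix_distrib PM algebra_simps)
  have BU: "B ** U = mat 1 - P"
    using M by (simp add: B_def matrix_distrib PU matrix_add_ldistrib MP algebra_simps)
  have "transpose (mat 1 - P) = mat 1 - P"
    using P(1) by (auto simp: vec_eq_iff transpose_def mat_def)
  moreover have "(mat 1 - P) ** U = U" by (simp add: matrix_distrib PU)
  moreover have "(mat 1 - P) ** B = B" by (simp add: B_def matrix_distrib PM PP)
  ultimately have "is_pinv U B" by (simp add: is_pinv_def UB BU)
  then show ?thesis ..
qed

lemma is_pinv_pinv:
  fixes U :: "real^'n^'n"
  assumes "transpose U = U"
  shows "is_pinv U (pinv U)"
  unfolding pinv_def using is_pinv_symmetric_exists[OF assms]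
  by (metis (no_types, lifting) is_pinv_unique theI)

lemma psd_conj:
  fixes U :: "real^'p^'p" and C :: "real^'d^'p"
  assumes "psd U"
  shows "psd (transpose C ** U ** C)"
  using assms
  by (auto simp: psd_def matrix_transpose_mul matrix_mul_assoc inner_transpose_mult
      simp del: transpose_matrix_vector simp flip: matrix_vector_mul_assoc)

text \<open>Testing nonnegativity with \<open>C = s y a\<^sup>T\<close>, where \<open>U y = 0\<close> and \<open>a = V\<^sup>T y\<close>, shows
  that the kernel of \<open>U\<close> is contained in that of \<open>V\<^sup>T\<close>, so that \<open>U U\<^sup>\<dagger> V = V\<close>.\<close>

lemma psd_quadratic_minimizer:
  fixes G :: "real^'d^'d" and U :: "real^'p^'p" and V :: "real^'d^'p"
  defines "S \<equiv> \<lambda>C. G + transpose C ** U ** C - transpose C ** V - transpose V ** C"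
  assumes U: "psd U" and S: "\<And>C. psd (S C)"
  shows "psd (S C - S (pinv U ** V))"
proof -
  have symU: "transpose U = U" using U by (simp add: psd_def)
  let ?B = "pinv U"
  note B = is_pinv_pinv[OF symU, unfolded is_pinv_def]
  have ker: "transpose V *v y = 0" if y: "U *v y = 0" for y
  proof -
    define a where "a = transpose V *v y"
    have "a \<bullet> (G *v a) + s * (- 2 * (a \<bullet> a)\<^sup>2) \<ge> 0" for s
    proof -
      let ?C = "s *\<^sub>R outer y a"
      have Ca: "?C *v a = (s * (a \<bullet> a)) *\<^sub>R y"
        by (simp add: outer_mult_vec scaleR_matrix_vector_assoc[symmetric])
      have aV: "y \<bullet> (V *v a) = a \<bullet> a"
        unfolding a_def by (metis inner_commute inner_transpose_mult)
      have "a \<bullet> (S ?C *v a) = a \<bullet> (G *v a) + (?C *v a) \<bullet> (U *v (?C *v a)) - 2 * ((?C *v a) \<bullet> (V *v a))"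
        by (simp add: S_def matrix_vector_mult_diff_rdistrib matrix_vector_mult_add_rdistrib
            inner_add_right inner_diff_right inner_transpose_mult inner_commute[of "V *v a"]
            del: transpose_matrix_vector flip: matrix_vector_mul_assoc)
      also have "\<dots> = a \<bullet> (G *v a) + s * (- 2 * (a \<bullet> a)\<^sup>2)"
        unfolding Ca matrix_vector_mult_scaleR y by (simp add: aV power2_eq_square)
      finally show ?thesis using S[of ?C] unfolding psd_def by metis
    qed
    from affine_nonneg_imp_slope_zero[OF this] show ?thesis by (simp add: a_def)
  qed
  \<comment> \<open>\<open>R\<close> projects orthogonally onto the kernel of \<open>U\<close>. By
    \<open>ker\<close> its columns are annihilated by \<open>transpose V\<close>, and transposing
    gives \<open>R ** V = 0\<close>.\<close>
  define R where "R = mat 1 - U ** ?B"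
  have symR: "transpose R = R"
    using B by (auto simp: R_def vec_eq_iff transpose_def mat_def)
  have "R ** U = 0" using B by (simp add: R_def matrix_distrib)
  moreover have "U ** R = transpose (R ** U)" using symR symU by (simp add: matrix_transpose_mul)
  ultimately have "U ** R = 0" by (simp add: transpose_zero)
  then have "U *v (R *v z) = 0" for z by (simp add: matrix_vector_mul_assoc)
  then have "transpose V ** R = 0"
    unfolding matrix_eq by (simp add: ker del: transpose_matrix_vector flip: matrix_vector_mul_assoc)
  moreover have "R ** V = transpose (transpose V ** R)" using symR by (simp add: matrix_transpose_mul)
  ultimately have "R ** V = 0" by (simp add: transpose_zero)
  then have UC: "U ** (?B ** V) = V" by (simp add: R_def matrix_distrib matrix_mul_assoc)
  define E where "E = ?B ** V"
  have UE: "U ** E = V" using UC E_def by simp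
  have EU: "transpose E ** U = transpose V"
    using arg_cong[OF UE, of transpose] symU by (simp add: matrix_transpose_mul)
  have EV: "transpose E ** V = transpose V ** E"
    using UE EU by (metis matrix_mul_assoc)
  have tdiff: "transpose (C - E) = transpose C - transpose E"
    by (simp add: vec_eq_iff transpose_def)
  have CUE: "transpose C ** U ** E = transpose C ** V" by (metis UE matrix_mul_assoc)
  \<comment> \<open>Completing the square: the linear terms of \<open>S\<close> cancel because
    \<open>U ** E = V\<close>.\<close>
  have "S C - S E = transpose (C - E) ** U ** (C - E)"
    by (simp add: S_def tdiff matrix_distrib matrix_distrib EU CUE EV)
  then show ?thesis using psd_conj[OF U] E_def by metis
qed

subsection \<open>The Levy continuity theorem for random vectors\<close>

lemma borel_measurable_vec_nth [measurable (raw)]: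
  fixes f :: "'w \<Rightarrow> real^'n"
  assumes "f \<in> borel_measurable M"
  shows "(\<lambda>w. f w $ i) \<in> borel_measurable M"
  using assms
  by (rule measurable_compose) (intro borel_measurable_continuous_onI continuous_intros)

section \<open>Trigonometric polynomials and approximation on the torus\<close>

inductive_set trig_poly :: "(real^'n \<Rightarrow> complex) set" where
  monomial: "(\<lambda>x. a * iexp (t \<bullet> x)) \<in> trig_poly"
| add: "f \<in> trig_poly \<Longrightarrow> h \<in> trig_poly \<Longrightarrow> (\<lambda>x. f x + h x) \<in> trig_poly"

lemma trig_poly_const: "(\<lambda>x. a) \<in> trig_poly"
  using trig_poly.monomial[of a 0] by simp

lemma trig_poly_monomial_mult:
  assumes "f \<in> trig_poly"
  shows "(\<lambda>x. a * iexp (t \<bullet> x) * f x) \<in> trig_poly"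
  using assms
proof induction
  case (monomial b s)
  have "(\<lambda>x. (a * b) * iexp ((t + s) \<bullet> x)) \<in> trig_poly" by (rule trig_poly.monomial)
  then show ?case by (simp add: inner_add_left exp_add distrib_left mult_ac)
next
  case (add f h)
  then show ?case by (simp add: distrib_left trig_poly.add)
qed

lemma trig_poly_mult:
  assumes "f \<in> trig_poly" "h \<in> trig_poly"
  shows "(\<lambda>x. f x * h x) \<in> trig_poly"
  using assms(1)
proof induction
  case (monomial a t)
  then show ?case by (rule trig_poly_monomial_mult[OF assms(2)])
next
  case (add f k)
  then show ?case by (simp add: distrib_right trig_poly.add)
qed

lemma trig_poly_sum:
  assumes "finite I" "\<And>i. i \<in> I \<Longrightarrow> f i \<in> trig_poly"
  shows "(\<lambda>x. \<Sum>i\<in>I. f i x) \<in> trig_poly"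
  using assms by (induction I rule: finite_induct) (auto intro: trig_poly_const trig_poly.add)

text \<open>A product of unit circles is compact, so polynomials approximate continuous functions
  uniformly there; composed with this map they become trigonometric polynomials.\<close>

definition torus_map :: "real \<Rightarrow> real^'n \<Rightarrow> complex^'n" where
  "torus_map c x = (\<chi> i. cis (c * x $ i))"

lemma trig_poly_cos_sin:
  "(\<lambda>x. complex_of_real (cos (c * x $ i))) \<in> trig_poly"
  "(\<lambda>x. complex_of_real (sin (c * x $ i))) \<in> trig_poly"
proof -
  have e: "(c *\<^sub>R axis i 1) \<bullet> x = c * x $ i" "((- c) *\<^sub>R axis i 1) \<bullet> x = - (c * x $ i)" for x
    by (simp_all add: inner_axis')
  have "(\<lambda>x. (1/2) * iexp ((c *\<^sub>R axis i 1) \<bullet> x) + (1/2) * iexp (((- c) *\<^sub>R axis i 1) \<bullet> x)) \<in> trig_poly"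
    by (intro trig_poly.intros)
  then show "(\<lambda>x. complex_of_real (cos (c * x $ i))) \<in> trig_poly"
    unfolding e by (simp add: cos_of_real[symmetric] cos_exp_eq add_divide_distrib)
  have s: "complex_of_real (sin y) = (- \<i> / 2) * iexp y + (\<i> / 2) * iexp (- y)" for y
    by (simp add: sin_of_real[symmetric] sin_exp_eq field_simps)
  have "(\<lambda>x. (- \<i> / 2) * iexp ((c *\<^sub>R axis i 1) \<bullet> x) + (\<i> / 2) * iexp (((- c) *\<^sub>R axis i 1) \<bullet> x)) \<in> trig_poly"
    by (intro trig_poly.intros)
  then show "(\<lambda>x. complex_of_real (sin (c * x $ i))) \<in> trig_poly"
    unfolding e s .
qed

text \<open>Real polynomial functions are generated by bounded linear functionals, and over the
  reals \<open>torus_map c x\<close> is a combination of the fixed vectors \<open>axis i 1\<close>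
  and \<open>axis i \<i>\<close> with cosine and sine coefficients.\<close>

lemma trig_poly_polynomial:
  fixes p :: "complex^'n \<Rightarrow> real"
  assumes "real_polynomial_function p"
  shows "(\<lambda>x. complex_of_real (p (torus_map c x))) \<in> trig_poly"
  using assms
proof induction
  case (linear h)
  then interpret bounded_linear h .
  have "h (torus_map c x) = (\<Sum>i\<in>UNIV. cos (c * x $ i) * h (axis i 1) + sin (c * x $ i) * h (axis i \<i>))" for x
  proof -
    have "torus_map c x = (\<Sum>i\<in>UNIV. cos (c * x $ i) *\<^sub>R axis i 1 + sin (c * x $ i) *\<^sub>R axis i \<i>)"
    proof (subst vec_eq_iff, rule allI)
      fix j
      have "(\<Sum>i\<in>UNIV. cos (c * x $ i) *\<^sub>R axis i 1 + sin (c * x $ i) *\<^sub>R axis i \<i>) $ j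
        = (\<Sum>i\<in>UNIV. if i = j then complex_of_real (cos (c * x $ i)) + \<i> * complex_of_real (sin (c * x $ i)) else 0)"
        unfolding sum_component by (intro sum.cong) (auto simp: axis_def complex_eq_iff)
      then show "torus_map c x $ j = (\<Sum>i\<in>UNIV. cos (c * x $ i) *\<^sub>R axis i 1 + sin (c * x $ i) *\<^sub>R axis i \<i>) $ j"
        by (simp add: torus_map_def complex_eq_iff)
    qed
    then show ?thesis by (simp add: sum add scaleR)
  qed
  moreover have "(\<lambda>x. \<Sum>i\<in>UNIV. complex_of_real (cos (c * x $ i)) * complex_of_real (h (axis i 1))
      + complex_of_real (sin (c * x $ i)) * complex_of_real (h (axis i \<i>))) \<in> trig_poly"
    by (intro trig_poly_sum trig_poly.add trig_poly_mult trig_poly_cos_sin trig_poly_const) auto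
  ultimately show ?case by simp
next
  case (const a)
  then show ?case by (simp add: trig_poly_const)
next
  case (add p q)
  then show ?case by (simp add: trig_poly.add)
next
  case (mult p q)
  then show ?case by (simp add: trig_poly_mult)
qed

text \<open>A continuous function supported in the ball of radius \<open>2/c\<close> descends to a continuous
  function on the torus, since \<open>2 < \<pi>\<close>.\<close>

lemma continuous_on_torus:
  fixes h :: "real^'n \<Rightarrow> real"
  assumes h: "continuous_on UNIV h" and c: "c > 0" and supp: "\<And>x. norm x \<ge> 2 / c \<Longrightarrow> h x = 0"
  shows "continuous_on {z :: complex^'n. \<forall>i. norm (z $ i) = 1} (\<lambda>z. h (\<chi> i. Arg (z $ i) / c))"
    (is "continuous_on ?T ?h")
  unfolding continuous_on_def
proof
  fix z :: "complex^'n" assume z: "z \<in> ?T"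
  show "(?h \<longlongrightarrow> ?h z) (at z within ?T)"
  proof (cases "\<forall>i. z $ i \<notin> \<real>\<^sub>\<le>\<^sub>0")
    case True
    have "((\<lambda>z. \<chi> i. Arg (z $ i) / c) \<longlongrightarrow> (\<chi> i. Arg (z $ i) / c)) (at z within ?T)"
      using True c
      by (intro tendsto_vec_lambda tendsto_divide tendsto_const
          isCont_tendsto_compose[OF continuous_at_Arg] tendsto_vec_nth tendsto_ident_at) auto
    then show ?thesis
      using h by (intro isCont_tendsto_compose[of _ h]) (auto simp: continuous_on_eq_continuous_at)
  next
    case False
    \<comment> \<open>Some coordinate of \<open>z\<close> lies on the cut of \<open>Arg\<close>.
      Where its real part is below \<open>cos 2\<close> the angle exceeds 2 in modulus, the rescaled
      point leaves the support, and the function is locally zero.\<close>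
    then obtain i where i: "z $ i \<in> \<real>\<^sub>\<le>\<^sub>0" by auto
    have re: "Re (y $ j) = cos (Arg (y $ j))" if "y \<in> ?T" for y j
    proof -
      from that have "norm (y $ j) = 1" by auto
      then have "y $ j = cis (Arg (y $ j))" using rcis_cmod_Arg[of "y $ j"] by (simp add: rcis_def)
      then show ?thesis by (metis cis.sel(1))
    qed
    have zero: "?h y = 0" if "y \<in> ?T" "Re (y $ i) < cos 2" for y
    proof -
      let ?t = "Arg (y $ i)"
      have "2 < \<bar>?t\<bar>"
      proof (rule ccontr)
        assume "\<not> 2 < \<bar>?t\<bar>"
        then have "cos 2 \<le> cos \<bar>?t\<bar>"
          using pi_gt3 by (intro cos_monotone_0_pi_le) auto
        then show False using that re[of y i] by simp
      qed
      then have "2 / c \<le> \<bar>?t / c\<bar>" using c by (simp add: field_simps)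
      also have "\<dots> \<le> norm (\<chi> i. Arg (y $ i) / c)"
        using component_le_norm_cart[of "\<chi> i. Arg (y $ i) / c" i] by simp
      finally show ?thesis by (rule supp)
    qed
    have zi: "z $ i = -1"
    proof -
      have "cmod (z $ i) = 1" using z by auto
      moreover have "Im (z $ i) = 0" "Re (z $ i) \<le> 0" using i by (auto simp: complex_nonpos_Reals_iff)
      ultimately show ?thesis by (simp add: cmod_eq_Re complex_eq_iff)
    qed
    have "cos 2 > (-1 :: real)"
      using cos_monotone_0_pi[of 2 pi] pi_gt3 by simp
    then have zr: "Re (z $ i) < cos 2" using zi by simp
    have "open {y :: complex^'n. Re (y $ i) < cos 2}"
      by (intro open_Collect_less continuous_intros)
    then have "eventually (\<lambda>y. ?h y = 0) (at z within ?T)"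
      unfolding eventually_at_topological using zr zero by blast
    then have "(?h \<longlongrightarrow> 0) (at z within ?T)" by (rule tendsto_eventually)
    then show ?thesis using zero[OF z zr] by simp
  qed
qed

text \<open>Stone-Weierstrass on the torus, after scaling by \<open>1/L\<close>. On the ball of
  radius \<open>L\<close> the angles are at most 1 and are recovered by \<open>Arg\<close>. The
  bound \<open>B + 1\<close> holds everywhere, because every value of \<open>torus_map\<close> lies
  on the torus, where the approximant is within \<open>e \<le> 1\<close> of a function bounded by
  \<open>B\<close>.\<close>

lemma trig_poly_approx:
  fixes h :: "real^'n \<Rightarrow> real"
  assumes h: "continuous_on UNIV h" and L: "L > 0" and supp: "\<And>x. norm x \<ge> 2 * L \<Longrightarrow> h x = 0"
    and B: "\<And>x. \<bar>h x\<bar> \<le> B" and e: "e > 0" "e \<le> 1"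
  obtains p where "(\<lambda>x. complex_of_real (p x)) \<in> trig_poly"
    "\<And>x. norm x \<le> L \<Longrightarrow> \<bar>h x - p x\<bar> \<le> e" "\<And>x. \<bar>p x\<bar> \<le> B + 1"
proof -
  let ?T = "{z :: complex^'n. \<forall>i. norm (z $ i) = 1}"
  let ?h = "\<lambda>z :: complex^'n. h (\<chi> i. Arg (z $ i) / (1 / L))"
  have "closed ?T"
  proof -
    have "?T = (\<Inter>i. {z. norm (z $ i) = 1})" by auto
    moreover have "closed (\<Inter>i. {z :: complex^'n. norm (z $ i) = 1})"
      by (intro closed_INT ballI closed_Collect_eq continuous_intros)
    ultimately show ?thesis by simp
  qed
  moreover have "bounded ?T"
  proof (rule boundedI)
    fix z :: "complex^'n" assume "z \<in> ?T"
    then show "norm z \<le> real CARD('n)"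
      using L2_set_le_sum[of UNIV "\<lambda>i. norm (z $ i)"] by (simp add: norm_vec_def)
  qed
  ultimately have "compact ?T" by (simp add: compact_eq_bounded_closed)
  moreover have "continuous_on ?T ?h"
    using L supp by (intro continuous_on_torus h) auto
  ultimately obtain q where q: "real_polynomial_function q" "\<And>z. z \<in> ?T \<Longrightarrow> \<bar>?h z - q z\<bar> < e"
    by (rule Stone_Weierstrass_real_polynomial_function[OF _ _ e(1)]) blast
  let ?p = "\<lambda>x. q (torus_map (1/L) x)"
  have T: "torus_map c x \<in> ?T" for c :: real and x :: "real^'n"
    by (simp add: torus_map_def)
  have close: "\<bar>h x - ?p x\<bar> \<le> e" if "norm x \<le> L" for x
  proof -
    have "\<bar>x $ i / L\<bar> \<le> 1" for i
      using component_le_norm_cart[of x i] that L by (simp add: field_simps)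
    then have *: "x $ i / L \<le> 1" "x $ i / L \<ge> -1" for i
      by (auto simp only: abs_le_iff minus_le_iff)
    have "Arg (cis (x $ i / L)) = x $ i / L" for i
      using *[of i] pi_gt3 by (intro Arg_cis) auto
    then have "(\<chi> i. Arg (torus_map (1/L) x $ i) / (1 / L)) = x"
      using L by (simp add: torus_map_def vec_eq_iff)
    then show ?thesis using q(2)[OF T, of "1/L" x] by simp
  qed
  have "\<bar>?p x\<bar> \<le> B + 1" for x
    using q(2)[OF T, of "1/L" x] B[of "\<chi> i. Arg (torus_map (1/L) x $ i) / (1 / L)"] e by linarith
  with close trig_poly_polynomial[OF q(1), of "1/L"] show thesis by (intro that[of ?p]) auto
qed

lemma trig_poly_integrable:
  fixes Y :: "'w \<Rightarrow> real^'n"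
  assumes "prob_space M" "Y \<in> borel_measurable M" "p \<in> trig_poly"
  shows "integrable M (\<lambda>w. p (Y w))"
proof -
  interpret prob_space M by fact
  note [measurable] = assms(2)
  from assms(3) show ?thesis
  proof induction
    case (monomial a t)
    then show ?case by (intro integrable_const_bound[where B="cmod a"]) (auto simp: norm_mult)
  qed auto
qed

lemma trig_poly_integral_tendsto:
  fixes Y :: "nat \<Rightarrow> 'w \<Rightarrow> real^'n" and \<mu> :: "(real^'n) measure"
  assumes M: "prob_space M" and Y: "\<And>n. Y n \<in> borel_measurable M"
    and \<mu>: "prob_space \<mu>" "sets \<mu> = sets borel"
    and cf: "\<And>t. (\<lambda>n. CLINT w|M. iexp (t \<bullet> Y n w)) \<longlonglongrightarrow> (CLINT y|\<mu>. iexp (t \<bullet> y))"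
    and p: "p \<in> trig_poly"
  shows "(\<lambda>n. CLINT w|M. p (Y n w)) \<longlonglongrightarrow> (CLINT y|\<mu>. p y)"
  using p
proof induction
  case (monomial a t)
  show ?case using tendsto_mult_left[OF cf[of t], of a] by simp
next
  case (add f h)
  have "integrable \<mu> (\<lambda>y. k y)" if "k \<in> trig_poly" for k :: "real^'n \<Rightarrow> complex"
    using trig_poly_integrable[OF \<mu>(1) _ that, of "\<lambda>y. y"] \<mu>(2) by (simp cong: measurable_cong_sets)
  then show ?case
    using add tendsto_add[OF add(3,4)] trig_poly_integrable[OF M Y add(1)] trig_poly_integrable[OF M Y add(2)]
    by simp
qed

text \<open>The one dimensional continuity theorem applied to the marginals. It is the source of
  tightness in the vector case.\<close>

lemma coordinate_tendsto:
  fixes Y :: "nat \<Rightarrow> 'w \<Rightarrow> real^'n" and \<mu> :: "(real^'n) measure" and h :: "real \<Rightarrow> real"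
  assumes M: "prob_space M" and Y: "\<And>n. Y n \<in> borel_measurable M"
    and \<mu>: "prob_space \<mu>" "sets \<mu> = sets borel"
    and cf: "\<And>t. (\<lambda>n. CLINT w|M. iexp (t \<bullet> Y n w)) \<longlonglongrightarrow> (CLINT y|\<mu>. iexp (t \<bullet> y))"
    and h: "\<And>x. isCont h x" "\<And>x. \<bar>h x\<bar> \<le> B"
  shows "(\<lambda>n. \<integral>w. h (Y n w $ i) \<partial>M) \<longlonglongrightarrow> (\<integral>y. h (y $ i) \<partial>\<mu>)"
proof -
  interpret M: prob_space M by fact
  interpret \<mu>: prob_space \<mu> by fact
  note [measurable] = Y and [measurable_cong] = \<mu>(2)
  have [measurable]: "h \<in> borel_measurable borel"
    using h(1) by (intro borel_measurable_continuous_onI continuous_at_imp_continuous_on) auto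
  let ?N = "\<lambda>n. distr M borel (\<lambda>w. Y n w $ i)" and ?L = "distr \<mu> borel (\<lambda>y. y $ i)"
  have char: "char (?N n) t = (CLINT w|M. iexp ((t *\<^sub>R axis i 1) \<bullet> Y n w))"
    "char ?L t = (CLINT y|\<mu>. iexp ((t *\<^sub>R axis i 1) \<bullet> y))" for n t
    by (simp_all add: char_def integral_distr inner_axis')
  have "weak_conv_m ?N ?L"
    by (rule levy_continuity) (auto simp only: char intro!: M.real_distribution_distr \<mu>.real_distribution_distr cf, measurable)
  then have "(\<lambda>n. integral\<^sup>L (?N n) h) \<longlonglongrightarrow> integral\<^sup>L ?L h"
    by (rule weak_conv_imp_integral_bdd_continuous_conv[rotated 2])
       (use h in \<open>auto intro!: M.real_distribution_distr \<mu>.real_distribution_distr\<close>)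
  then show ?thesis by (simp add: integral_distr)
qed

text \<open>Trigonometric polynomials approximate the test function only on a ball, so the mass
  outside has to be small uniformly in \<open>n\<close>; this is read off the coordinates, whose
  laws converge.\<close>

theorem vector_levy_continuity:
  fixes Y :: "nat \<Rightarrow> 'w \<Rightarrow> real^'n" and \<mu> :: "(real^'n) measure"
  assumes M: "prob_space M" and Y: "\<And>n. Y n \<in> borel_measurable M"
    and \<mu>: "prob_space \<mu>" "sets \<mu> = sets borel"
    and cf: "\<And>t. (\<lambda>n. CLINT w|M. iexp (t \<bullet> Y n w)) \<longlonglongrightarrow> (CLINT y|\<mu>. iexp (t \<bullet> y))"
  shows "converges_in_distribution M Y \<mu>"
  unfolding converges_in_distribution_def
proof (intro allI impI)
  fix \<phi> :: "real^'n \<Rightarrow> real"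
  assume \<phi>: "continuous_on UNIV \<phi>" "bounded (range \<phi>)"
  from \<phi>(2) obtain B where B: "\<And>x. \<bar>\<phi> x\<bar> \<le> B" by (auto simp: bounded_iff)
  have B0: "B \<ge> 0" using B[of 0] by linarith
  interpret M: prob_space M by fact
  interpret \<mu>: prob_space \<mu> by fact
  note [measurable] = Y and [measurable_cong] = \<mu>(2)
  have [measurable]: "\<phi> \<in> borel_measurable borel"
    using \<phi>(1) by (rule borel_measurable_continuous_onI)
  \<comment> \<open>A continuous substitute for a tail indicator: 0 up to \<open>L/2\<close> and 1
    from \<open>L\<close> on.\<close>
  define H where "H L x = max 0 (min 1 (2 * \<bar>x\<bar> / L - 1))" for L x :: real
  have H: "isCont (H L) x" "\<bar>H L x\<bar> \<le> 1" "0 \<le> H L x" if "L > 0" for L x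
    using that unfolding H_def by (auto intro!: continuous_intros)
  have H1: "H L x = 1" if "L > 0" "L \<le> \<bar>x\<bar>" for L x
    using that by (auto simp: H_def field_simps)
  have [measurable]: "H L \<in> borel_measurable borel" for L
    unfolding H_def by measurable
  define n where "n = real CARD('n)"
  have n: "n > 0" by (simp add: n_def)
  show "(\<lambda>n. \<integral>w. \<phi> (Y n w) \<partial>M) \<longlonglongrightarrow> (\<integral>y. \<phi> y \<partial>\<mu>)"
  proof (rule LIMSEQ_I)
    fix e0 :: real assume e0: "0 < e0"
    \<comment> \<open>Each of the two comparisons of \<phi> with its approximant costs
      \<open>e + 2 * (B + 1) * e\<close>, and the convergence for the approximant costs
      \<open>e\<close>; the factor leaves room for the sum.\<close>
    define e where "e = min 1 (e0 / (4 + 8 * (B + 1)))"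
    have e: "0 < e" "e \<le> 1" using e0 B0 by (auto simp: e_def)
    have e_le: "(4 + 8 * (B + 1)) * e \<le> e0"
    proof -
      have "e \<le> e0 / (4 + 8 * (B + 1))" by (simp add: e_def)
      then show ?thesis using B0 by (simp add: field_simps)
    qed
    define \<tau> where "\<tau> L y = (\<Sum>i\<in>UNIV. H L (y $ i))" for L and y :: "real^'n"
    have "((\<lambda>k. \<integral>y. \<tau> (real k) y \<partial>\<mu>) \<longlonglongrightarrow> (\<integral>y. 0 \<partial>\<mu>))"
    proof (rule integral_dominated_convergence[where w="\<lambda>_. n"])
      show "AE y in \<mu>. (\<lambda>k. \<tau> (real k) y) \<longlonglongrightarrow> 0"
      proof (rule AE_I2)
        fix y :: "real^'n"
        have "eventually (\<lambda>k. \<tau> (real k) y = 0) sequentially"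
        proof -
          obtain k0 :: nat where k0: "real k0 \<ge> 2 * norm y + 1" using real_arch_simple by blast
          have "\<tau> (real k) y = 0" if "k \<ge> k0" for k
            unfolding \<tau>_def
          proof (rule sum.neutral, rule ballI)
            fix i
            have "2 * \<bar>y $ i\<bar> \<le> real k" "real k > 0"
              using component_le_norm_cart[of y i] that k0 norm_ge_zero[of y] by linarith+
            then show "H (real k) (y $ i) = 0" by (auto simp: H_def field_simps)
          qed
          then show ?thesis unfolding eventually_sequentially by blast
        qed
        then show "(\<lambda>k. \<tau> (real k) y) \<longlonglongrightarrow> 0" by (rule tendsto_eventually)
      qed
      show "AE y in \<mu>. norm (\<tau> (real k) y) \<le> n" for k
      proof (rule AE_I2)
        fix y
        have "\<bar>\<tau> (real k) y\<bar> \<le> (\<Sum>i\<in>(UNIV::'n set). 1)"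
          unfolding \<tau>_def by (rule order_trans[OF sum_abs]) (intro sum_mono, auto simp: H_def)
        then show "norm (\<tau> (real k) y) \<le> n" by (simp add: n_def)
      qed
    qed (auto simp: \<tau>_def)
    then have "eventually (\<lambda>k. (\<integral>y. \<tau> (real k) y \<partial>\<mu>) < e) sequentially"
      using e(1) by (auto dest: order_tendstoD(2))
    moreover have "eventually (\<lambda>k. k > 0) sequentially" by (rule eventually_gt_at_top)
    ultimately obtain k where k: "(\<integral>y. \<tau> (real k) y \<partial>\<mu>) < e" "k > 0"
      by (metis (mono_tags, lifting) eventually_conj_iff eventually_sequentially order_refl)
    define L0 where "L0 = real k"
    have L0: "L0 > 0" using k by (simp add: L0_def)
    define L where "L = n * L0"
    have L: "L > 0" using L0 n by (simp add: L_def)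
    \<comment> \<open>A vector of norm above \<open>n * L0\<close> has a coordinate of modulus at
      least \<open>L0\<close>, by comparison with the l1 norm.\<close>
    have tail: "1 \<le> \<tau> L0 y" if "norm y > L" for y :: "real^'n"
    proof -
      have "\<exists>i. L0 \<le> \<bar>y $ i\<bar>"
      proof (rule ccontr)
        assume "\<not> ?thesis"
        then have "(\<Sum>i\<in>UNIV. \<bar>y $ i\<bar>) \<le> (\<Sum>i\<in>(UNIV::'n set). L0)"
          by (intro sum_mono) (auto simp: not_le less_imp_le)
        then show False using norm_le_l1_cart[of y] that by (simp add: L_def n_def)
      qed
      then obtain i where "H L0 (y $ i) = 1" using H1[OF L0] by blast
      then show ?thesis using member_le_sum[of i UNIV "\<lambda>i. H L0 (y $ i)"] H(3)[OF L0]
        by (simp add: \<tau>_def)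
    qed
    have \<tau>0: "0 \<le> \<tau> L0 y" for y using H(3)[OF L0] by (auto simp: \<tau>_def intro: sum_nonneg)
    have int_H: "integrable M (\<lambda>w. H L0 (Y m w $ i))" "integrable \<mu> (\<lambda>y. H L0 (y $ i))" for m i
      using H(2)[OF L0] by (auto intro!: M.integrable_const_bound[where B=1] \<mu>.integrable_const_bound[where B=1])
    have int_\<tau>: "integrable M (\<lambda>w. \<tau> L0 (Y m w))" "integrable \<mu> (\<tau> L0)" for m
      unfolding \<tau>_def[abs_def] using int_H by auto
    have "(\<lambda>m. \<integral>w. \<tau> L0 (Y m w) \<partial>M) \<longlonglongrightarrow> (\<integral>y. \<tau> L0 y \<partial>\<mu>)"
      unfolding \<tau>_def using int_H
      by (simp, intro tendsto_sum coordinate_tendsto[OF M Y \<mu> cf, of "H L0" 1]) (use H[OF L0] in auto)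
    then have ev1: "eventually (\<lambda>m. (\<integral>w. \<tau> L0 (Y m w) \<partial>M) < e) sequentially"
      using k(1) by (intro order_tendstoD(2)) (auto simp: L0_def)
    define h where "h x = \<phi> x * max 0 (min 1 (2 - norm x / L))" for x
    have "continuous_on UNIV h" unfolding h_def using L by (intro continuous_intros \<phi>) auto
    moreover have "h x = 0" if "norm x \<ge> 2 * L" for x
      using that L by (auto simp: h_def field_simps)
    moreover have "\<bar>h x\<bar> \<le> B" for x
    proof -
      have "\<bar>h x\<bar> \<le> \<bar>\<phi> x\<bar> * 1" unfolding h_def abs_mult by (intro mult_left_mono) auto
      then show ?thesis using B[of x] by simp
    qed
    ultimately obtain p where p: "(\<lambda>x. complex_of_real (p x)) \<in> trig_poly"
      "\<And>x. norm x \<le> L \<Longrightarrow> \<bar>h x - p x\<bar> \<le> e" "\<And>x. \<bar>p x\<bar> \<le> B + 1"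
      using trig_poly_approx[OF _ L _ _ e] by metis
    \<comment> \<open>Outside the ball the two functions are bounded by \<open>B\<close> and
      \<open>B + 1\<close>, and the tail sum is at least 1.\<close>
    have close: "\<bar>\<phi> x - p x\<bar> \<le> e + 2 * (B + 1) * \<tau> L0 x" for x
    proof (cases "norm x \<le> L")
      case True
      then have "h x = \<phi> x" using L by (simp add: h_def field_simps)
      then show ?thesis using p(2)[OF True] \<tau>0[of x] B0 by (smt (verit) mult_nonneg_nonneg)
    next
      case False
      then have "2 * (B + 1) * 1 \<le> 2 * (B + 1) * \<tau> L0 x" using tail[of x] B0 by (intro mult_left_mono) auto
      then show ?thesis using B[of x] p(3)[of x] e by (smt (verit))
    qed
    have pM: "integrable M (\<lambda>w. p (Y m w))" for m
      using integrable_Re[OF trig_poly_integrable[OF M Y p(1)]] by simp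
    have p\<mu>: "integrable \<mu> p"
      using integrable_Re[OF trig_poly_integrable[OF \<mu>(1) _ p(1), of "\<lambda>y. y"]] by simp
    have "(\<lambda>m. Re (CLINT w|M. complex_of_real (p (Y m w)))) \<longlonglongrightarrow> Re (CLINT y|\<mu>. complex_of_real (p y))"
      by (intro tendsto_Re trig_poly_integral_tendsto[OF M Y \<mu> cf p(1)])
    then have "(\<lambda>m. \<integral>w. p (Y m w) \<partial>M) \<longlonglongrightarrow> (\<integral>y. p y \<partial>\<mu>)" by simp
    then have ev2: "eventually (\<lambda>m. \<bar>(\<integral>w. p (Y m w) \<partial>M) - (\<integral>y. p y \<partial>\<mu>)\<bar> < e) sequentially"
      using e(1) by (auto dest!: tendstoD simp: dist_real_def)
    have \<phi>M: "integrable M (\<lambda>w. \<phi> (Y m w))" for m using B by (intro M.integrable_const_bound[where B=B]) auto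
    have \<phi>\<mu>: "integrable \<mu> \<phi>" using B by (intro \<mu>.integrable_const_bound[where B=B]) auto
    have "eventually (\<lambda>m. norm ((\<integral>w. \<phi> (Y m w) \<partial>M) - (\<integral>y. \<phi> y \<partial>\<mu>)) < e0) sequentially"
      using ev1 ev2
    proof eventually_elim
      case (elim m)
      have "\<bar>(\<integral>w. \<phi> (Y m w) - p (Y m w) \<partial>M)\<bar> \<le> (\<integral>w. e + 2 * (B + 1) * \<tau> L0 (Y m w) \<partial>M)"
        by (rule order_trans[OF integral_abs_bound], rule integral_mono)
           (use close int_\<tau> \<phi>M pM in \<open>auto\<close>)
      also have "\<dots> = e + 2 * (B + 1) * (\<integral>w. \<tau> L0 (Y m w) \<partial>M)"
        using int_\<tau> by (simp add: M.prob_space)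
      also have "\<dots> \<le> e + 2 * (B + 1) * e" using elim(1) B0 by (intro add_left_mono mult_left_mono) auto
      finally have a: "\<bar>(\<integral>w. \<phi> (Y m w) \<partial>M) - (\<integral>w. p (Y m w) \<partial>M)\<bar> \<le> e + 2 * (B + 1) * e"
        using \<phi>M pM by simp
      have "\<bar>(\<integral>y. \<phi> y - p y \<partial>\<mu>)\<bar> \<le> (\<integral>y. e + 2 * (B + 1) * \<tau> L0 y \<partial>\<mu>)"
        by (rule order_trans[OF integral_abs_bound], rule integral_mono)
           (use close int_\<tau> \<phi>\<mu> p\<mu> in \<open>auto\<close>)
      also have "\<dots> = e + 2 * (B + 1) * (\<integral>y. \<tau> L0 y \<partial>\<mu>)"
        using int_\<tau> by (simp add: \<mu>.prob_space)
      also have "\<dots> \<le> e + 2 * (B + 1) * e" using k(1) B0 by (intro add_left_mono mult_left_mono) (auto simp: L0_def)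
      finally have b: "\<bar>(\<integral>y. \<phi> y \<partial>\<mu>) - (\<integral>y. p y \<partial>\<mu>)\<bar> \<le> e + 2 * (B + 1) * e"
        using \<phi>\<mu> p\<mu> by simp
      have "norm ((\<integral>w. \<phi> (Y m w) \<partial>M) - (\<integral>y. \<phi> y \<partial>\<mu>)) < 3 * e + 4 * (B + 1) * e"
        unfolding real_norm_def using a b elim(2) e(1) by argo
      also have "\<dots> \<le> (4 + 8 * (B + 1)) * e" using e B0 by (simp add: algebra_simps)
      also have "\<dots> \<le> e0" by (rule e_le)
      finally show ?case .
    qed
    then show "\<exists>no. \<forall>n\<ge>no. norm ((\<integral>w. \<phi> (Y n w) \<partial>M) - (\<integral>y. \<phi> y \<partial>\<mu>)) < e0"
      unfolding eventually_sequentially .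
  qed
qed

subsection \<open>Integration against kernels\<close>

lemma integral_kernel_measurable:
  fixes f :: "'x \<Rightarrow> 'b::{banach, second_countable_topology}"
  assumes "N \<in> M \<rightarrow>\<^sub>M subprob_algebra B" "f \<in> borel_measurable B"
  shows "(\<lambda>x. \<integral>y. f y \<partial>N x) \<in> borel_measurable M"
  using assms(1) integral_measurable_subprob_algebra[OF assms(2)] by (rule measurable_compose)

lemma nn_integral_kernel_measurable:
  fixes f :: "'x \<Rightarrow> ennreal"
  assumes "N \<in> M \<rightarrow>\<^sub>M subprob_algebra B" "f \<in> borel_measurable B"
  shows "(\<lambda>x. \<integral>\<^sup>+y. f y \<partial>N x) \<in> borel_measurable M"
  using assms(1) nn_integral_measurable_subprob_algebra[OF assms(2)] by (rule measurable_compose)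

lemma norm_integral_le_nn_integral:
  fixes f :: "'x \<Rightarrow> 'b::{banach, second_countable_topology}"
  shows "ennreal (norm (\<integral>x. f x \<partial>M)) \<le> (\<integral>\<^sup>+x. ennreal (norm (f x)) \<partial>M)"
  by (cases "integrable M f") (auto simp: integral_norm_bound_ennreal not_integrable_integral_eq)

text \<open>Fubini for a law followed by a kernel. The inner integral converges only for almost
  every \<open>x\<close>, so additivity and limits in the induction hold almost everywhere; the
  limit step dominates twice, under \<open>N x\<close> and then under \<open>M\<close>, starting
  from \<open>2 * norm (f y)\<close>.\<close>

lemma
  fixes f :: "'y \<Rightarrow> 'b::{banach, second_countable_topology}"
  assumes N: "N \<in> M \<rightarrow>\<^sub>M subprob_algebra B" and ne: "space M \<noteq> {}" and f: "integrable (M \<bind> N) f"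
  shows AE_integrable_bind: "AE x in M. integrable (N x) f"
    and integrable_integral_bind: "integrable M (\<lambda>x. \<integral>y. f y \<partial>N x)"
    and integral_bind_integrable: "(\<integral>y. f y \<partial>(M \<bind> N)) = (\<integral>x. \<integral>y. f y \<partial>N x \<partial>M)"
proof -
  have sets: "sets (M \<bind> N) = sets B" by (rule sets_bind[OF sets_kernel[OF N] ne])
  have setsN: "sets (N x) = sets B" if "x \<in> space M" for x using N that by (rule sets_kernel)
  have meas: "h \<in> borel_measurable B" if "integrable (M \<bind> N) h" for h :: "'y \<Rightarrow> 'b"
    using borel_measurable_integrable[OF that] sets by (simp cong: measurable_cong_sets)
  have fin: "(\<integral>\<^sup>+x. \<integral>\<^sup>+y. ennreal (norm (h y)) \<partial>N x \<partial>M) < \<infinity>" if "integrable (M \<bind> N) h" for h :: "'y \<Rightarrow> 'b"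
  proof -
    have "(\<integral>\<^sup>+x. \<integral>\<^sup>+y. ennreal (norm (h y)) \<partial>N x \<partial>M) = (\<integral>\<^sup>+y. ennreal (norm (h y)) \<partial>(M \<bind> N))"
      using nn_integral_bind[OF _ N, of "\<lambda>y. ennreal (norm (h y))"] meas[OF that] by simp
    also have "\<dots> < \<infinity>" using that by (simp add: integrable_iff_bounded)
    finally show ?thesis .
  qed
  have ae: "AE x in M. integrable (N x) h" if "integrable (M \<bind> N) h" for h :: "'y \<Rightarrow> 'b"
  proof -
    note [measurable] = meas[OF that]
    have "(\<lambda>x. \<integral>\<^sup>+y. ennreal (norm (h y)) \<partial>N x) \<in> borel_measurable M"
      by (rule nn_integral_kernel_measurable[OF N]) measurable
    then have "AE x in M. (\<integral>\<^sup>+y. ennreal (norm (h y)) \<partial>N x) \<noteq> \<infinity>"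
      using fin[OF that] by (intro nn_integral_PInf_AE) auto
    then show ?thesis
    proof (rule AE_mp, intro AE_I2 impI)
      fix x assume x: "x \<in> space M" "(\<integral>\<^sup>+y. ennreal (norm (h y)) \<partial>N x) \<noteq> \<infinity>"
      then show "integrable (N x) h" using setsN[OF x(1)] meas[OF that]
        by (simp add: integrable_iff_bounded less_top cong: measurable_cong_sets)
    qed
  qed
  have int: "integrable M (\<lambda>x. \<integral>y. h y \<partial>N x)" if "integrable (M \<bind> N) h" for h :: "'y \<Rightarrow> 'b"
    unfolding integrable_iff_bounded
  proof
    show "(\<lambda>x. \<integral>y. h y \<partial>N x) \<in> borel_measurable M"
      by (rule integral_kernel_measurable[OF N meas[OF that]])
    have "(\<integral>\<^sup>+x. ennreal (norm (\<integral>y. h y \<partial>N x)) \<partial>M) \<le> (\<integral>\<^sup>+x. \<integral>\<^sup>+y. ennreal (norm (h y)) \<partial>N x \<partial>M)"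
      by (intro nn_integral_mono norm_integral_le_nn_integral)
    also note fin[OF that]
    finally show "(\<integral>\<^sup>+x. ennreal (norm (\<integral>y. h y \<partial>N x)) \<partial>M) < \<infinity>" .
  qed
  show "AE x in M. integrable (N x) f" by (rule ae[OF f])
  show "integrable M (\<lambda>x. \<integral>y. f y \<partial>N x)" by (rule int[OF f])
  show "(\<integral>y. f y \<partial>(M \<bind> N)) = (\<integral>x. \<integral>y. f y \<partial>N x \<partial>M)"
    using f
  proof (induction rule: integrable_induct)
    case (base A c)
    have A: "A \<in> sets B" using base sets by simp
    have "emeasure (M \<bind> N) A = (\<integral>\<^sup>+x. emeasure (N x) A \<partial>M)"
      by (rule emeasure_bind[OF ne N A])
    then have fin: "(\<integral>\<^sup>+x. emeasure (N x) A \<partial>M) < \<infinity>" using base by simp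
    have sub: "subprob_space (N x)" if "x \<in> space M" for x using N that by (rule subprob_space_kernel)
    have "measure (M \<bind> N) A = (\<integral>x. measure (N x) A \<partial>M)"
    proof -
      have "(\<integral>\<^sup>+x. emeasure (N x) A \<partial>M) = (\<integral>\<^sup>+x. ennreal (measure (N x) A) \<partial>M)"
        using sub by (intro nn_integral_cong) (simp add: subprob_space_def finite_measure.emeasure_eq_measure)
      moreover have "(\<lambda>x. measure (N x) A) \<in> borel_measurable M"
        using measurable_compose[OF N measurable_measure_subprob_algebra[OF A]] by simp
      ultimately show ?thesis
        using \<open>emeasure (M \<bind> N) A = _\<close> by (simp add: measure_def[of "M \<bind> N"] integral_eq_nn_integral)
    qed
    moreover have "(\<integral>x. \<integral>y. indicator A y *\<^sub>R c \<partial>N x \<partial>M) = (\<integral>x. measure (N x) A *\<^sub>R c \<partial>M)"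
    proof (rule Bochner_Integration.integral_cong[OF refl])
      fix x assume x: "x \<in> space M"
      interpret subprob_space "N x" by (rule sub[OF x])
      show "(\<integral>y. indicator A y *\<^sub>R c \<partial>N x) = measure (N x) A *\<^sub>R c"
        using A setsN[OF x] emeasure_finite[of A]
        by (subst integral_scaleR_left) (simp_all add: less_top[symmetric] integrable_real_indicator)
    qed
    moreover have "integrable M (\<lambda>x. measure (N x) A)"
      unfolding integrable_iff_bounded
    proof
      show "(\<lambda>x. measure (N x) A) \<in> borel_measurable M"
        using measurable_compose[OF N measurable_measure_subprob_algebra[OF A]] by simp
      have "(\<integral>\<^sup>+x. ennreal (norm (measure (N x) A)) \<partial>M) = (\<integral>\<^sup>+x. emeasure (N x) A \<partial>M)"
        using sub by (intro nn_integral_cong) (simp add: subprob_space_def finite_measure.emeasure_eq_measure)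
      then show "(\<integral>\<^sup>+x. ennreal (norm (measure (N x) A)) \<partial>M) < \<infinity>" using fin by simp
    qed
    ultimately show ?case using base by simp
  next
    case (add f g)
    have "(\<integral>x. \<integral>y. f y + g y \<partial>N x \<partial>M) = (\<integral>x. (\<integral>y. f y \<partial>N x) + (\<integral>y. g y \<partial>N x) \<partial>M)"
    proof (rule integral_cong_AE)
      show "AE x in M. (\<integral>y. f y + g y \<partial>N x) = (\<integral>y. f y \<partial>N x) + (\<integral>y. g y \<partial>N x)"
        using ae[OF add(1)] ae[OF add(2)] by eventually_elim simp
      show "(\<lambda>x. \<integral>y. f y + g y \<partial>N x) \<in> borel_measurable M"
        using add(1,2) by (intro integral_kernel_measurable[OF N] meas) auto
      show "(\<lambda>x. (\<integral>y. f y \<partial>N x) + (\<integral>y. g y \<partial>N x)) \<in> borel_measurable M"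
        using int[OF add(1)] int[OF add(2)] by auto
    qed
    then show ?case using add int[OF add(1)] int[OF add(2)] by simp
  next
    case (lim f s)
    have "(\<lambda>i. \<integral>y. s i y \<partial>(M \<bind> N)) \<longlonglongrightarrow> (\<integral>y. f y \<partial>(M \<bind> N))"
      using lim(2-4) lim(1) by (intro integral_dominated_convergence[where w="\<lambda>y. 2 * norm (f y)"]) auto
    moreover have "(\<lambda>i. \<integral>x. \<integral>y. s i y \<partial>N x \<partial>M) \<longlonglongrightarrow> (\<integral>x. \<integral>y. f y \<partial>N x \<partial>M)"
    proof (rule integral_dominated_convergence[where w="\<lambda>x. \<integral>y. 2 * norm (f y) \<partial>N x"])
      show "(\<lambda>x. \<integral>y. f y \<partial>N x) \<in> borel_measurable M" using int[OF lim(4)] by auto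
      show "(\<lambda>x. \<integral>y. s i y \<partial>N x) \<in> borel_measurable M" for i using int[OF lim(1)] by auto
      show "integrable M (\<lambda>x. \<integral>y. 2 * norm (f y) \<partial>N x)"
        unfolding integrable_iff_bounded
      proof
        show "(\<lambda>x. \<integral>y. 2 * norm (f y) \<partial>N x) \<in> borel_measurable M"
          using meas[OF lim(4)] by (intro integral_kernel_measurable[OF N]) auto
        have "(\<integral>\<^sup>+x. ennreal (norm (\<integral>y. 2 * norm (f y) \<partial>N x)) \<partial>M) \<le> (\<integral>\<^sup>+x. \<integral>\<^sup>+y. 2 * ennreal (norm (f y)) \<partial>N x \<partial>M)"
          by (intro nn_integral_mono order_trans[OF norm_integral_le_nn_integral])
             (simp add: ennreal_mult)
        also have "\<dots> = (\<integral>\<^sup>+x. 2 * (\<integral>\<^sup>+y. ennreal (norm (f y)) \<partial>N x) \<partial>M)"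
        proof (rule nn_integral_cong)
          fix x assume x: "x \<in> space M"
          have "(\<lambda>y. ennreal (norm (f y))) \<in> borel_measurable (N x)"
            using meas[OF lim(4)] setsN[OF x] by (simp cong: measurable_cong_sets)
          then show "(\<integral>\<^sup>+y. 2 * ennreal (norm (f y)) \<partial>N x) = 2 * (\<integral>\<^sup>+y. ennreal (norm (f y)) \<partial>N x)"
            by (rule nn_integral_cmult)
        qed
        also have "\<dots> = 2 * (\<integral>\<^sup>+x. \<integral>\<^sup>+y. ennreal (norm (f y)) \<partial>N x \<partial>M)"
          using meas[OF lim(4)] by (intro nn_integral_cmult nn_integral_kernel_measurable[OF N]) auto
        also have "\<dots> < \<infinity>" using fin[OF lim(4)] by (simp add: ennreal_mult_less_top)
        finally show "(\<integral>\<^sup>+x. ennreal (norm (\<integral>y. 2 * norm (f y) \<partial>N x)) \<partial>M) < \<infinity>" .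
      qed
      have dom: "norm (s i y) \<le> 2 * norm (f y)" "(\<lambda>i. s i y) \<longlonglongrightarrow> f y" if "x \<in> space M" "y \<in> space (N x)" for x y i
      proof -
        have "y \<in> space (M \<bind> N)"
          using that setsN[OF that(1)] sets sets_eq_imp_space_eq by metis
        then show "norm (s i y) \<le> 2 * norm (f y)" "(\<lambda>i. s i y) \<longlonglongrightarrow> f y" using lim(2,3) by auto
      qed
      have sae: "AE x in M. \<forall>i. integrable (N x) (s i)" unfolding AE_all_countable using ae[OF lim(1)] by auto
      show "AE x in M. (\<lambda>i. \<integral>y. s i y \<partial>N x) \<longlonglongrightarrow> (\<integral>y. f y \<partial>N x)"
        using ae[OF lim(4)] sae AE_space
        by eventually_elim (rule integral_dominated_convergence[where w="\<lambda>y. 2 * norm (f y)"],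
            auto simp: dom intro: borel_measurable_integrable)
      show "AE x in M. norm (\<integral>y. s i y \<partial>N x) \<le> (\<integral>y. 2 * norm (f y) \<partial>N x)" for i
        using ae[OF lim(4)] sae AE_space
      proof eventually_elim
        case (elim x)
        show ?case
          by (rule order_trans[OF integral_norm_bound], rule integral_mono) (use elim dom in auto)
      qed
    qed
    ultimately show ?case using lim(5) by (simp add: LIMSEQ_unique)
  qed
qed

lemma emeasure_countable_UN_eq_0:
  assumes "countable I" "\<And>i. i \<in> I \<Longrightarrow> A i \<in> sets M" "\<And>i. i \<in> I \<Longrightarrow> emeasure M (A i) = 0"
  shows "emeasure M (\<Union>i\<in>I. A i) = 0"
  using null_sets_UN'[OF assms(1), of A M] assms(2,3) by (auto simp: null_sets_def)

lemma prob_kernelD: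
  assumes "prob_kernel P"
  shows "P \<in> borel \<rightarrow>\<^sub>M subprob_algebra borel" "sets (P x) = sets borel" "space (P x) = UNIV"
    "prob_space (P x)"
proof -
  show *: "P \<in> borel \<rightarrow>\<^sub>M subprob_algebra borel"
    using assms by (simp add: prob_kernel_def measurable_prob_algebraD)
  have "P x \<in> space (prob_algebra borel)"
    using assms by (auto simp: prob_kernel_def intro: measurable_space)
  then show "sets (P x) = sets borel" "prob_space (P x)" by (auto simp: space_prob_algebra)
  then show "space (P x) = UNIV" using sets_eq_imp_space_eq by force
qed

lemma kernel_integral_measurable:
  fixes f :: "'x::polish_space \<Rightarrow> 'b::{banach, second_countable_topology}"
  assumes "prob_kernel P" "f \<in> borel_measurable borel"
  shows "(\<lambda>x. \<integral>y. f y \<partial>P x) \<in> borel_measurable borel"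
  using prob_kernelD(1)[OF assms(1)] assms(2) by (rule integral_kernel_measurable)

lemma kernel_emeasure_measurable:
  assumes "prob_kernel P" "A \<in> sets borel"
  shows "(\<lambda>x. emeasure (P x) A) \<in> borel_measurable borel"
  using measurable_compose[OF prob_kernelD(1)[OF assms(1)] measurable_emeasure_subprob_algebra[OF assms(2)]]
  by simp

lemma prob_kernel_comp:
  assumes "prob_kernel P" "prob_kernel R"
  shows "prob_kernel (kernel_comp P R)"
  using assms unfolding prob_kernel_def kernel_comp_def[abs_def] by measurable

lemma kernel_subst_sets:
  assumes "prob_kernel R" "sets M = sets borel"
  shows "R \<in> M \<rightarrow>\<^sub>M subprob_algebra borel"
  using prob_kernelD(1)[OF assms(1)] assms(2) by (simp cong: measurable_cong_sets)

lemma nn_integral_bind_kernel: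
  assumes "prob_kernel R" "sets M = sets borel" "f \<in> borel_measurable borel"
  shows "(\<integral>\<^sup>+y. f y \<partial>(M \<bind> R)) = (\<integral>\<^sup>+y. \<integral>\<^sup>+z. f z \<partial>R y \<partial>M)"
  by (rule nn_integral_bind[OF assms(3) kernel_subst_sets[OF assms(1,2)]])

lemma emeasure_bind_kernel:
  assumes "prob_kernel R" "sets M = sets borel" "A \<in> sets borel"
  shows "emeasure (M \<bind> R) A = (\<integral>\<^sup>+y. emeasure (R y) A \<partial>M)"
proof -
  have "space M = UNIV" using sets_eq_imp_space_eq[OF assms(2)] by simp
  then show ?thesis by (intro emeasure_bind[OF _ kernel_subst_sets[OF assms(1,2)] assms(3)]) auto
qed

subsection \<open>Powers of a kernel\<close>

lemma prob_kernel_return: "prob_kernel (return borel)"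
  by (simp add: prob_kernel_def)

lemma kernel_power_0: "kernel_power P 0 = return borel"
  by (simp add: kernel_power_def)

lemma kernel_power_Suc: "kernel_power P (Suc n) x = P x \<bind> kernel_power P n"
  by (simp add: kernel_power_def kernel_comp_def)

lemma prob_kernel_power:
  assumes "prob_kernel P"
  shows "prob_kernel (kernel_power P n)"
proof (induction n)
  case 0
  show ?case by (simp add: kernel_power_0 prob_kernel_return)
next
  case (Suc n)
  then show ?case using prob_kernel_comp[OF assms Suc]
    by (simp add: kernel_power_def)
qed

lemma bind_kernel_assoc:
  assumes "prob_kernel R" "prob_kernel S" "sets M = sets borel"
  shows "(M \<bind> R) \<bind> S = M \<bind> (\<lambda>x. R x \<bind> S)"
  by (rule bind_assoc[OF kernel_subst_sets[OF assms(1,3)] prob_kernelD(1)[OF assms(2)]])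

lemma bind_return_left: "return borel x \<bind> R = R x" if "prob_kernel R"
  using prob_kernelD(1)[OF that] by (intro bind_return) auto

lemma kernel_power_add:
  assumes "prob_kernel P"
  shows "kernel_power P (m + n) x = kernel_power P m x \<bind> kernel_power P n"
proof (induction m arbitrary: x)
  case 0
  show ?case by (simp add: kernel_power_0 bind_return_left prob_kernel_power assms)
next
  case (Suc m)
  have "kernel_power P (m + n) = (\<lambda>x. kernel_power P m x \<bind> kernel_power P n)"
    by (rule ext) (rule Suc.IH)
  then show ?case
    by (simp add: kernel_power_Suc bind_kernel_assoc prob_kernel_power assms prob_kernelD)
qed

lemma kernel_power_1:
  assumes "prob_kernel P"
  shows "kernel_power P (Suc 0) x = P x"
  using prob_kernelD[OF assms] by (simp add: kernel_power_Suc kernel_power_0 bind_return'')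

lemma emeasure_kernel_power_add:
  assumes "prob_kernel P" "A \<in> sets borel"
  shows "emeasure (kernel_power P (m + n) x) A = (\<integral>\<^sup>+y. emeasure (kernel_power P n y) A \<partial>kernel_power P m x)"
  using assms by (simp add: kernel_power_add emeasure_bind_kernel prob_kernel_power prob_kernelD)

lemma emeasure_kernel_power_ge:
  assumes P: "prob_kernel P" and A: "A \<in> sets borel" and B: "B \<in> sets borel"
    and c: "\<And>y. y \<in> B \<Longrightarrow> c \<le> emeasure (kernel_power P n y) A"
  shows "emeasure (kernel_power P m x) B * c \<le> emeasure (kernel_power P (m + n) x) A"
proof -
  have "emeasure (kernel_power P m x) B * c = (\<integral>\<^sup>+y. c * indicator B y \<partial>kernel_power P m x)"
    using B by (subst nn_integral_cmult_indicator) (auto simp: prob_kernelD prob_kernel_power P mult.commute)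
  also have "\<dots> \<le> (\<integral>\<^sup>+y. emeasure (kernel_power P n y) A \<partial>kernel_power P m x)"
    using c by (intro nn_integral_mono) (auto split: split_indicator)
  finally show ?thesis by (simp add: emeasure_kernel_power_add P A)
qed

lemma emeasure_kernel_power_pos:
  assumes P: "prob_kernel P" and A: "A \<in> sets borel"
    and pos: "0 < emeasure (kernel_power P m x) {y. 0 < emeasure (kernel_power P n y) A}"
  shows "0 < emeasure (kernel_power P (m + n) x) A"
proof (rule ccontr)
  assume "\<not> ?thesis"
  then have "(\<integral>\<^sup>+y. emeasure (kernel_power P n y) A \<partial>kernel_power P m x) = 0"
    by (simp add: emeasure_kernel_power_add P A)
  moreover have meas: "(\<lambda>y. emeasure (kernel_power P n y) A) \<in> borel_measurable borel"
    by (intro kernel_emeasure_measurable prob_kernel_power P A)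
  ultimately have "AE y in kernel_power P m x. emeasure (kernel_power P n y) A = 0"
    by (subst (asm) nn_integral_0_iff_AE) (auto simp: prob_kernelD prob_kernel_power P cong: measurable_cong_sets)
  then have "AE y in kernel_power P m x. \<not> 0 < emeasure (kernel_power P n y) A" by simp
  then have "emeasure (kernel_power P m x) {y \<in> space (kernel_power P m x). 0 < emeasure (kernel_power P n y) A} = 0"
    by (rule emeasure_eq_0_AE)
  then have "emeasure (kernel_power P m x) {y. 0 < emeasure (kernel_power P n y) A} = 0"
    by (simp only: prob_kernelD[OF prob_kernel_power[OF P]] UNIV_I simp_thms)
  with pos show False by simp
qed

subsection \<open>Sublevel sets of the drift function are small\<close>

text \<open>\<open>d\<close> is the least positive difference of two elements. If \<open>t\<close>
  left a remainder modulo \<open>d\<close>, that remainder would again be a difference of two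
  elements, against minimality.\<close>

lemma additive_semigroup_gap:
  fixes S :: "nat set"
  assumes ne: "S \<noteq> {}" and pos: "0 \<notin> S" and add: "\<And>a b. a \<in> S \<Longrightarrow> b \<in> S \<Longrightarrow> a + b \<in> S"
  obtains d s where "d \<ge> 1" "s \<in> S" "s + d \<in> S" "\<And>t. t \<in> S \<Longrightarrow> d dvd t"
proof -
  let ?Q = "\<lambda>d. d \<ge> 1 \<and> (\<exists>s\<in>S. s + d \<in> S)"
  have mult: "q * a \<in> S" if "a \<in> S" "q \<ge> 1" for q a
    using that(2,1) by (induction q rule: dec_induct) (auto intro: add)
  obtain a where "a \<in> S" using ne by auto
  then have "a \<noteq> 0" "a + a \<in> S" using pos add by metis+
  then have "?Q a" using \<open>a \<in> S\<close> by (metis One_nat_def Suc_leI not_gr_zero)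
  then have Qd: "?Q (LEAST d. ?Q d)" by (rule LeastI)
  define d where "d = (LEAST d. ?Q d)"
  have least: "d \<le> r" if "?Q r" for r unfolding d_def using that by (rule Least_le)
  obtain s where s: "d \<ge> 1" "s \<in> S" "s + d \<in> S" using Qd by (auto simp: d_def)
  have "d dvd t" if t: "t \<in> S" for t
  proof (rule ccontr)
    assume nd: "\<not> d dvd t"
    define q where "q = t div d + 1"
    define r where "r = t mod d"
    have r: "r \<ge> 1" "r < d" using nd s(1) by (auto simp: r_def dvd_eq_mod_eq_0 Suc_le_eq)
    have q: "q \<ge> 1" by (simp add: q_def)
    have "t + d = q * d + r" by (simp add: q_def r_def)
    then have "q * (s + d) + r = q * s + (t + d)" by (simp add: algebra_simps)
    \<comment> \<open>The number \<open>q * (s + d)\<close> and the right side both lie in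
      \<open>S\<close>, which exhibits \<open>r\<close> as a difference of elements.\<close>
    then have "q * (s + d) + r = ((q - 1) * s + (s + d)) + t" using q by (cases q) (auto simp: algebra_simps)
    moreover have "((q - 1) * s + (s + d)) + t \<in> S"
      using add[OF s(3) t] mult[OF s(2), of "q - 1"] add
      by (cases "q - 1 = 0") (auto simp: add.assoc)
    moreover have "q * (s + d) \<in> S" using mult[OF s(3) q] .
    ultimately have "?Q r" using r by metis
    then show False using least r by force
  qed
  then show thesis using that s by blast
qed

text \<open>For \<open>n \<ge> s * s\<close> the quotient by \<open>s\<close> is at least
  \<open>s\<close> and hence exceeds the remainder \<open>r\<close>, so \<open>r\<close> copies of
  \<open>s\<close> can be exchanged for \<open>s + 1\<close>.\<close>

lemma additive_semigroup_large:
  fixes S :: "nat set"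
  assumes s: "s \<in> S" "s + 1 \<in> S" "s \<ge> 1" and add: "\<And>a b. a \<in> S \<Longrightarrow> b \<in> S \<Longrightarrow> a + b \<in> S"
    and n: "n \<ge> s * s"
  shows "n \<in> S"
proof -
  have mult: "q * a \<in> S" if "a \<in> S" "q \<ge> 1" for q a
    using that(2,1) by (induction q rule: dec_induct) (auto intro: add)
  define q r where "q = n div s" and "r = n mod s"
  have r: "r < s" using s(3) by (simp add: r_def)
  have "s \<le> q" using div_le_mono[OF n, of s] s(3) by (simp add: q_def)
  then have qr: "q - r \<ge> 1" using r by simp
  have "n = q * s + r" by (simp add: q_def r_def)
  also have "q = (q - r) + r" using qr by simp
  finally have e: "n = (q - r) * s + r * (s + 1)" by (simp add: distrib_right)
  show ?thesis
  proof (cases "r = 0")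
    case True
    then show ?thesis using e mult[OF s(1) qr] by simp
  next
    case False
    then show ?thesis using e mult[OF s(1) qr] mult[OF s(2), of r] add by simp
  qed
qed

section \<open>Return times to a small set under a drift condition\<close>

locale drift_kernel =
  fixes P :: "'x::polish_space \<Rightarrow> 'x measure" and V :: "'x \<Rightarrow> real" and lam b :: real
    and D :: "'x set" and m :: nat and \<nu> \<psi> :: "'x measure"
  assumes P: "prob_kernel P" and V[measurable]: "V \<in> borel_measurable borel" and V1: "\<And>x. 1 \<le> V x"
    and lam: "0 \<le> lam" "lam < 1" and b: "0 < b"
    and drift: "\<And>x. (\<integral>\<^sup>+y. ennreal (V y) \<partial>P x) \<le> ennreal (lam * V x + b * indicat_real D x)"
    and D[measurable]: "D \<in> sets borel" and m: "m > 0"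
    and \<nu>: "sets \<nu> = sets borel" "emeasure \<nu> UNIV > 0"
    and minor: "\<And>x B. x \<in> D \<Longrightarrow> B \<in> sets borel \<Longrightarrow> emeasure \<nu> B \<le> emeasure (kernel_power P m x) B"
    and \<psi>: "prob_space \<psi>" "sets \<psi> = sets borel"
    and irr: "\<And>A x. A \<in> sets borel \<Longrightarrow> emeasure \<psi> A > 0 \<Longrightarrow> \<exists>t>0. emeasure (kernel_power P t x) A > 0"
    and aper: "aperiodic_kernel \<psi> P"
begin

abbreviation "Pn \<equiv> kernel_power P"

lemma Pn: "prob_kernel (Pn n)" by (rule prob_kernel_power[OF P])

lemmas PnD = prob_kernelD[OF Pn]

lemma emeasure_Pn_measurable [measurable (raw)]:
  assumes "A \<in> sets borel" "f \<in> M \<rightarrow>\<^sub>M borel"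
  shows "(\<lambda>x. emeasure (Pn n (f x)) A) \<in> borel_measurable M"
  using measurable_compose[OF assms(2) kernel_emeasure_measurable[OF Pn assms(1)]] .

text \<open>The visits to \<open>D\<close> keep their probabilities instead of being bounded by 1.
  This is what later turns the inequality into a lower bound on those probabilities.\<close>

lemma drift_iterate:
  "(\<integral>\<^sup>+y. ennreal (V y) \<partial>Pn n x) \<le> ennreal (lam ^ n * V x + b * (\<Sum>j<n. lam ^ (n - 1 - j) * measure (Pn j x) D))"
proof (induction n)
  case 0
  show ?case by (simp add: kernel_power_0 nn_integral_return)
next
  case (Suc n)
  interpret Pn: prob_space "Pn n x" by (rule PnD)
  have [measurable_cong]: "sets (Pn n x) = sets borel" by (rule PnD)
  let ?S = "\<Sum>j<n. lam ^ (n - 1 - j) * measure (Pn j x) D"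
  have S0: "0 \<le> ?S" using lam by (intro sum_nonneg) auto
  have V0: "0 \<le> V x" for x using V1[of x] by simp
  have "(\<integral>\<^sup>+y. ennreal (V y) \<partial>Pn (Suc n) x) = (\<integral>\<^sup>+y. \<integral>\<^sup>+z. ennreal (V z) \<partial>P y \<partial>Pn n x)"
    using kernel_power_add[OF P, of n 1 x] kernel_power_1[OF P]
    by (simp add: nn_integral_bind_kernel[OF Pn] PnD)
  also have "\<dots> \<le> (\<integral>\<^sup>+y. ennreal lam * ennreal (V y) + ennreal b * indicator D y \<partial>Pn n x)"
  proof (intro nn_integral_mono)
    fix y
    have "ennreal lam * ennreal (V y) + ennreal b * indicator D y = ennreal (lam * V y + b * indicat_real D y)"
      using V0[of y] lam b by (cases "y \<in> D") (simp_all add: ennreal_mult ennreal_plus)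
    then show "(\<integral>\<^sup>+z. ennreal (V z) \<partial>P y) \<le> ennreal lam * ennreal (V y) + ennreal b * indicator D y"
      using drift[of y] by simp
  qed
  also have "\<dots> = ennreal lam * (\<integral>\<^sup>+y. ennreal (V y) \<partial>Pn n x) + ennreal b * emeasure (Pn n x) D"
    by (subst nn_integral_add) (auto simp: nn_integral_cmult)
  also have "\<dots> \<le> ennreal lam * ennreal (lam ^ n * V x + b * ?S) + ennreal b * ennreal (measure (Pn n x) D)"
    using Suc by (intro add_mono mult_left_mono) (auto simp: Pn.emeasure_eq_measure)
  also have "\<dots> = ennreal (lam * (lam ^ n * V x + b * ?S) + b * measure (Pn n x) D)"
    using lam b S0 V0[of x]
    by (simp add: ennreal_mult[symmetric] ennreal_plus[symmetric] del: ennreal_plus)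
  also have "lam * (lam ^ n * V x + b * ?S) + b * measure (Pn n x) D
    = lam ^ Suc n * V x + b * (lam * ?S + measure (Pn n x) D)"
    by (simp add: algebra_simps)
  also have "lam * ?S + measure (Pn n x) D = (\<Sum>j<Suc n. lam ^ (Suc n - 1 - j) * measure (Pn j x) D)"
  proof -
    have "lam * ?S = (\<Sum>j<n. lam ^ (n - j) * measure (Pn j x) D)"
      unfolding sum_distrib_left
    proof (intro sum.cong refl)
      fix j assume "j \<in> {..<n}"
      then have "n - j = Suc (n - 1 - j)" by auto
      then show "lam * (lam ^ (n - 1 - j) * measure (Pn j x) D) = lam ^ (n - j) * measure (Pn j x) D" by simp
    qed
    then show ?thesis by simp
  qed
  finally show ?case .
qed

lemma drift_bound: "(\<integral>\<^sup>+y. ennreal (V y) \<partial>Pn n x) \<le> ennreal (lam ^ n * V x + b / (1 - lam))"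
proof -
  have "(\<Sum>j<n. lam ^ (n - 1 - j) * measure (Pn j x) D) \<le> (\<Sum>j<n. lam ^ (n - 1 - j))"
    using lam prob_space.prob_le_1[OF PnD(4)] by (intro sum_mono mult_left_le) auto
  also have "\<dots> = (\<Sum>j<n. lam ^ j)" using sum.nat_diff_reindex[of "\<lambda>j. lam ^ j" n] by simp
  also have "\<dots> = (1 - lam ^ n) / (1 - lam)" using lam by (simp add: sum_gp_strict)
  also have "\<dots> \<le> 1 / (1 - lam)" using lam by (intro divide_right_mono) auto
  finally have "b * (\<Sum>j<n. lam ^ (n - 1 - j) * measure (Pn j x) D) \<le> b * (1 / (1 - lam))"
    using b by (intro mult_left_mono) auto
  then show ?thesis by (intro order_trans[OF drift_iterate] ennreal_leI) simp
qed

text \<open>Since \<open>V \<ge> 1\<close>, its mean after \<open>n\<close> steps is at least 1,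
  while the drift without visits to \<open>D\<close> would bring it below 1 once
  \<open>lam ^ n * R\<close> is small. So some visit before time \<open>n\<close> has probability
  bounded below.\<close>

lemma reach:
  fixes R :: real
  obtains n \<delta> where "0 < \<delta>" "\<And>x. V x \<le> R \<Longrightarrow> \<exists>j<n. \<delta> \<le> measure (Pn j x) D"
proof -
  define R' where "R' = max R 1"
  obtain n where "lam ^ n < 1 / (2 * R')"
    using real_arch_pow_inv[of "1 / (2 * R')" lam] lam by (auto simp: R'_def)
  then have n: "lam ^ n * R' < 1 / 2" by (simp add: R'_def field_simps split: if_splits)
  \<comment> \<open>If all visit probabilities before \<open>n\<close> were at most \<delta>, they
    would contribute at most 1/2, and the initial weight contributes less than 1/2.\<close>
  define \<delta> where "\<delta> = 1 / (2 * b * (real n + 1))"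
  have \<delta>: "0 < \<delta>" using b by (simp add: \<delta>_def)
  have "\<exists>j<n. \<delta> \<le> measure (Pn j x) D" if x: "V x \<le> R" for x
  proof (rule ccontr)
    assume "\<not> ?thesis"
    then have small: "measure (Pn j x) D \<le> \<delta>" if "j < n" for j using that by force
    interpret Pn: prob_space "Pn n x" by (rule PnD)
    have "(\<integral>\<^sup>+y. 1 \<partial>Pn n x) \<le> (\<integral>\<^sup>+y. ennreal (V y) \<partial>Pn n x)"
      using V1 by (intro nn_integral_mono) (metis ennreal_1 ennreal_leI)
    then have "1 \<le> ennreal (lam ^ n * V x + b * (\<Sum>j<n. lam ^ (n - 1 - j) * measure (Pn j x) D))"
      using order_trans[OF _ drift_iterate[of n x], of 1] by (simp only: nn_integral_const Pn.emeasure_space_1 mult_1_left)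
    then have "1 \<le> lam ^ n * V x + b * (\<Sum>j<n. lam ^ (n - 1 - j) * measure (Pn j x) D)"
      unfolding ennreal_1[symmetric] ennreal_le_iff2 by linarith
    moreover have "lam ^ n * V x \<le> lam ^ n * R'"
      using x lam by (intro mult_left_mono) (auto simp: R'_def)
    moreover have "b * (\<Sum>j<n. lam ^ (n - 1 - j) * measure (Pn j x) D) \<le> b * (\<Sum>j<n. 1 * \<delta>)"
      using b lam small \<delta> by (intro mult_left_mono sum_mono mult_mono power_le_one) auto
    moreover have "b * (\<Sum>j<n. 1 * \<delta>) \<le> 1 / 2"
    proof -
      have "b * (\<Sum>j<n. 1 * \<delta>) = real n * (b * \<delta>)" by simp
      also have "b * \<delta> = 1 / (2 * (real n + 1))" using b by (simp add: \<delta>_def)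
      also have "real n * (1 / (2 * (real n + 1))) \<le> 1 / 2" by (simp add: field_simps)
      finally show ?thesis .
    qed
    ultimately show False using n by linarith
  qed
  then show thesis using that \<delta> by blast
qed

lemma reach_pos: "\<exists>j. 0 < emeasure (Pn j x) D"
proof -
  obtain n \<delta> where "0 < \<delta>" "\<And>y. V y \<le> V x \<Longrightarrow> \<exists>j<n. \<delta> \<le> measure (Pn j y) D"
    using reach[of "V x"] by metis
  from this(2)[of x] obtain j where "\<delta> \<le> measure (Pn j x) D" by auto
  then have "0 < measure (Pn j x) D" using \<open>0 < \<delta>\<close> by linarith
  then show ?thesis by (metis measure_def enn2real_positive_iff)
qed

text \<open>The lower bound is uniform over \<open>D\<close>, so that return times can be added
  while their bounds multiply.\<close>

definition returns :: "nat set" where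
  "returns = {n. n \<ge> 1 \<and> (\<exists>\<delta>>0. \<forall>x\<in>D. \<delta> \<le> emeasure (Pn n x) D)}"

lemma returns_add: "i \<in> returns \<Longrightarrow> j \<in> returns \<Longrightarrow> i + j \<in> returns"
proof -
  assume "i \<in> returns" "j \<in> returns"
  then obtain \<delta> \<epsilon> where *: "i \<ge> 1" "\<delta> > 0" "\<forall>x\<in>D. \<delta> \<le> emeasure (Pn i x) D"
    "\<epsilon> > 0" "\<forall>x\<in>D. \<epsilon> \<le> emeasure (Pn j x) D" by (auto simp: returns_def)
  have "\<delta> * \<epsilon> \<le> emeasure (Pn (i + j) x) D" if "x \<in> D" for x
    using * that by (intro order_trans[OF _ emeasure_kernel_power_ge[OF P D D, of \<epsilon>]] mult_right_mono) auto
  moreover have "\<delta> * \<epsilon> > 0" using * by (simp add: ennreal_zero_less_mult_iff)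
  ultimately show ?thesis using * by (auto simp: returns_def)
qed

text \<open>Countable additivity finds a level \<open>1 / (i + 1)\<close> such that the points
  reaching \<open>D\<close> with at least this probability have positive \<nu> mass; the
  minorization sends every point of \<open>D\<close> into that set uniformly.\<close>

lemma returnsI:
  assumes "0 < emeasure \<nu> {y. 0 < emeasure (Pn k y) D}"
  shows "m + k \<in> returns"
proof -
  let ?A = "\<lambda>i. {y. inverse (of_nat (Suc i)) \<le> emeasure (Pn k y) D}"
  have [measurable]: "?A i \<in> sets borel" for i by measurable
  have "{y. 0 < emeasure (Pn k y) D} = (\<Union>i. ?A i)"
  proof (intro set_eqI iffI)
    fix y assume "y \<in> {y. 0 < emeasure (Pn k y) D}"
    interpret prob_space "Pn k y" by (rule PnD)
    have "0 < measure (Pn k y) D" using \<open>y \<in> _\<close> by (simp add: emeasure_eq_measure)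
    then obtain i where "inverse (real (Suc i)) < measure (Pn k y) D" using reals_Archimedean by blast
    then have "ennreal (inverse (real (Suc i))) \<le> emeasure (Pn k y) D"
      by (simp add: emeasure_eq_measure)
    moreover have "ennreal (inverse (real (Suc i))) = inverse (of_nat (Suc i))"
      by (subst inverse_ennreal[symmetric]) (auto simp: ennreal_of_nat_eq_real_of_nat)
    ultimately show "y \<in> (\<Union>i. ?A i)" by auto
  next
    fix y assume "y \<in> (\<Union>i. ?A i)"
    then obtain i where "inverse (of_nat (Suc i)) \<le> emeasure (Pn k y) D" by blast
    moreover have "(0::ennreal) < inverse (of_nat (Suc i))"
      by (simp add: ennreal_inverse_positive del: of_nat_Suc)
    ultimately show "y \<in> {y. 0 < emeasure (Pn k y) D}" by auto
  qed
  moreover have "emeasure \<nu> (\<Union>i. ?A i) = 0" if "\<And>i. emeasure \<nu> (?A i) = 0"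
    using that \<nu>(1) by (intro emeasure_UN_eq_0) auto
  ultimately obtain i where i: "emeasure \<nu> (?A i) > 0"
    using assms by (metis not_gr_zero)
  have "emeasure \<nu> (?A i) * inverse (of_nat (Suc i)) \<le> emeasure (Pn (m + k) x) D" if "x \<in> D" for x
  proof -
    have "emeasure \<nu> (?A i) * inverse (of_nat (Suc i)) \<le> emeasure (Pn m x) (?A i) * inverse (of_nat (Suc i))"
      by (rule mult_right_mono[OF minor[OF that]]) auto
    also have "\<dots> \<le> emeasure (Pn (m + k) x) D"
      by (rule emeasure_kernel_power_ge[OF P D]) auto
    finally show ?thesis .
  qed
  moreover have "emeasure \<nu> (?A i) * inverse (of_nat (Suc i)) > 0"
    using i by (simp add: ennreal_zero_less_mult_iff ennreal_inverse_positive del: of_nat_Suc)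
  ultimately show ?thesis using m by (auto simp: returns_def)
qed

text \<open>Without return times \<nu> would vanish on the set of points reaching \<open>D\<close>
  at any fixed time, but these countably many sets cover the space.\<close>

lemma returns_nonempty: "returns \<noteq> {}"
proof
  assume "returns = {}"
  then have "emeasure \<nu> {y. 0 < emeasure (Pn k y) D} = 0" for k
    using returnsI[of k] by (metis empty_iff not_gr_zero)
  then have "emeasure \<nu> (\<Union>k. {y. 0 < emeasure (Pn k y) D}) = 0"
    using \<nu>(1) by (intro emeasure_UN_eq_0) auto
  moreover have "(\<Union>k. {y. 0 < emeasure (Pn k y) D}) = UNIV" using reach_pos by auto
  ultimately show False using \<nu>(2) by simp
qed

text \<open>If all return times are divisible by \<open>d\<close>, then the phase (mod \<open>d\<close>) at which a point can
  reach \<open>D\<close> is unique off the set \<open>Z\<close> of points leading to two-phase points, and these phases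
  form a \<open>d\<close>-cycle; \<open>Z\<close> is negligible because its complement is absorbing.\<close>

lemma returns_dvd_cycle:
  assumes d: "d \<ge> 1" "\<And>t. t \<in> returns \<Longrightarrow> d dvd t"
  shows "kernel_cycle \<psi> P d"
proof -
  \<comment> \<open>Phase \<open>i\<close> means that \<open>D\<close> can be reached in some number
    \<open>n\<close> of steps with \<open>n + i\<close> divisible by \<open>d\<close>; a step
    forward shortens \<open>n\<close> and so raises the phase by one.\<close>
  define E where "E i = (\<Union>n\<in>{n. d dvd (n + i)}. {y. 0 < emeasure (Pn n y) D})" for i
  have [measurable]: "E i \<in> sets borel" for i unfolding E_def by measurable
  define N0 where "N0 = (\<Union>i<d. \<Union>j\<in>{..<d}-{i}. E i \<inter> E j)"
  have [measurable]: "N0 \<in> sets borel" unfolding N0_def by measurable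
  define Z where "Z = (\<Union>k. {y. 0 < emeasure (Pn k y) N0})"
  have [measurable]: "Z \<in> sets borel" unfolding Z_def by measurable
  have N0Z: "N0 \<subseteq> Z"
  proof
    fix y assume "y \<in> N0"
    then have "0 < emeasure (Pn 0 y) N0" by (simp add: kernel_power_0)
    then show "y \<in> Z" unfolding Z_def by blast
  qed
  have phase: "i = j" if "i < d" "j < d" "y \<in> E i" "y \<in> E j" "y \<notin> Z" for i j y
    using that N0Z unfolding N0_def by blast
  \<comment> \<open>A point of \<open>Z\<close> can reach \<open>D\<close> at two times incongruent
    modulo \<open>d\<close>. For each such pair of times one of the two reaching sets is \<nu>-null,
    as otherwise \<open>returnsI\<close> would give incongruent return times; and there are
    countably many pairs.\<close>
  have \<nu>Z: "emeasure \<nu> Z = 0"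
  proof -
    let ?H = "\<lambda>k. {y. 0 < emeasure (Pn k y) D}"
    let ?I = "{(k :: nat, n, n'). \<not> int d dvd int n - int n'}"
    let ?U = "\<Union>(k, n, n')\<in>?I. ?H (k + n) \<inter> ?H (k + n')"
    have HH: "(case p of (k, n, n') \<Rightarrow> ?H (k + n) \<inter> ?H (k + n')) \<in> sets \<nu>" for p
    proof -
      have "?H (k + n) \<inter> ?H (k + n') \<in> sets borel" for k n n' by measurable
      then show ?thesis by (cases p) (simp only: prod.case \<nu>(1))
    qed
    have "Z \<subseteq> ?U"
    proof
      fix y assume "y \<in> Z"
      then obtain k where k: "0 < emeasure (Pn k y) N0" by (auto simp: Z_def)
      let ?J = "{(i, j, n, n'). i < d \<and> j < d \<and> i \<noteq> j \<and> d dvd (n + i) \<and> d dvd (n' + j)}"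
      have N0: "N0 = (\<Union>(i, j, n, n')\<in>?J. ?H n \<inter> ?H n')"
        unfolding N0_def E_def by auto
      have "\<exists>(i, j, n, n')\<in>?J. 0 < emeasure (Pn k y) (?H n \<inter> ?H n')"
      proof (rule ccontr)
        assume "\<not> ?thesis"
        then have "emeasure (Pn k y) (\<Union>(i, j, n, n')\<in>?J. ?H n \<inter> ?H n') = 0"
          by (intro emeasure_countable_UN_eq_0) (auto simp: PnD)
        with k N0 show False by simp
      qed
      then obtain i j n n' where *: "i < d" "j < d" "i \<noteq> j" "d dvd (n + i)" "d dvd (n' + j)"
        "0 < emeasure (Pn k y) (?H n \<inter> ?H n')" by auto
      have "emeasure (Pn k y) (?H n \<inter> ?H n') \<le> emeasure (Pn k y) (?H n)"
        "emeasure (Pn k y) (?H n \<inter> ?H n') \<le> emeasure (Pn k y) (?H n')"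
        by (intro emeasure_mono; simp add: PnD)+
      then have "y \<in> ?H (k + n)" "y \<in> ?H (k + n')"
        using *(6) emeasure_kernel_power_pos[OF P D] by (auto intro: less_le_trans)
      moreover have "\<not> int d dvd int n - int n'"
      proof
        assume "int d dvd int n - int n'"
        moreover have "int d dvd int (n + i)" "int d dvd int (n' + j)" using *(4,5) by (simp_all only: int_dvd_int_iff)
        ultimately have "int d dvd (int (n + i) - int (n' + j)) - (int n - int n')" by (metis dvd_diff)
        then have "int d dvd int i - int j" by (simp add: algebra_simps)
        then show False using *(1-3) dvd_imp_le_int[of "int i - int j" "int d"] by auto
      qed
      ultimately show "y \<in> ?U" by blast
    qed
    moreover have "emeasure \<nu> ?U = 0"
    proof (rule emeasure_countable_UN_eq_0[OF countableI_type HH])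
      fix p assume "p \<in> ?I"
      then obtain k n n' where p: "p = (k, n, n')" "\<not> int d dvd int n - int n'" by auto
      have "emeasure \<nu> (?H (k + n)) = 0 \<or> emeasure \<nu> (?H (k + n')) = 0"
      proof (rule ccontr)
        assume "\<not> ?thesis"
        then have "d dvd (m + (k + n))" "d dvd (m + (k + n'))"
          using returnsI d(2) by (auto simp: zero_less_iff_neq_zero)
        then have "int d dvd int (m + (k + n)) - int (m + (k + n'))" by (intro dvd_diff) (simp_all only: int_dvd_int_iff)
        then show False using p(2) by simp
      qed
      moreover have "emeasure \<nu> (?H (k + n) \<inter> ?H (k + n')) \<le> emeasure \<nu> (?H (k + n))"
        "emeasure \<nu> (?H (k + n) \<inter> ?H (k + n')) \<le> emeasure \<nu> (?H (k + n'))"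
        by (intro emeasure_mono; simp add: \<nu>(1))+
      ultimately show "emeasure \<nu> (case p of (k, n, n') \<Rightarrow> ?H (k + n) \<inter> ?H (k + n')) = 0"
        unfolding p by auto
    qed
    moreover have "?U \<in> sets \<nu>" by (rule sets.countable_UN''[OF countableI_type HH])
    ultimately have "emeasure \<nu> Z \<le> 0" by (metis (lifting) emeasure_mono)
    then show ?thesis by simp
  qed
  have absorb: "emeasure (Pn t x) Z = 0" if "x \<notin> Z" for t x
  proof -
    have "emeasure (Pn t x) {y. 0 < emeasure (Pn k y) N0} = 0" for k
    proof (rule ccontr)
      assume "\<not> ?thesis"
      then have "0 < emeasure (Pn t x) {y. 0 < emeasure (Pn k y) N0}" by (simp only: zero_less_iff_neq_zero not_False_eq_True)
      then have "0 < emeasure (Pn (t + k) x) N0"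
        by (intro emeasure_kernel_power_pos P \<open>N0 \<in> sets borel\<close>)
      then show False using that by (auto simp: Z_def)
    qed
    then show ?thesis unfolding Z_def by (intro emeasure_UN_eq_0) (auto simp: PnD)
  qed
  have "Z \<noteq> UNIV" using \<nu>Z \<nu>(2) by auto
  then obtain x0 where "x0 \<notin> Z" by blast
  \<comment> \<open>Otherwise irreducibility would lead from \<open>x0\<close> into \<open>Z\<close>
    with positive probability, but the complement of \<open>Z\<close> is absorbing.\<close>
  have \<psi>Z: "emeasure \<psi> Z = 0"
  proof (rule ccontr)
    assume "emeasure \<psi> Z \<noteq> 0"
    then have "0 < emeasure \<psi> Z" by (simp add: zero_less_iff_neq_zero)
    from irr[OF \<open>Z \<in> sets borel\<close> this, of x0] absorb[OF \<open>x0 \<notin> Z\<close>] show False by auto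
  qed
  have cover: "\<exists>i<d. y \<in> E i" for y
  proof -
    obtain n where n: "0 < emeasure (Pn n y) D" using reach_pos by blast
    have "(n + (d - n mod d) mod d) mod d = (n mod d + (d - n mod d)) mod d"
      by (simp only: mod_add_right_eq mod_add_left_eq)
    also have "\<dots> = 0" using d(1) by simp
    finally have "d dvd (n + (d - n mod d) mod d)" unfolding dvd_eq_mod_eq_0 .
    moreover have "(d - n mod d) mod d < d" using d(1) by simp
    ultimately show ?thesis using n unfolding E_def by blast
  qed
  define F where "F i = E i - Z" for i
  have [measurable]: "F i \<in> sets borel" for i unfolding F_def by measurable
  have "emeasure (P x) (F (Suc i mod d)) = 1" if i: "i < d" "x \<in> F i" for i x
  proof -
    interpret prob_space "P x" by (rule prob_kernelD[OF P])
    note [measurable_cong] = prob_kernelD(2)[OF P, of x]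
    have x: "x \<in> E i" "x \<notin> Z" using i by (auto simp: F_def)
    have PZ: "AE y in P x. y \<notin> Z"
      using absorb[OF x(2), of 1] by (intro AE_not_in) (auto simp: kernel_power_1[OF P] prob_kernelD[OF P] null_sets_def)
    have "AE y in P x. y \<notin> E j" if j: "j < d" "j \<noteq> Suc i mod d" for j
    proof -
      \<comment> \<open>If \<open>P x\<close> charged these points, \<open>x\<close> would have the
        phase preceding \<open>j\<close> modulo \<open>d\<close>. Uniqueness of phases off
        \<open>Z\<close> identifies that phase with \<open>i\<close>, against the choice of
        \<open>j\<close>.\<close>
      have "emeasure (P x) {y. 0 < emeasure (Pn n y) D} = 0" if n: "d dvd (n + j)" for n
      proof (rule ccontr)
        assume "\<not> ?thesis"
        then have "0 < emeasure (Pn 1 x) {y. 0 < emeasure (Pn n y) D}"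
          by (simp only: zero_less_iff_neq_zero not_False_eq_True One_nat_def kernel_power_1[OF P])
        then have "0 < emeasure (Pn (1 + n) x) D"
          by (intro emeasure_kernel_power_pos P D)
        moreover have "d dvd (1 + n + (j + d - 1) mod d)"
        proof -
          have "(1 + n + (j + d - 1) mod d) mod d = (1 + n + (j + d - 1)) mod d" by (simp only: mod_add_right_eq)
          also have "1 + n + (j + d - 1) = n + j + d" using d(1) by simp
          also have "(n + j + d) mod d = 0" using n by (simp add: dvd_eq_mod_eq_0)
          finally show ?thesis unfolding dvd_eq_mod_eq_0 .
        qed
        ultimately have "x \<in> E ((j + d - 1) mod d)" unfolding E_def by blast
        then have "(j + d - 1) mod d = i" using phase[OF _ i(1) _ x(1) x(2), of "(j + d - 1) mod d"] d(1) by simp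
        then have "Suc i mod d = Suc (j + d - 1) mod d" by (metis mod_Suc_eq)
        also have "\<dots> = j" using j d(1) by simp
        finally show False using j by simp
      qed
      then have "emeasure (P x) (E j) = 0" unfolding E_def
        by (intro emeasure_countable_UN_eq_0) (auto simp: prob_kernelD[OF P])
      then show ?thesis by (intro AE_not_in) (auto simp: null_sets_def prob_kernelD[OF P])
    qed
    then have "AE y in P x. \<forall>j\<in>{..<d} - {Suc i mod d}. y \<notin> E j"
      by (intro AE_finite_allI) auto
    then have "AE y in P x. y \<in> F (Suc i mod d)"
      using PZ by eventually_elim (use cover in \<open>auto simp: F_def\<close>)
    then show ?thesis by (intro emeasure_eq_1_AE) auto
  qed
  moreover have "disjoint_family_on F {..<d}"
    using phase by (auto simp: disjoint_family_on_def F_def)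
  moreover have "- (\<Union>i<d. F i) = Z" using cover by (auto simp: F_def)
  ultimately show ?thesis using d(1) \<psi>Z unfolding kernel_cycle_def
    by (intro conjI exI[of _ F]) auto
qed

text \<open>A common divisor \<open>d\<close> of the return times yields a \<open>d\<close>-cycle,
  so aperiodicity forces \<open>d = 1\<close>, and two consecutive return times generate all large
  ones.\<close>

lemma returns_large: "\<exists>n0. \<forall>n\<ge>n0. n \<in> returns"
proof -
  have "0 \<notin> returns" by (simp add: returns_def)
  then obtain d s where ds: "d \<ge> 1" "s \<in> returns" "s + d \<in> returns" "\<And>t. t \<in> returns \<Longrightarrow> d dvd t"
    using additive_semigroup_gap[OF returns_nonempty _ returns_add] by metis
  then have "d = 1" using returns_dvd_cycle aper by (metis aperiodic_kernel_def le_antisym)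
  moreover have "s \<ge> 1" using ds by (simp add: returns_def)
  ultimately have "n \<in> returns" if "n \<ge> s * s" for n
    using additive_semigroup_large[OF ds(2) _ _ returns_add that] ds by simp
  then show ?thesis by blast
qed

text \<open>The time \<open>j\<close> at which \<open>D\<close> is likely to be visited varies with
  \<open>x\<close>. The way from \<open>D\<close> back to \<open>D\<close> is given
  \<open>n + n0 - j\<close> steps, a return time for every \<open>j < n\<close>, so that together
  with the final minorization the total \<open>N\<close> is the same for all
  \<open>x\<close>.\<close>

theorem sublevel_small:
  "\<exists>N>0. \<exists>c>0. \<forall>x. V x \<le> R \<longrightarrow> (\<forall>B\<in>sets borel. c * emeasure \<nu> B \<le> emeasure (Pn N x) B)"
proof -
  obtain n \<delta> where \<delta>: "0 < \<delta>" "\<And>x. V x \<le> R \<Longrightarrow> \<exists>j<n. \<delta> \<le> measure (Pn j x) D"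
    using reach[of R] by metis
  obtain n0 where n0: "\<And>i. i \<ge> n0 \<Longrightarrow> i \<in> returns" using returns_large by blast
  define N where "N = n + n0 + m"
  have "\<forall>j. \<exists>e>0. j < n \<longrightarrow> (\<forall>x\<in>D. e \<le> emeasure (Pn (n + n0 - j) x) D)"
  proof
    fix j
    show "\<exists>e>0. j < n \<longrightarrow> (\<forall>x\<in>D. e \<le> emeasure (Pn (n + n0 - j) x) D)"
      using n0[of "n + n0 - j"] by (cases "j < n") (auto simp: returns_def intro: exI[of _ 1])
  qed
  then obtain e :: "nat \<Rightarrow> ennreal" where e: "\<And>j. e j > 0" "\<And>j x. j < n \<Longrightarrow> x \<in> D \<Longrightarrow> e j \<le> emeasure (Pn (n + n0 - j) x) D"
    by metis
  \<comment> \<open>Inserting 1 keeps the set nonempty when \<open>n = 0\<close>.\<close>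
  define c where "c = ennreal \<delta> * Min (insert 1 (e ` {..<n}))"
  have "Min (insert 1 (e ` {..<n})) > 0" using e(1) by (subst Min_gr_iff) auto
  then have c: "c > 0" using \<delta>(1) by (simp add: c_def ennreal_zero_less_mult_iff)
  have "c * emeasure \<nu> B \<le> emeasure (Pn N x) B" if x: "V x \<le> R" and B: "B \<in> sets borel" for x B
  proof -
    obtain j where j: "j < n" "\<delta> \<le> measure (Pn j x) D" using \<delta>(2)[OF x] by blast
    interpret prob_space "Pn j x" by (rule PnD)
    have "c * emeasure \<nu> B \<le> emeasure (Pn j x) D * e j * emeasure \<nu> B"
      unfolding c_def using j by (intro mult_mono Min_le) (auto simp: emeasure_eq_measure)
    also have "\<dots> = emeasure (Pn j x) D * (e j * emeasure \<nu> B)" by (simp add: mult.assoc)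
    also have "\<dots> \<le> emeasure (Pn (j + ((n + n0 - j) + m)) x) B"
    proof (rule emeasure_kernel_power_ge[OF P B D])
      fix y assume y: "y \<in> D"
      have "e j * emeasure \<nu> B \<le> emeasure (Pn (n + n0 - j) y) D * emeasure \<nu> B"
        using e(2)[OF j(1) y] by (rule mult_right_mono) simp
      also have "\<dots> \<le> emeasure (Pn ((n + n0 - j) + m) y) B"
        using minor B by (intro emeasure_kernel_power_ge P D) auto
      finally show "e j * emeasure \<nu> B \<le> emeasure (Pn ((n + n0 - j) + m) y) B" .
    qed
    also have "j + ((n + n0 - j) + m) = N" using j(1) by (simp add: N_def)
    finally show ?thesis .
  qed
  then show ?thesis using c m unfolding N_def by (intro exI[of _ "n + n0 + m"] conjI exI[of _ c]) auto
qed

end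

subsection \<open>Stationary kernels\<close>

lemma stationary_bind:
  assumes "prob_kernel P" "sets \<pi> = sets borel" "stationary_kernel \<pi> P"
  shows "\<pi> \<bind> P = \<pi>"
proof (rule measure_eqI)
  have sp: "space \<pi> \<noteq> {}" using sets_eq_imp_space_eq[OF assms(2)] by auto
  show s: "sets (\<pi> \<bind> P) = sets \<pi>"
    using sets_bind[of \<pi> P borel] prob_kernelD(2)[OF assms(1)] sp assms(2) by simp
  fix A assume "A \<in> sets (\<pi> \<bind> P)"
  then have A: "A \<in> sets borel" using s assms(2) by simp
  show "emeasure (\<pi> \<bind> P) A = emeasure \<pi> A"
    using assms(3) A by (simp add: emeasure_bind_kernel[OF assms(1,2) A] stationary_kernel_def)
qed

lemma bind_stationary:
  assumes "prob_kernel P" "sets \<pi> = sets borel" "\<pi> \<bind> P = \<pi>"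
  shows "stationary_kernel \<pi> P"
  using emeasure_bind_kernel[OF assms(1,2)] assms(3) by (simp add: stationary_kernel_def)

lemma stationary_kernel_comp:
  assumes "prob_kernel P" "prob_kernel R" "sets \<pi> = sets borel" "stationary_kernel \<pi> P" "stationary_kernel \<pi> R"
  shows "stationary_kernel \<pi> (kernel_comp P R)"
proof (rule bind_stationary[OF prob_kernel_comp[OF assms(1,2)] assms(3)])
  have "\<pi> \<bind> kernel_comp P R = (\<pi> \<bind> P) \<bind> R"
    unfolding kernel_comp_def[abs_def] by (rule bind_kernel_assoc[OF assms(1,2,3), symmetric])
  also have "\<dots> = \<pi>" using assms by (simp add: stationary_bind)
  finally show "\<pi> \<bind> kernel_comp P R = \<pi>" .
qed

lemma stationary_return: "stationary_kernel \<pi> (return borel)" if "sets \<pi> = sets borel"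
  by (rule bind_stationary) (simp_all add: prob_kernel_return that bind_return'')

lemma stationary_kernel_power:
  assumes "prob_kernel P" "sets \<pi> = sets borel" "stationary_kernel \<pi> P"
  shows "stationary_kernel \<pi> (kernel_power P n)"
proof (induction n)
  case 0
  show ?case by (simp add: kernel_power_0 stationary_return assms)
next
  case (Suc n)
  then show ?case using stationary_kernel_comp[OF assms(1) prob_kernel_power[OF assms(1)] assms(2,3), of n]
    by (simp add: kernel_power_def)
qed

locale stationary_pair =
  fixes \<pi> :: "'x::polish_space measure" and P :: "'x \<Rightarrow> 'x measure"
  assumes prob_\<pi>: "prob_space \<pi>" and sets_\<pi>[measurable_cong]: "sets \<pi> = sets borel"
    and kernel_P: "prob_kernel P" and stat_P: "stationary_kernel \<pi> P"
begin

lemma space_\<pi>: "space \<pi> = UNIV" using sets_eq_imp_space_eq[OF sets_\<pi>] by simp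

lemma bind_P: "\<pi> \<bind> P = \<pi>" by (rule stationary_bind[OF kernel_P sets_\<pi> stat_P])

lemmas kernel_sub = kernel_subst_sets[OF kernel_P sets_\<pi>]

lemma AE_stationary:
  assumes "AE x in \<pi>. Q x"
  shows "AE x in \<pi>. AE y in P x. Q y"
proof -
  obtain N where N: "{x \<in> space \<pi>. \<not> Q x} \<subseteq> N" "emeasure \<pi> N = 0" "N \<in> sets \<pi>"
    using assms by (rule AE_E)
  have Nb: "N \<in> sets borel" using N(3) sets_\<pi> by simp
  have "(\<integral>\<^sup>+x. emeasure (P x) N \<partial>\<pi>) = 0"
    using emeasure_bind_kernel[OF kernel_P sets_\<pi> Nb] bind_P N(2) by simp
  then have "AE x in \<pi>. emeasure (P x) N = 0"
    using kernel_emeasure_measurable[OF kernel_P Nb] by (subst (asm) nn_integral_0_iff_AE) auto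
  then show ?thesis
  proof eventually_elim
    case (elim x)
    then show "AE y in P x. Q y"
      using N(1) Nb by (intro AE_I[of _ _ N]) (auto simp: space_\<pi> prob_kernelD[OF kernel_P])
  qed
qed

lemma
  fixes f :: "'x \<Rightarrow> 'b::{banach, second_countable_topology}"
  assumes "integrable \<pi> f"
  shows AE_integrable_stationary: "AE x in \<pi>. integrable (P x) f"
    and integrable_stationary: "integrable \<pi> (\<lambda>x. \<integral>y. f y \<partial>P x)"
    and integral_stationary: "(\<integral>x. \<integral>y. f y \<partial>P x \<partial>\<pi>) = (\<integral>x. f x \<partial>\<pi>)"
proof -
  have ne: "space \<pi> \<noteq> {}" by (simp add: space_\<pi>)
  have f: "integrable (\<pi> \<bind> P) f" using assms by (simp add: bind_P)
  show "AE x in \<pi>. integrable (P x) f" by (rule AE_integrable_bind[OF kernel_sub ne f])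
  show "integrable \<pi> (\<lambda>x. \<integral>y. f y \<partial>P x)" by (rule integrable_integral_bind[OF kernel_sub ne f])
  show "(\<integral>x. \<integral>y. f y \<partial>P x \<partial>\<pi>) = (\<integral>x. f x \<partial>\<pi>)"
    using integral_bind_integrable[OF kernel_sub ne f] by (simp add: bind_P)
qed

end

section \<open>Second moment bounds\<close>

lemma (in prob_space) square_integral_le:
  fixes u :: "'a \<Rightarrow> real"
  assumes "integrable M u" "integrable M (\<lambda>x. (u x)\<^sup>2)"
  shows "(\<integral>x. u x \<partial>M)\<^sup>2 \<le> (\<integral>x. (u x)\<^sup>2 \<partial>M)"
  using variance_positive[of u] variance_eq[OF assms] by simp

lemma (in prob_space) integrable_square_imp_integrable:
  fixes u :: "'a \<Rightarrow> real"
  assumes "u \<in> borel_measurable M" "integrable M (\<lambda>x. (u x)\<^sup>2)"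
  shows "integrable M u"
proof (rule Bochner_Integration.integrable_bound[of M "\<lambda>x. 1 + (u x)\<^sup>2"])
  have "\<bar>t\<bar> \<le> 1 + t\<^sup>2" for t :: real
    using power2_sum[of "\<bar>t\<bar>" 1] zero_le_power2[of "\<bar>t\<bar> - 1"] by (simp add: power2_diff)
  then show "AE x in M. norm (u x) \<le> norm (1 + (u x)\<^sup>2)" by (intro AE_I2) simp
qed (use assms in auto)

lemma integrable_product:
  fixes u v :: "'a \<Rightarrow> real"
  assumes [measurable]: "u \<in> borel_measurable M" "v \<in> borel_measurable M"
    and "integrable M (\<lambda>x. (u x)\<^sup>2)" "integrable M (\<lambda>x. (v x)\<^sup>2)"
  shows "integrable M (\<lambda>x. u x * v x)"
proof (rule Bochner_Integration.integrable_bound[of M "\<lambda>x. (u x)\<^sup>2 + (v x)\<^sup>2"])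
  have "\<bar>s * t\<bar> \<le> s\<^sup>2 + t\<^sup>2" for s t :: real
  proof -
    have "2 * (\<bar>s\<bar> * \<bar>t\<bar>) \<le> s\<^sup>2 + t\<^sup>2"
      using sum_squares_bound[of "\<bar>s\<bar>" "\<bar>t\<bar>"] by (simp add: mult.assoc)
    moreover have "0 \<le> \<bar>s\<bar> * \<bar>t\<bar>" by simp
    ultimately show ?thesis unfolding abs_mult by linarith
  qed
  then show "AE x in M. norm (u x * v x) \<le> norm ((u x)\<^sup>2 + (v x)\<^sup>2)" by (intro AE_I2) simp
qed (use assms in auto)

context stationary_pair
begin

lemma
  fixes u :: "'x \<Rightarrow> real"
  assumes [measurable]: "u \<in> borel_measurable borel" and u: "integrable \<pi> (\<lambda>x. (u x)\<^sup>2)"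
  shows AE_square_le: "AE x in \<pi>. (\<integral>y. u y \<partial>P x)\<^sup>2 \<le> (\<integral>y. (u y)\<^sup>2 \<partial>P x)"
    and integrable_square_kernel: "integrable \<pi> (\<lambda>x. (\<integral>y. u y \<partial>P x)\<^sup>2)"
proof -
  interpret \<pi>: prob_space \<pi> by (rule prob_\<pi>)
  have "u \<in> borel_measurable \<pi>" by measurable
  then have u1: "integrable \<pi> u" using u by (rule \<pi>.integrable_square_imp_integrable)
  show *: "AE x in \<pi>. (\<integral>y. u y \<partial>P x)\<^sup>2 \<le> (\<integral>y. (u y)\<^sup>2 \<partial>P x)"
    using AE_integrable_stationary[OF u] AE_integrable_stationary[OF u1]
    by eventually_elim (rule prob_space.square_integral_le[OF prob_kernelD(4)[OF kernel_P]])
  show "integrable \<pi> (\<lambda>x. (\<integral>y. u y \<partial>P x)\<^sup>2)"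
  proof (rule Bochner_Integration.integrable_bound[OF integrable_stationary[OF u]])
    show "(\<lambda>x. (\<integral>y. u y \<partial>P x)\<^sup>2) \<in> borel_measurable \<pi>"
      using borel_measurable_integrable[OF integrable_stationary[OF u1]] by measurable
    show "AE x in \<pi>. norm ((\<integral>y. u y \<partial>P x)\<^sup>2) \<le> norm (\<integral>y. (u y)\<^sup>2 \<partial>P x)"
      using * by eventually_elim (metis abs_ge_self order_trans real_norm_def abs_of_nonneg zero_le_power2)
  qed
qed

end

subsection \<open>Geometric ergodicity in a weighted norm\<close>

text \<open>A bound on weighted oscillations is a bound on the distance to the constants in a
  weighted supremum norm; the supremum of \<open>\<phi> x - h x\<close> is a suitable
  constant.\<close>

lemma shift_weighted_oscillation:
  fixes \<phi> h :: "'x \<Rightarrow> real"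
  assumes "\<And>x y. \<bar>\<phi> x - \<phi> y\<bar> \<le> h x + h y"
  shows "\<exists>c. \<forall>x. \<bar>\<phi> x - c\<bar> \<le> h x"
proof -
  have le: "\<phi> x - h x \<le> \<phi> y + h y" for x y using assms[of x y] by linarith
  then have bdd: "bdd_above (range (\<lambda>x. \<phi> x - h x))" by (intro bdd_aboveI) auto
  define c where "c = (SUP x. \<phi> x - h x)"
  have "\<phi> x - h x \<le> c" for x unfolding c_def using bdd by (rule cSUP_upper[OF UNIV_I])
  moreover have "c \<le> \<phi> y + h y" for y unfolding c_def using le by (intro cSUP_least) auto
  ultimately show ?thesis by (intro exI[of _ c]) (smt (verit))
qed

text \<open>The rate is the \<open>N\<close>-th root of \<rho>; rounding \<open>j\<close> down to a
  multiple of \<open>N\<close> costs at most the factor \<open>1 / r ^ N\<close>.\<close>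

lemma geometric_div_bound:
  fixes \<rho> :: real
  assumes "0 < \<rho>" "\<rho> < 1" "N > 0"
  obtains r C where "0 < r" "r < 1" "0 < C" "\<And>j. \<rho> ^ (j div N) \<le> C * r ^ j"
proof -
  define r where "r = root N \<rho>"
  have r: "0 < r" "r < 1" "r ^ N = \<rho>" using assms by (auto simp: r_def)
  have "\<rho> ^ (j div N) \<le> (1 / r ^ N) * r ^ j" for j
  proof -
    have "\<rho> ^ (j div N) * r ^ N \<le> \<rho> ^ (j div N) * r ^ (j mod N)"
      using r assms by (intro mult_left_mono power_decreasing) (auto intro: less_imp_le)
    also have "\<dots> = r ^ (N * (j div N) + j mod N)" by (simp only: power_add power_mult r(3))
    also have "\<dots> = r ^ j" by simp
    finally show ?thesis using r assms(1) by (simp add: field_simps)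
  qed
  then show thesis using that[of r "1 / r ^ N"] r assms(1) by simp
qed

locale ergodic_kernel = drift_kernel P V lam b D m \<nu> \<psi> + stationary_pair \<pi> P
  for P :: "'x::polish_space \<Rightarrow> 'x measure" and V lam b D m \<nu> \<psi> \<pi> +
  assumes V_\<pi>: "integrable \<pi> V"
begin

lemma V_integrable: "integrable (Pn n x) V"
proof -
  have [measurable_cong]: "sets (Pn n x) = sets borel" by (rule PnD)
  have "0 \<le> V y" for y using V1[of y] by simp
  then show ?thesis using drift_bound[of n x]
    by (intro integrableI_nonneg) (auto intro: le_less_trans)
qed

lemma V_integral_le: "(\<integral>y. V y \<partial>Pn n x) \<le> lam ^ n * V x + b / (1 - lam)"
proof -
  have V0: "0 \<le> V y" for y using V1[of y] by simp
  have "ennreal (\<integral>y. V y \<partial>Pn n x) = (\<integral>\<^sup>+y. ennreal (V y) \<partial>Pn n x)"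
    using V_integrable V0 by (simp add: nn_integral_eq_integral)
  also note drift_bound
  finally show ?thesis using V0[of x] lam b by (subst (asm) ennreal_le_iff) auto
qed

lemma dominated_integrable:
  assumes [measurable]: "\<phi> \<in> borel_measurable borel" and "\<And>y. \<bar>\<phi> y\<bar> \<le> A + B * V y"
  shows "integrable (Pn n x) (\<phi> :: 'x \<Rightarrow> real)"
proof (rule Bochner_Integration.integrable_bound[of _ "\<lambda>y. A + B * V y"])
  interpret prob_space "Pn n x" by (rule PnD)
  show "integrable (Pn n x) (\<lambda>y. A + B * V y)" using V_integrable by simp
  have [measurable_cong]: "sets (Pn n x) = sets borel" by (rule PnD)
  show "\<phi> \<in> borel_measurable (Pn n x)" by measurable
  show "AE y in Pn n x. norm (\<phi> y) \<le> norm (A + B * V y)"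
    using order_trans[OF assms(2) abs_ge_self] by (intro AE_I2) simp
qed

lemma small_level:
  obtains N \<kappa> where "N > 0" "sets \<kappa> = sets borel" "emeasure \<kappa> UNIV > 0" "emeasure \<kappa> UNIV \<le> 1"
    "\<And>x B. V x \<le> R \<Longrightarrow> B \<in> sets borel \<Longrightarrow> emeasure \<kappa> B \<le> emeasure (Pn N x) B"
proof -
  \<comment> \<open>Raising the level to include \<open>V undefined\<close> makes the sublevel set
    nonempty; comparison with a probability measure at that point bounds the mass of the scaled
    measure by 1.\<close>
  obtain N c where Nc: "N > 0" "c > 0"
    "\<And>x B. V x \<le> max R (V undefined) \<Longrightarrow> B \<in> sets borel \<Longrightarrow> c * emeasure \<nu> B \<le> emeasure (Pn N x) B"
    using sublevel_small[of "max R (V undefined)"] by blast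
  let ?\<kappa> = "scale_measure c \<nu>"
  have "emeasure ?\<kappa> UNIV \<le> emeasure (Pn N undefined) UNIV" using Nc(3)[of undefined UNIV] by simp
  also have "\<dots> = 1" using prob_space.emeasure_space_1[OF PnD(4)] by (simp add: PnD)
  finally show thesis using Nc \<nu> by (intro that[of N ?\<kappa>]) (auto simp: ennreal_zero_less_mult_iff)
qed

lemma minorized_integral:
  assumes \<kappa>: "sets \<kappa> = sets borel" "emeasure \<kappa> UNIV \<le> 1"
    and min: "\<And>B. B \<in> sets borel \<Longrightarrow> emeasure \<kappa> B \<le> emeasure (Pn N x) B"
    and w: "integrable (Pn N x) w" "\<And>y. 0 \<le> w y"
  shows "integrable \<kappa> (w :: 'x \<Rightarrow> real)" "(\<integral>y. w y \<partial>\<kappa>) \<le> (\<integral>y. w y \<partial>Pn N x)"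
proof -
  have sets: "sets \<kappa> = sets (Pn N x)" using \<kappa>(1) by (simp add: PnD)
  have "\<kappa> \<le> Pn N x" using min sets \<kappa>(1) by (simp add: le_measure)
  then have le: "(\<integral>\<^sup>+y. ennreal (w y) \<partial>\<kappa>) \<le> (\<integral>\<^sup>+y. ennreal (w y) \<partial>Pn N x)"
    by (intro nn_integral_mono_measure sets)
  have m: "w \<in> borel_measurable \<kappa>"
    using borel_measurable_integrable[OF w(1)] sets by (simp cong: measurable_cong_sets)
  have "(\<integral>\<^sup>+y. ennreal (w y) \<partial>Pn N x) = ennreal (\<integral>y. w y \<partial>Pn N x)"
    using w by (simp add: nn_integral_eq_integral)
  with le have le': "(\<integral>\<^sup>+y. ennreal (w y) \<partial>\<kappa>) \<le> ennreal (\<integral>y. w y \<partial>Pn N x)" by simp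
  then show i: "integrable \<kappa> w" using m w(2) by (intro integrableI_nonneg) (auto intro: le_less_trans)
  show "(\<integral>y. w y \<partial>\<kappa>) \<le> (\<integral>y. w y \<partial>Pn N x)"
    using le' w(2) nn_integral_eq_integral[OF i] by (simp add: integral_nonneg)
qed

text \<open>The contraction argument of Hairer and Mattingly.  If both drift values are small, the
  common part of the two kernels cancels; otherwise the drift itself contracts the weight.\<close>

lemma oscillation_contraction:
  obtains N \<beta> \<rho> where "N > 0" "0 < \<beta>" "0 < \<rho>" "\<rho> < 1"
    "\<And>\<phi> M x y. \<phi> \<in> borel_measurable borel \<Longrightarrow> 0 \<le> M \<Longrightarrow>
       (\<And>x y. \<bar>\<phi> x - \<phi> y\<bar> \<le> M * (2 + \<beta> * V x + \<beta> * V y)) \<Longrightarrow>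
       \<bar>(\<integral>z. \<phi> z \<partial>Pn N x) - (\<integral>z. \<phi> z \<partial>Pn N y)\<bar> \<le> \<rho> * M * (2 + \<beta> * V x + \<beta> * V y)"
proof -
  define B where "B = b / (1 - lam)"
  have B: "B > 0" using b lam by (simp add: B_def)
  \<comment> \<open>Above this level the additive term \<open>2 * B\<close> of the two drift bounds
    is at most half of the drop \<open>(1 - lam) * (V x + V y)\<close>.\<close>
  define R where "R = 4 * B / (1 - lam)"
  have R: "R > 0" using B lam by (simp add: R_def)
  obtain N \<kappa> where N: "N > 0" and \<kappa>: "sets \<kappa> = sets borel" "emeasure \<kappa> UNIV > 0" "emeasure \<kappa> UNIV \<le> 1"
    and min: "\<And>x B. V x \<le> R \<Longrightarrow> B \<in> sets borel \<Longrightarrow> emeasure \<kappa> B \<le> emeasure (Pn N x) B"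
    by (rule small_level[of R]) blast
  define \<alpha> where "\<alpha> = measure \<kappa> UNIV"
  have sp\<kappa>: "space \<kappa> = UNIV" using sets_eq_imp_space_eq[OF \<kappa>(1)] by simp
  have fin\<kappa>: "finite_measure \<kappa>"
    using \<kappa>(3) by (intro finite_measureI) (auto simp: sp\<kappa> top_unique)
  interpret \<kappa>: finite_measure \<kappa> by fact
  have \<alpha>: "0 < \<alpha>" "\<alpha> \<le> 1" using \<kappa>(2,3) by (auto simp: \<alpha>_def \<kappa>.emeasure_eq_measure)
  \<comment> \<open>With this weight the additive drift terms cost
    \<open>2 * (\<beta> * B) = \<alpha>\<close> at low levels, half of the
    \<open>2 * \<alpha>\<close> that the common part removes.\<close>
  define \<beta> where "\<beta> = \<alpha> / (2 * B)"
  have \<beta>: "0 < \<beta>" using \<alpha> B by (simp add: \<beta>_def)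
  have \<beta>B: "2 * (\<beta> * B) = \<alpha>" using B by (simp add: \<beta>_def)
  define \<gamma>0 where "\<gamma>0 = lam + (1 - lam) / 2"
  have \<gamma>0: "\<gamma>0 < 1" "0 < \<gamma>0" using lam by (auto simp: \<gamma>0_def field_simps)
  \<comment> \<open>The ratio \<open>(2 + \<beta> * \<gamma>0 * s) / (2 + \<beta> * s)\<close>
    decreases in \<open>s\<close>, so its value at \<open>R\<close> bounds it for all
    \<open>s \<ge> R\<close>.\<close>
  define \<gamma>1 where "\<gamma>1 = (2 + \<beta> * R * \<gamma>0) / (2 + \<beta> * R)"
  have \<beta>R: "\<beta> * R > 0" using \<beta> R by simp
  have "\<beta> * R * \<gamma>0 < \<beta> * R * 1" using \<beta>R \<gamma>0 by (intro mult_strict_left_mono)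
  then have \<gamma>1: "\<gamma>1 < 1" using \<beta>R by (simp add: \<gamma>1_def)
  define \<rho> where "\<rho> = max \<gamma>1 (max (1 - \<alpha> / 2) lam)"
  have \<rho>: "0 < \<rho>" "\<rho> < 1" using \<alpha> \<gamma>1 lam by (auto simp: \<rho>_def)
  have PV: "(\<integral>y. V y \<partial>Pn N x) \<le> lam * V x + B" for x
  proof -
    have "lam ^ N \<le> lam ^ 1" using N lam by (intro power_decreasing) auto
    then have "lam ^ N * V x \<le> lam * V x" using V1[of x] by (intro mult_right_mono) auto
    then show ?thesis using V_integral_le[of N x] by (simp add: B_def)
  qed
  have "\<bar>(\<integral>z. \<phi> z \<partial>Pn N x) - (\<integral>z. \<phi> z \<partial>Pn N y)\<bar> \<le> \<rho> * M * (2 + \<beta> * V x + \<beta> * V y)"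
    if \<phi>[measurable]: "\<phi> \<in> borel_measurable borel" and M: "0 \<le> M"
      and osc: "\<And>x y. \<bar>\<phi> x - \<phi> y\<bar> \<le> M * (2 + \<beta> * V x + \<beta> * V y)" for \<phi> M x y
  proof -
    define h where "h z = M * (1 + \<beta> * V z)" for z
    have h0: "h z \<ge> 0" for z using M \<beta> V1[of z] by (simp add: h_def)
    have "\<bar>\<phi> x - \<phi> y\<bar> \<le> h x + h y" for x y using osc[of x y] by (simp add: h_def algebra_simps)
    from shift_weighted_oscillation[of \<phi> h, OF this]
    obtain c where c: "\<And>z. \<bar>\<phi> z - c\<bar> \<le> h z" by blast
    define \<psi>' where "\<psi>' z = \<phi> z - c" for z
    have [measurable]: "\<psi>' \<in> borel_measurable borel" by (simp add: \<psi>'_def[abs_def])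
    have \<psi>'h: "\<bar>\<psi>' z\<bar> \<le> h z" for z using c by (simp add: \<psi>'_def)
    have [measurable]: "h \<in> borel_measurable borel" unfolding h_def[abs_def] by measurable
    have int: "integrable (Pn N u) \<psi>'" "integrable (Pn N u) h" for u
      using \<psi>'h h0 by (auto intro!: dominated_integrable[of _ M "M * \<beta>"] simp: h_def algebra_simps)
    have int\<phi>: "(\<integral>z. \<phi> z \<partial>Pn N u) = (\<integral>z. \<psi>' z \<partial>Pn N u) + c" for u
    proof -
      interpret prob_space "Pn N u" by (rule PnD)
      have "(\<integral>z. \<phi> z \<partial>Pn N u) = (\<integral>z. \<psi>' z + c \<partial>Pn N u)" by (simp add: \<psi>'_def)
      also have "\<dots> = (\<integral>z. \<psi>' z \<partial>Pn N u) + c" using int by (simp add: prob_space)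
      finally show ?thesis .
    qed
    have inth: "(\<integral>z. h z \<partial>Pn N u) \<le> M * (1 + \<beta> * (lam * V u + B))" for u
    proof -
      interpret prob_space "Pn N u" by (rule PnD)
      have "(\<integral>z. h z \<partial>Pn N u) = M * (1 + \<beta> * (\<integral>z. V z \<partial>Pn N u))"
        unfolding h_def using V_integrable by (simp add: prob_space)
      also have "\<dots> \<le> M * (1 + \<beta> * (lam * V u + B))"
        using PV[of u] M \<beta> by (intro mult_left_mono add_left_mono) auto
      finally show ?thesis .
    qed
    have abs\<psi>': "\<bar>\<integral>z. \<psi>' z \<partial>Pn N u\<bar> \<le> (\<integral>z. h z \<partial>Pn N u)" for u
      by (rule order_trans[OF integral_abs_bound], rule integral_mono) (use int \<psi>'h in auto)
    let ?s = "V x + V y"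
    show ?thesis
    proof (cases "?s \<ge> R")
      case True
      have "\<bar>(\<integral>z. \<phi> z \<partial>Pn N x) - (\<integral>z. \<phi> z \<partial>Pn N y)\<bar> \<le> (\<integral>z. h z \<partial>Pn N x) + (\<integral>z. h z \<partial>Pn N y)"
        using abs\<psi>'[of x] abs\<psi>'[of y] unfolding int\<phi> by linarith
      also have "\<dots> \<le> M * (1 + \<beta> * (lam * V x + B)) + M * (1 + \<beta> * (lam * V y + B))"
        using inth by (intro add_mono)
      also have "\<dots> = M * (2 + \<beta> * (lam * ?s + 2 * B))" by (simp add: algebra_simps)
      also have "\<dots> \<le> M * (\<rho> * (2 + \<beta> * ?s))"
      proof (intro mult_left_mono M)
        have "2 * B = (1 - lam) / 2 * R" using lam by (simp add: R_def)
        also have "\<dots> \<le> (1 - lam) / 2 * ?s" using True lam by (intro mult_left_mono) auto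
        finally have "lam * ?s + 2 * B \<le> \<gamma>0 * ?s" by (simp add: \<gamma>0_def algebra_simps)
        then have "2 + \<beta> * (lam * ?s + 2 * B) \<le> 2 + \<beta> * (\<gamma>0 * ?s)"
          using \<beta> by (intro add_left_mono mult_left_mono) auto
        also have "\<dots> \<le> \<gamma>1 * (2 + \<beta> * ?s)"
        proof -
          have "0 \<le> 2 * \<beta> * ((1 - \<gamma>0) * (?s - R))" using \<beta> \<gamma>0 True by simp
          then have "(2 + \<beta> * (\<gamma>0 * ?s)) * (2 + \<beta> * R) \<le> (2 + \<beta> * R * \<gamma>0) * (2 + \<beta> * ?s)"
            by (simp add: algebra_simps)
          then show ?thesis using \<beta>R by (simp add: \<gamma>1_def pos_le_divide_eq)
        qed
        also have "\<dots> \<le> \<rho> * (2 + \<beta> * ?s)"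
          using \<beta> V1[of x] V1[of y] by (intro mult_right_mono) (auto simp: \<rho>_def)
        finally show "2 + \<beta> * (lam * ?s + 2 * B) \<le> \<rho> * (2 + \<beta> * ?s)" .
      qed
      finally show ?thesis by (simp add: algebra_simps)
    next
      case False
      have level: "V x \<le> R" "V y \<le> R" using False V1[of x] V1[of y] by auto
      \<comment> \<open>Removing the common part \<kappa> leaves a positive measure, against which
        \<open>\<psi>'\<close> is bounded by \<open>h\<close>; on \<kappa> the weight
        \<open>h\<close> is at least \<open>M\<close>, so the bound drops by
        \<open>M * \<alpha>\<close>.\<close>
      have key: "\<bar>(\<integral>z. \<psi>' z \<partial>Pn N u) - (\<integral>z. \<psi>' z \<partial>\<kappa>)\<bar> \<le> (\<integral>z. h z \<partial>Pn N u) - M * \<alpha>" if u: "V u \<le> R" for u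
      proof -
        note mi = minorized_integral[OF \<kappa>(1,3) min[OF u]]
        have i\<kappa>h: "integrable \<kappa> h" using mi(1)[OF _ int(2)] h0 by blast
        have p: "integrable \<kappa> (\<lambda>z. h z + \<psi>' z)" "(\<integral>z. h z + \<psi>' z \<partial>\<kappa>) \<le> (\<integral>z. h z + \<psi>' z \<partial>Pn N u)"
          using mi[of "\<lambda>z. h z + \<psi>' z"] int \<psi>'h by (auto simp: abs_le_iff) (smt (verit))+
        have q: "(\<integral>z. h z - \<psi>' z \<partial>\<kappa>) \<le> (\<integral>z. h z - \<psi>' z \<partial>Pn N u)"
          using mi(2)[of "\<lambda>z. h z - \<psi>' z"] int \<psi>'h by (auto simp: abs_le_iff)
        have i\<kappa>\<psi>': "integrable \<kappa> \<psi>'" using Bochner_Integration.integrable_diff[OF p(1) i\<kappa>h] by simp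
        have "M * \<alpha> = (\<integral>z. M \<partial>\<kappa>)" by (simp add: \<alpha>_def sp\<kappa>)
        also have "\<dots> \<le> (\<integral>z. h z \<partial>\<kappa>)"
        proof (rule integral_mono[OF _ i\<kappa>h])
          fix z
          have "0 \<le> \<beta> * V z" using \<beta> V1[of z] by simp
          then have "M * 1 \<le> M * (1 + \<beta> * V z)" using M by (intro mult_left_mono) auto
          then show "M \<le> h z" by (simp add: h_def)
        qed simp
        finally show ?thesis using p q int i\<kappa>h i\<kappa>\<psi>' by simp
      qed
      have "\<bar>(\<integral>z. \<phi> z \<partial>Pn N x) - (\<integral>z. \<phi> z \<partial>Pn N y)\<bar> \<le> (\<integral>z. h z \<partial>Pn N x) + (\<integral>z. h z \<partial>Pn N y) - 2 * (M * \<alpha>)"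
        using key[OF level(1)] key[OF level(2)] unfolding int\<phi> by linarith
      also have "\<dots> \<le> M * (1 + \<beta> * (lam * V x + B)) + M * (1 + \<beta> * (lam * V y + B)) - 2 * (M * \<alpha>)"
        using inth by (intro diff_right_mono add_mono)
      also have "\<dots> = M * (2 + \<beta> * lam * ?s + 2 * (\<beta> * B) - 2 * \<alpha>)" by (simp add: algebra_simps)
      also have "\<dots> = M * (2 * (1 - \<alpha> / 2) + lam * (\<beta> * ?s))" unfolding \<beta>B by (simp add: algebra_simps)
      also have "\<dots> \<le> M * (2 * \<rho> + \<rho> * (\<beta> * ?s))"
        using M \<beta> V1[of x] V1[of y] by (intro mult_left_mono add_mono mult_right_mono) (auto simp: \<rho>_def)
      finally show ?thesis by (simp add: algebra_simps)
    qed
  qed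
  then show thesis using that[of N \<beta> \<rho>] N \<beta> \<rho> by blast
qed

lemma integral_Pn_add:
  assumes "\<phi> \<in> borel_measurable borel" "\<And>y. \<bar>\<phi> y\<bar> \<le> V y"
  shows "(\<integral>z. \<phi> z \<partial>Pn (i + j) x) = (\<integral>y. \<integral>z. \<phi> z \<partial>Pn j y \<partial>Pn i x)" "integrable (Pn i x) (\<lambda>y. \<integral>z. \<phi> z \<partial>Pn j y)"
proof -
  have i: "integrable (Pn i x \<bind> Pn j) \<phi>"
    using dominated_integrable[of \<phi> 0 1 "i + j" x] assms by (simp add: kernel_power_add[OF P])
  have ne: "space (Pn i x) \<noteq> {}" by (simp add: PnD)
  note s = kernel_subst_sets[OF Pn PnD(2)]
  show "(\<integral>z. \<phi> z \<partial>Pn (i + j) x) = (\<integral>y. \<integral>z. \<phi> z \<partial>Pn j y \<partial>Pn i x)"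
    using integral_bind_integrable[OF s ne i] by (simp add: kernel_power_add[OF P])
  show "integrable (Pn i x) (\<lambda>y. \<integral>z. \<phi> z \<partial>Pn j y)" by (rule integrable_integral_bind[OF s ne i])
qed

lemma stationary_Pn: "stationary_pair \<pi> (Pn n)"
  using prob_\<pi> sets_\<pi> Pn stationary_kernel_power[OF kernel_P sets_\<pi> stat_P]
  by (intro stationary_pair.intro)

text \<open>Blocks of \<open>N\<close> steps contract the oscillation. Averaging the second starting
  point over the stationary \<pi>, for which \<open>V\<close> is integrable, turns this into
  convergence to the mean; the fewer than \<open>N\<close> remaining steps cost a factor
  \<open>1 + B\<close> by the drift bound.\<close>

theorem geometric_ergodicity:
  obtains C r where "0 < r" "r < 1" "0 < C"
    "\<And>\<phi> n x. \<phi> \<in> borel_measurable borel \<Longrightarrow> (\<And>y. \<bar>\<phi> y\<bar> \<le> V y) \<Longrightarrow>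
      \<bar>(\<integral>z. \<phi> z \<partial>Pn n x) - (\<integral>z. \<phi> z \<partial>\<pi>)\<bar> \<le> C * r ^ n * V x"
proof -
  interpret \<pi>: prob_space \<pi> by (rule prob_\<pi>)
  obtain N \<beta> \<rho> where N: "N > 0" "0 < \<beta>" "0 < \<rho>" "\<rho> < 1" and contr:
    "\<And>\<phi> M x y. \<phi> \<in> borel_measurable borel \<Longrightarrow> 0 \<le> M \<Longrightarrow>
       (\<And>x y. \<bar>\<phi> x - \<phi> y\<bar> \<le> M * (2 + \<beta> * V x + \<beta> * V y)) \<Longrightarrow>
       \<bar>(\<integral>z. \<phi> z \<partial>Pn N x) - (\<integral>z. \<phi> z \<partial>Pn N y)\<bar> \<le> \<rho> * M * (2 + \<beta> * V x + \<beta> * V y)"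
    by (rule oscillation_contraction) blast
  \<comment> \<open>A function dominated by \<open>V\<close> oscillates by at most
    \<open>V x + V y\<close>, which is below
    \<open>M0 * (2 + \<beta> * V x + \<beta> * V y)\<close>.\<close>
  define M0 where "M0 = 1 / \<beta>"
  have M0: "0 < M0" using N by (simp add: M0_def)
  define A where "A = M0 * (2 + \<beta> + \<beta> * (\<integral>x. V x \<partial>\<pi>))"
  have "0 \<le> (\<integral>x. V x \<partial>\<pi>)" using V1 by (intro integral_nonneg_AE AE_I2) (metis order_trans zero_le_one)
  then have A: "0 < A" unfolding A_def using M0 N by (intro mult_pos_pos add_pos_nonneg) auto
  define B where "B = b / (1 - lam)"
  have B: "B > 0" using b lam by (simp add: B_def)
  obtain r C where rC: "0 < r" "r < 1" "0 < C" "\<And>j. \<rho> ^ (j div N) \<le> C * r ^ j"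
    using geometric_div_bound[OF N(3,4,1)] by metis
  have "\<bar>(\<integral>z. \<phi> z \<partial>Pn n x) - (\<integral>z. \<phi> z \<partial>\<pi>)\<bar> \<le> (A * (1 + B) * C) * r ^ n * V x"
    if \<phi>[measurable]: "\<phi> \<in> borel_measurable borel" and dom: "\<And>y. \<bar>\<phi> y\<bar> \<le> V y" for \<phi> n x
  proof -
    have meas: "(\<lambda>x. \<integral>z. \<phi> z \<partial>Pn i x) \<in> borel_measurable borel" for i
      by (rule kernel_integral_measurable[OF Pn \<phi>])
    have osc: "\<bar>(\<integral>z. \<phi> z \<partial>Pn (N * i) x) - (\<integral>z. \<phi> z \<partial>Pn (N * i) y)\<bar>
        \<le> \<rho> ^ i * M0 * (2 + \<beta> * V x + \<beta> * V y)" for i x y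
    proof (induction i arbitrary: x y)
      case 0
      have "\<bar>\<phi> x - \<phi> y\<bar> \<le> V x + V y" using dom[of x] dom[of y] by linarith
      also have "\<dots> \<le> M0 * (2 + \<beta> * V x + \<beta> * V y)" using N by (simp add: M0_def field_simps)
      finally show ?case by (simp add: kernel_power_0 integral_return)
    next
      case (Suc i)
      show ?case
        using contr[OF meas[of "N * i"] _ Suc, of x y] M0 N integral_Pn_add(1)[OF \<phi> dom, of N "N * i"]
        by (simp add: mult.assoc)
    qed
    have conv: "\<bar>(\<integral>z. \<phi> z \<partial>Pn (N * i) y) - (\<integral>z. \<phi> z \<partial>\<pi>)\<bar> \<le> \<rho> ^ i * A * V y" for i y
    proof -
      interpret S: stationary_pair \<pi> "Pn (N * i)" by (rule stationary_Pn)
      have \<phi>\<pi>: "integrable \<pi> \<phi>"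
        using order_trans[OF dom abs_ge_self] by (intro Bochner_Integration.integrable_bound[OF V_\<pi>]) auto
      let ?T = "\<lambda>y. \<integral>z. \<phi> z \<partial>Pn (N * i) y"
      have "\<bar>?T y - (\<integral>z. \<phi> z \<partial>\<pi>)\<bar> = \<bar>\<integral>u. ?T y - ?T u \<partial>\<pi>\<bar>"
        using S.integral_stationary[OF \<phi>\<pi>] S.integrable_stationary[OF \<phi>\<pi>] by (simp add: \<pi>.prob_space)
      also have "\<dots> \<le> (\<integral>u. \<rho> ^ i * M0 * (2 + \<beta> * V y + \<beta> * V u) \<partial>\<pi>)"
        by (rule order_trans[OF integral_abs_bound], rule integral_mono)
           (use osc S.integrable_stationary[OF \<phi>\<pi>] V_\<pi> in auto)
      also have "\<dots> = \<rho> ^ i * (M0 * (2 + \<beta> * V y + \<beta> * (\<integral>u. V u \<partial>\<pi>)))"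
        using V_\<pi> by (simp add: \<pi>.prob_space)
      also have "\<dots> \<le> \<rho> ^ i * (A * V y)"
      proof (rule mult_left_mono)
        have "2 + \<beta> * V y + \<beta> * (\<integral>u. V u \<partial>\<pi>) \<le> 2 * V y + \<beta> * V y + \<beta> * (\<integral>u. V u \<partial>\<pi>) * V y"
        proof -
          have "0 \<le> \<beta> * (\<integral>u. V u \<partial>\<pi>)" using \<open>0 \<le> (\<integral>x. V x \<partial>\<pi>)\<close> N by simp
          from mult_left_mono[OF V1[of y] this] V1[of y] show ?thesis by linarith
        qed
        then have "M0 * (2 + \<beta> * V y + \<beta> * (\<integral>u. V u \<partial>\<pi>)) \<le> M0 * (2 * V y + \<beta> * V y + \<beta> * (\<integral>u. V u \<partial>\<pi>) * V y)"
          using M0 by (intro mult_left_mono) auto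
        then show "M0 * (2 + \<beta> * V y + \<beta> * (\<integral>u. V u \<partial>\<pi>)) \<le> A * V y"
          by (simp add: A_def algebra_simps)
      qed (use N in simp)
      finally show ?thesis by (simp add: mult.assoc)
    qed
    define i j where "i = n div N" and "j = n mod N"
    \<comment> \<open>The incomplete block comes first, so that the contraction estimate is
      integrated against \<open>Pn j x\<close>, where \<open>V\<close> has a controlled
      mean.\<close>
    have n: "n = j + N * i" by (simp add: i_def j_def)
    interpret Pj: prob_space "Pn j x" by (rule PnD)
    have "\<bar>(\<integral>z. \<phi> z \<partial>Pn n x) - (\<integral>z. \<phi> z \<partial>\<pi>)\<bar> = \<bar>\<integral>y. (\<integral>z. \<phi> z \<partial>Pn (N * i) y) - (\<integral>z. \<phi> z \<partial>\<pi>) \<partial>Pn j x\<bar>"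
      unfolding n using integral_Pn_add(1)[OF \<phi> dom, of j "N * i" x] integral_Pn_add(2)[OF \<phi> dom, of j x "N * i"] by (simp add: Pj.prob_space)
    also have "\<dots> \<le> (\<integral>y. \<rho> ^ i * A * V y \<partial>Pn j x)"
      by (rule order_trans[OF integral_abs_bound], rule integral_mono)
         (use conv V_integrable integral_Pn_add(2)[OF \<phi> dom] in auto)
    also have "\<dots> = \<rho> ^ i * A * (\<integral>y. V y \<partial>Pn j x)" by simp
    also have "\<dots> \<le> \<rho> ^ i * A * ((1 + B) * V x)"
    proof (rule mult_left_mono)
      have "lam ^ j * V x \<le> 1 * V x" using lam V1[of x] by (intro mult_right_mono power_le_one) auto
      moreover have "B \<le> B * V x" using B V1[of x] by simp
      ultimately show "(\<integral>y. V y \<partial>Pn j x) \<le> (1 + B) * V x"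
        using V_integral_le[of j x] by (simp add: B_def algebra_simps)
    qed (use A N in auto)
    also have "\<dots> = A * (1 + B) * V x * \<rho> ^ i" by simp
    also have "\<dots> \<le> A * (1 + B) * V x * (C * r ^ n)"
      using rC(4)[of n] A B V1[of x] by (intro mult_left_mono) (auto simp: i_def)
    finally show ?thesis by (simp add: mult_ac)
  qed
  then show thesis using that[of r "A * (1 + B) * C"] rC A B by auto
qed

end

subsection \<open>Twisted transition operators\<close>

lemma integral_kernel_measurable2:
  fixes f :: "'x \<Rightarrow> 'y \<Rightarrow> 'b::{banach, second_countable_topology}"
  assumes f[measurable]: "(\<lambda>(x, y). f x y) \<in> borel_measurable (M \<Otimes>\<^sub>M N)"
    and L[measurable]: "L \<in> M \<rightarrow>\<^sub>M subprob_algebra N"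
  shows "(\<lambda>x. \<integral>y. f x y \<partial>L x) \<in> borel_measurable M"
proof -
  have "(\<lambda>x. distr (L x) (M \<Otimes>\<^sub>M N) (\<lambda>y. (x, y))) \<in> M \<rightarrow>\<^sub>M subprob_algebra (M \<Otimes>\<^sub>M N)"
    by (rule measurable_distr2) measurable
  from measurable_compose[OF this integral_measurable_subprob_algebra[OF f]]
  show ?thesis
    by (rule measurable_cong[THEN iffD1, rotated]) (simp add: integral_distr)
qed

text \<open>Fourier perturbation of the transition operator: \<open>a\<close> weights the departure
  point and \<open>c\<close> the arrival point. Both weights occur, since a martingale increment
  involves both ends of a step.\<close>

definition twisted :: "('x \<Rightarrow> complex) \<Rightarrow> ('x \<Rightarrow> complex) \<Rightarrow> ('x \<Rightarrow> 'x measure) \<Rightarrow> ('x \<Rightarrow> complex) \<Rightarrow> 'x \<Rightarrow> complex" where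
  "twisted a c P h x = a x * (CLINT y|P x. c y * h y)"

text \<open>Time increases inwards: the factor of time \<open>s\<close> is outermost, as it
  conditions on the earliest state.\<close>

fun op_prod :: "(nat \<Rightarrow> ('x \<Rightarrow> complex) \<Rightarrow> 'x \<Rightarrow> complex) \<Rightarrow> nat \<Rightarrow> nat \<Rightarrow> ('x \<Rightarrow> complex) \<Rightarrow> 'x \<Rightarrow> complex" where
  "op_prod T s 0 h = h"
| "op_prod T s (Suc n) h = T s (op_prod T (Suc s) n h)"

lemma op_prod_add: "op_prod T s (m + n) h = op_prod T s m (op_prod T (s + m) n h)"
  by (induction m arbitrary: s) auto

lemma op_prod_Suc_right: "op_prod T s (Suc n) h = op_prod T s n (T (s + n) h)"
  using op_prod_add[of T s n 1 h] by simp

text \<open>Functions of this class are integrable under every probability law on the Borel sets,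
  which allows them to pass between initial laws.\<close>

definition unit_bounded :: "('x::topological_space \<Rightarrow> complex) \<Rightarrow> bool" where
  "unit_bounded a \<longleftrightarrow> a \<in> borel_measurable borel \<and> (\<forall>x. norm (a x) \<le> 1)"

lemma unit_bounded_const: "unit_bounded (\<lambda>x. 1)"
  by (simp add: unit_bounded_def)

lemma unit_bounded_iexp: "f \<in> borel_measurable borel \<Longrightarrow> unit_bounded (\<lambda>x. iexp (f x))"
  by (simp add: unit_bounded_def)

lemma twisted_measurable:
  assumes "prob_kernel P" "unit_bounded a" "unit_bounded c" "h \<in> borel_measurable borel"
  shows "twisted a c P h \<in> borel_measurable borel"
proof -
  have [measurable]: "a \<in> borel_measurable borel" "c \<in> borel_measurable borel" "h \<in> borel_measurable borel"
    using assms by (auto simp: unit_bounded_def)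
  have [measurable]: "(\<lambda>x. CLINT y|P x. c y * h y) \<in> borel_measurable borel"
    by (rule kernel_integral_measurable[OF assms(1)]) measurable
  show ?thesis unfolding twisted_def[abs_def] by measurable
qed

lemma norm_twisted_le:
  assumes "unit_bounded a" "unit_bounded c" "integrable (P x) (h :: 'x::polish_space \<Rightarrow> complex)"
  shows "norm (twisted a c P h x) \<le> (\<integral>y. norm (h y) \<partial>P x)"
proof -
  have "norm (twisted a c P h x) \<le> 1 * norm (CLINT y|P x. c y * h y)"
    unfolding twisted_def norm_mult using assms(1) by (intro mult_right_mono) (auto simp: unit_bounded_def)
  also have "\<dots> \<le> (\<integral>y. norm (c y * h y) \<partial>P x)" by (simp add: integral_norm_bound)
  also have "\<dots> \<le> (\<integral>y. norm (h y) \<partial>P x)"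
  proof (rule integral_mono_AE')
    show "integrable (P x) (\<lambda>y. norm (h y))" using assms(3) by simp
    show "AE y in P x. norm (c y * h y) \<le> norm (h y)"
      using assms(2) by (intro AE_I2) (auto simp: norm_mult unit_bounded_def mult_left_le_one_le)
  qed simp
  finally show ?thesis .
qed

lemma unit_bounded_integrable:
  assumes "unit_bounded h" "prob_space M" "sets M = sets borel"
  shows "integrable M h"
proof -
  interpret prob_space M by fact
  have "h \<in> borel_measurable M" using assms by (simp add: unit_bounded_def cong: measurable_cong_sets)
  then show ?thesis using assms(1) by (intro integrable_const_bound[where B=1]) (auto simp: unit_bounded_def)
qed

lemma unit_bounded_twisted:
  assumes "prob_kernel P" "unit_bounded a" "unit_bounded c" "unit_bounded h"
  shows "unit_bounded (twisted a c P h)"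
  unfolding unit_bounded_def
proof (intro conjI allI)
  show "twisted a c P h \<in> borel_measurable borel"
    using assms by (intro twisted_measurable) (auto simp: unit_bounded_def)
  fix x
  interpret prob_space "P x" by (rule prob_kernelD(4)[OF assms(1)])
  have i: "integrable (P x) h"
    using assms prob_kernelD[OF assms(1)] by (intro unit_bounded_integrable) auto
  have "norm (twisted a c P h x) \<le> (\<integral>y. norm (h y) \<partial>P x)" by (rule norm_twisted_le[of a c P x h, OF assms(2,3) i])
  also have "\<dots> \<le> (\<integral>y. 1 \<partial>P x)"
    using i assms(4) by (intro integral_mono) (auto simp: unit_bounded_def)
  finally show "norm (twisted a c P h x) \<le> 1" by (simp add: prob_space)
qed

context stationary_pair
begin

lemma integrable_unit_mult:
  assumes "unit_bounded c" "integrable \<pi> h"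
  shows "integrable \<pi> (\<lambda>x. c x * h x :: complex)"
proof (rule Bochner_Integration.integrable_bound[OF assms(2)])
  have [measurable]: "c \<in> borel_measurable borel" "h \<in> borel_measurable \<pi>"
    using assms by (auto simp: unit_bounded_def)
  show "(\<lambda>x. c x * h x) \<in> borel_measurable \<pi>" by measurable
  show "AE x in \<pi>. norm (c x * h x) \<le> norm (h x)"
    using assms(1) by (intro AE_I2) (auto simp: norm_mult unit_bounded_def mult_left_le_one_le)
qed

text \<open>Weights bounded by 1 and stationarity make these operators contractions of L1(\<pi>), so
  errors do not grow along products of length \<open>n\<close>.\<close>

lemma
  assumes a: "unit_bounded a" and c: "unit_bounded c" and h: "integrable \<pi> h"
  shows integrable_twisted: "integrable \<pi> (twisted a c P h)"
    and norm_twisted: "(\<integral>x. norm (twisted a c P h x) \<partial>\<pi>) \<le> (\<integral>x. norm (h x) \<partial>\<pi>)"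
proof -
  show i: "integrable \<pi> (twisted a c P h)"
    unfolding twisted_def[abs_def]
    by (intro integrable_unit_mult[OF a] integrable_stationary integrable_unit_mult[OF c] h)
  have "(\<integral>x. norm (twisted a c P h x) \<partial>\<pi>) \<le> (\<integral>x. \<integral>y. norm (h y) \<partial>P x \<partial>\<pi>)"
  proof (rule integral_mono_AE)
    show "integrable \<pi> (\<lambda>x. norm (twisted a c P h x))" using i by simp
    show "integrable \<pi> (\<lambda>x. \<integral>y. norm (h y) \<partial>P x)" using h by (intro integrable_stationary) simp
    show "AE x in \<pi>. norm (twisted a c P h x) \<le> (\<integral>y. norm (h y) \<partial>P x)"
      using AE_integrable_stationary[OF h] by eventually_elim (rule norm_twisted_le[OF a c])
  qed
  also have "\<dots> = (\<integral>x. norm (h x) \<partial>\<pi>)" using h by (intro integral_stationary) simp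
  finally show "(\<integral>x. norm (twisted a c P h x) \<partial>\<pi>) \<le> (\<integral>x. norm (h x) \<partial>\<pi>)" .
qed

lemma twisted_cong_AE:
  assumes h: "integrable \<pi> h" "integrable \<pi> h'" and eq: "AE x in \<pi>. h x = h' x"
    and c: "unit_bounded c"
  shows "AE x in \<pi>. twisted a c P h x = twisted a c P h' x"
  using AE_stationary[OF eq] AE_integrable_stationary[OF integrable_unit_mult[OF c h(1)]]
    AE_integrable_stationary[OF integrable_unit_mult[OF c h(2)]]
proof eventually_elim
  case (elim x)
  have "(CLINT y|P x. c y * h y) = (CLINT y|P x. c y * h' y)"
    using elim(1) by (intro integral_cong_AE borel_measurable_integrable[OF elim(2)]
        borel_measurable_integrable[OF elim(3)]) auto
  then show ?case by (simp add: twisted_def)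
qed

lemma twisted_diff_AE:
  assumes h: "integrable \<pi> h" "integrable \<pi> h'" and c: "unit_bounded c"
  shows "AE x in \<pi>. twisted a c P (\<lambda>y. h y - h' y) x = twisted a c P h x - twisted a c P h' x"
  using AE_integrable_stationary[OF integrable_unit_mult[OF c h(1)]]
    AE_integrable_stationary[OF integrable_unit_mult[OF c h(2)]]
  by eventually_elim (simp add: twisted_def right_diff_distrib)

text \<open>Dominated convergence under \<open>P x\<close> for almost every \<open>x\<close>, and
  then under \<pi>. The dominating function depends on both points because the increments
  do.\<close>

lemma integral_kernel_dominated:
  fixes F :: "nat \<Rightarrow> 'x \<Rightarrow> 'x \<Rightarrow> complex"
  assumes F: "\<And>n. (\<lambda>(x, y). F n x y) \<in> borel_measurable (borel \<Otimes>\<^sub>M borel)"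
    and lim: "\<And>x y. (\<lambda>n. F n x y) \<longlonglongrightarrow> 0" and dom: "\<And>n x y. norm (F n x y) \<le> G x y"
    and G: "AE x in \<pi>. integrable (P x) (G x)" "integrable \<pi> (\<lambda>x. \<integral>y. G x y \<partial>P x)"
  shows "(\<lambda>n. \<integral>x. norm (\<integral>y. F n x y \<partial>P x) \<partial>\<pi>) \<longlonglongrightarrow> 0"
proof -
  have Fx: "F n x \<in> borel_measurable (P x)" for n x
    using measurable_Pair2[OF F, of x] prob_kernelD(2)[OF kernel_P] by (simp cong: measurable_cong_sets)
  have "(\<lambda>n. \<integral>x. norm (\<integral>y. F n x y \<partial>P x) \<partial>\<pi>) \<longlonglongrightarrow> (\<integral>x. 0 \<partial>\<pi>)"
  proof (rule integral_dominated_convergence[where w="\<lambda>x. \<integral>y. G x y \<partial>P x"])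
    show "(\<lambda>x. norm (\<integral>y. F n x y \<partial>P x)) \<in> borel_measurable \<pi>" for n
    proof -
      have "(\<lambda>x. \<integral>y. F n x y \<partial>P x) \<in> borel_measurable borel"
        by (rule integral_kernel_measurable2[OF F prob_kernelD(1)[OF kernel_P]])
      then show ?thesis by measurable
    qed
    show "AE x in \<pi>. (\<lambda>n. norm (\<integral>y. F n x y \<partial>P x)) \<longlonglongrightarrow> 0"
      using G(1)
    proof eventually_elim
      case (elim x)
      have "(\<lambda>n. \<integral>y. F n x y \<partial>P x) \<longlonglongrightarrow> (\<integral>y. 0 \<partial>P x)"
        by (rule integral_dominated_convergence[where w="G x"]) (use elim Fx lim dom in auto)
      then show ?case by (simp add: tendsto_norm_zero)
    qed
    show "AE x in \<pi>. norm (norm (\<integral>y. F n x y \<partial>P x)) \<le> (\<integral>y. G x y \<partial>P x)" for n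
      using G(1)
    proof eventually_elim
      case (elim x)
      have "norm (\<integral>y. F n x y \<partial>P x) \<le> (\<integral>y. norm (F n x y) \<partial>P x)" by (rule integral_norm_bound)
      also have "\<dots> \<le> (\<integral>y. G x y \<partial>P x)"
      proof (rule integral_mono)
        show "integrable (P x) (\<lambda>y. norm (F n x y))"
          using Fx[of n x] dom order_trans[OF dom abs_ge_self] by (intro Bochner_Integration.integrable_bound[OF elim]) auto
      qed (use elim dom in auto)
      finally show ?case by simp
    qed
    show "integrable \<pi> (\<lambda>x. \<integral>y. G x y \<partial>P x)" by (rule G(2))
  qed auto
  then show ?thesis by simp
qed

end

subsection \<open>The central limit theorem for a periodic martingale difference array\<close>

text \<open>The increments are \<open>u t (X\<^bsub>t+1\<^esub>) - (R t u t) (X\<^bsub>t\<^esub>)\<close>.  Working with the operators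
  \<open>T\<^bsub>n,t\<^esub>\<close> below instead of with the chain, all estimates take place in \<open>L\<^sup>1(\<pi>)\<close>.\<close>

locale periodic_kernels =
  fixes \<pi> :: "'x::polish_space measure" and R :: "nat \<Rightarrow> 'x \<Rightarrow> 'x measure" and K :: nat
  assumes R: "\<And>t. stationary_pair \<pi> (R t)" and K: "K \<ge> 1" and R_per: "\<And>t. R (t + K) = R t"
begin

sublocale R: stationary_pair \<pi> "R t" for t by (rule R)

sublocale \<pi>: prob_space \<pi> using R.prob_\<pi> .

abbreviation "Nrm h \<equiv> (\<integral>x. norm (h x :: complex) \<partial>\<pi>)"

abbreviation "plain t \<equiv> twisted (\<lambda>_. 1) (\<lambda>_. 1) (R t)"

lemma integrable_op_prod:
  assumes "\<And>t. \<exists>a c. unit_bounded a \<and> unit_bounded c \<and> T t = twisted a c (R t)" "integrable \<pi> h"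
  shows "integrable \<pi> (op_prod T s n h) \<and> Nrm (op_prod T s n h) \<le> Nrm h"
proof (induction n arbitrary: s)
  case 0 then show ?case using assms(2) by simp
next
  case (Suc n)
  obtain a c where T: "unit_bounded a" "unit_bounded c" "T s = twisted a c (R s)" using assms(1) by blast
  show ?case
    using R.integrable_twisted[OF T(1,2), of "op_prod T (Suc s) n h" s] R.norm_twisted[OF T(1,2), of "op_prod T (Suc s) n h" s]
      Suc[of "Suc s"] unfolding op_prod.simps T(3) by (meson order_trans)
qed

lemma integrable_plain_prod:
  assumes "integrable \<pi> h"
  shows "integrable \<pi> (op_prod plain s n h)" "Nrm (op_prod plain s n h) \<le> Nrm h"
  using integrable_op_prod[of plain h s n] assms unit_bounded_const by blast+

lemma plain_prod_measurable:
  "h \<in> borel_measurable borel \<Longrightarrow> op_prod plain s n h \<in> borel_measurable borel"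
  by (induction n arbitrary: s) (auto intro!: twisted_measurable R.kernel_P unit_bounded_const)

lemma op_prod_diff_AE:
  assumes T: "\<And>t. \<exists>a c. unit_bounded a \<and> unit_bounded c \<and> T t = twisted a c (R t)"
    and h: "integrable \<pi> h" "integrable \<pi> h'"
  shows "AE x in \<pi>. op_prod T s n (\<lambda>y. h y - h' y) x = op_prod T s n h x - op_prod T s n h' x"
proof (induction n arbitrary: s)
  case 0 then show ?case by simp
next
  case (Suc n)
  obtain a c where Ts: "unit_bounded a" "unit_bounded c" "T s = twisted a c (R s)" using T by blast
  have hh: "integrable \<pi> (\<lambda>y. h y - h' y)" using h by simp
  note i = integrable_op_prod[OF T, of _ "Suc s" n, THEN conjunct1]
  show ?case
    using R.twisted_cong_AE[OF i[OF hh] Bochner_Integration.integrable_diff[OF i[OF h(1)] i[OF h(2)]] Suc[of "Suc s"] Ts(2), of a s]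
      R.twisted_diff_AE[OF i[OF h(1)] i[OF h(2)] Ts(2), of a s]
    by eventually_elim (simp add: Ts(3))
qed

lemma plain_prod_periodic: "op_prod plain (s + K * j) n h = op_prod plain s n h"
proof -
  have "R (t + K * j) = R t" for t by (induction j arbitrary: t) (simp_all add: R_per algebra_simps flip: add.assoc)
  then show ?thesis by (induction n arbitrary: s) (simp_all flip: add_Suc)
qed

end

text \<open>Makes the errors of a \<open>K\<close>-periodic array uniform in time, the maximum over
  a period being replaced by the sum.\<close>

lemma summable_mod_bound:
  fixes f :: "nat \<Rightarrow> real"
  assumes "K \<ge> 1" "\<And>t. f (t + K) = f t" "\<And>t. 0 \<le> f t"
  shows "f t \<le> (\<Sum>j<K. f j)"
proof -
  have "f (s + K * j) = f s" for s j by (induction j arbitrary: s) (simp_all add: assms(2) algebra_simps flip: add.assoc)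
  from this[of "t mod K" "t div K"] have "f t = f (t mod K)" by simp
  also have "\<dots> \<le> (\<Sum>j<K. f j)" using assms by (intro member_le_sum) auto
  finally show ?thesis .
qed

text \<open>All ergodicity enters through \<open>mixing\<close>: an L1 statement about full sweeps
  started at an arbitrary position \<open>t\<close>, without a rate.\<close>

locale martingale_array = periodic_kernels \<pi> R K
  for \<pi> :: "'x::polish_space measure" and R K +
  fixes u :: "nat \<Rightarrow> 'x \<Rightarrow> real"
  assumes u_meas[measurable]: "\<And>t. u t \<in> borel_measurable borel"
    and u_sq: "\<And>t. integrable \<pi> (\<lambda>x. (u t x)\<^sup>2)" and u_per: "\<And>t. u (t + K) = u t"
    and mixing: "\<And>t (q :: 'x \<Rightarrow> complex) e. integrable \<pi> q \<Longrightarrow> (CLINT x|\<pi>. q x) = 0 \<Longrightarrow> e > 0 \<Longrightarrow>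
      \<exists>L0. \<forall>L\<ge>L0. (\<integral>x. norm (op_prod plain t (K * L) q x) \<partial>\<pi>) \<le> e"
begin

definition cu :: "nat \<Rightarrow> 'x \<Rightarrow> real" where
  "cu t x = (\<integral>y. u t y \<partial>R t x)"

definition sig :: "nat \<Rightarrow> 'x \<Rightarrow> real" where
  "sig t x = (\<integral>y. (u t y - cu t x)\<^sup>2 \<partial>R t x)"

definition v :: "nat \<Rightarrow> real" where
  "v t = (\<integral>x. sig t x \<partial>\<pi>)"

text \<open>The two weights multiply to the exponential of the centered increment
  \<open>(u t y - cu t x) / sqrt n\<close>, so products of these operators carry the characteristic
  function of the scaled martingale.\<close>

definition T :: "nat \<Rightarrow> nat \<Rightarrow> ('x \<Rightarrow> complex) \<Rightarrow> 'x \<Rightarrow> complex" where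
  "T n t = twisted (\<lambda>x. iexp (- cu t x / sqrt n)) (\<lambda>y. iexp (u t y / sqrt n)) (R t)"

lemma cu_meas[measurable]: "cu t \<in> borel_measurable borel"
  unfolding cu_def[abs_def] by (rule kernel_integral_measurable[OF R.kernel_P]) measurable

lemma sig_meas[measurable]: "sig t \<in> borel_measurable borel"
  unfolding sig_def[abs_def]
  by (rule integral_kernel_measurable2[OF _ prob_kernelD(1)[OF R.kernel_P]]) measurable

lemma u_int: "integrable \<pi> (u t)"
proof -
  have "u t \<in> borel_measurable \<pi>" by measurable
  then show ?thesis using u_sq by (rule \<pi>.integrable_square_imp_integrable)
qed

lemma cu_sq: "integrable \<pi> (\<lambda>x. (cu t x)\<^sup>2)"
  unfolding cu_def by (rule R.integrable_square_kernel[OF u_meas u_sq])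

lemma sig_eq:
  "AE x in \<pi>. integrable (R t x) (\<lambda>y. (u t y - cu t x)\<^sup>2) \<and> sig t x = (\<integral>y. (u t y)\<^sup>2 \<partial>R t x) - (cu t x)\<^sup>2"
  using R.AE_integrable_stationary[OF u_int, of t t] R.AE_integrable_stationary[OF u_sq, of t t]
proof eventually_elim
  case (elim x)
  interpret prob_space "R t x" by (rule prob_kernelD(4)[OF R.kernel_P])
  show ?case
  proof
    show "integrable (R t x) (\<lambda>y. (u t y - cu t x)\<^sup>2)"
      using elim by (simp add: power2_diff)
    have "sig t x = (\<integral>y. (u t y)\<^sup>2 + (cu t x)\<^sup>2 - 2 * cu t x * u t y \<partial>R t x)"
      by (simp add: sig_def power2_diff algebra_simps)
    also have "\<dots> = (\<integral>y. (u t y)\<^sup>2 \<partial>R t x) + (cu t x)\<^sup>2 - 2 * cu t x * cu t x"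
      using elim by (simp add: prob_space cu_def)
    finally show "sig t x = (\<integral>y. (u t y)\<^sup>2 \<partial>R t x) - (cu t x)\<^sup>2" by (simp add: power2_eq_square)
  qed
qed

lemma sig_nonneg: "0 \<le> sig t x" by (simp add: sig_def)

lemma sig_int: "integrable \<pi> (sig t)"
proof -
  have "integrable \<pi> (\<lambda>x. (\<integral>y. (u t y)\<^sup>2 \<partial>R t x) - (cu t x)\<^sup>2)"
    using R.integrable_stationary[OF u_sq, of t t] cu_sq by simp
  then show ?thesis
    by (rule integrable_cong_AE_imp) (use sig_eq[of t] in \<open>auto\<close>)
qed

lemma v_eq: "v t = (\<integral>x. (u t x)\<^sup>2 \<partial>\<pi>) - (\<integral>x. (cu t x)\<^sup>2 \<partial>\<pi>)"
proof -
  have "v t = (\<integral>x. (\<integral>y. (u t y)\<^sup>2 \<partial>R t x) - (cu t x)\<^sup>2 \<partial>\<pi>)"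
    unfolding v_def
  proof (rule integral_cong_AE)
    show "sig t \<in> borel_measurable \<pi>" by measurable
    show "(\<lambda>x. (\<integral>y. (u t y)\<^sup>2 \<partial>R t x) - (cu t x)\<^sup>2) \<in> borel_measurable \<pi>"
      using borel_measurable_integrable[OF R.integrable_stationary[OF u_sq, of t t]] by measurable
    show "AE x in \<pi>. sig t x = (\<integral>y. (u t y)\<^sup>2 \<partial>R t x) - (cu t x)\<^sup>2"
      using sig_eq[of t] by eventually_elim simp
  qed
  also have "\<dots> = (\<integral>x. (u t x)\<^sup>2 \<partial>\<pi>) - (\<integral>x. (cu t x)\<^sup>2 \<partial>\<pi>)"
    using R.integrable_stationary[OF u_sq, of t t] cu_sq R.integral_stationary[OF u_sq, of t t] by simp
  finally show ?thesis .
qed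

lemma v_nonneg: "0 \<le> v t" unfolding v_def by (simp add: sig_nonneg)

lemma periodic: "cu (t + K) = cu t" "sig (t + K) = sig t" "v (t + K) = v t" "T n (t + K) = T n t"
proof -
  show 1: "cu (t + K) = cu t" by (simp add: cu_def[abs_def] R_per u_per)
  show 2: "sig (t + K) = sig t" by (simp add: sig_def[abs_def] R_per u_per 1)
  show "v (t + K) = v t" by (simp add: v_def 2)
  show "T n (t + K) = T n t" by (simp add: T_def R_per u_per 1)
qed

lemma T_twisted: "\<exists>a c. unit_bounded a \<and> unit_bounded c \<and> T n t = twisted a c (R t)"
proof -
  have "unit_bounded (\<lambda>x. iexp (- cu t x / sqrt n))" "unit_bounded (\<lambda>y. iexp (u t y / sqrt n))"
    by (rule unit_bounded_iexp, measurable)+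
  then show ?thesis unfolding T_def by blast
qed

lemma
  assumes "integrable \<pi> h"
  shows integrable_T_prod: "integrable \<pi> (op_prod (T n) s m h)"
    and norm_T_prod: "Nrm (op_prod (T n) s m h) \<le> Nrm h"
  using integrable_op_prod[of "T n" h s m] T_twisted assms by blast+

lemma T_prod_diff_AE:
  assumes "integrable \<pi> h" "integrable \<pi> h'"
  shows "AE x in \<pi>. op_prod (T n) s m (\<lambda>y. h y - h' y) x = op_prod (T n) s m h x - op_prod (T n) s m h' x"
  using T_twisted assms by (intro op_prod_diff_AE)

lemma T_eq: "T n t h x = (CLINT y|R t x. iexp ((u t y - cu t x) / sqrt n) * h y)"
proof -
  have "iexp (- cu t x / sqrt n) * (CLINT y|R t x. iexp (u t y / sqrt n) * h y)
    = (CLINT y|R t x. iexp (- cu t x / sqrt n) * (iexp (u t y / sqrt n) * h y))" by simp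
  also have "\<dots> = (CLINT y|R t x. iexp ((u t y - cu t x) / sqrt n) * h y)"
    by (simp add: mult.assoc[symmetric] exp_add[symmetric] algebra_simps diff_divide_distrib)
  finally show ?thesis by (simp add: T_def twisted_def)
qed

lemma inv_sqrt_tendsto: "(\<lambda>n. a / sqrt (real n)) \<longlonglongrightarrow> 0"
  by (rule tendsto_divide_0[OF tendsto_const])
     (intro filterlim_at_top_imp_at_infinity filterlim_compose[OF sqrt_at_top filterlim_real_sequentially])

lemma T_plain_diff:
  assumes h: "integrable \<pi> h" and hm[measurable]: "h \<in> borel_measurable borel"
  shows "(\<lambda>n. Nrm (\<lambda>x. T n t h x - plain t h x)) \<longlonglongrightarrow> 0"
proof -
  let ?F = "\<lambda>n x y. (iexp ((u t y - cu t x) / sqrt (real n)) - 1) * h y"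
  have "(\<lambda>n. \<integral>x. norm (\<integral>y. ?F n x y \<partial>R t x) \<partial>\<pi>) \<longlonglongrightarrow> 0"
  proof (rule R.integral_kernel_dominated[where G="\<lambda>x y. 2 * norm (h y)"])
    show "(\<lambda>(x, y). ?F n x y) \<in> borel_measurable (borel \<Otimes>\<^sub>M borel)" for n by measurable
    fix x y :: 'x
    have "(\<lambda>n. ?F n x y) \<longlonglongrightarrow> (iexp 0 - 1) * h y"
      by (intro tendsto_intros isCont_tendsto_compose[OF isCont_iexp] inv_sqrt_tendsto)
    then show "(\<lambda>n. ?F n x y) \<longlonglongrightarrow> 0" by simp
    have "norm (iexp s - 1) \<le> 2" for s :: real
      using norm_triangle_ineq4[of "iexp s" 1] by simp
    then show "norm (?F n x y) \<le> 2 * norm (h y)" for n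
      unfolding norm_mult by (rule mult_right_mono) simp
  next
    show "AE x in \<pi>. integrable (R t x) (\<lambda>y. 2 * norm (h y))"
      using R.AE_integrable_stationary[OF h, of t] by eventually_elim simp
    show "integrable \<pi> (\<lambda>x. \<integral>y. 2 * norm (h y) \<partial>R t x)"
      using h by (intro R.integrable_stationary) simp
  qed
  moreover have "(\<integral>x. norm (\<integral>y. ?F n x y \<partial>R t x) \<partial>\<pi>) = Nrm (\<lambda>x. T n t h x - plain t h x)" for n
  proof (rule integral_cong_AE)
    show "AE x in \<pi>. norm (\<integral>y. ?F n x y \<partial>R t x) = norm (T n t h x - plain t h x)"
      using R.AE_integrable_stationary[OF h, of t]
    proof eventually_elim
      case (elim x)
      have [measurable_cong]: "sets (R t x) = sets borel" by (rule prob_kernelD(2)[OF R.kernel_P])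
      have "integrable (R t x) (\<lambda>y. iexp ((u t y - cu t x) / sqrt (real n)) * h y)"
        by (rule Bochner_Integration.integrable_bound[OF elim]) (auto simp: norm_mult)
      then show ?case using elim by (simp add: T_eq twisted_def left_diff_distrib)
    qed
    obtain a c where T: "unit_bounded a" "unit_bounded c" "T n t = twisted a c (R t)" using T_twisted by blast
    have [measurable]: "T n t h \<in> borel_measurable borel" "plain t h \<in> borel_measurable borel"
      unfolding T by (intro twisted_measurable R.kernel_P T unit_bounded_const hm)+
    show "(\<lambda>x. norm (T n t h x - plain t h x)) \<in> borel_measurable \<pi>" by measurable
    have "(\<lambda>x. \<integral>y. ?F n x y \<partial>R t x) \<in> borel_measurable borel"
      by (rule integral_kernel_measurable2[OF _ prob_kernelD(1)[OF R.kernel_P]]) measurable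
    then show "(\<lambda>x. norm (\<integral>y. ?F n x y \<partial>R t x)) \<in> borel_measurable \<pi>" by measurable
  qed
  ultimately show ?thesis by simp
qed

text \<open>The number \<open>L\<close> of factors stays fixed while \<open>n\<close> grows, and the
  contraction property lets the one step errors be added.\<close>

lemma op_prod_plain_diff:
  assumes h: "integrable \<pi> h" and hm: "h \<in> borel_measurable borel"
  shows "(\<lambda>n. Nrm (\<lambda>x. op_prod (T n) t L h x - op_prod plain t L h x)) \<longlonglongrightarrow> 0"
proof (induction L arbitrary: t)
  case 0 then show ?case by simp
next
  case (Suc L)
  let ?P = "op_prod plain (Suc t) L h" and ?T = "\<lambda>n. op_prod (T n) (Suc t) L h"
  have Pm: "?P \<in> borel_measurable borel" by (rule plain_prod_measurable[OF hm])
  have iP: "integrable \<pi> ?P" by (rule integrable_plain_prod[OF h])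
  have iT: "integrable \<pi> (?T n)" for n by (rule integrable_T_prod[OF h])
  have iTT: "integrable \<pi> (T n t k)" if "integrable \<pi> k" for n k
    using T_twisted[of n t] R.integrable_twisted[OF _ _ that] by metis
  have bound: "Nrm (\<lambda>x. T n t (?T n) x - plain t ?P x) \<le> Nrm (\<lambda>x. ?T n x - ?P x) + Nrm (\<lambda>x. T n t ?P x - plain t ?P x)" for n
  proof -
    obtain a c where T: "unit_bounded a" "unit_bounded c" "T n t = twisted a c (R t)" using T_twisted by blast
    let ?D = "\<lambda>x. ?T n x - ?P x"
    have iD: "integrable \<pi> ?D" using iP iT by simp
    have ip: "integrable \<pi> (plain t ?P)" by (intro R.integrable_twisted unit_bounded_const iP)
    have "Nrm (\<lambda>x. T n t (?T n) x - plain t ?P x) \<le> (\<integral>x. norm (T n t ?D x) + norm (T n t ?P x - plain t ?P x) \<partial>\<pi>)"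
    proof (rule integral_mono_AE)
      show "AE x in \<pi>. norm (T n t (?T n) x - plain t ?P x) \<le> norm (T n t ?D x) + norm (T n t ?P x - plain t ?P x)"
        using R.twisted_diff_AE[OF iT[of n] iP T(2), of a t]
      proof eventually_elim
        case (elim x)
        then have "T n t (?T n) x - plain t ?P x = T n t ?D x + (T n t ?P x - plain t ?P x)" by (simp add: T(3))
        then show ?case by (simp only:) (rule norm_triangle_ineq)
      qed
      show "integrable \<pi> (\<lambda>x. norm (T n t (?T n) x - plain t ?P x))"
        using iTT[OF iT[of n], of n] ip by simp
      show "integrable \<pi> (\<lambda>x. norm (T n t ?D x) + norm (T n t ?P x - plain t ?P x))"
        using iTT[OF iD, of n] iTT[OF iP, of n] ip by simp
    qed
    also have "\<dots> = Nrm (T n t ?D) + Nrm (\<lambda>x. T n t ?P x - plain t ?P x)"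
      using iTT[OF iD, of n] iTT[OF iP, of n] ip by simp
    also have "Nrm (T n t ?D) \<le> Nrm ?D" unfolding T(3) by (rule R.norm_twisted[OF T(1,2) iD])
    finally show ?thesis by simp
  qed
  have "(\<lambda>n. Nrm (\<lambda>x. ?T n x - ?P x) + Nrm (\<lambda>x. T n t ?P x - plain t ?P x)) \<longlonglongrightarrow> 0 + 0"
    by (intro tendsto_add Suc T_plain_diff iP Pm)
  then show ?case
    using bound by (intro Lim_null_comparison[OF always_eventually, of "\<lambda>n. Nrm (\<lambda>x. op_prod (T n) t (Suc L) h x - op_prod plain t (Suc L) h x)"]) auto
qed

text \<open>The Taylor remainder times \<open>n\<close> is bounded by the squared increment, which
  dominates, and by the cube over \<open>sqrt n\<close>, which gives the pointwise limit. Two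
  moments therefore suffice. The linear term vanishes because the increment is centered.\<close>

lemma second_order:
  "(\<lambda>n. Nrm (\<lambda>x. of_nat n * (T n t (\<lambda>_. 1) x - 1) + of_real (sig t x) / 2)) \<longlonglongrightarrow> 0"
proof -
  let ?\<eta> = "\<lambda>x y. u t y - cu t x"
  let ?F = "\<lambda>n x y. of_nat n * (iexp (?\<eta> x y / sqrt (real n)) - 1 - \<i> * of_real (?\<eta> x y / sqrt (real n))) + of_real ((?\<eta> x y)\<^sup>2) / 2"
  have F: "norm (?F n x y) \<le> (?\<eta> x y)\<^sup>2" "norm (?F n x y) \<le> \<bar>?\<eta> x y\<bar> ^ 3 / sqrt (real n)" if "n > 0" for n :: nat and x y
  proof -
    let ?s = "?\<eta> x y / sqrt (real n)"
    have sq: "real n * ?s\<^sup>2 = (?\<eta> x y)\<^sup>2" using that by (simp add: power_divide)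
    have sum: "(\<Sum>k\<le>2. (\<i> * complex_of_real s) ^ k / fact k) = 1 + \<i> * of_real s - of_real (s\<^sup>2) / 2" for s
      by (simp add: numeral_2_eq_2) (simp add: algebra_simps)
    have "?F n x y = of_nat n * (iexp ?s - (\<Sum>k\<le>2. (\<i> * complex_of_real ?s) ^ k / fact k))"
      unfolding sum using arg_cong[OF sq, of complex_of_real] by (simp add: algebra_simps)
    then have eq: "norm (?F n x y) = real n * norm (iexp ?s - (\<Sum>k\<le>2. (\<i> * complex_of_real ?s) ^ k / fact k))"
      by (simp add: norm_mult)
    have "norm (?F n x y) \<le> real n * (2 * \<bar>?s\<bar> ^ 2 / fact 2)"
      unfolding eq by (intro mult_left_mono iexp_approx2) auto
    then show "norm (?F n x y) \<le> (?\<eta> x y)\<^sup>2" using that by (simp add: fact_numeral power_divide)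
    have "norm (?F n x y) \<le> real n * (\<bar>?s\<bar> ^ Suc 2 / fact (Suc 2))"
      unfolding eq by (intro mult_left_mono iexp_approx1) auto
    also have "\<dots> = (real n * ?s\<^sup>2) * \<bar>?s\<bar> / 6" by (simp add: fact_numeral power3_eq_cube power2_eq_square numeral_3_eq_3)
    also have "\<dots> = (?\<eta> x y)\<^sup>2 * (\<bar>?\<eta> x y\<bar> / sqrt (real n)) / 6" unfolding sq by simp
    also have "\<dots> \<le> (?\<eta> x y)\<^sup>2 * (\<bar>?\<eta> x y\<bar> / sqrt (real n))"
      by (simp add: divide_le_eq mult_le_cancel_left1)
    also have "\<dots> = \<bar>?\<eta> x y\<bar> ^ 3 / sqrt (real n)" by (simp add: power3_eq_cube power2_eq_square abs_mult_self_eq)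
    finally show "norm (?F n x y) \<le> \<bar>?\<eta> x y\<bar> ^ 3 / sqrt (real n)" .
  qed
  \<comment> \<open>At \<open>n = 0\<close> the first term vanishes and half the squared increment
    remains; the domination has to cover this index as well.\<close>
  have F0: "norm (?F 0 x y) \<le> (?\<eta> x y)\<^sup>2" for x y
    by (simp add: norm_divide norm_power flip: of_real_diff)
  have "(\<lambda>n. \<integral>x. norm (\<integral>y. ?F n x y \<partial>R t x) \<partial>\<pi>) \<longlonglongrightarrow> 0"
  proof (rule R.integral_kernel_dominated[where G="\<lambda>x y. (?\<eta> x y)\<^sup>2"])
    show "(\<lambda>(x, y). ?F n x y) \<in> borel_measurable (borel \<Otimes>\<^sub>M borel)" for n by measurable
    fix x y :: 'x
    show "norm (?F n x y) \<le> (?\<eta> x y)\<^sup>2" for n using F(1)[of n y x] F0 by (cases "n = 0") blast+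
    have "eventually (\<lambda>n. norm (?F n x y) \<le> \<bar>?\<eta> x y\<bar> ^ 3 / sqrt (real n)) sequentially"
      using eventually_gt_at_top[of 0] by eventually_elim (rule F(2))
    then show "(\<lambda>n. ?F n x y) \<longlonglongrightarrow> 0"
      by (rule Lim_null_comparison[OF _ inv_sqrt_tendsto])
  next
    show "AE x in \<pi>. integrable (R t x) (\<lambda>y. (?\<eta> x y)\<^sup>2)" using sig_eq[of t] by eventually_elim simp
    show "integrable \<pi> (\<lambda>x. \<integral>y. (?\<eta> x y)\<^sup>2 \<partial>R t x)" using sig_int[of t] by (simp add: sig_def[abs_def])
  qed
  moreover have "(\<integral>x. norm (\<integral>y. ?F n x y \<partial>R t x) \<partial>\<pi>)
      = Nrm (\<lambda>x. of_nat n * (T n t (\<lambda>_. 1) x - 1) + of_real (sig t x) / 2)" for n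
  proof (rule integral_cong_AE)
    show "AE x in \<pi>. norm (\<integral>y. ?F n x y \<partial>R t x) = norm (of_nat n * (T n t (\<lambda>_. 1) x - 1) + of_real (sig t x) / 2)"
      using sig_eq[of t] R.AE_integrable_stationary[OF u_int, of t t]
    proof eventually_elim
      case (elim x)
      interpret prob_space "R t x" by (rule prob_kernelD(4)[OF R.kernel_P])
      have [measurable_cong]: "sets (R t x) = sets borel" by (rule prob_kernelD(2)[OF R.kernel_P])
      have i1: "integrable (R t x) (\<lambda>y. iexp (?\<eta> x y / sqrt (real n)))"
        by (rule integrable_const_bound[where B=1]) auto
      have i2: "integrable (R t x) (\<lambda>y. complex_of_real (?\<eta> x y / sqrt (real n)))" using elim by simp
      have z: "(CLINT y|R t x. complex_of_real (?\<eta> x y / sqrt (real n))) = 0"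
        using elim(2) by (simp add: prob_space cu_def diff_divide_distrib flip: of_real_diff of_real_divide)
      have i3: "integrable (R t x) (\<lambda>y. complex_of_real ((?\<eta> x y)\<^sup>2))" using elim by (intro integrable_of_real) simp
      have "(\<integral>y. ?F n x y \<partial>R t x) = of_nat n * ((CLINT y|R t x. iexp (?\<eta> x y / sqrt (real n))) - 1
          - \<i> * (CLINT y|R t x. complex_of_real (?\<eta> x y / sqrt (real n)))) + (CLINT y|R t x. complex_of_real ((?\<eta> x y)\<^sup>2)) / 2"
        using i1 i2 i3 by (simp only: integral_mult_right_zero integral_divide_zero
            Bochner_Integration.integral_add Bochner_Integration.integral_diff integrable_mult_right
            Bochner_Integration.integrable_diff integrable_const integrable_divide lebesgue_integral_const prob_space
            scaleR_one)
      moreover have "(CLINT y|R t x. complex_of_real ((?\<eta> x y)\<^sup>2)) = of_real (sig t x)"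
        unfolding sig_def by (rule integral_complex_of_real)
      moreover have "T n t (\<lambda>_. 1) x = (CLINT y|R t x. iexp (?\<eta> x y / sqrt (real n)))"
        by (simp only: T_eq mult_1_right)
      ultimately show ?case by (simp only: z mult_zero_right diff_0_right)
    qed
    obtain a c where T: "unit_bounded a" "unit_bounded c" "T n t = twisted a c (R t)" using T_twisted by blast
    have [measurable]: "T n t (\<lambda>_. 1) \<in> borel_measurable borel"
      unfolding T by (intro twisted_measurable R.kernel_P T) simp
    show "(\<lambda>x. norm (of_nat n * (T n t (\<lambda>_. 1) x - 1) + of_real (sig t x) / 2)) \<in> borel_measurable \<pi>" by measurable
    have "(\<lambda>x. \<integral>y. ?F n x y \<partial>R t x) \<in> borel_measurable borel"
      by (rule integral_kernel_measurable2[OF _ prob_kernelD(1)[OF R.kernel_P]]) measurable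
    then show "(\<lambda>x. norm (\<integral>y. ?F n x y \<partial>R t x)) \<in> borel_measurable \<pi>" by measurable
  qed
  ultimately show ?thesis by simp
qed

lemma op_prod_T_cmult: "op_prod (T n) s m (\<lambda>y. c * h y) = (\<lambda>x. c * op_prod (T n) s m h x)"
proof (induction m arbitrary: s)
  case (Suc m)
  have "T n s (\<lambda>y. c * k y) = (\<lambda>x. c * T n s k x)" for k
    by (simp add: fun_eq_iff T_def twisted_def mult.left_commute[of _ c])
  then show ?case by (simp only: op_prod.simps Suc)
qed simp

lemma T_unit:
  assumes "unit_bounded h"
  shows "unit_bounded (op_prod (T n) s m h)"
proof (induction m arbitrary: s)
  case (Suc m)
  obtain a c where T: "unit_bounded a" "unit_bounded c" "T n s = twisted a c (R s)" using T_twisted by blast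
  show ?case unfolding op_prod.simps T(3) by (intro unit_bounded_twisted R.kernel_P T Suc)
qed (simp add: assms)

lemma unit_integrable: "unit_bounded h \<Longrightarrow> integrable \<pi> h"
  using R.sets_\<pi> \<pi>.prob_space_axioms by (intro unit_bounded_integrable)

lemma exp_increment_tendsto: "(\<lambda>n. real n * (exp (a / (2 * real n)) - 1) - a / 2) \<longlonglongrightarrow> 0" if "a \<ge> 0"
proof (rule Lim_null_comparison)
  show "eventually (\<lambda>n. norm (real n * (exp (a / (2 * real n)) - 1) - a / 2) \<le> a\<^sup>2 / real n) sequentially"
    using eventually_ge_at_top[of "nat \<lceil>a\<rceil> + 1"]
  proof eventually_elim
    case (elim n)
    define s where "s = a / (2 * real n)"
    have n: "real n \<ge> a" "real n > 0" using elim by linarith+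
    have s: "0 \<le> s" "s \<le> 1" using that n by (auto simp: s_def field_simps)
    have a: "a / 2 = real n * s" using n by (simp add: s_def)
    have "1 + s \<le> exp s" "exp s \<le> 1 + s + s\<^sup>2" using exp_ge_add_one_self[of s] exp_bound[OF s] by auto
    then have "s \<le> exp s - 1" "exp s - 1 \<le> s + s\<^sup>2" by linarith+
    then have "real n * s \<le> real n * (exp s - 1)" "real n * (exp s - 1) \<le> real n * (s + s\<^sup>2)"
      using n by (auto intro: mult_left_mono)
    then have "norm (real n * (exp s - 1) - a / 2) \<le> real n * s\<^sup>2"
      unfolding a by (simp add: algebra_simps)
    also have "\<dots> = a\<^sup>2 / real n / 4" using n by (simp add: s_def power2_eq_square field_simps)
    also have "\<dots> \<le> a\<^sup>2 / real n" using n by (simp add: field_simps)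
    finally show ?case by (simp add: s_def)
  qed
  show "(\<lambda>n. a\<^sup>2 / real n) \<longlonglongrightarrow> 0" by (rule lim_const_over_n)
qed

text \<open>The effect of order \<open>1 / n\<close> of one step after compensation by the mean
  variance \<open>v t\<close>. Its \<pi>-mean is 0, but it is not small pointwise, so mixing has to
  remove it.\<close>

definition q :: "nat \<Rightarrow> 'x \<Rightarrow> complex" where
  "q t x = of_real ((v t - sig t x) / 2)"

definition w :: "nat \<Rightarrow> nat \<Rightarrow> 'x \<Rightarrow> complex" where
  "w n t x = of_nat n * (of_real (exp (v t / (2 * real n))) * T n t (\<lambda>_. 1) x - 1) - q t x"

lemma q_meas[measurable]: "q t \<in> borel_measurable borel" unfolding q_def[abs_def] by measurable

lemma q_int: "integrable \<pi> (q t)" using sig_int[of t] unfolding q_def[abs_def] by (intro integrable_of_real) simp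

lemma q_mean: "(CLINT x|\<pi>. q t x) = 0"
  using sig_int[of t] by (simp add: q_def v_def[symmetric] \<pi>.prob_space)

lemma q_w_periodic: "q (t + K) = q t" "w n (t + K) = w n t"
  by (auto simp: q_def[abs_def] w_def[abs_def] periodic)

lemma T1_unit: "unit_bounded (T n t (\<lambda>_. 1))"
  using T_unit[OF unit_bounded_const, of n t 1] by simp

lemma w_int: "integrable \<pi> (w n t)"
  unfolding w_def[abs_def] using unit_integrable[OF T1_unit, of n t] q_int[of t] by simp

lemma w_tendsto: "(\<lambda>n. Nrm (w n t)) \<longlonglongrightarrow> 0"
proof -
  let ?T = "\<lambda>n x. T n t (\<lambda>_. 1) x"
  let ?e = "\<lambda>n. real n * (exp (v t / (2 * real n)) - 1) - v t / 2"
  let ?A = "\<lambda>n x. of_nat n * (?T n x - 1) + of_real (sig t x) / 2"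
  have iT: "integrable \<pi> (?T n)" for n by (rule unit_integrable[OF T1_unit])
  have iA: "integrable \<pi> (?A n)" for n using iT[of n] sig_int[of t] by auto
  have plain1: "plain t (\<lambda>_. 1) = (\<lambda>_. 1)"
    using prob_space.prob_space[OF prob_kernelD(4)[OF R.kernel_P]] by (auto simp: twisted_def)
  have T1: "(\<lambda>n. Nrm (\<lambda>x. ?T n x - 1)) \<longlonglongrightarrow> 0"
    using T_plain_diff[of "\<lambda>_. 1" t] by (simp add: plain1)
  have "Nrm (w n t) \<le> Nrm (?A n) + \<bar>?e n\<bar> + v t / 2 * Nrm (\<lambda>x. ?T n x - 1)" for n
  proof -
    have "Nrm (w n t) \<le> (\<integral>x. norm (?A n x) + \<bar>?e n\<bar> + v t / 2 * norm (?T n x - 1) \<partial>\<pi>)"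
    proof (rule integral_mono)
      fix x
      \<comment> \<open>Splits off the error of \<open>T\<close>, the error of the compensating
        exponential and their interaction, which vanishes because a single step of
        \<open>T n\<close> tends to the plain operator.\<close>
      have "w n t x = ?A n x + of_real (?e n) * ?T n x + of_real (v t / 2) * (?T n x - 1)"
        by (simp add: w_def q_def algebra_simps diff_divide_distrib)
      then have "norm (w n t x) \<le> norm (?A n x) + norm (of_real (?e n) * ?T n x) + norm (of_real (v t / 2) * (?T n x - 1))"
        by (simp only:) (rule order_trans[OF norm_triangle_ineq add_right_mono[OF norm_triangle_ineq]])
      moreover have "norm (of_real (?e n) * ?T n x) \<le> \<bar>?e n\<bar> * 1"
        unfolding norm_mult norm_of_real using T1_unit[of n t] by (intro mult_left_mono) (auto simp: unit_bounded_def)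
      moreover have "norm (of_real (v t / 2) * (?T n x - 1)) = v t / 2 * norm (?T n x - 1)"
        unfolding norm_mult norm_of_real using v_nonneg[of t] by simp
      moreover have "a \<le> b + c + d \<Longrightarrow> c \<le> e * 1 \<Longrightarrow> d = f \<Longrightarrow> a \<le> b + e + f" for a b c d e f :: real by simp
      ultimately show "norm (w n t x) \<le> norm (?A n x) + \<bar>?e n\<bar> + v t / 2 * norm (?T n x - 1)" by blast
    qed (use w_int[of n t] iA[of n] iT[of n] in auto)
    also have "\<dots> = Nrm (?A n) + \<bar>?e n\<bar> + v t / 2 * Nrm (\<lambda>x. ?T n x - 1)"
      using iA[of n] iT[of n] by (simp add: \<pi>.prob_space)
    finally show ?thesis .
  qed
  moreover have "(\<lambda>n. Nrm (?A n) + \<bar>?e n\<bar> + v t / 2 * Nrm (\<lambda>x. ?T n x - 1)) \<longlonglongrightarrow> 0 + \<bar>0\<bar> + v t / 2 * 0"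
    by (intro tendsto_intros second_order exp_increment_tendsto v_nonneg T1)
  ultimately show ?thesis
    by (intro Lim_null_comparison[OF always_eventually, of "\<lambda>n. Nrm (w n t)"]) auto
qed

lemma integral_op_prod_le:
  assumes "integrable \<pi> h"
  shows "norm (CLINT x|\<pi>. op_prod (T n) 0 m h x) \<le> Nrm h"
  by (rule order_trans[OF integral_norm_bound norm_T_prod[OF assms]])

text \<open>The deterministic factor \<open>c n m\<close> makes the partial characteristic functions
  nearly constant in \<open>m\<close>, so a telescoping sum over \<open>m < n\<close> remains. Each
  increment is of order \<open>1 / n\<close> times the integral of \<open>q m\<close> propagated
  through \<open>m\<close> operators, up to a remainder that is negligible uniformly in
  \<open>m\<close>.\<close>

lemma compensated_char_tendsto:
  "(\<lambda>n. (CLINT x|\<pi>. op_prod (T n) 0 n (\<lambda>_. 1) x) * of_real (exp ((\<Sum>s<n. v s) / (2 * real n)))) \<longlonglongrightarrow> 1"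
proof -
  define \<Lambda> where "\<Lambda> n m h = (CLINT x|\<pi>. op_prod (T n) 0 m h x)" for n m h
  define c where "c n m = exp ((\<Sum>s<m. v s) / (2 * real n))" for n m
  define vm where "vm = (\<Sum>t<K. v t)"
  define B where "B = exp (vm / 2)"
  define Qb where "Qb = (\<Sum>t<K. Nrm (q t))"
  define \<epsilon> where "\<epsilon> n = (\<Sum>t<K. Nrm (w n t))" for n
  have vm: "v t \<le> vm" for t unfolding vm_def by (rule summable_mod_bound[where f=v, OF K periodic(3) v_nonneg])
  have Qb: "Nrm (q t) \<le> Qb" for t unfolding Qb_def by (rule summable_mod_bound[OF K]) (simp_all add: q_w_periodic)
  have \<epsilon>: "Nrm (w n t) \<le> \<epsilon> n" for n t unfolding \<epsilon>_def by (rule summable_mod_bound[OF K]) (simp_all add: q_w_periodic)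
  have \<epsilon>0: "\<epsilon> \<longlonglongrightarrow> 0"
    unfolding \<epsilon>_def[abs_def] using tendsto_sum[of "{..<K}" "\<lambda>t n. Nrm (w n t)" "\<lambda>_. 0" sequentially] w_tendsto by simp
  have vm0: "0 \<le> vm" using v_nonneg[of 0] vm[of 0] by linarith
  have c_le: "c n m \<le> B" if "m \<le> n" for n m
  proof -
    have "(\<Sum>s<m. v s) \<le> real m * vm" using sum_bounded_above[of "{..<m}" v vm] vm by simp
    also have "\<dots> \<le> real n * vm" using that vm0 by (intro mult_right_mono) auto
    finally have "(\<Sum>s<m. v s) / (2 * real n) \<le> vm / 2"
      using vm0 by (cases "n = 0") (auto simp: field_simps)
    then show ?thesis by (simp add: c_def B_def)
  qed
  have incr: "norm (\<Lambda> n (Suc m) (\<lambda>_. 1) * of_real (c n (Suc m)) - \<Lambda> n m (\<lambda>_. 1) * of_real (c n m))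
      \<le> B / real n * (\<epsilon> n + norm (\<Lambda> n m (q m)))" if mn: "m < n" for m n
  proof -
    define e where "e = complex_of_real (exp (v m / (2 * real n)))"
    define D where "D x = e * T n m (\<lambda>_. 1) x - 1" for x
    have n: "real n > 0" using mn by simp
    have cS: "of_real (c n (Suc m)) = of_real (c n m) * e"
      by (simp add: c_def e_def add_divide_distrib exp_add)
    have iT: "integrable \<pi> (T n m (\<lambda>_. 1))" by (rule unit_integrable[OF T1_unit])
    have iD: "integrable \<pi> D" unfolding D_def using iT by simp
    note iop = integrable_T_prod
    have linD: "\<Lambda> n m D = e * \<Lambda> n (Suc m) (\<lambda>_. 1) - \<Lambda> n m (\<lambda>_. 1)"
    proof -
      have i1: "integrable \<pi> (\<lambda>x. e * T n m (\<lambda>_. 1) x)" using iT by simp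
      have "\<Lambda> n m D = (CLINT x|\<pi>. op_prod (T n) 0 m (\<lambda>x. e * T n m (\<lambda>_. 1) x) x - op_prod (T n) 0 m (\<lambda>_. 1) x)"
        unfolding \<Lambda>_def D_def
        by (intro integral_cong_AE T_prod_diff_AE[OF i1] borel_measurable_integrable iop
            Bochner_Integration.integrable_diff iT i1) auto
      also have "\<dots> = \<Lambda> n m (\<lambda>x. e * T n m (\<lambda>_. 1) x) - \<Lambda> n m (\<lambda>_. 1)"
        unfolding \<Lambda>_def by (intro Bochner_Integration.integral_diff iop i1) auto
      also have "\<Lambda> n m (\<lambda>x. e * T n m (\<lambda>_. 1) x) = e * \<Lambda> n (Suc m) (\<lambda>_. 1)"
        unfolding \<Lambda>_def op_prod_T_cmult op_prod_Suc_right by simp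
      finally show ?thesis .
    qed
    have wD: "w n m = (\<lambda>x. of_nat n * D x - q m x)" by (simp add: w_def[abs_def] D_def e_def)
    have linw: "\<Lambda> n m (w n m) = of_nat n * \<Lambda> n m D - \<Lambda> n m (q m)"
    proof -
      have i1: "integrable \<pi> (\<lambda>x. of_nat n * D x)" using iD by simp
      have "\<Lambda> n m (w n m) = (CLINT x|\<pi>. op_prod (T n) 0 m (\<lambda>x. of_nat n * D x) x - op_prod (T n) 0 m (q m) x)"
        unfolding \<Lambda>_def wD
        by (intro integral_cong_AE T_prod_diff_AE[OF i1] borel_measurable_integrable iop
            Bochner_Integration.integrable_diff i1 q_int)
      also have "\<dots> = \<Lambda> n m (\<lambda>x. of_nat n * D x) - \<Lambda> n m (q m)"
        unfolding \<Lambda>_def by (intro Bochner_Integration.integral_diff iop i1 q_int)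
      also have "\<Lambda> n m (\<lambda>x. of_nat n * D x) = of_nat n * \<Lambda> n m D"
        unfolding \<Lambda>_def op_prod_T_cmult by simp
      finally show ?thesis .
    qed
    have "real n * norm (\<Lambda> n m D) = norm (\<Lambda> n m (w n m) + \<Lambda> n m (q m))" unfolding linw by (simp add: norm_mult)
    also have "\<dots> \<le> norm (\<Lambda> n m (w n m)) + norm (\<Lambda> n m (q m))" by (rule norm_triangle_ineq)
    also have "norm (\<Lambda> n m (w n m)) \<le> \<epsilon> n"
      unfolding \<Lambda>_def by (rule order_trans[OF integral_op_prod_le[OF w_int] \<epsilon>])
    finally have D_le: "norm (\<Lambda> n m D) \<le> (\<epsilon> n + norm (\<Lambda> n m (q m))) / real n" using n by (simp add: field_simps)
    have "\<Lambda> n (Suc m) (\<lambda>_. 1) * of_real (c n (Suc m)) - \<Lambda> n m (\<lambda>_. 1) * of_real (c n m) = of_real (c n m) * \<Lambda> n m D"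
      unfolding linD cS by (simp add: algebra_simps)
    then have "norm (\<Lambda> n (Suc m) (\<lambda>_. 1) * of_real (c n (Suc m)) - \<Lambda> n m (\<lambda>_. 1) * of_real (c n m)) = c n m * norm (\<Lambda> n m D)"
      by (simp add: norm_mult c_def)
    also have "\<dots> \<le> B * ((\<epsilon> n + norm (\<Lambda> n m (q m))) / real n)"
      using D_le c_le[of m n] mn by (intro mult_mono) (auto simp: B_def)
    finally show ?thesis by simp
  qed
  show ?thesis
  proof (rule LIMSEQ_I)
    fix e0 :: real assume e0: "0 < e0"
    define e where "e = e0 / (4 * B)"
    have B: "B > 0" by (simp add: B_def)
    have e: "e > 0" using e0 B by (simp add: e_def)
    have "\<forall>t. \<exists>L0. \<forall>L\<ge>L0. Nrm (op_prod plain t (K * L) (q t)) \<le> e"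
      using mixing[OF q_int q_mean e] by blast
    then obtain L0 where L0: "\<And>t L. L \<ge> L0 t \<Longrightarrow> Nrm (op_prod plain t (K * L) (q t)) \<le> e" by metis
    define L where "L = Max (L0 ` {..<K})"
    define M where "M = K * L"
    have plain_le: "Nrm (op_prod plain t M (q t)) \<le> e" for t
    proof -
      have per: "q (s + K * j) = q s" for s j by (induction j arbitrary: s) (simp_all add: q_w_periodic algebra_simps flip: add.assoc)
      have t: "t = t mod K + K * (t div K)" by simp
      have "op_prod plain t M (q t) = op_prod plain (t mod K) M (q (t mod K))"
        by (subst (1 2) t) (simp only: plain_prod_periodic per)
      moreover have "L0 (t mod K) \<le> L" using K unfolding L_def by (intro Max_ge) auto
      ultimately show ?thesis using L0[of "t mod K" L] by (simp add: M_def)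
    qed
    define \<Delta> where "\<Delta> n = (\<Sum>t<K. Nrm (\<lambda>x. op_prod (T n) t M (q t) x - op_prod plain t M (q t) x))" for n
    have \<Delta>0: "\<Delta> \<longlonglongrightarrow> 0"
      unfolding \<Delta>_def[abs_def]
      using tendsto_sum[of "{..<K}" "\<lambda>t n. Nrm (\<lambda>x. op_prod (T n) t M (q t) x - op_prod plain t M (q t) x)" "\<lambda>_. 0" sequentially]
        op_prod_plain_diff[OF q_int q_meas] by simp
    have \<Delta>: "Nrm (\<lambda>x. op_prod (T n) t M (q t) x - op_prod plain t M (q t) x) \<le> \<Delta> n" for n t
      unfolding \<Delta>_def
    proof (rule summable_mod_bound[OF K])
      fix t
      have "op_prod (T n) (s + K) m h = op_prod (T n) s m h" for s m h
        by (induction m arbitrary: s) (simp_all add: periodic flip: add_Suc)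
      moreover have "op_prod plain (s + K) m h = op_prod plain s m h" for s m h
        using plain_prod_periodic[of s 1] by simp
      ultimately show "Nrm (\<lambda>x. op_prod (T n) (t + K) M (q (t + K)) x - op_prod plain (t + K) M (q (t + K)) x)
        = Nrm (\<lambda>x. op_prod (T n) t M (q t) x - op_prod plain t M (q t) x)" by (simp add: q_w_periodic)
    qed simp
    \<comment> \<open>The last \<open>M\<close> operators are close to the plain ones, which almost
      annihilate the mean zero \<open>q\<close>; all earlier ones are contractions.\<close>
    have late: "norm (\<Lambda> n m (q m)) \<le> e + \<Delta> n" if "m \<ge> M" for n m
    proof -
      define s where "s = m - M"
      have m: "m = s + M" using that by (simp add: s_def)
      have qm: "q m = q s"
      proof -
        have "q (s + K * j) = q s" for s j by (induction j arbitrary: s) (simp_all add: q_w_periodic algebra_simps flip: add.assoc)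
        then show ?thesis by (simp add: m M_def)
      qed
      have iT: "integrable \<pi> (op_prod (T n) s M (q s))" by (rule integrable_T_prod[OF q_int])
      have iP: "integrable \<pi> (op_prod plain s M (q s))" by (rule integrable_plain_prod[OF q_int])
      have "norm (\<Lambda> n m (q m)) = norm (CLINT x|\<pi>. op_prod (T n) 0 s (op_prod (T n) s M (q s)) x)"
        unfolding \<Lambda>_def qm by (simp add: m op_prod_add)
      also have "\<dots> \<le> Nrm (op_prod (T n) s M (q s))" by (rule integral_op_prod_le[OF iT])
      also have "\<dots> \<le> (\<integral>x. norm (op_prod plain s M (q s) x) + norm (op_prod (T n) s M (q s) x - op_prod plain s M (q s) x) \<partial>\<pi>)"
        using iT iP by (intro integral_mono) (auto intro: norm_triangle_sub)
      also have "\<dots> = Nrm (op_prod plain s M (q s)) + Nrm (\<lambda>x. op_prod (T n) s M (q s) x - op_prod plain s M (q s) x)"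
        using iT iP by simp
      also have "\<dots> \<le> e + \<Delta> n" by (intro add_mono plain_le \<Delta>)
      finally show ?thesis .
    qed
    \<comment> \<open>For \<open>m < M\<close> there is no room for mixing, but the number of such
      indices is fixed and each is weighted by \<open>1 / n\<close>.\<close>
    have early: "norm (\<Lambda> n m (q m)) \<le> Qb" for n m
      unfolding \<Lambda>_def by (rule order_trans[OF integral_op_prod_le[OF q_int] Qb])
    have Qb0: "0 \<le> Qb" unfolding Qb_def by (intro sum_nonneg) simp
    have \<Delta>n: "0 \<le> \<Delta> n" for n unfolding \<Delta>_def by (intro sum_nonneg) simp
    have total: "norm (\<Lambda> n n (\<lambda>_. 1) * of_real (c n n) - 1) \<le> B * (\<epsilon> n + e + \<Delta> n + real M * Qb / real n)" if n: "n > 0" for n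
    proof -
      have z: "\<Lambda> n 0 (\<lambda>_. 1) * of_real (c n 0) = 1" by (simp add: \<Lambda>_def c_def \<pi>.prob_space)
      have "\<Lambda> n n (\<lambda>_. 1) * of_real (c n n) - 1
        = (\<Sum>m<n. \<Lambda> n (Suc m) (\<lambda>_. 1) * of_real (c n (Suc m)) - \<Lambda> n m (\<lambda>_. 1) * of_real (c n m))"
        using sum_lessThan_telescope[of "\<lambda>m. \<Lambda> n m (\<lambda>_. 1) * of_real (c n m)" n] z by simp
      also have "norm \<dots> \<le> (\<Sum>m<n. B / real n * (\<epsilon> n + norm (\<Lambda> n m (q m))))"
        by (intro order_trans[OF norm_sum] sum_mono incr) auto
      also have "\<dots> \<le> (\<Sum>m<n. B / real n * (\<epsilon> n + (e + \<Delta> n) + (if m < M then Qb else 0)))"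
      proof (intro sum_mono mult_left_mono)
        fix m
        show "\<epsilon> n + norm (\<Lambda> n m (q m)) \<le> \<epsilon> n + (e + \<Delta> n) + (if m < M then Qb else 0)"
          using early[of n m] late[of m n] e \<Delta>n[of n] by auto
      qed (use B in auto)
      also have "\<dots> = B / real n * (real n * (\<epsilon> n + (e + \<Delta> n)) + (\<Sum>m<n. if m < M then Qb else 0))"
        by (simp only: sum_distrib_left[symmetric] sum.distrib sum_constant card_lessThan distrib_left add.assoc)
      also have "\<dots> \<le> B / real n * (real n * (\<epsilon> n + (e + \<Delta> n)) + real M * Qb)"
      proof (intro mult_left_mono add_left_mono)
        have "(\<Sum>m<n. if m < M then Qb else 0) = (\<Sum>m\<in>{..<n} \<inter> {..<M}. Qb)"
          by (simp add: sum.If_cases Int_def lessThan_def)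
        also have "\<dots> \<le> real M * Qb"
          using card_mono[of "{..<M}" "{..<n} \<inter> {..<M}"] Qb0 by (auto intro!: mult_right_mono)
        finally show "(\<Sum>m<n. if m < M then Qb else 0) \<le> real M * Qb" .
      qed (use B in auto)
      also have "\<dots> = B * (\<epsilon> n + e + \<Delta> n + real M * Qb / real n)" using n by (simp add: field_simps)
      finally show ?thesis .
    qed
    have "(\<lambda>n. B * (\<epsilon> n + e + \<Delta> n + real M * Qb / real n)) \<longlonglongrightarrow> B * (0 + e + 0 + 0)"
      by (intro tendsto_intros \<epsilon>0 \<Delta>0 lim_const_over_n)
    moreover have "B * (0 + e + 0 + 0) < e0" using e0 B by (simp add: e_def)
    ultimately have "eventually (\<lambda>n. B * (\<epsilon> n + e + \<Delta> n + real M * Qb / real n) < e0) sequentially"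
      by (rule order_tendstoD(2))
    then have "eventually (\<lambda>n. norm (\<Lambda> n n (\<lambda>_. 1) * of_real (c n n) - 1) < e0) sequentially"
      using eventually_gt_at_top[of 0] by eventually_elim (rule le_less_trans[OF total])
    then show "\<exists>no. \<forall>n\<ge>no. norm ((CLINT x|\<pi>. op_prod (T n) 0 n (\<lambda>_. 1) x) *
        of_real (exp ((\<Sum>s<n. v s) / (2 * real n))) - 1) < e0"
      unfolding eventually_sequentially \<Lambda>_def c_def .
  qed
qed

lemma v_average: "(\<lambda>n. (\<Sum>s<n. v s) / real n) \<longlonglongrightarrow> (\<Sum>t<K. v t) / real K"
proof -
  define V where "V = (\<Sum>t<K. v t)"
  have per: "(\<Sum>s<K * j + r. v s) = real j * V + (\<Sum>s<r. v s)" for j r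
  proof (induction j)
    case (Suc j)
    have split: "(\<Sum>s<K + n. v s) = (\<Sum>s<K. v s) + (\<Sum>s<n. v (s + K))" for n
      by (induction n) (simp_all add: add.commute)
    have "K * Suc j + r = K + (K * j + r)" by simp
    then have "(\<Sum>s<K * Suc j + r. v s) = (\<Sum>s<K. v s) + (\<Sum>s<K * j + r. v (s + K))"
      using split[of "K * j + r"] by (simp add: add.assoc)
    then have "(\<Sum>s<K * Suc j + r. v s) = V + (real j * V + (\<Sum>s<r. v s))"
      by (simp only: periodic Suc V_def)
    then show ?case by (simp add: distrib_right)
  qed simp
  have V0: "0 \<le> V" unfolding V_def by (intro sum_nonneg v_nonneg)
  have bound: "\<bar>(\<Sum>s<n. v s) - real n / real K * V\<bar> \<le> V" for n
  proof -
    have e: "(\<Sum>s<n. v s) = real (n div K) * V + (\<Sum>s<n mod K. v s)" using per[of "n div K" "n mod K"] by simp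
    have "0 \<le> (\<Sum>s<n mod K. v s)" by (intro sum_nonneg v_nonneg)
    moreover have "(\<Sum>s<n mod K. v s) \<le> V"
      unfolding V_def using K mod_less_divisor[of K n] by (intro sum_mono2 v_nonneg) auto
    moreover have "real n = real K * real (n div K) + real (n mod K)"
      by (metis mult_div_mod_eq of_nat_add of_nat_mult)
    then have "real n / real K = real (n div K) + real (n mod K) / real K" using K by (simp add: field_simps)
    then have "real n / real K * V = real (n div K) * V + real (n mod K) / real K * V" by (simp only: distrib_right)
    moreover have "real (n mod K) / real K \<le> 1"
      using K mod_less_divisor[of K n] by (simp add: less_imp_le)
    then have "real (n mod K) / real K * V \<le> 1 * V" by (rule mult_right_mono[OF _ V0])
    moreover have "0 \<le> real (n mod K) / real K * V" using V0 by simp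
    ultimately show ?thesis unfolding e by linarith
  qed
  have "(\<lambda>n. (\<Sum>s<n. v s) / real n - V / real K) \<longlonglongrightarrow> 0"
  proof (rule Lim_null_comparison[OF _ lim_const_over_n[of V]])
    show "eventually (\<lambda>n. norm ((\<Sum>s<n. v s) / real n - V / real K) \<le> V / real n) sequentially"
      using eventually_gt_at_top[of 0]
    proof eventually_elim
      case (elim n)
      have "(\<Sum>s<n. v s) / real n - V / real K = ((\<Sum>s<n. v s) - real n / real K * V) / real n"
        using elim by (simp add: diff_divide_distrib)
      then show ?case using bound[of n] elim by (simp add: divide_right_mono)
    qed
  qed
  then show ?thesis unfolding V_def by (simp add: LIM_zero_iff)
qed

text \<open>Dividing by the compensating factor, which converges because the averages of the
  periodic \<open>v\<close> do.\<close>

theorem martingale_char_tendsto: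
  "(\<lambda>n. CLINT x|\<pi>. op_prod (T n) 0 n (\<lambda>_. 1) x) \<longlonglongrightarrow> of_real (exp (- ((\<Sum>t<K. v t) / real K) / 2))"
proof -
  let ?V = "(\<Sum>t<K. v t) / real K"
  have "(\<lambda>n. exp (((\<Sum>s<n. v s) / real n) / 2)) \<longlonglongrightarrow> exp (?V / 2)"
    by (intro tendsto_intros v_average) simp
  then have "(\<lambda>n. complex_of_real (exp ((\<Sum>s<n. v s) / (2 * real n)))) \<longlonglongrightarrow> of_real (exp (?V / 2))"
    by (intro tendsto_of_real) (simp add: mult.commute)
  from tendsto_divide[OF compensated_char_tendsto this]
  show ?thesis by (simp add: exp_minus inverse_eq_divide)
qed

lemma iexp_minus_one_tendsto:
  assumes [measurable]: "f \<in> borel_measurable borel"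
  shows "(\<lambda>n. Nrm (\<lambda>x. iexp (f x / sqrt (real n)) - 1)) \<longlonglongrightarrow> 0"
proof -
  have "(\<lambda>n. Nrm (\<lambda>x. iexp (f x / sqrt (real n)) - 1)) \<longlonglongrightarrow> (\<integral>x. 0 \<partial>\<pi>)"
  proof (rule integral_dominated_convergence[where w="\<lambda>_. 2"])
    show "AE x in \<pi>. (\<lambda>n. norm (iexp (f x / sqrt (real n)) - 1)) \<longlonglongrightarrow> 0"
    proof (rule AE_I2)
      fix x
      have "(\<lambda>n. iexp (f x / sqrt (real n)) - 1) \<longlonglongrightarrow> iexp 0 - 1"
        by (intro tendsto_intros isCont_tendsto_compose[OF isCont_iexp] inv_sqrt_tendsto)
      then show "(\<lambda>n. norm (iexp (f x / sqrt (real n)) - 1)) \<longlonglongrightarrow> 0" by (simp add: tendsto_norm_zero)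
    qed
    have "norm (iexp s - 1) \<le> 2" for s :: real
      using norm_triangle_ineq4[of "iexp s" 1] by simp
    then have "norm (norm (iexp (f x / sqrt (real n)) - 1)) \<le> 2" for n x
      unfolding real_norm_def abs_norm_cancel .
    then show "AE x in \<pi>. norm (norm (iexp (f x / sqrt (real n)) - 1)) \<le> 2" for n by (intro AE_I2)
  qed auto
  then show ?thesis by simp
qed

text \<open>Passing from the martingale to an additive functional \<open>\<theta>\<close> which differs from it by a
  coboundary: the corresponding operators are conjugate.\<close>

theorem additive_char_tendsto:
  fixes \<theta> :: "nat \<Rightarrow> 'x \<Rightarrow> real"
  assumes \<theta>[measurable]: "\<And>t. \<theta> t \<in> borel_measurable borel"
    and cob: "\<And>t. AE x in \<pi>. \<theta> t x = u (t + K - 1) x - cu t x"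
  shows "(\<lambda>n. CLINT x|\<pi>. op_prod (\<lambda>t. twisted (\<lambda>x. iexp (\<theta> t x / sqrt (real n))) (\<lambda>_. 1) (R t)) 0 n (\<lambda>_. 1) x)
    \<longlonglongrightarrow> of_real (exp (- ((\<Sum>t<K. v t) / real K) / 2))"
proof -
  define S where "S n t = twisted (\<lambda>x. iexp (\<theta> t x / sqrt (real n))) (\<lambda>_. 1) (R t)" for n t
  \<comment> \<open>The index \<open>t + K - 1\<close> is \<open>t - 1\<close> modulo
    \<open>K\<close>, written so that it makes sense at \<open>t = 0\<close>.\<close>
  define \<omega> where "\<omega> t = u (t + K - 1)" for t
  have [measurable]: "\<omega> t \<in> borel_measurable borel" for t by (simp add: \<omega>_def)
  have \<omega>S: "\<omega> (Suc t) = u t" for t using u_per[of t] by (simp add: \<omega>_def)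
  have \<omega>_per: "\<omega> (t + K) = \<omega> t" for t
  proof -
    have "t + K + K - 1 = (t + K - 1) + K" using K by simp
    then show ?thesis unfolding \<omega>_def using u_per[of "t + K - 1"] by simp
  qed
  define E where "E n t x = iexp (\<omega> t x / sqrt (real n))" for n t x
  define E' where "E' n t x = iexp (- \<omega> t x / sqrt (real n))" for n t x
  have uE: "unit_bounded (E n t)" "unit_bounded (E' n t)" for n t
    unfolding E_def[abs_def] E'_def[abs_def] by (rule unit_bounded_iexp, measurable)+
  have EE': "E n t x * E' n t x = 1" for n t x by (simp add: E_def E'_def exp_add[symmetric])
  have S_twisted: "\<exists>a c. unit_bounded a \<and> unit_bounded c \<and> S n t = twisted a c (R t)" for n t
  proof -
    have "unit_bounded (\<lambda>x. iexp (\<theta> t x / sqrt (real n)))" by (rule unit_bounded_iexp) measurable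
    then show ?thesis unfolding S_def using unit_bounded_const by blast
  qed
  \<comment> \<open>Since \<open>\<theta> t = \<omega> t - cu t\<close> almost everywhere and
    \<open>\<omega> (Suc t) = u t\<close>, the potentials \<omega> telescope along the product and
    leave one factor at each end.\<close>
  have conj: "AE x in \<pi>. op_prod (S n) s m h x = E n s x * op_prod (T n) s m (\<lambda>y. E' n (s + m) y * h y) x"
    if h: "integrable \<pi> h" for n s m h
  proof (induction m arbitrary: s)
    case 0
    show ?case using EE' by (simp add: mult.assoc[symmetric])
  next
    case (Suc m)
    let ?X = "op_prod (T n) (Suc s) m (\<lambda>y. E' n (Suc s + m) y * h y)"
    have iX: "integrable \<pi> ?X"
      by (intro integrable_T_prod R.integrable_unit_mult uE h)
    have iS: "integrable \<pi> (op_prod (S n) (Suc s) m h)" using integrable_op_prod[of "S n" h "Suc s" m] S_twisted h by blast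
    have "AE x in \<pi>. S n s (op_prod (S n) (Suc s) m h) x = S n s (\<lambda>x. E n (Suc s) x * ?X x) x"
      unfolding S_def[of n s]
      by (rule R.twisted_cong_AE[OF iS R.integrable_unit_mult[OF uE(1) iX] Suc[of "Suc s"] unit_bounded_const])
    then show ?case
      using cob[of s]
    proof eventually_elim
      case (elim x)
      have "S n s (\<lambda>x. E n (Suc s) x * ?X x) x = E n s x * T n s ?X x"
        unfolding S_def twisted_def T_def elim(2) E_def \<omega>S
        by (simp add: \<omega>_def diff_divide_distrib right_diff_distrib exp_diff exp_minus field_simps)
      then show ?case using elim(1) by simp
    qed
  qed
  \<comment> \<open>Both end factors tend to 1 in L1. Bounding them by sums over a period handles
    the final time index \<open>n\<close>, which moves with the limit.\<close>
  have diff: "norm ((CLINT x|\<pi>. op_prod (S n) 0 n (\<lambda>_. 1) x) - (CLINT x|\<pi>. op_prod (T n) 0 n (\<lambda>_. 1) x))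
    \<le> (\<Sum>t<K. Nrm (\<lambda>x. E n t x - 1)) + (\<Sum>t<K. Nrm (\<lambda>x. E' n t x - 1))" for n
  proof -
    let ?Y = "op_prod (T n) 0 n (E' n n)" and ?Z = "op_prod (T n) 0 n (\<lambda>_. 1)"
    have uY: "unit_bounded ?Y" by (rule T_unit[OF uE(2)])
    have iY: "integrable \<pi> ?Y" and iZ: "integrable \<pi> ?Z" and iE': "integrable \<pi> (E' n n)" and iE: "integrable \<pi> (E n 0)"
      using unit_integrable T_unit uE unit_bounded_const by blast+
    have iEY: "integrable \<pi> (\<lambda>x. E n 0 x * ?Y x)" by (rule R.integrable_unit_mult[OF uE(1) iY])
    have iYZ: "integrable \<pi> (op_prod (T n) 0 n (\<lambda>y. E' n n y - 1))"
      using iE' by (intro integrable_T_prod) simp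
    have "(CLINT x|\<pi>. op_prod (S n) 0 n (\<lambda>_. 1) x) = (CLINT x|\<pi>. E n 0 x * ?Y x)"
    proof (rule integral_cong_AE)
      have "integrable \<pi> (op_prod (S n) 0 n (\<lambda>_. 1))"
        using integrable_op_prod[of "S n" "\<lambda>_. 1" 0 n] S_twisted by simp
      then show "op_prod (S n) 0 n (\<lambda>_. 1) \<in> borel_measurable \<pi>" by (rule borel_measurable_integrable)
      show "(\<lambda>x. E n 0 x * ?Y x) \<in> borel_measurable \<pi>" using iEY by (rule borel_measurable_integrable)
      show "AE x in \<pi>. op_prod (S n) 0 n (\<lambda>_. 1) x = E n 0 x * ?Y x"
        using conj[of "\<lambda>_. 1" n 0 n] by simp
    qed
    then have "norm ((CLINT x|\<pi>. op_prod (S n) 0 n (\<lambda>_. 1) x) - (CLINT x|\<pi>. ?Z x)) = norm (CLINT x|\<pi>. E n 0 x * ?Y x - ?Z x)"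
      using iEY iZ by simp
    also have "\<dots> \<le> Nrm (\<lambda>x. E n 0 x * ?Y x - ?Z x)" by (rule integral_norm_bound)
    also have "\<dots> \<le> (\<integral>x. norm (E n 0 x - 1) + norm (op_prod (T n) 0 n (\<lambda>y. E' n n y - 1) x) \<partial>\<pi>)"
    proof (rule integral_mono_AE)
      show "AE x in \<pi>. norm (E n 0 x * ?Y x - ?Z x) \<le> norm (E n 0 x - 1) + norm (op_prod (T n) 0 n (\<lambda>y. E' n n y - 1) x)"
        using T_prod_diff_AE[OF iE', of "\<lambda>_. 1" n 0 n, simplified]
      proof eventually_elim
        case (elim x)
        have "E n 0 x * ?Y x - ?Z x = (E n 0 x - 1) * ?Y x + op_prod (T n) 0 n (\<lambda>y. E' n n y - 1) x"
          unfolding elim by (simp add: algebra_simps)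
        then have "norm (E n 0 x * ?Y x - ?Z x) \<le> norm ((E n 0 x - 1) * ?Y x) + norm (op_prod (T n) 0 n (\<lambda>y. E' n n y - 1) x)"
          by (simp only:) (rule norm_triangle_ineq)
        moreover have "norm ((E n 0 x - 1) * ?Y x) \<le> norm (E n 0 x - 1) * 1"
          unfolding norm_mult using uY by (intro mult_left_mono) (auto simp: unit_bounded_def)
        ultimately show ?case by simp
      qed
    qed (use iEY iZ iE iYZ in auto)
    also have "\<dots> = Nrm (\<lambda>x. E n 0 x - 1) + Nrm (op_prod (T n) 0 n (\<lambda>y. E' n n y - 1))"
      using iE iYZ by simp
    also have "Nrm (op_prod (T n) 0 n (\<lambda>y. E' n n y - 1)) \<le> Nrm (\<lambda>y. E' n n y - 1)"
      using iE' by (intro norm_T_prod) simp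
    also have "Nrm (\<lambda>x. E n 0 x - 1) \<le> (\<Sum>t<K. Nrm (\<lambda>x. E n t x - 1))"
      by (rule summable_mod_bound[OF K]) (simp_all add: E_def \<omega>_per)
    also have "Nrm (\<lambda>x. E' n n x - 1) \<le> (\<Sum>t<K. Nrm (\<lambda>x. E' n t x - 1))"
      by (rule summable_mod_bound[OF K]) (simp_all add: E'_def \<omega>_per)
    finally show ?thesis by simp
  qed
  have "(\<lambda>n. (\<Sum>t<K. Nrm (\<lambda>x. E n t x - 1)) + (\<Sum>t<K. Nrm (\<lambda>x. E' n t x - 1))) \<longlonglongrightarrow> (\<Sum>t<K. 0) + (\<Sum>t<K. 0)"
    unfolding E_def E'_def by (intro tendsto_add tendsto_sum iexp_minus_one_tendsto) measurable
  then have lim: "(\<lambda>n. (\<Sum>t<K. Nrm (\<lambda>x. E n t x - 1)) + (\<Sum>t<K. Nrm (\<lambda>x. E' n t x - 1))) \<longlonglongrightarrow> 0" by simp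
  have "(\<lambda>n. (CLINT x|\<pi>. op_prod (S n) 0 n (\<lambda>_. 1) x) - (CLINT x|\<pi>. op_prod (T n) 0 n (\<lambda>_. 1) x)) \<longlonglongrightarrow> 0"
    by (rule Lim_null_comparison[OF _ lim]) (intro always_eventually allI diff)
  from tendsto_add[OF this martingale_char_tendsto] show ?thesis by (simp add: S_def[abs_def])
qed

end

subsection \<open>Path functionals of the sweep chain\<close>

text \<open>For a nonnegative weight the hypothesis says that two finite measures agree on sets: the
  weighted law of \<open>Y\<close>, and the weighted law of \<open>X\<close> followed by
  \<open>R\<close>. Bounded integrands then follow from the equality of these measures.\<close>

lemma bind_law_eqI:
  fixes R :: "'x::polish_space \<Rightarrow> 'x measure"
  assumes M: "prob_space M" and F: "F \<in> borel_measurable M" "\<And>w. 0 \<le> F w" "\<And>w. F w \<le> (B :: real)"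
    and XY[measurable]: "X \<in> M \<rightarrow>\<^sub>M borel" "Y \<in> M \<rightarrow>\<^sub>M borel" and R: "prob_kernel R"
    and eq: "\<And>A. A \<in> sets borel \<Longrightarrow> (\<integral>w. F w * indicat_real A (Y w) \<partial>M) = (\<integral>w. F w * measure (R (X w)) A \<partial>M)"
    and h: "unit_bounded h"
  shows "(CLINT w|M. of_real (F w) * h (Y w)) = (CLINT w|M. of_real (F w) * (CLINT y|R (X w). h y))"
proof -
  interpret prob_space M by fact
  note [measurable] = F(1)
  have hm[measurable]: "h \<in> borel_measurable borel" using h by (simp add: unit_bounded_def)
  let ?D = "density M (\<lambda>w. ennreal (F w))"
  let ?\<mu>X = "distr ?D borel X" and ?\<mu>Y = "distr ?D borel Y"
  have fin: "(\<integral>\<^sup>+w. ennreal (F w) \<partial>M) < \<infinity>"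
  proof -
    have "(\<integral>\<^sup>+w. ennreal (F w) \<partial>M) \<le> (\<integral>\<^sup>+w. ennreal B \<partial>M)" using F(3) by (intro nn_integral_mono ennreal_leI)
    also have "\<dots> < \<infinity>" by (simp add: emeasure_space_1)
    finally show ?thesis .
  qed
  have intF: "integrable M (\<lambda>w. F w * k w)" if [measurable]: "k \<in> borel_measurable M" and k: "\<And>w. 0 \<le> k w" "\<And>w. k w \<le> 1" for k :: "_ \<Rightarrow> real"
  proof (rule integrable_const_bound[where B=B])
    have "\<bar>F w * k w\<bar> \<le> B" for w
      using mult_mono[OF F(3) k(2) _ k(1), of w w] F(2,3)[of w] k(1)[of w] by (simp add: abs_mult)
    then show "AE w in M. norm (F w * k w) \<le> B" by simp
  qed measurable
  have Rm: "(\<lambda>x. measure (R x) A) \<in> borel_measurable borel" if "A \<in> sets borel" for A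
    using measurable_compose[OF prob_kernelD(1)[OF R] measurable_measure_subprob_algebra[OF that]] by simp
  have sX: "sets ?\<mu>X = sets borel" by simp
  have bind_eq: "?\<mu>Y = ?\<mu>X \<bind> R"
  proof (rule measure_eqI)
    show sets: "sets ?\<mu>Y = sets (?\<mu>X \<bind> R)"
      using sets_bind[of ?\<mu>X R borel] prob_kernelD(2)[OF R] by simp
    fix A assume "A \<in> sets ?\<mu>Y"
    then have A[measurable]: "A \<in> sets borel" by simp
    interpret R: prob_space "R x" for x by (rule prob_kernelD(4)[OF R])
    note Rm[OF A, measurable]
    have "emeasure ?\<mu>Y A = (\<integral>\<^sup>+w. ennreal (F w) * indicator A (Y w) \<partial>M)"
      by (subst nn_integral_indicator[symmetric]) (simp_all add: nn_integral_distr nn_integral_density del: nn_integral_indicator)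
    also have "\<dots> = (\<integral>\<^sup>+w. ennreal (F w * indicat_real A (Y w)) \<partial>M)"
      using F(2) by (intro nn_integral_cong) (auto split: split_indicator)
    also have "\<dots> = ennreal (\<integral>w. F w * indicat_real A (Y w) \<partial>M)"
      using F(2) by (intro nn_integral_eq_integral intF) auto
    also have "\<dots> = ennreal (\<integral>w. F w * measure (R (X w)) A \<partial>M)" by (simp add: eq)
    also have "\<dots> = (\<integral>\<^sup>+w. ennreal (F w * measure (R (X w)) A) \<partial>M)"
      using F(2) by (intro nn_integral_eq_integral[symmetric] intF) auto
    also have "\<dots> = (\<integral>\<^sup>+w. ennreal (F w) * emeasure (R (X w)) A \<partial>M)"
      using F(2) by (intro nn_integral_cong) (simp add: ennreal_mult R.emeasure_eq_measure)
    also have "\<dots> = (\<integral>\<^sup>+x. emeasure (R x) A \<partial>?\<mu>X)"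
      using kernel_emeasure_measurable[OF R A] by (simp add: nn_integral_distr nn_integral_density)
    also have "\<dots> = emeasure (?\<mu>X \<bind> R) A" by (rule emeasure_bind_kernel[OF R sX A, symmetric])
    finally show "emeasure ?\<mu>Y A = emeasure (?\<mu>X \<bind> R) A" .
  qed
  have "finite_measure ?\<mu>Y"
    using fin by (intro finite_measureI) (simp add: emeasure_distr emeasure_density cong: nn_integral_cong)
  then interpret \<mu>Y: finite_measure ?\<mu>Y .
  have ih: "integrable (?\<mu>X \<bind> R) h"
    unfolding bind_eq[symmetric] using h by (intro \<mu>Y.integrable_const_bound[where B=1]) (auto simp: unit_bounded_def)
  have hR[measurable]: "(\<lambda>x. CLINT y|R x. h y) \<in> borel_measurable borel"
    by (rule kernel_integral_measurable[OF R hm])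
  have "(CLINT w|M. of_real (F w) * h (Y w)) = (CLINT y|?\<mu>Y. h y)"
    using F(2) by (simp add: integral_distr integral_density scaleR_conv_of_real)
  also have "\<dots> = (CLINT x|?\<mu>X. CLINT y|R x. h y)"
    unfolding bind_eq by (rule integral_bind_integrable[OF kernel_subst_sets[OF R sX] _ ih]) simp
  also have "\<dots> = (CLINT w|M. of_real (F w) * (CLINT y|R (X w). h y))"
    using F(2) by (simp add: integral_distr integral_density scaleR_conv_of_real)
  finally show ?thesis .
qed

text \<open>The phase \<open>Z\<close> is complex, while the comparison of measures asks for
  nonnegative weights. The weights \<open>1 + cos\<close> and \<open>1 + sin\<close> of the partial
  sum are nonnegative and measurable with respect to the past, and a constant weight corrects the
  shift.\<close>

lemma sweep_chain_markov:
  assumes chain: "sweep_chain K Q \<nu> M X" and R: "prob_kernel (Q ((cyc K ^^ s) 1))"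
    and \<theta>[measurable]: "\<And>t. \<theta> t \<in> borel_measurable borel" and h: "unit_bounded h"
  defines "Z \<equiv> \<lambda>w. iexp (\<Sum>t<Suc s. \<theta> t (X t w))"
  shows "(CLINT w|M. Z w * h (X (Suc s) w)) = (CLINT w|M. Z w * (CLINT y|Q ((cyc K ^^ s) 1) (X s w). h y))"
proof -
  interpret prob_space M using chain by (simp add: sweep_chain_def)
  have X[measurable]: "X t \<in> M \<rightarrow>\<^sub>M borel" for t using chain by (simp add: sweep_chain_def)
  let ?R = "Q ((cyc K ^^ s) 1)"
  let ?p = "\<lambda>w. \<lambda>t\<in>{..s}. X t w" and ?N = "\<Pi>\<^sub>M t\<in>{..s}. (borel :: 'a measure)"
  let ?F = "vimage_algebra (space M) ?p ?N"
  have p: "?p \<in> M \<rightarrow>\<^sub>M ?N" by measurable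
  have sub: "subalgebra M ?F"
    unfolding subalgebra_def
  proof
    show "space ?F = space M" by simp
    show "sets ?F \<subseteq> sets M"
      using p measurable_space[OF p] by (subst sets_vimage_algebra2) (auto intro: measurable_sets)
  qed
  interpret F: finite_measure_subalgebra M ?F
    using sub by unfold_locales
  have XF: "X t \<in> ?F \<rightarrow>\<^sub>M borel" if "t \<le> s" for t
  proof -
    have "?p \<in> ?F \<rightarrow>\<^sub>M ?N" by (rule measurable_vimage_algebra1) (use measurable_space[OF p] in auto)
    from measurable_compose[OF this measurable_component_singleton[of t "{..s}"]]
    show ?thesis using that by (simp cong: measurable_cong)
  qed
  have ZF: "(\<lambda>w. \<Sum>t<Suc s. \<theta> t (X t w)) \<in> borel_measurable ?F"
    by (intro borel_measurable_sum measurable_compose[OF XF \<theta>]) auto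
  have step: "(CLINT w|M. of_real (G w) * h (X (Suc s) w)) = (CLINT w|M. of_real (G w) * (CLINT y|?R (X s w). h y))"
    if G: "G \<in> borel_measurable ?F" "\<And>w. 0 \<le> G w" "\<And>w. G w \<le> 2" for G :: "_ \<Rightarrow> real"
  proof (rule bind_law_eqI[where B=2])
    show GM: "G \<in> borel_measurable M" using measurable_from_subalg[OF sub G(1)] .
    fix A :: "'a set" assume A[measurable]: "A \<in> sets borel"
    let ?I = "indicat_real (X (Suc s) -` A \<inter> space M)"
    have I: "?I \<in> borel_measurable M" by measurable
    have int: "integrable M (\<lambda>w. G w * ?I w)"
      using G by (intro integrable_const_bound[where B=2] borel_measurable_times GM I) (auto split: split_indicator)
    have "(\<integral>w. G w * indicat_real A (X (Suc s) w) \<partial>M) = (\<integral>w. G w * ?I w \<partial>M)"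
      by (intro Bochner_Integration.integral_cong) (auto split: split_indicator)
    also have "\<dots> = (\<integral>w. G w * real_cond_exp M ?F ?I w \<partial>M)"
      using F.real_cond_exp_intg(2)[OF int G(1) I] by simp
    also have "\<dots> = (\<integral>w. G w * measure (?R (X s w)) A \<partial>M)"
    proof (rule integral_cong_AE)
      have "(\<lambda>x. measure (?R x) A) \<in> borel_measurable borel"
        using measurable_compose[OF prob_kernelD(1)[OF R] measurable_measure_subprob_algebra[OF A]] by simp
      then have "(\<lambda>w. measure (?R (X s w)) A) \<in> borel_measurable M" by (rule measurable_compose[OF X])
      then show "(\<lambda>w. G w * measure (?R (X s w)) A) \<in> borel_measurable M" by (intro borel_measurable_times GM)
      have "AE w in M. real_cond_exp M ?F ?I w = measure (?R (X s w)) A"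
        using chain A unfolding sweep_chain_def by blast
      then show "AE w in M. G w * real_cond_exp M ?F ?I w = G w * measure (?R (X s w)) A" by eventually_elim simp
    qed (intro borel_measurable_times GM borel_measurable_cond_exp2)
    finally show "(\<integral>w. G w * indicat_real A (X (Suc s) w) \<partial>M) = (\<integral>w. G w * measure (?R (X s w)) A \<partial>M)" .
  qed (use G R h X prob_space_axioms in auto)
  have hm[measurable]: "h \<in> borel_measurable borel" using h by (simp add: unit_bounded_def)
  have hR[measurable]: "(\<lambda>x. CLINT y|?R x. h y) \<in> borel_measurable borel"
    by (rule kernel_integral_measurable[OF R hm])
  have uR: "unit_bounded (\<lambda>x. CLINT y|?R x. h y)"
    using unit_bounded_twisted[OF R unit_bounded_const unit_bounded_const h] by (simp add: twisted_def[abs_def])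
  let ?S = "\<lambda>w. \<Sum>t<Suc s. \<theta> t (X t w)"
  have S[measurable]: "?S \<in> borel_measurable M" by measurable
  have dec: "(CLINT w|M. Z w * k (Y w)) = (CLINT w|M. of_real (1 + cos (?S w)) * k (Y w)) + \<i> * (CLINT w|M. of_real (1 + sin (?S w)) * k (Y w))
      - (1 + \<i>) * (CLINT w|M. of_real 1 * k (Y w))" if k: "unit_bounded k" and Y[measurable]: "Y \<in> M \<rightarrow>\<^sub>M borel" for k :: "'a \<Rightarrow> complex" and Y
  proof -
    have [measurable]: "k \<in> borel_measurable borel" using k by (simp add: unit_bounded_def)
    have i: "integrable M (\<lambda>w. of_real (G w) * k (Y w))" if [measurable]: "G \<in> borel_measurable M" and "\<And>w. \<bar>G w\<bar> \<le> 2" for G :: "_ \<Rightarrow> real"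
    proof (rule integrable_const_bound[where B=2])
      have "norm (of_real (G w) * k (Y w)) \<le> 2 * 1" for w
        unfolding norm_mult norm_of_real using that k by (intro mult_mono) (auto simp: unit_bounded_def)
      then show "AE w in M. norm (of_real (G w) * k (Y w)) \<le> 2" by simp
    qed measurable
    have "\<bar>1 + cos x\<bar> \<le> 2" "\<bar>1 + sin x\<bar> \<le> 2" for x :: real
      using cos_le_one[of x] sin_le_one[of x] cos_ge_minus_one[of x] sin_ge_minus_one[of x] by linarith+
    then have i1: "integrable M (\<lambda>w. of_real (1 + cos (?S w)) * k (Y w))" and i2: "integrable M (\<lambda>w. of_real (1 + sin (?S w)) * k (Y w))"
      and i3: "integrable M (\<lambda>w. of_real 1 * k (Y w))"
      by (intro i; measurable; simp)+
    have "Z w * k (Y w) = of_real (1 + cos (?S w)) * k (Y w) + \<i> * (of_real (1 + sin (?S w)) * k (Y w)) - (1 + \<i>) * (of_real 1 * k (Y w))" for w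
      unfolding Z_def cis_conv_exp[symmetric] by (simp add: complex_eq_iff algebra_simps)
    then show ?thesis using i1 i2 i3 by (simp only: Bochner_Integration.integral_add Bochner_Integration.integral_diff
        integral_mult_right_zero integrable_mult_right Bochner_Integration.integrable_add)
  qed
  have t1: "0 \<le> 1 + cos x" "1 + cos x \<le> 2" "0 \<le> 1 + sin x" "1 + sin x \<le> 2" for x :: real
    using cos_le_one[of x] sin_le_one[of x] cos_ge_minus_one[of x] sin_ge_minus_one[of x] by linarith+
  have c: "(\<lambda>w. 1 + cos (?S w)) \<in> borel_measurable ?F" "(\<lambda>w. 1 + sin (?S w)) \<in> borel_measurable ?F"
    using ZF by measurable
  show ?thesis
    unfolding dec[OF h X] dec[OF uR X]
    using step[OF c(1) t1(1,2)] step[OF c(2) t1(3,4)] step[of "\<lambda>_. 1"] by simp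
qed

text \<open>The induction peels off the last step, so it carries a general bounded function
  \<open>h\<close> of the current state.\<close>

lemma sweep_chain_char:
  assumes chain: "sweep_chain K Q \<nu> M X" and R: "\<And>t. prob_kernel (Q ((cyc K ^^ t) 1))"
    and \<theta>[measurable]: "\<And>t. \<theta> t \<in> borel_measurable borel"
  shows "(CLINT w|M. iexp (\<Sum>t<n. \<theta> t (X t w)))
    = (CLINT x|\<nu>. op_prod (\<lambda>t. twisted (\<lambda>x. iexp (\<theta> t x)) (\<lambda>_. 1) (Q ((cyc K ^^ t) 1))) 0 n (\<lambda>_. 1) x)"
proof -
  let ?S = "\<lambda>t. twisted (\<lambda>x. iexp (\<theta> t x)) (\<lambda>_. 1) (Q ((cyc K ^^ t) 1))"
  have X[measurable]: "X t \<in> M \<rightarrow>\<^sub>M borel" for t using chain by (simp add: sweep_chain_def)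
  have "(CLINT w|M. iexp (\<Sum>t<s. \<theta> t (X t w)) * h (X s w)) = (CLINT x|\<nu>. op_prod ?S 0 s h x)"
    if "unit_bounded h" for s h
    using that
  proof (induction s arbitrary: h)
    case 0
    have [measurable]: "h \<in> borel_measurable borel" using 0 by (simp add: unit_bounded_def)
    have "\<nu> = distr M borel (X 0)" using chain by (simp add: sweep_chain_def)
    then show ?case by (simp add: integral_distr)
  next
    case (Suc s)
    have u: "unit_bounded (?S s h)"
      by (intro unit_bounded_twisted R unit_bounded_iexp \<theta> unit_bounded_const Suc.prems)
    have "(CLINT w|M. iexp (\<Sum>t<Suc s. \<theta> t (X t w)) * h (X (Suc s) w))
      = (CLINT w|M. iexp (\<Sum>t<Suc s. \<theta> t (X t w)) * (CLINT y|Q ((cyc K ^^ s) 1) (X s w). h y))"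
      by (rule sweep_chain_markov[OF chain R \<theta> Suc.prems])
    also have "\<dots> = (CLINT w|M. iexp (\<Sum>t<s. \<theta> t (X t w)) * ?S s h (X s w))"
      by (simp add: twisted_def exp_add distrib_left mult.assoc del: funpow.simps)
    also have "\<dots> = (CLINT x|\<nu>. op_prod ?S 0 s (?S s h) x)" by (rule Suc.IH[OF u])
    finally show ?case by (simp only: op_prod_Suc_right add_0)
  qed
  from this[OF unit_bounded_const, of n] show ?thesis by simp
qed

subsection \<open>Forgetting the initial law\<close>

text \<open>The bound \<tau> holds at every starting point and is capped at 2, so by bounded
  convergence its integral tends to 0 under every probability law.\<close>

locale ergodic_periodic = periodic_kernels \<pi> R K
  for \<pi> :: "'x::polish_space measure" and R K +
  fixes \<tau> :: "nat \<Rightarrow> nat \<Rightarrow> 'x \<Rightarrow> real"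
  assumes \<tau>_meas[measurable]: "\<And>t j. \<tau> t j \<in> borel_measurable borel"
    and \<tau>_bounds: "\<And>t j x. 0 \<le> \<tau> t j x" "\<And>t j x. \<tau> t j x \<le> 2"
    and \<tau>_lim: "\<And>t x. (\<lambda>j. \<tau> t j x) \<longlonglongrightarrow> 0"
    and \<tau>: "\<And>t j x H. unit_bounded H \<Longrightarrow> norm (op_prod plain t (K * j) H x - (CLINT y|\<pi>. H y)) \<le> \<tau> t j x"
begin

lemma \<tau>_integral_tendsto:
  assumes "prob_space \<nu>" "sets \<nu> = sets borel"
  shows "(\<lambda>j. \<integral>x. \<tau> t j x \<partial>\<nu>) \<longlonglongrightarrow> 0"
proof -
  interpret \<nu>: prob_space \<nu> by fact
  note [measurable_cong] = assms(2)
  have "(\<lambda>j. \<integral>x. \<tau> t j x \<partial>\<nu>) \<longlonglongrightarrow> (\<integral>x. 0 \<partial>\<nu>)"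
    by (rule integral_dominated_convergence[where w="\<lambda>_. 2"]) (use \<tau>_bounds \<tau>_lim in auto)
  then show ?thesis by simp
qed

lemma plain_prod_cmult: "op_prod plain s m (\<lambda>y. c * h y) = (\<lambda>x. c * op_prod plain s m h x)"
proof (induction m arbitrary: s)
  case (Suc m)
  have "plain s (\<lambda>y. c * k y) = (\<lambda>x. c * plain s k x)" for k
    by (simp add: fun_eq_iff twisted_def)
  then show ?case by (simp only: op_prod.simps Suc)
qed simp

text \<open>\<tau> controls functions bounded by 1, so \<open>q\<close> is truncated at a level
  \<open>B\<close>. The truncation error enters twice, through the contraction and through the mean
  of the truncated function; the last third of \<open>e\<close> goes to \<open>B\<close> times
  \<tau>.\<close>

lemma mixing:
  assumes q: "integrable \<pi> q" "(CLINT x|\<pi>. q x) = 0" and e: "e > 0"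
  shows "\<exists>L0. \<forall>L\<ge>L0. Nrm (op_prod plain t (K * L) q) \<le> e"
proof -
  have qm[measurable]: "q \<in> borel_measurable borel"
    using borel_measurable_integrable[OF q(1)] R.sets_\<pi> by (simp cong: measurable_cong_sets)
  define tr where "tr B x = (if norm (q x) \<le> real B then q x else 0)" for B x
  have tr_meas[measurable]: "tr B \<in> borel_measurable borel" for B unfolding tr_def[abs_def] by measurable
  have tr_le: "norm (tr B x) \<le> norm (q x)" "norm (tr B x) \<le> real B" for B x by (auto simp: tr_def)
  have "(\<lambda>B. Nrm (\<lambda>x. q x - tr B x)) \<longlonglongrightarrow> (\<integral>x. 0 \<partial>\<pi>)"
  proof (rule integral_dominated_convergence[where w="\<lambda>x. norm (q x)"])
    show "AE x in \<pi>. (\<lambda>B. norm (q x - tr B x)) \<longlonglongrightarrow> 0"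
    proof (rule AE_I2)
      fix x
      obtain B0 :: nat where "norm (q x) \<le> real B0" using real_arch_simple by blast
      then have "eventually (\<lambda>B. norm (q x - tr B x) = 0) sequentially"
        unfolding eventually_sequentially by (intro exI[of _ B0]) (auto simp: tr_def)
      then show "(\<lambda>B. norm (q x - tr B x)) \<longlonglongrightarrow> 0" by (rule tendsto_eventually)
    qed
    show "AE x in \<pi>. norm (norm (q x - tr B x)) \<le> norm (q x)" for B by (intro AE_I2) (auto simp: tr_def)
  qed (use q in auto)
  then have "eventually (\<lambda>B. Nrm (\<lambda>x. q x - tr B x) < e / 3) sequentially"
    using e by (intro order_tendstoD(2)) auto
  then obtain B where B: "B > 0" "Nrm (\<lambda>x. q x - tr B x) < e / 3"
    by (metis (mono_tags, lifting) eventually_gt_at_top eventually_conj_iff eventually_sequentially order_refl)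
  let ?h = "tr B"
  have ih: "integrable \<pi> ?h"
    by (rule Bochner_Integration.integrable_bound[OF q(1)]) (use tr_le in auto)
  have uh: "unit_bounded (\<lambda>x. ?h x / of_nat B)"
    using B(1) tr_le(2)[of B] by (auto simp: unit_bounded_def norm_divide)
  have "(\<lambda>L. real B * (\<integral>x. \<tau> t L x \<partial>\<pi>)) \<longlonglongrightarrow> real B * 0"
    by (intro tendsto_intros \<tau>_integral_tendsto \<pi>.prob_space_axioms R.sets_\<pi>)
  then have "eventually (\<lambda>L. real B * (\<integral>x. \<tau> t L x \<partial>\<pi>) < e / 3) sequentially"
    using e by (intro order_tendstoD(2)) auto
  then obtain L0 where L0: "\<And>L. L \<ge> L0 \<Longrightarrow> real B * (\<integral>x. \<tau> t L x \<partial>\<pi>) < e / 3"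
    unfolding eventually_sequentially by blast
  have "Nrm (op_prod plain t (K * L) q) \<le> e" if "L \<ge> L0" for L
  proof -
    let ?P = "op_prod plain t (K * L)"
    define m where "m = (CLINT y|\<pi>. ?h y)"
    have plain_tw: "\<exists>a c. unit_bounded a \<and> unit_bounded c \<and> plain t = twisted a c (R t)" for t
      using unit_bounded_const by blast
    have iq: "integrable \<pi> (\<lambda>y. q y - ?h y)" using q ih by simp
    have i: "integrable \<pi> (?P q)" "integrable \<pi> (?P ?h)" "integrable \<pi> (?P (\<lambda>y. q y - ?h y))"
      by (intro integrable_plain_prod q ih iq)+
    have i\<tau>: "integrable \<pi> (\<tau> t L)"
      using \<tau>_bounds by (intro \<pi>.integrable_const_bound[where B=2]) auto
    have close: "norm (?P ?h x - m) \<le> real B * \<tau> t L x" for x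
    proof -
      have "?P ?h x = of_nat B * ?P (\<lambda>x. ?h x / of_nat B) x"
        using plain_prod_cmult[of t "K * L" "of_nat B" "\<lambda>x. ?h x / of_nat B"] B(1) by (simp add: fun_eq_iff)
      moreover have "m = of_nat B * (CLINT y|\<pi>. ?h y / of_nat B)" using B(1) by (simp add: m_def)
      ultimately have "?P ?h x - m = of_nat B * (?P (\<lambda>x. ?h x / of_nat B) x - (CLINT y|\<pi>. ?h y / of_nat B))"
        by (simp only: right_diff_distrib)
      then show ?thesis using \<tau>[OF uh, of t L x] by (simp add: norm_mult mult_left_mono)
    qed
    have "norm m \<le> Nrm (\<lambda>x. q x - ?h x)"
    proof -
      have "m = - (CLINT x|\<pi>. q x - ?h x)" using q ih by (simp add: m_def)
      then show ?thesis using integral_norm_bound[of \<pi> "\<lambda>x. q x - ?h x"] by simp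
    qed
    moreover have "Nrm (?P q) \<le> (\<integral>x. norm (?P (\<lambda>y. q y - ?h y) x) + real B * \<tau> t L x + norm m \<partial>\<pi>)"
    proof (rule integral_mono_AE)
      show "AE x in \<pi>. norm (?P q x) \<le> norm (?P (\<lambda>y. q y - ?h y) x) + real B * \<tau> t L x + norm m"
        using op_prod_diff_AE[OF plain_tw q(1) ih, of t "K * L"]
      proof eventually_elim
        case (elim x)
        have "?P q x = ?P (\<lambda>y. q y - ?h y) x + (?P ?h x - m) + m" unfolding elim by simp
        then have "norm (?P q x) \<le> norm (?P (\<lambda>y. q y - ?h y) x) + norm (?P ?h x - m) + norm m"
          by (simp only:) (rule order_trans[OF norm_triangle_ineq add_right_mono[OF norm_triangle_ineq]])
        then show ?case using close[of x] by linarith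
      qed
    qed (use i i\<tau> in auto)
    moreover have "(\<integral>x. norm (?P (\<lambda>y. q y - ?h y) x) + real B * \<tau> t L x + norm m \<partial>\<pi>)
        = Nrm (?P (\<lambda>y. q y - ?h y)) + real B * (\<integral>x. \<tau> t L x \<partial>\<pi>) + norm m"
      using i i\<tau> by (simp add: \<pi>.prob_space)
    moreover have "Nrm (?P (\<lambda>y. q y - ?h y)) \<le> Nrm (\<lambda>y. q y - ?h y)" by (rule integrable_plain_prod[OF iq])
    ultimately show ?thesis using L0[OF that] B(2) by linarith
  qed
  then show ?thesis by blast
qed

text \<open>The bound \<open>d n\<close> may not depend on \<open>H\<close>, because the later
  factors of the product change with \<open>n\<close>; and it must tend to 0 at every
  \<open>x\<close>, because the initial law may charge \<pi>-null sets.\<close>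

lemma scaled_plain_close:
  fixes \<theta> :: "nat \<Rightarrow> 'x \<Rightarrow> real"
  assumes \<theta>[measurable]: "\<And>t. \<theta> t \<in> borel_measurable borel"
  defines "S \<equiv> \<lambda>n t. twisted (\<lambda>x. iexp (\<theta> t x / sqrt (real n))) (\<lambda>_. 1) (R t)"
  shows "\<exists>d :: nat \<Rightarrow> 'x \<Rightarrow> real. (\<forall>n. d n \<in> borel_measurable borel) \<and> (\<forall>n x. 0 \<le> d n x \<and> d n x \<le> 2 * real r) \<and>
    (\<forall>x. (\<lambda>n. d n x) \<longlonglongrightarrow> 0) \<and>
    (\<forall>n H x. unit_bounded H \<longrightarrow> norm (op_prod (S n) s r H x - op_prod plain s r H x) \<le> d n x)"
proof (induction r arbitrary: s)
  case 0
  show ?case by (intro exI[of _ "\<lambda>_ _. 0"]) auto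
next
  case (Suc r)
  obtain d :: "nat \<Rightarrow> 'x \<Rightarrow> real" where d: "\<And>n. d n \<in> borel_measurable borel" "\<And>n x. 0 \<le> d n x" "\<And>n x. d n x \<le> 2 * real r"
    "\<And>x. (\<lambda>n. d n x) \<longlonglongrightarrow> 0"
    "\<And>n H x. unit_bounded H \<Longrightarrow> norm (op_prod (S n) (Suc s) r H x - op_prod plain (Suc s) r H x) \<le> d n x"
    using Suc[of "Suc s"] by blast
  note [measurable] = d(1)
  define d' where "d' n x = norm (iexp (\<theta> s x / sqrt (real n)) - 1) + (\<integral>y. d n y \<partial>R s x)" for n x
  interpret Rs: prob_space "R s x" for x by (rule prob_kernelD(4)[OF R.kernel_P])
  have Rsets[measurable_cong]: "sets (R s x) = sets borel" for x by (rule prob_kernelD(2)[OF R.kernel_P])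
  have id: "integrable (R s x) (d n)" for n x
    using d(2,3) by (intro Rs.integrable_const_bound[where B="2 * real r"]) (auto, measurable)
  have e2: "norm (iexp a - 1) \<le> 2" for a :: real using norm_triangle_ineq4[of "iexp a" 1] by simp
  have d_int: "0 \<le> (\<integral>y. d n y \<partial>R s x)" "(\<integral>y. d n y \<partial>R s x) \<le> 2 * real r" for n x
  proof -
    show "0 \<le> (\<integral>y. d n y \<partial>R s x)" using d(2) by simp
    have "(\<integral>y. d n y \<partial>R s x) \<le> (\<integral>y. 2 * real r \<partial>R s x)" using d(3) by (intro integral_mono id) auto
    then show "(\<integral>y. d n y \<partial>R s x) \<le> 2 * real r" by (simp add: Rs.prob_space)
  qed
  have "d' n \<in> borel_measurable borel" for n
  proof -
    have [measurable]: "(\<lambda>x. \<integral>y. d n y \<partial>R s x) \<in> borel_measurable borel"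
      by (rule kernel_integral_measurable[OF R.kernel_P d(1)])
    show ?thesis unfolding d'_def[abs_def] by measurable
  qed
  moreover have "0 \<le> d' n x \<and> d' n x \<le> 2 * real (Suc r)" for n x
  proof
    show "0 \<le> d' n x" unfolding d'_def using d_int by (intro add_nonneg_nonneg) auto
    have "d' n x \<le> 2 + 2 * real r" unfolding d'_def by (intro add_mono e2 d_int(2))
    then show "d' n x \<le> 2 * real (Suc r)" by simp
  qed
  moreover have "(\<lambda>n. d' n x) \<longlonglongrightarrow> 0" for x
  proof -
    have "(\<lambda>n. \<integral>y. d n y \<partial>R s x) \<longlonglongrightarrow> (\<integral>y. 0 \<partial>R s x)"
      by (rule integral_dominated_convergence[where w="\<lambda>_. 2 * real r"]) (use d(2-4) in auto)
    moreover have "(\<lambda>n. \<theta> s x / sqrt (real n)) \<longlonglongrightarrow> 0"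
      by (rule tendsto_divide_0[OF tendsto_const])
         (intro filterlim_at_top_imp_at_infinity filterlim_compose[OF sqrt_at_top filterlim_real_sequentially])
    then have "(\<lambda>n. norm (iexp (\<theta> s x / sqrt (real n)) - 1)) \<longlonglongrightarrow> norm (iexp 0 - 1)"
      by (intro tendsto_intros isCont_tendsto_compose[OF isCont_iexp])
    ultimately have "(\<lambda>n. d' n x) \<longlonglongrightarrow> norm (iexp 0 - 1) + 0" unfolding d'_def by (intro tendsto_add) auto
    then show ?thesis by simp
  qed
  moreover have "norm (op_prod (S n) s (Suc r) H x - op_prod plain s (Suc r) H x) \<le> d' n x" if H: "unit_bounded H" for n H x
  proof -
    have uS: "unit_bounded (\<lambda>x. iexp (\<theta> t x / sqrt (real n)))" for n t
      by (rule unit_bounded_iexp) measurable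
    have S_unit: "unit_bounded h \<Longrightarrow> unit_bounded (S n t h)" for n t h
      unfolding S_def by (intro unit_bounded_twisted R.kernel_P unit_bounded_const uS)
    let ?A = "op_prod (S n) (Suc s) r H" and ?B = "op_prod plain (Suc s) r H"
    have uA: "unit_bounded (op_prod (S n) t r H)" for t
      by (induction r arbitrary: t) (simp_all add: S_unit H)
    have uB: "unit_bounded (op_prod plain t r H)" for t
      by (induction r arbitrary: t) (auto simp: H intro!: unit_bounded_twisted R.kernel_P unit_bounded_const)
    have iA: "integrable (R s x) ?A" and iB: "integrable (R s x) ?B"
      by (intro unit_bounded_integrable uA uB Rs.prob_space_axioms Rsets)+
    let ?e = "iexp (\<theta> s x / sqrt (real n))"
    have "op_prod (S n) s (Suc r) H x - op_prod plain s (Suc r) H x = (?e - 1) * (CLINT y|R s x. ?A y) + (CLINT y|R s x. ?A y - ?B y)"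
      using iA iB by (simp add: S_def twisted_def algebra_simps)
    then have "norm (op_prod (S n) s (Suc r) H x - op_prod plain s (Suc r) H x)
      \<le> norm ((?e - 1) * (CLINT y|R s x. ?A y)) + norm (CLINT y|R s x. ?A y - ?B y)"
      by (simp only:) (rule norm_triangle_ineq)
    also have "norm ((?e - 1) * (CLINT y|R s x. ?A y)) \<le> norm (?e - 1) * 1"
    proof (unfold norm_mult, rule mult_left_mono)
      have "norm (CLINT y|R s x. ?A y) \<le> (\<integral>y. norm (?A y) \<partial>R s x)" by (rule integral_norm_bound)
      also have "\<dots> \<le> (\<integral>y. 1 \<partial>R s x)" using iA uA by (intro integral_mono) (auto simp: unit_bounded_def)
      finally show "norm (CLINT y|R s x. ?A y) \<le> 1" by (simp add: Rs.prob_space)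
    qed simp
    also have "norm (CLINT y|R s x. ?A y - ?B y) \<le> (\<integral>y. d n y \<partial>R s x)"
      by (rule order_trans[OF integral_norm_bound], rule integral_mono) (use iA iB id d(5)[OF H] in auto)
    finally show ?thesis by (simp add: d'_def)
  qed
  ultimately show ?case by (intro exI[of _ d']) blast
qed

text \<open>Once the first \<open>r = K * j\<close> factors are replaced by plain ones, the
  remaining product \<open>H n\<close> is a function bounded by 1, and full sweeps bring it close to
  its \<pi>-mean from any start. Both laws are compared with this one number; \<open>j\<close> is
  fixed before \<open>n\<close> grows.\<close>

theorem initial_law_forgotten:
  fixes \<theta> :: "nat \<Rightarrow> 'x \<Rightarrow> real"
  assumes \<theta>[measurable]: "\<And>t. \<theta> t \<in> borel_measurable borel" and \<nu>: "prob_space \<nu>" "sets \<nu> = sets borel"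
  defines "S \<equiv> \<lambda>n t. twisted (\<lambda>x. iexp (\<theta> t x / sqrt (real n))) (\<lambda>_. 1) (R t)"
  shows "(\<lambda>n. (CLINT x|\<nu>. op_prod (S n) 0 n (\<lambda>_. 1) x) - (CLINT x|\<pi>. op_prod (S n) 0 n (\<lambda>_. 1) x)) \<longlonglongrightarrow> 0"
proof (rule LIMSEQ_I)
  fix e :: real assume e: "0 < e"
  note s\<pi> = \<pi>.prob_space_axioms R.sets_\<pi>
  have "eventually (\<lambda>j. (\<integral>x. \<tau> 0 j x \<partial>\<nu>) < e / 4 \<and> (\<integral>x. \<tau> 0 j x \<partial>\<pi>) < e / 4) sequentially"
    using e by (intro eventually_conj order_tendstoD(2)[OF \<tau>_integral_tendsto] \<nu> s\<pi>) auto
  then obtain j where j: "(\<integral>x. \<tau> 0 j x \<partial>\<nu>) < e / 4" "(\<integral>x. \<tau> 0 j x \<partial>\<pi>) < e / 4"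
    unfolding eventually_sequentially by blast
  define r where "r = K * j"
  obtain d :: "nat \<Rightarrow> 'x \<Rightarrow> real" where d: "\<And>n. d n \<in> borel_measurable borel" "\<And>n x. 0 \<le> d n x" "\<And>n x. d n x \<le> 2 * real r"
    "\<And>x. (\<lambda>n. d n x) \<longlonglongrightarrow> 0"
    "\<And>n H x. unit_bounded H \<Longrightarrow> norm (op_prod (S n) 0 r H x - op_prod plain 0 r H x) \<le> d n x"
    using scaled_plain_close[where \<theta>=\<theta> and r=r and s=0, OF \<theta>] unfolding S_def by blast
  note [measurable] = d(1)
  have d_tendsto: "(\<lambda>n. \<integral>x. d n x \<partial>M) \<longlonglongrightarrow> 0" if "prob_space M" "sets M = sets borel" for M
  proof -
    interpret M: prob_space M by fact
    note [measurable_cong] = that(2)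
    have "(\<lambda>n. \<integral>x. d n x \<partial>M) \<longlonglongrightarrow> (\<integral>x. 0 \<partial>M)"
      by (rule integral_dominated_convergence[where w="\<lambda>_. 2 * real r"]) (use d(2-4) in auto)
    then show ?thesis by simp
  qed
  define H where "H n = op_prod (S n) r (n - r) (\<lambda>_. 1)" for n
  have uS: "unit_bounded (\<lambda>x. iexp (\<theta> t x / sqrt (real n)))" for n t
    by (rule unit_bounded_iexp) measurable
  have S_unit: "unit_bounded h \<Longrightarrow> unit_bounded (S n t h)" for n t h
    unfolding S_def by (intro unit_bounded_twisted R.kernel_P unit_bounded_const uS)
  have uH': "unit_bounded (op_prod (S n) t m (\<lambda>_. 1))" for n t m
    by (induction m arbitrary: t) (simp_all add: S_unit unit_bounded_const)
  have uH: "unit_bounded (H n)" for n unfolding H_def by (rule uH')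
  have near: "norm ((CLINT x|M. op_prod (S n) 0 n (\<lambda>_. 1) x) - (CLINT y|\<pi>. H n y)) \<le> (\<integral>x. d n x \<partial>M) + (\<integral>x. \<tau> 0 j x \<partial>M)"
    if M: "prob_space M" "sets M = sets borel" and n: "n \<ge> r" for M n
  proof -
    interpret M: prob_space M by fact
    note [measurable_cong] = M(2)
    let ?m = "CLINT y|\<pi>. H n y"
    have eq: "op_prod (S n) 0 n (\<lambda>_. 1) = op_prod (S n) 0 r (H n)"
      unfolding H_def using op_prod_add[of "S n" 0 r "n - r"] n by simp
    have i: "integrable M (op_prod (S n) 0 n (\<lambda>_. 1))" by (rule unit_bounded_integrable[OF uH' M])
    have "(CLINT x|M. op_prod (S n) 0 n (\<lambda>_. 1) x) - ?m = (CLINT x|M. op_prod (S n) 0 n (\<lambda>_. 1) x - ?m)"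
      using i by (simp add: M.prob_space)
    also have "norm \<dots> \<le> (\<integral>x. norm (op_prod (S n) 0 n (\<lambda>_. 1) x - ?m) \<partial>M)" by (rule integral_norm_bound)
    also have "\<dots> \<le> (\<integral>x. d n x + \<tau> 0 j x \<partial>M)"
    proof (rule integral_mono)
      have "integrable M (d n)" using d(2,3) by (intro M.integrable_const_bound[where B="2 * real r"]) auto
      moreover have "integrable M (\<tau> 0 j)" using \<tau>_bounds by (intro M.integrable_const_bound[where B=2]) auto
      ultimately show "integrable M (\<lambda>x. d n x + \<tau> 0 j x)" by simp
      fix x
      have "op_prod (S n) 0 n (\<lambda>_. 1) x - ?m = (op_prod (S n) 0 r (H n) x - op_prod plain 0 r (H n) x) + (op_prod plain 0 r (H n) x - ?m)"
        unfolding eq by simp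
      then have "norm (op_prod (S n) 0 n (\<lambda>_. 1) x - ?m)
        \<le> norm (op_prod (S n) 0 r (H n) x - op_prod plain 0 r (H n) x) + norm (op_prod plain 0 r (H n) x - ?m)"
        by (simp only:) (rule norm_triangle_ineq)
      then show "norm (op_prod (S n) 0 n (\<lambda>_. 1) x - ?m) \<le> d n x + \<tau> 0 j x"
        using d(5)[OF uH[of n], of n x] \<tau>[OF uH[of n], of 0 j x] unfolding r_def by linarith
    qed (use i in auto)
    also have "\<dots> = (\<integral>x. d n x \<partial>M) + (\<integral>x. \<tau> 0 j x \<partial>M)"
    proof (rule Bochner_Integration.integral_add)
      show "integrable M (d n)" using d(2,3) by (intro M.integrable_const_bound[where B="2 * real r"]) auto
      show "integrable M (\<tau> 0 j)" using \<tau>_bounds by (intro M.integrable_const_bound[where B=2]) auto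
    qed
    finally show ?thesis .
  qed
  have "eventually (\<lambda>n. (\<integral>x. d n x \<partial>\<nu>) < e / 4 \<and> (\<integral>x. d n x \<partial>\<pi>) < e / 4) sequentially"
    using e by (intro eventually_conj order_tendstoD(2)[OF d_tendsto] \<nu> s\<pi>) auto
  then have "eventually (\<lambda>n. norm ((CLINT x|\<nu>. op_prod (S n) 0 n (\<lambda>_. 1) x) - (CLINT x|\<pi>. op_prod (S n) 0 n (\<lambda>_. 1) x) - 0) < e) sequentially"
    using eventually_ge_at_top[of r]
  proof eventually_elim
    case (elim n)
    let ?a = "CLINT x|\<nu>. op_prod (S n) 0 n (\<lambda>_. 1) x" and ?b = "CLINT x|\<pi>. op_prod (S n) 0 n (\<lambda>_. 1) x" and ?m = "CLINT y|\<pi>. H n y"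
    have "norm (?a - ?b) \<le> norm (?a - ?m) + norm (?b - ?m)" using norm_triangle_ineq4[of "?a - ?m" "?b - ?m"] by simp
    then show ?case using near[OF \<nu> elim(2)] near[OF s\<pi> elim(2)] elim(1) j by simp
  qed
  then show "\<exists>no. \<forall>n\<ge>no. norm ((CLINT x|\<nu>. op_prod (S n) 0 n (\<lambda>_. 1) x) - (CLINT x|\<pi>. op_prod (S n) 0 n (\<lambda>_. 1) x) - 0) < e"
    unfolding eventually_sequentially .
qed

end

subsection \<open>Sweeps\<close>

text \<open>Labels run from 1 to \<open>K\<close>, so the rotation modulo \<open>K\<close> acts on
  \<open>k - 1\<close>.\<close>

lemma cyc_funpow:
  assumes "K \<ge> 1" "k \<in> {1..K}"
  shows "(cyc K ^^ s) k = (k - 1 + s) mod K + 1"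
proof (induction s)
  case 0
  have "k - 1 < K" "k \<ge> 1" using assms by auto
  then show ?case by simp
next
  case (Suc s)
  have "(k - 1 + Suc s) mod K = (if Suc ((k - 1 + s) mod K) = K then 0 else Suc ((k - 1 + s) mod K))"
    by (simp add: mod_Suc)
  moreover have "(k - 1 + s) mod K < K" using assms by simp
  ultimately show ?case using Suc by (auto simp: cyc_def)
qed

lemma cyc_funpow_period:
  assumes "K \<ge> 1" "k \<in> {1..K}"
  shows "(cyc K ^^ (s + K * j)) k = (cyc K ^^ s) k"
  by (simp only: cyc_funpow[OF assms] add.assoc[symmetric] mod_mult_self2)

lemma cyc_range: "K \<ge> 1 \<Longrightarrow> k \<in> {1..K} \<Longrightarrow> cyc K k \<in> {1..K}"
  using cyc_funpow_range[of K k 1] by simp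

lemma bij_betw_cyc:
  assumes "K \<ge> 1"
  shows "bij_betw (cyc K) {1..K} {1..K}"
proof -
  have "inj_on (cyc K) {1..K}" by (auto simp: inj_on_def cyc_def split: if_splits)
  moreover have "cyc K ` {1..K} \<subseteq> {1..K}" using cyc_range[OF assms] by auto
  ultimately show ?thesis by (simp add: bij_betw_def endo_inj_surj)
qed

lemma sum_cyc: "K \<ge> 1 \<Longrightarrow> (\<Sum>k=1..K. F (cyc K k)) = (\<Sum>k=1..K. F k)"
  by (rule sum.reindex_bij_betw[OF bij_betw_cyc])

lemma sum_cyc_funpow:
  assumes "K \<ge> 1"
  shows "(\<Sum>t<K. F ((cyc K ^^ t) 1)) = (\<Sum>k=1..K. F k)"
proof -
  have "(\<Sum>t<K. F ((cyc K ^^ t) 1)) = (\<Sum>t<K. F (Suc t))"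
    using assms by (intro sum.cong) (auto simp: cyc_funpow)
  also have "\<dots> = (\<Sum>k=1..K. F k)"
    by (rule sum.reindex_bij_witness[of _ "\<lambda>k. k - 1" Suc]) auto
  finally show ?thesis .
qed

section \<open>Sweep operators and their kernels\<close>

lemma upt_Suc_shift: "[0..<Suc t] = 0 # map Suc [0..<t]"
  by (simp add: map_Suc_upt upt_conv_Cons del: upt_Suc)

lemma sweep_op_0: "sweep_op K Q k 0 u = u"
  by (simp add: sweep_op_def)

lemma sweep_op_Suc: "sweep_op K Q k (Suc t) u = kernel_op (Q k) (sweep_op K Q (cyc K k) t u)"
  unfolding sweep_op_def upt_Suc_shift by (simp add: foldr_map o_def funpow_swap1)

lemma sweep_op_add: "sweep_op K Q k (s + t) u = sweep_op K Q k s (sweep_op K Q ((cyc K ^^ s) k) t u)"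
  by (induction s arbitrary: k) (simp_all add: sweep_op_0 sweep_op_Suc funpow_swap1)

lemma sweep_kernel_0: "sweep_kernel K Q k 0 = return borel"
  by (simp add: sweep_kernel_def)

lemma sweep_kernel_Suc: "sweep_kernel K Q k (Suc t) = kernel_comp (Q k) (sweep_kernel K Q (cyc K k) t)"
  unfolding sweep_kernel_def upt_Suc_shift by (simp add: foldr_map o_def funpow_swap1)

lemma kernel_op_measurable:
  "prob_kernel P \<Longrightarrow> u \<in> borel_measurable borel \<Longrightarrow> kernel_op P u \<in> borel_measurable borel"
  unfolding kernel_op_def[abs_def] by (rule kernel_integral_measurable)

locale kernel_sweep =
  fixes \<pi> :: "'x::polish_space measure" and K :: nat and Q :: "nat \<Rightarrow> 'x \<Rightarrow> 'x measure"
  assumes prob_space_\<pi>: "prob_space \<pi>" and sets_borel: "sets \<pi> = sets borel" and K1: "K \<ge> 1"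
    and kernel_Q: "\<And>k. k \<in> {1..K} \<Longrightarrow> prob_kernel (Q k)"
    and stat_Q: "\<And>k. k \<in> {1..K} \<Longrightarrow> stationary_kernel \<pi> (Q k)"
begin

lemmas cycr = cyc_range[OF K1]

lemma sweep_kernel_facts:
  "k \<in> {1..K} \<Longrightarrow> prob_kernel (sweep_kernel K Q k t) \<and> stationary_kernel \<pi> (sweep_kernel K Q k t)"
proof (induction t arbitrary: k)
  case 0
  show ?case by (simp add: sweep_kernel_0 prob_kernel_return stationary_return sets_borel)
next
  case (Suc t)
  note IH = Suc.IH[OF cycr[OF Suc.prems]]
  show ?case unfolding sweep_kernel_Suc
    using prob_kernel_comp[OF kernel_Q[OF Suc.prems], of "sweep_kernel K Q (cyc K k) t"]
      stationary_kernel_comp[OF kernel_Q[OF Suc.prems] _ sets_borel stat_Q[OF Suc.prems], of "sweep_kernel K Q (cyc K k) t"] IH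
    by blast
qed

lemma sweep_kernel_prob: "k \<in> {1..K} \<Longrightarrow> prob_kernel (sweep_kernel K Q k t)"
  using sweep_kernel_facts by blast

lemma sweep_stationary: "k \<in> {1..K} \<Longrightarrow> stationary_pair \<pi> (sweep_kernel K Q k t)"
  using sweep_kernel_facts prob_space_\<pi> sets_borel by (intro stationary_pair.intro) auto

lemma Q_stationary: "k \<in> {1..K} \<Longrightarrow> stationary_pair \<pi> (Q k)"
  using kernel_Q stat_Q prob_space_\<pi> sets_borel by (intro stationary_pair.intro) auto

lemma sweep_kernel_add:
  "k \<in> {1..K} \<Longrightarrow> sweep_kernel K Q k (s + t) x = sweep_kernel K Q k s x \<bind> sweep_kernel K Q ((cyc K ^^ s) k) t"
proof (induction s arbitrary: k x)
  case 0
  show ?case using sweep_kernel_prob[OF 0] by (simp add: sweep_kernel_0 bind_return_left)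
next
  case (Suc s)
  have c: "cyc K k \<in> {1..K}" by (rule cycr[OF Suc.prems])
  have c': "(cyc K ^^ s) (cyc K k) \<in> {1..K}" by (rule cyc_funpow_range[OF K1 c])
  have "sweep_kernel K Q (cyc K k) (s + t) = (\<lambda>y. sweep_kernel K Q (cyc K k) s y \<bind> sweep_kernel K Q ((cyc K ^^ s) (cyc K k)) t)"
    by (rule ext) (rule Suc.IH[OF c])
  then show ?case
    using bind_kernel_assoc[OF sweep_kernel_prob[OF c] sweep_kernel_prob[OF c'] prob_kernelD(2)[OF kernel_Q[OF Suc.prems]]]
    by (simp add: sweep_kernel_Suc kernel_comp_def funpow_swap1)
qed

lemma kernel_power_sweep:
  assumes "k \<in> {1..K}"
  shows "kernel_power (sweep_kernel K Q k K) n x = sweep_kernel K Q k (K * n) x"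
proof (induction n arbitrary: x)
  case 0
  show ?case by (simp add: kernel_power_0 sweep_kernel_0)
next
  case (Suc n)
  have "(cyc K ^^ K) k = k" using cyc_funpow_period[OF K1 assms, of 0 1] by simp
  moreover have "kernel_power (sweep_kernel K Q k K) n = sweep_kernel K Q k (K * n)" by (rule ext) (rule Suc)
  ultimately show ?case using sweep_kernel_add[OF assms, of K "K * n" x] by (simp add: kernel_power_Suc)
qed

lemma sweep_op_measurable:
  "k \<in> {1..K} \<Longrightarrow> u \<in> borel_measurable borel \<Longrightarrow> sweep_op K Q k t u \<in> borel_measurable borel"
proof (induction t arbitrary: k)
  case 0
  then show ?case by (simp add: sweep_op_0)
next
  case (Suc t)
  show ?case unfolding sweep_op_Suc
    by (intro kernel_op_measurable kernel_Q Suc cycr)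
qed

text \<open>The iterated operator takes the default value 0 where an inner integral diverges. If
  \<open>u\<close> is integrable under the composite kernel at \<open>x\<close>, such points are
  null for the first kernel.\<close>

lemma sweep_op_eq_integral:
  "k \<in> {1..K} \<Longrightarrow> u \<in> borel_measurable borel \<Longrightarrow> integrable (sweep_kernel K Q k t x) u \<Longrightarrow>
    sweep_op K Q k t u x = (\<integral>y. u y \<partial>sweep_kernel K Q k t x)"
proof (induction t arbitrary: k x)
  case 0
  then show ?case by (simp add: sweep_op_0 sweep_kernel_0 integral_return)
next
  case (Suc t)
  let ?S = "sweep_kernel K Q (cyc K k) t"
  have c: "cyc K k \<in> {1..K}" by (rule cycr[OF Suc.prems(1)])
  note sub = kernel_subst_sets[OF sweep_kernel_prob[OF c, of t] prob_kernelD(2)[OF kernel_Q[OF Suc.prems(1)]]]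
  have ne: "space (Q k x) \<noteq> {}" by (simp add: prob_kernelD(3)[OF kernel_Q[OF Suc.prems(1)]])
  have i: "integrable (Q k x \<bind> ?S) u" using Suc.prems(3) by (simp add: sweep_kernel_Suc kernel_comp_def)
  have [measurable_cong]: "sets (Q k x) = sets borel" by (rule prob_kernelD(2)[OF kernel_Q[OF Suc.prems(1)]])
  have m1: "sweep_op K Q (cyc K k) t u \<in> borel_measurable borel" by (rule sweep_op_measurable[OF c Suc.prems(2)])
  have m2: "(\<lambda>y. \<integral>z. u z \<partial>?S y) \<in> borel_measurable borel"
    by (rule kernel_integral_measurable[OF sweep_kernel_prob[OF c] Suc.prems(2)])
  have "sweep_op K Q k (Suc t) u x = (\<integral>y. sweep_op K Q (cyc K k) t u y \<partial>Q k x)"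
    by (simp add: sweep_op_Suc kernel_op_def)
  also have "\<dots> = (\<integral>y. \<integral>z. u z \<partial>?S y \<partial>Q k x)"
  proof (rule integral_cong_AE)
    show "AE y in Q k x. sweep_op K Q (cyc K k) t u y = (\<integral>z. u z \<partial>?S y)"
      using AE_integrable_bind[OF sub ne i] by eventually_elim (rule Suc.IH[OF c Suc.prems(2)])
  qed (use m1 m2 in measurable)
  also have "\<dots> = (\<integral>z. u z \<partial>(Q k x \<bind> ?S))" by (rule integral_bind_integrable[OF sub ne i, symmetric])
  finally show ?case by (simp add: sweep_kernel_Suc kernel_comp_def)
qed

text \<open>The default value 0 of a divergent integral only lowers the left side. This carries
  bounds for full sweeps over to sweeps that start with an incomplete one.\<close>

lemma sweep_op_le_integral:
  "k \<in> {1..K} \<Longrightarrow> u \<in> borel_measurable borel \<Longrightarrow>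
    ennreal \<bar>sweep_op K Q k t u x\<bar> \<le> (\<integral>\<^sup>+y. ennreal \<bar>u y\<bar> \<partial>sweep_kernel K Q k t x)"
proof (induction t arbitrary: k x)
  case 0
  then show ?case by (simp add: sweep_op_0 sweep_kernel_0 nn_integral_return)
next
  case (Suc t)
  have c: "cyc K k \<in> {1..K}" by (rule cycr[OF Suc.prems(1)])
  have "ennreal \<bar>sweep_op K Q k (Suc t) u x\<bar> \<le> (\<integral>\<^sup>+y. ennreal \<bar>sweep_op K Q (cyc K k) t u y\<bar> \<partial>Q k x)"
    using norm_integral_le_nn_integral[of "Q k x" "sweep_op K Q (cyc K k) t u"] by (simp add: sweep_op_Suc kernel_op_def)
  also have "\<dots> \<le> (\<integral>\<^sup>+y. \<integral>\<^sup>+z. ennreal \<bar>u z\<bar> \<partial>sweep_kernel K Q (cyc K k) t y \<partial>Q k x)"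
    by (intro nn_integral_mono Suc.IH c Suc.prems)
  also have "\<dots> = (\<integral>\<^sup>+z. ennreal \<bar>u z\<bar> \<partial>sweep_kernel K Q k (Suc t) x)"
    unfolding sweep_kernel_Suc kernel_comp_def
  proof (rule nn_integral_bind_kernel[OF sweep_kernel_prob[OF c] prob_kernelD(2)[OF kernel_Q[OF Suc.prems(1)]], symmetric])
    show "(\<lambda>z. ennreal \<bar>u z\<bar>) \<in> borel_measurable borel" using Suc.prems(2) by measurable
  qed
  finally show ?case .
qed

section \<open>Square integrable functions under the stationary law\<close>

definition L2 :: "('x \<Rightarrow> real) \<Rightarrow> bool" where
  "L2 u \<longleftrightarrow> u \<in> borel_measurable borel \<and> integrable \<pi> (\<lambda>x. (u x)\<^sup>2)"

lemma \<pi>_measurable: "u \<in> borel_measurable borel \<Longrightarrow> u \<in> borel_measurable \<pi>"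
  using sets_borel by (simp cong: measurable_cong_sets)

lemma L2_integrable_mult: "L2 u \<Longrightarrow> L2 w \<Longrightarrow> integrable \<pi> (\<lambda>x. u x * w x)"
  unfolding L2_def using \<pi>_measurable by (blast intro: integrable_product)

lemma L2_integrable: "L2 u \<Longrightarrow> integrable \<pi> u"
  unfolding L2_def using \<pi>_measurable prob_space.integrable_square_imp_integrable[OF prob_space_\<pi>] by blast

lemma L2_add: "L2 u \<Longrightarrow> L2 w \<Longrightarrow> L2 (\<lambda>x. u x + w x)"
  using L2_integrable_mult[of u w] by (auto simp: L2_def power2_sum mult.assoc)

lemma L2_cmult: "L2 u \<Longrightarrow> L2 (\<lambda>x. c * u x)"
  by (auto simp: L2_def power_mult_distrib)

lemma L2_diff: "L2 u \<Longrightarrow> L2 w \<Longrightarrow> L2 (\<lambda>x. u x - w x)"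
  using L2_add[of u "\<lambda>x. - 1 * w x"] L2_cmult[of w "- 1"] by simp

lemma L2_sum:
  assumes "finite I" "\<And>i. i \<in> I \<Longrightarrow> L2 (F i)"
  shows "L2 (\<lambda>x. \<Sum>i\<in>I. F i x)"
  using assms
proof (induction I rule: finite_induct)
  case empty
  then show ?case by (simp add: L2_def)
next
  case (insert i I)
  then show ?case using L2_add[of "F i" "\<lambda>x. \<Sum>i\<in>I. F i x"] by simp
qed

lemma L2_kernel:
  assumes "stationary_pair \<pi> P" "L2 u"
  shows "L2 (\<lambda>x. \<integral>y. u y \<partial>P x)"
proof -
  interpret stationary_pair \<pi> P by fact
  show ?thesis using assms(2) unfolding L2_def
    by (auto intro: kernel_integral_measurable[OF kernel_P] integrable_square_kernel)
qed

lemma L2_kernel_op: "k \<in> {1..K} \<Longrightarrow> L2 u \<Longrightarrow> L2 (kernel_op (Q k) u)"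
  unfolding kernel_op_def[abs_def] by (intro L2_kernel Q_stationary)

lemma L2_dominated:
  assumes "u \<in> borel_measurable borel" "L2 w" "AE x in \<pi>. \<bar>u x\<bar> \<le> w x"
  shows "L2 u"
  unfolding L2_def
proof (intro conjI assms(1))
  show "integrable \<pi> (\<lambda>x. (u x)\<^sup>2)"
  proof (rule Bochner_Integration.integrable_bound)
    show "integrable \<pi> (\<lambda>x. (w x)\<^sup>2)" using assms(2) by (simp add: L2_def)
    show "(\<lambda>x. (u x)\<^sup>2) \<in> borel_measurable \<pi>" using \<pi>_measurable[OF assms(1)] by measurable
    show "AE x in \<pi>. norm ((u x)\<^sup>2) \<le> norm ((w x)\<^sup>2)"
      using assms(3) by eventually_elim (simp add: abs_le_square_iff[symmetric])
  qed
qed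

end

section \<open>Geometric decay along sweeps\<close>

locale sweep_ergodic = kernel_sweep \<pi> K Q
  for \<pi> :: "'x::polish_space measure" and K Q +
  fixes \<psi> :: "'x measure" and D :: "nat \<Rightarrow> 'x set" and lam b :: "nat \<Rightarrow> real" and W :: "nat \<Rightarrow> 'x \<Rightarrow> real"
  assumes \<psi>: "prob_space \<psi>" "sets \<psi> = sets borel"
    and irreducible: "\<And>k A x. k \<in> {1..K} \<Longrightarrow> A \<in> sets borel \<Longrightarrow> emeasure \<psi> A > 0 \<Longrightarrow>
         \<exists>t>0. emeasure (sweep_kernel K Q k (K * t) x) A > 0"
    and small: "\<And>k. k \<in> {1..K} \<Longrightarrow> small_set (sweep_kernel K Q k K) (D k)"
    and lam: "\<And>k. k \<in> {1..K} \<Longrightarrow> lam k < 1"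
    and W_meas: "\<And>k. k \<in> {1..K} \<Longrightarrow> W k \<in> borel_measurable borel"
    and W1: "\<And>k x. k \<in> {1..K} \<Longrightarrow> W k x \<ge> 1"
    and drift: "\<And>k x. k \<in> {1..K} \<Longrightarrow>
         (\<integral>\<^sup>+ y. ennreal (W k y) \<partial>sweep_kernel K Q k K x)
           \<le> ennreal (lam k * W k x + b k * indicat_real (D k) x)"
    and aperiodic: "\<And>k. k \<in> {1..K} \<Longrightarrow> aperiodic_kernel \<psi> (sweep_kernel K Q k K)"
    and W_sq: "\<And>k. k \<in> {1..K} \<Longrightarrow> integrable \<pi> (\<lambda>x. (W k x)\<^sup>2)"
begin

lemma L2_W: "k \<in> {1..K} \<Longrightarrow> L2 (W k)"
  by (simp add: L2_def W_meas W_sq)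

text \<open>A negative \<open>lam k\<close> is raised to 0 and \<open>b k\<close> to at least 1; as
  \<open>W k \<ge> 1\<close> and indicators are nonnegative, this only enlarges the right side of
  the drift inequality.\<close>

lemma ergodic_kernel_exists:
  assumes k: "k \<in> {1..K}"
  shows "\<exists>m \<nu>. ergodic_kernel (sweep_kernel K Q k K) (W k) (max 0 (lam k)) (max 1 (b k)) (D k) m \<nu> \<psi> \<pi>"
proof -
  obtain m \<nu> where m: "m > 0" and \<nu>: "sets \<nu> = sets borel" "emeasure \<nu> UNIV > 0"
    "\<And>x B. x \<in> D k \<Longrightarrow> B \<in> sets borel \<Longrightarrow> emeasure (kernel_power (sweep_kernel K Q k K) m x) B \<ge> emeasure \<nu> B"
    and D: "D k \<in> sets borel"
    using small[OF k] unfolding small_set_def by blast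
  have dr: "(\<integral>\<^sup>+y. ennreal (W k y) \<partial>sweep_kernel K Q k K x) \<le> ennreal (max 0 (lam k) * W k x + max 1 (b k) * indicat_real (D k) x)" for x
  proof -
    have "lam k * W k x + b k * indicat_real (D k) x \<le> max 0 (lam k) * W k x + max 1 (b k) * indicat_real (D k) x"
      using W1[OF k, of x] by (intro add_mono mult_right_mono) auto
    then show ?thesis by (intro order_trans[OF drift[OF k]] ennreal_leI)
  qed
  have "drift_kernel (sweep_kernel K Q k K) (W k) (max 0 (lam k)) (max 1 (b k)) (D k) m \<nu> \<psi>"
  proof (rule drift_kernel.intro)
    show "0 \<le> max 0 (lam k)" "max 0 (lam k) < 1" "0 < max 1 (b k)" using lam[OF k] by auto
    show "\<exists>t>0. 0 < emeasure (kernel_power (sweep_kernel K Q k K) t x) A" if "A \<in> sets borel" "0 < emeasure \<psi> A" for A x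
      using irreducible[OF k that] by (simp only: kernel_power_sweep[OF k])
  qed (fact sweep_kernel_prob[OF k] W_meas[OF k] W1[OF k] dr D m \<nu> \<psi> aperiodic[OF k])+
  moreover have "ergodic_kernel_axioms (W k) \<pi>"
    using L2_integrable[OF L2_W[OF k]] by (rule ergodic_kernel_axioms.intro)
  ultimately show ?thesis
    using sweep_stationary[OF k] by (intro exI ergodic_kernel.intro)
qed

lemma W_integrable:
  assumes k: "k \<in> {1..K}"
  shows "integrable (sweep_kernel K Q k (K * n) x) (W k)"
proof -
  obtain m \<nu> where "ergodic_kernel (sweep_kernel K Q k K) (W k) (max 0 (lam k)) (max 1 (b k)) (D k) m \<nu> \<psi> \<pi>"
    using ergodic_kernel_exists[OF k] by blast
  then interpret ergodic_kernel "sweep_kernel K Q k K" "W k" "max 0 (lam k)" "max 1 (b k)" "D k" m \<nu> \<psi> \<pi> .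
  show ?thesis using V_integrable[of n x] by (simp add: kernel_power_sweep[OF k])
qed

lemma uniform_geometric_ergodicity:
  obtains C r where "0 < r" "r < 1" "0 < C"
    "\<And>k \<phi> n x. k \<in> {1..K} \<Longrightarrow> \<phi> \<in> borel_measurable borel \<Longrightarrow> (\<And>y. \<bar>\<phi> y\<bar> \<le> W k y) \<Longrightarrow>
      \<bar>(\<integral>z. \<phi> z \<partial>sweep_kernel K Q k (K * n) x) - (\<integral>z. \<phi> z \<partial>\<pi>)\<bar> \<le> C * r ^ n * W k x"
proof -
  define bound where "bound k C r \<longleftrightarrow> (\<forall>\<phi> n x. \<phi> \<in> borel_measurable borel \<longrightarrow> (\<forall>y. \<bar>\<phi> y\<bar> \<le> W k y) \<longrightarrow>
      \<bar>(\<integral>z. \<phi> z \<partial>sweep_kernel K Q k (K * n) x) - (\<integral>z. \<phi> z \<partial>\<pi>)\<bar> \<le> C * r ^ n * W k x)" for k C r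
  let ?G = "\<lambda>k C r. 0 < r \<and> r < 1 \<and> 0 < C \<and> bound k C r"
  have "\<forall>k. \<exists>C r. k \<in> {1..K} \<longrightarrow> ?G k C r"
  proof
    fix k
    show "\<exists>C r. k \<in> {1..K} \<longrightarrow> ?G k C r"
    proof (cases "k \<in> {1..K}")
      case True
      obtain m \<nu> where "ergodic_kernel (sweep_kernel K Q k K) (W k) (max 0 (lam k)) (max 1 (b k)) (D k) m \<nu> \<psi> \<pi>"
        using ergodic_kernel_exists[OF True] by blast
      then interpret ergodic_kernel "sweep_kernel K Q k K" "W k" "max 0 (lam k)" "max 1 (b k)" "D k" m \<nu> \<psi> \<pi> .
      obtain C r where "0 < r" "r < 1" "0 < C"
        "\<And>\<phi> n x. \<phi> \<in> borel_measurable borel \<Longrightarrow> (\<And>y. \<bar>\<phi> y\<bar> \<le> W k y) \<Longrightarrow>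
          \<bar>(\<integral>z. \<phi> z \<partial>kernel_power (sweep_kernel K Q k K) n x) - (\<integral>z. \<phi> z \<partial>\<pi>)\<bar> \<le> C * r ^ n * W k x"
        by (rule geometric_ergodicity) blast
      then have "?G k C r" by (simp add: kernel_power_sweep[OF True] bound_def)
      then show ?thesis by blast
    qed blast
  qed
  then obtain C r where Cr: "\<And>k. k \<in> {1..K} \<Longrightarrow> ?G k (C k) (r k)" by metis
  define C' where "C' = (\<Sum>k=1..K. C k)"
  define r' where "r' = Max (r ` {1..K})"
  have ne: "r ` {1..K} \<noteq> {}" "finite (r ` {1..K})" using K1 by auto
  have r: "r k \<le> r'" if "k \<in> {1..K}" for k unfolding r'_def using that by (intro Max_ge) auto
  have one: "1 \<in> {1..K}" using K1 by simp
  have C: "C k \<le> C'" if "k \<in> {1..K}" for k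
    unfolding C'_def using that Cr by (intro member_le_sum) (auto intro: less_imp_le)
  have "0 < r'" using r[OF one] Cr[OF one] by linarith
  moreover have "r' < 1" unfolding r'_def using ne Cr by (subst Max_less_iff) auto
  moreover have "0 < C'" using C[OF one] Cr[OF one] by linarith
  moreover have "\<bar>(\<integral>z. \<phi> z \<partial>sweep_kernel K Q k (K * n) x) - (\<integral>z. \<phi> z \<partial>\<pi>)\<bar> \<le> C' * r' ^ n * W k x"
    if k: "k \<in> {1..K}" and \<phi>: "\<phi> \<in> borel_measurable borel" "\<And>y. \<bar>\<phi> y\<bar> \<le> W k y" for k \<phi> n x
  proof -
    have "\<bar>(\<integral>z. \<phi> z \<partial>sweep_kernel K Q k (K * n) x) - (\<integral>z. \<phi> z \<partial>\<pi>)\<bar> \<le> C k * r k ^ n * W k x"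
      using Cr[OF k] \<phi> unfolding bound_def by blast
    also have "\<dots> \<le> C' * r' ^ n * W k x"
      using C[OF k] r[OF k] Cr[OF k] W1[OF k, of x] \<open>0 < C'\<close>
      by (intro mult_right_mono mult_mono power_mono) auto
    finally show ?thesis .
  qed
  ultimately show thesis using that[of r' C'] by blast
qed

text \<open>The kernel in use at time \<open>t\<close> of the chain: times start at 0, labels at
  1.\<close>

definition label :: "nat \<Rightarrow> nat" where
  "label t = (cyc K ^^ t) 1"

lemma label_range: "label t \<in> {1..K}"
  unfolding label_def using K1 by (intro cyc_funpow_range) auto

lemma label_Suc: "label (Suc t) = cyc K (label t)"
  by (simp add: label_def)

lemma label_period: "label (t + K) = label t"
  using cyc_funpow_period[OF K1, of 1 t 1] K1 by (simp add: label_def)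

sublocale periodic_kernels \<pi> "\<lambda>t. Q (label t)" K
  by (rule periodic_kernels.intro) (simp_all only: Q_stationary[OF label_range] K1 label_period)

lemma plain_prod_eq_sweep:
  assumes H: "unit_bounded H"
  shows "op_prod plain t n H x = (CLINT y|sweep_kernel K Q (label t) n x. H y)"
proof (induction n arbitrary: t x)
  case 0
  have "H \<in> borel_measurable borel" using H by (simp add: unit_bounded_def)
  then show ?case by (simp add: sweep_kernel_0 integral_return)
next
  case (Suc n)
  let ?S = "sweep_kernel K Q (label (Suc t)) n"
  note S = sweep_kernel_prob[OF label_range, of "Suc t" n]
  note sub = kernel_subst_sets[OF S prob_kernelD(2)[OF kernel_Q[OF label_range[of t]]]]
  have ne: "space (Q (label t) x) \<noteq> {}" by (simp add: prob_kernelD(3)[OF kernel_Q[OF label_range]])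
  have comp: "sweep_kernel K Q (label t) (Suc n) x = Q (label t) x \<bind> ?S"
    by (simp add: sweep_kernel_Suc kernel_comp_def label_Suc)
  have "integrable (sweep_kernel K Q (label t) (Suc n) x) H"
    by (intro unit_bounded_integrable H prob_kernelD[OF sweep_kernel_prob[OF label_range]])
  then have i: "integrable (Q (label t) x \<bind> ?S) H" by (simp only: comp)
  show ?case
    unfolding op_prod.simps twisted_def[of _ _ "Q (label t)"] Suc comp integral_bind_integrable[OF sub ne i] by simp
qed

lemma ergodic_periodic_exists:
  "\<exists>\<tau>. ergodic_periodic \<pi> (\<lambda>t. Q (label t)) K \<tau>"
proof -
  obtain C r where Cr: "0 < r" "r < 1" "0 < C" and geo:
    "\<And>k \<phi> n x. k \<in> {1..K} \<Longrightarrow> \<phi> \<in> borel_measurable borel \<Longrightarrow> (\<And>y. \<bar>\<phi> y\<bar> \<le> W k y) \<Longrightarrow>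
      \<bar>(\<integral>z. \<phi> z \<partial>sweep_kernel K Q k (K * n) x) - (\<integral>z. \<phi> z \<partial>\<pi>)\<bar> \<le> C * r ^ n * W k x"
    by (rule uniform_geometric_ergodicity) blast
  \<comment> \<open>The factor 2 covers real and imaginary parts, each dominated by
    \<open>1 \<le> W\<close>; the cap 2 is the trivial bound for a difference of two averages of a
    function bounded by 1.\<close>
  define \<tau> where "\<tau> t j x = min 2 (2 * (C * r ^ j * W (label t) x))" for t j x
  have W0: "0 \<le> W (label t) x" for t x using W1[OF label_range, of t x] by simp
  have "ergodic_periodic_axioms \<pi> (\<lambda>t. Q (label t)) K \<tau>"
  proof
    fix t j x
    have [measurable]: "W (label t) \<in> borel_measurable borel" by (rule W_meas[OF label_range])
    show "\<tau> t j \<in> borel_measurable borel" unfolding \<tau>_def[abs_def] by measurable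
    show "0 \<le> \<tau> t j x" "\<tau> t j x \<le> 2" using Cr W0[of t x] by (auto simp: \<tau>_def)
    have "(\<lambda>j. min 2 (2 * (C * r ^ j * W (label t) x))) \<longlonglongrightarrow> min 2 (2 * (C * 0 * W (label t) x))"
      using Cr by (intro tendsto_intros LIMSEQ_realpow_zero) auto
    then show "(\<lambda>j. \<tau> t j x) \<longlonglongrightarrow> 0" by (simp add: \<tau>_def)
    fix H :: "'x \<Rightarrow> complex" assume H: "unit_bounded H"
    let ?P = "sweep_kernel K Q (label t) (K * j) x"
    have [measurable]: "H \<in> borel_measurable borel" using H by (simp add: unit_bounded_def)
    have iP: "integrable ?P H" and i\<pi>: "integrable \<pi> H"
      by (intro unit_bounded_integrable H prob_kernelD[OF sweep_kernel_prob[OF label_range]] prob_space_\<pi> sets_borel)+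
    let ?z = "(CLINT y|?P. H y) - (CLINT y|\<pi>. H y)"
    have le1: "\<bar>Re (H y)\<bar> \<le> W (label t) y" "\<bar>Im (H y)\<bar> \<le> W (label t) y" for y
      using H abs_Re_le_cmod[of "H y"] abs_Im_le_cmod[of "H y"] W1[OF label_range, of t y]
      by (auto simp: unit_bounded_def intro: order_trans)
    have "Re ?z = (\<integral>y. Re (H y) \<partial>?P) - (\<integral>y. Re (H y) \<partial>\<pi>)" "Im ?z = (\<integral>y. Im (H y) \<partial>?P) - (\<integral>y. Im (H y) \<partial>\<pi>)"
      using iP i\<pi> by simp_all
    then have "\<bar>Re ?z\<bar> \<le> C * r ^ j * W (label t) x" "\<bar>Im ?z\<bar> \<le> C * r ^ j * W (label t) x"
      using geo[OF label_range, of "\<lambda>y. Re (H y)" t j x] geo[OF label_range, of "\<lambda>y. Im (H y)" t j x] le1 by simp_all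
    then have "norm ?z \<le> 2 * (C * r ^ j * W (label t) x)" using cmod_le[of ?z] by linarith
    moreover have "norm ?z \<le> 2"
    proof -
      have "norm (CLINT y|M. H y) \<le> 1" if "prob_space M" "integrable M H" for M
      proof -
        interpret M: prob_space M by fact
        have "norm (CLINT y|M. H y) \<le> (\<integral>y. norm (H y) \<partial>M)" by (rule integral_norm_bound)
        also have "\<dots> \<le> (\<integral>y. 1 \<partial>M)" using that(2) H by (intro integral_mono) (auto simp: unit_bounded_def)
        finally show ?thesis by (simp add: M.prob_space)
      qed
      from this[OF prob_kernelD(4)[OF sweep_kernel_prob[OF label_range]] iP] this[OF prob_space_\<pi> i\<pi>]
      show ?thesis using norm_triangle_ineq4[of "CLINT y|?P. H y" "CLINT y|\<pi>. H y"] by linarith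
    qed
    ultimately show "norm (op_prod plain t (K * j) H x - (CLINT y|\<pi>. H y)) \<le> \<tau> t j x"
      unfolding plain_prod_eq_sweep[OF H] \<tau>_def by simp
  qed
  then show ?thesis using periodic_kernels_axioms by (intro exI ergodic_periodic.intro)
qed

text \<open>Writing \<open>t = s + K n\<close> with \<open>s < K\<close> reduces the bound to the geometric decay of whole sweeps.\<close>

lemma geometric_domination:
  obtains C r G where "0 < r" "r < 1" "0 < C" "\<And>k. k \<in> {1..K} \<Longrightarrow> L2 (G k)" "\<And>k x. k \<in> {1..K} \<Longrightarrow> 0 \<le> G k x"
    "\<And>k u. k \<in> {1..K} \<Longrightarrow> u \<in> borel_measurable borel \<Longrightarrow> (\<And>k y. k \<in> {1..K} \<Longrightarrow> \<bar>u y\<bar> \<le> W k y) \<Longrightarrow> (\<integral>x. u x \<partial>\<pi>) = 0 \<Longrightarrow>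
      AE x in \<pi>. \<forall>t. \<bar>sweep_op K Q k t u x\<bar> \<le> C * r ^ t * G k x"
proof -
  obtain C r where Cr: "0 < r" "r < 1" "0 < C" and geo:
    "\<And>k \<phi> n x. k \<in> {1..K} \<Longrightarrow> \<phi> \<in> borel_measurable borel \<Longrightarrow> (\<And>y. \<bar>\<phi> y\<bar> \<le> W k y) \<Longrightarrow>
      \<bar>(\<integral>z. \<phi> z \<partial>sweep_kernel K Q k (K * n) x) - (\<integral>z. \<phi> z \<partial>\<pi>)\<bar> \<le> C * r ^ n * W k x"
    by (rule uniform_geometric_ergodicity) blast
  have "K > 0" using K1 by simp
  then obtain r1 C1 where r1: "0 < r1" "r1 < 1" "0 < C1" "\<And>j. r ^ (j div K) \<le> C1 * r1 ^ j"
    by (rule geometric_div_bound[OF Cr(1,2)]) blast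
  let ?k = "\<lambda>k s. (cyc K ^^ s) k"
  \<comment> \<open>\<open>G k\<close> collects the mean weights after each possible incomplete
    sweep of length \<open>s < K\<close>; stationarity keeps every summand in L2.\<close>
  define G where "G k x = (\<Sum>s<K. \<integral>y. W (?k k s) y \<partial>sweep_kernel K Q k s x)" for k x
  have kr: "?k k s \<in> {1..K}" if "k \<in> {1..K}" for k s by (rule cyc_funpow_range[OF K1 that])
  have G_L2: "L2 (G k)" if "k \<in> {1..K}" for k
    unfolding G_def[abs_def] by (intro L2_sum L2_kernel sweep_stationary that L2_W kr) auto
  have W0: "0 \<le> W k y" if "k \<in> {1..K}" for k y using W1[OF that, of y] by simp
  have G0: "0 \<le> (\<integral>y. W (?k k s) y \<partial>sweep_kernel K Q k s x)" if "k \<in> {1..K}" for k s x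
    using W0[OF kr[OF that]] by (intro Bochner_Integration.integral_nonneg)
  have bound: "AE x in \<pi>. \<forall>t. \<bar>sweep_op K Q k t u x\<bar> \<le> (C * C1) * r1 ^ t * G k x"
    if k: "k \<in> {1..K}" and u: "u \<in> borel_measurable borel" "\<And>k y. k \<in> {1..K} \<Longrightarrow> \<bar>u y\<bar> \<le> W k y" "(\<integral>x. u x \<partial>\<pi>) = 0" for k u
  proof -
    have whole: "\<bar>sweep_op K Q k (K * n) u x\<bar> \<le> C * r ^ n * W k x" if k: "k \<in> {1..K}" for k n x
    proof -
      have "integrable (sweep_kernel K Q k (K * n) x) u"
      proof (rule Bochner_Integration.integrable_bound[OF W_integrable[OF k]])
        show "u \<in> borel_measurable (sweep_kernel K Q k (K * n) x)"
          using u(1) prob_kernelD(2)[OF sweep_kernel_prob[OF k]] by (simp cong: measurable_cong_sets)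
        show "AE y in sweep_kernel K Q k (K * n) x. norm (u y) \<le> norm (W k y)"
          using u(2)[OF k] W0[OF k] by (intro AE_I2) simp
      qed
      from sweep_op_eq_integral[OF k u(1) this] geo[OF k u(1) u(2)[OF k], of n x] u(3) show ?thesis by simp
    qed
    \<comment> \<open>The weight at an intermediate label obeys a drift inequality for full sweeps
      from that label; after an incomplete sweep from \<open>k\<close> its integrability is obtained
      from stationarity, hence almost everywhere.\<close>
    have "AE x in \<pi>. \<forall>s\<in>{..<K}. integrable (sweep_kernel K Q k s x) (W (?k k s))"
    proof (intro AE_finite_allI)
      fix s
      interpret S: stationary_pair \<pi> "sweep_kernel K Q k s" by (rule sweep_stationary[OF k])
      show "AE x in \<pi>. integrable (sweep_kernel K Q k s x) (W (?k k s))"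
        by (rule S.AE_integrable_stationary[OF L2_integrable[OF L2_W[OF kr[OF k]]]])
    qed simp
    then show ?thesis
    proof eventually_elim
      case (elim x)
      show ?case
      proof
        fix t
        define s n where "s = t mod K" and "n = t div K"
        have t: "t = s + K * n" by (simp add: s_def n_def)
        have s: "s < K" using \<open>K > 0\<close> by (simp add: s_def)
        let ?v = "sweep_op K Q (?k k s) (K * n) u"
        have iW: "integrable (sweep_kernel K Q k s x) (W (?k k s))" using elim s by blast
        have "ennreal \<bar>sweep_op K Q k t u x\<bar> \<le> (\<integral>\<^sup>+y. ennreal \<bar>?v y\<bar> \<partial>sweep_kernel K Q k s x)"
          unfolding t sweep_op_add by (intro sweep_op_le_integral k sweep_op_measurable kr u)
        also have "\<dots> \<le> (\<integral>\<^sup>+y. ennreal (C * r ^ n * W (?k k s) y) \<partial>sweep_kernel K Q k s x)"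
          by (intro nn_integral_mono ennreal_leI whole kr k)
        also have "\<dots> = ennreal (\<integral>y. C * r ^ n * W (?k k s) y \<partial>sweep_kernel K Q k s x)"
          using iW W0[OF kr[OF k]] Cr by (intro nn_integral_eq_integral) auto
        finally have "\<bar>sweep_op K Q k t u x\<bar> \<le> (\<integral>y. C * r ^ n * W (?k k s) y \<partial>sweep_kernel K Q k s x)"
          using W0[OF kr[OF k]] Cr by (subst (asm) ennreal_le_iff) (auto intro!: Bochner_Integration.integral_nonneg)
        also have "\<dots> = C * r ^ n * (\<integral>y. W (?k k s) y \<partial>sweep_kernel K Q k s x)" by simp
        also have "\<dots> \<le> C * r ^ n * G k x"
          unfolding G_def using s G0[OF k] Cr by (intro mult_left_mono member_le_sum) auto
        also have "\<dots> \<le> C * (C1 * r1 ^ t) * G k x"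
          unfolding n_def using r1(4)[of t] Cr G0[OF k] by (intro mult_right_mono mult_left_mono) (auto simp: G_def intro: sum_nonneg)
        finally show "\<bar>sweep_op K Q k t u x\<bar> \<le> (C * C1) * r1 ^ t * G k x" by (simp add: mult.assoc)
      qed
    qed
  qed
  have GG: "0 \<le> G k x" if "k \<in> {1..K}" for k x unfolding G_def by (intro sum_nonneg G0[OF that])
  show thesis
    by (rule that[OF r1(1,2) mult_pos_pos[OF Cr(3) r1(3)] G_L2 GG bound])
qed

end

subsection \<open>Vector and matrix valued integrals\<close>

lemma bounded_linear_axis: "bounded_linear (axis i :: 'b::real_normed_vector \<Rightarrow> 'b^'n)"
proof (rule bounded_linear_intro[where K=1])
  fix x y :: 'b and r :: real
  show "axis i (x + y) = axis i x + (axis i y :: 'b^'n)" by (simp add: vec_eq_iff axis_def)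
  show "axis i (r *\<^sub>R x) = r *\<^sub>R (axis i x :: 'b^'n)" by (simp add: vec_eq_iff axis_def)
  have "norm (axis i x :: 'b^'n) \<le> (\<Sum>j\<in>UNIV. norm ((axis i x :: 'b^'n) $ j))"
    unfolding norm_vec_def by (rule L2_set_le_sum) simp
  also have "\<dots> = (\<Sum>j\<in>UNIV. if j = i then norm x else 0)"
    by (intro sum.cong) (auto simp: axis_def)
  finally show "norm (axis i x :: 'b^'n) \<le> norm x * 1" by simp
qed

lemma vec_eq_sum_axis: "(x :: 'b::real_normed_vector^'n) = (\<Sum>i\<in>UNIV. axis i (x $ i))"
proof (subst vec_eq_iff, rule allI)
  fix j
  have "(\<Sum>i\<in>UNIV. axis i (x $ i)) $ j = (\<Sum>i\<in>UNIV. if i = j then x $ j else 0)"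
    unfolding sum_component by (intro sum.cong) (auto simp: axis_def)
  then show "x $ j = (\<Sum>i\<in>UNIV. axis i (x $ i)) $ j" by simp
qed

lemma integrable_vec:
  fixes F :: "'a \<Rightarrow> 'b::euclidean_space^'n"
  assumes "\<And>i. integrable M (\<lambda>x. F x $ i)"
  shows "integrable M F"
proof -
  have "integrable M (\<lambda>x. \<Sum>i\<in>UNIV. axis i (F x $ i) :: 'b^'n)"
    by (intro Bochner_Integration.integrable_sum integrable_bounded_linear[OF bounded_linear_axis] assms)
  then show ?thesis by (simp only: vec_eq_sum_axis[symmetric])
qed

lemma borel_measurable_vecI:
  fixes F :: "'a \<Rightarrow> real^'n"
  assumes "\<And>i. (\<lambda>x. F x $ i) \<in> borel_measurable M"
  shows "F \<in> borel_measurable M"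
proof -
  have [measurable]: "(axis i :: real \<Rightarrow> real^'n) \<in> borel_measurable borel" for i
    by (intro borel_measurable_continuous_onI linear_continuous_on bounded_linear_axis)
  note assms[measurable]
  have "(\<lambda>x. \<Sum>i\<in>UNIV. axis i (F x $ i) :: real^'n) \<in> borel_measurable M" by measurable
  then show ?thesis by (simp only: vec_eq_sum_axis[symmetric])
qed

text \<open>Carries matrix valued integrals and series to scalar ones; with
  \<open>matrix_eqI_form\<close> it reduces matrix identities to pairings of real functions.\<close>

lemma bounded_linear_matrix_form: "bounded_linear (\<lambda>M :: real^'n^'m. a \<bullet> (M *v b))"
  unfolding linear_conv_bounded_linear[symmetric]
  by (rule linearI) (simp_all add: matrix_vector_mult_add_rdistrib inner_add_right scaleR_matrix_vector_assoc[symmetric])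

lemma bounded_linear_transpose: "bounded_linear (transpose :: real^'n^'m \<Rightarrow> real^'m^'n)"
  unfolding linear_conv_bounded_linear[symmetric]
  by (rule linearI) (simp_all add: vec_eq_iff transpose_def)

lemma outer_form: "a \<bullet> (outer u v *v b) = (a \<bullet> u) * (b \<bullet> v)"
  by (simp add: outer_mult_vec inner_commute)

lemma norm_outer: "norm (outer u v) = norm u * norm v"
proof -
  have "outer u v $ i = (u $ i) *\<^sub>R v" for i by (simp add: vec_eq_iff outer_def)
  then have "norm (outer u v) = L2_set (\<lambda>i. norm (u $ i) * norm v) UNIV"
    by (simp only: norm_vec_def[of "outer u v"] norm_scaleR real_norm_def)
  also have "\<dots> = L2_set (\<lambda>i. norm (u $ i)) UNIV * norm v" by (rule L2_set_left_distrib[symmetric]) simp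
  finally show ?thesis by (simp only: norm_vec_def[of u])
qed

lemma matrix_eqI_form:
  fixes M N :: "real^'n^'m"
  assumes "\<And>a b. a \<bullet> (M *v b) = a \<bullet> (N *v b)"
  shows "M = N"
proof -
  have "M *v b = N *v b" for b
  proof -
    have "(M *v b - N *v b) \<bullet> (M *v b - N *v b) = 0"
      using assms[of "M *v b - N *v b" b] by (simp only: inner_diff_right[of "M *v b - N *v b"])
    then show ?thesis by (simp only: inner_eq_zero_iff right_minus_eq)
  qed
  then show ?thesis by (simp add: matrix_eq)
qed

lemma transpose_integral:
  fixes M :: "'a \<Rightarrow> real^'n^'n"
  assumes "\<And>x. transpose (M x) = M x"
  shows "transpose (\<integral>x. M x \<partial>\<mu>) = (\<integral>x. M x \<partial>\<mu>)"
proof (cases "integrable \<mu> M")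
  case True
  from integral_bounded_linear[OF bounded_linear_transpose True, symmetric] show ?thesis by (simp only: assms)
\<comment> \<open>Without integrability the integral is the default 0, which is symmetric.\<close>
qed (simp add: not_integrable_integral_eq transpose_zero)

locale control_variates = sweep_ergodic \<pi> K Q \<psi> D lam b W
  for \<pi> :: "'x::polish_space measure" and K Q \<psi> D lam b W +
  fixes g :: "'x \<Rightarrow> real^'d" and f :: "'x \<Rightarrow> real^'p"
  assumes g_meas[measurable]: "g \<in> borel_measurable borel" and f_meas[measurable]: "f \<in> borel_measurable borel"
    and g_bound: "\<And>k x a. k \<in> {1..K} \<Longrightarrow> norm a \<le> 1 \<Longrightarrow> \<bar>a \<bullet> g x\<bar> \<le> W k x"
    and g_mean: "(\<integral>x. g x \<partial>\<pi>) = 0"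
    and f_sq: "integrable \<pi> (\<lambda>x. f x \<bullet> f x)"
begin

definition L2v :: "('x \<Rightarrow> real^'n) \<Rightarrow> bool" where
  "L2v F \<longleftrightarrow> F \<in> borel_measurable borel \<and> (\<forall>i. L2 (\<lambda>x. F x $ i))"

lemma L2v_inner:
  assumes "L2v F"
  shows "L2 (\<lambda>x. a \<bullet> F x)"
proof -
  have "L2 (\<lambda>x. \<Sum>i\<in>UNIV. a $ i * F x $ i)" using assms by (intro L2_sum L2_cmult) (auto simp: L2v_def)
  then show ?thesis by (simp add: inner_vec_def)
qed

lemma L2v_f: "L2v f"
  unfolding L2v_def
proof (intro conjI allI f_meas)
  fix i
  show "L2 (\<lambda>x. f x $ i)"
    unfolding L2_def
  proof
    show "(\<lambda>x. f x $ i) \<in> borel_measurable borel" by measurable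
    show "integrable \<pi> (\<lambda>x. (f x $ i)\<^sup>2)"
    proof (rule Bochner_Integration.integrable_bound[OF f_sq])
      show "(\<lambda>x. (f x $ i)\<^sup>2) \<in> borel_measurable \<pi>" by (intro \<pi>_measurable) measurable
      have "(f x $ i)\<^sup>2 \<le> f x \<bullet> f x" for x
        using component_le_norm_cart[of "f x" i] by (simp add: dot_square_norm abs_le_square_iff[symmetric])
      then show "AE x in \<pi>. norm ((f x $ i)\<^sup>2) \<le> norm (f x \<bullet> f x)" by simp
    qed
  qed
qed

lemma g_component_le: "k \<in> {1..K} \<Longrightarrow> \<bar>g x $ i\<bar> \<le> W k x"
  using g_bound[of k "axis i 1" x] by (simp add: inner_axis')

lemma one_in: "1 \<in> {1..K}" using K1 by simp

lemma L2v_g: "L2v g"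
  unfolding L2v_def
proof (intro conjI allI g_meas)
  fix i
  show "L2 (\<lambda>x. g x $ i)"
    using g_component_le[OF one_in] by (intro L2_dominated[OF _ L2_W[OF one_in]]) auto
qed

lemma L2v_integrable: "L2v F \<Longrightarrow> integrable \<pi> F"
  by (intro integrable_vec L2_integrable) (auto simp: L2v_def)

lemma g_mean_component: "(\<integral>x. g x $ i \<partial>\<pi>) = 0"
  using integral_bounded_linear[OF bounded_linear_vec_nth L2v_integrable[OF L2v_g], of i] g_mean by simp

lemma L2v_kernel_op_vec:
  assumes "k \<in> {1..K}" "L2v F"
  shows "L2v (kernel_op_vec (Q k) F)"
proof -
  have "L2 (\<lambda>x. kernel_op_vec (Q k) F x $ i)" for i
    using L2_kernel_op[OF assms(1), of "\<lambda>y. F y $ i"] assms(2) by (simp add: kernel_op_vec_def L2v_def)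
  then show ?thesis unfolding L2v_def by (auto simp: L2_def intro: borel_measurable_vecI)
qed

lemma inner_kernel_op_vec:
  assumes k: "k \<in> {1..K}" and F: "L2v F"
  shows "AE x in \<pi>. kernel_op (Q k) (\<lambda>y. a \<bullet> F y) x = a \<bullet> kernel_op_vec (Q k) F x"
proof -
  interpret S: stationary_pair \<pi> "Q k" by (rule Q_stationary[OF k])
  have "AE x in \<pi>. \<forall>i\<in>UNIV. integrable (Q k x) (\<lambda>y. F y $ i)"
    using F by (intro AE_finite_allI S.AE_integrable_stationary L2_integrable) (auto simp: L2v_def)
  then show ?thesis
  proof eventually_elim
    case (elim x)
    then show ?case by (simp add: kernel_op_def kernel_op_vec_def inner_vec_def)
  qed
qed

text \<open>By stationarity this is the \<pi>-average of the conditional covariance of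
  \<open>u\<close> and \<open>w\<close> under \<open>Q k\<close>, in a form that avoids conditional
  centering.\<close>

definition cond_cov :: "nat \<Rightarrow> ('x \<Rightarrow> real) \<Rightarrow> ('x \<Rightarrow> real) \<Rightarrow> real" where
  "cond_cov k u w = (\<integral>x. u x * w x \<partial>\<pi>) - (\<integral>x. kernel_op (Q k) u x * kernel_op (Q k) w x \<partial>\<pi>)"

lemma kernel_op_diff_AE:
  assumes k: "k \<in> {1..K}" and u: "L2 u" "L2 w"
  shows "AE x in \<pi>. kernel_op (Q k) (\<lambda>y. u y - w y) x = kernel_op (Q k) u x - kernel_op (Q k) w x"
proof -
  interpret S: stationary_pair \<pi> "Q k" by (rule Q_stationary[OF k])
  show ?thesis
    using S.AE_integrable_stationary[OF L2_integrable[OF u(1)]] S.AE_integrable_stationary[OF L2_integrable[OF u(2)]]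
    by eventually_elim (simp add: kernel_op_def)
qed

lemma integral_L2_cong:
  assumes "AE x in \<pi>. u x = u' x" "AE x in \<pi>. w x = w' x" "L2 u" "L2 u'" "L2 w" "L2 w'"
  shows "(\<integral>x. u x * w x \<partial>\<pi>) = (\<integral>x. u' x * w' x \<partial>\<pi>)"
proof (rule integral_cong_AE)
  show "AE x in \<pi>. u x * w x = u' x * w' x" using assms(1,2) by eventually_elim simp
qed (use assms L2_integrable_mult borel_measurable_integrable in blast)+

lemma cond_cov_diff_square:
  assumes k: "k \<in> {1..K}" and u: "L2 u" "L2 w"
  shows "cond_cov k (\<lambda>x. u x - w x) (\<lambda>x. u x - w x) = cond_cov k u u - 2 * cond_cov k w u + cond_cov k w w"
proof -
  have expand: "(\<integral>x. (a x - c x) * (a x - c x) \<partial>\<pi>) = (\<integral>x. a x * a x \<partial>\<pi>) - 2 * (\<integral>x. c x * a x \<partial>\<pi>) + (\<integral>x. c x * c x \<partial>\<pi>)"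
    if "L2 a" "L2 c" for a c
  proof -
    have "(\<integral>x. (a x - c x) * (a x - c x) \<partial>\<pi>) = (\<integral>x. a x * a x - 2 * (c x * a x) + c x * c x \<partial>\<pi>)"
      by (intro Bochner_Integration.integral_cong) (auto simp: algebra_simps)
    also have "\<dots> = (\<integral>x. a x * a x \<partial>\<pi>) - 2 * (\<integral>x. c x * a x \<partial>\<pi>) + (\<integral>x. c x * c x \<partial>\<pi>)"
      using L2_integrable_mult[OF that(1,1)] L2_integrable_mult[OF that(2,1)] L2_integrable_mult[OF that(2,2)] by simp
    finally show ?thesis .
  qed
  note Q = L2_kernel_op[OF k u(1)] L2_kernel_op[OF k u(2)]
  have "(\<integral>x. kernel_op (Q k) (\<lambda>x. u x - w x) x * kernel_op (Q k) (\<lambda>x. u x - w x) x \<partial>\<pi>)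
    = (\<integral>x. (kernel_op (Q k) u x - kernel_op (Q k) w x) * (kernel_op (Q k) u x - kernel_op (Q k) w x) \<partial>\<pi>)"
    by (intro integral_L2_cong kernel_op_diff_AE[OF k u] L2_kernel_op[OF k] L2_diff u Q)
  then show ?thesis using expand[OF u] expand[OF Q] by (simp add: cond_cov_def)
qed

text \<open>Jensen's inequality under almost every \<open>Q k x\<close>, integrated by
  stationarity.\<close>

lemma cond_cov_nonneg:
  assumes k: "k \<in> {1..K}" and u: "L2 u"
  shows "0 \<le> cond_cov k u u"
proof -
  interpret S: stationary_pair \<pi> "Q k" by (rule Q_stationary[OF k])
  have u': "u \<in> borel_measurable borel" "integrable \<pi> (\<lambda>x. (u x)\<^sup>2)" using u by (auto simp: L2_def)
  have "(\<integral>x. (\<integral>y. u y \<partial>Q k x)\<^sup>2 \<partial>\<pi>) \<le> (\<integral>x. \<integral>y. (u y)\<^sup>2 \<partial>Q k x \<partial>\<pi>)"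
    by (rule integral_mono_AE[OF S.integrable_square_kernel[OF u'] S.integrable_stationary[OF u'(2)] S.AE_square_le[OF u']])
  also have "\<dots> = (\<integral>x. (u x)\<^sup>2 \<partial>\<pi>)" by (rule S.integral_stationary[OF u'(2)])
  finally show ?thesis by (simp add: cond_cov_def kernel_op_def power2_eq_square)
qed

lemma integrable_outer:
  assumes "L2v F" "L2v H"
  shows "integrable \<pi> (\<lambda>x. outer (F x) (H x))"
proof (intro integrable_vec)
  fix i j
  show "integrable \<pi> (\<lambda>x. outer (F x) (H x) $ i $ j)"
    using assms L2_integrable_mult[of "\<lambda>x. F x $ i" "\<lambda>x. H x $ j"] by (simp add: L2v_def outer_def)
qed

lemma integral_outer_form:
  assumes "L2v F" "L2v H"
  shows "a \<bullet> ((\<integral>x. outer (F x) (H x) \<partial>\<pi>) *v c) = (\<integral>x. (a \<bullet> F x) * (c \<bullet> H x) \<partial>\<pi>)"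
  using integral_bounded_linear[OF bounded_linear_matrix_form integrable_outer[OF assms], of a c]
  by (simp add: outer_form)

lemma covariance_form:
  assumes k: "k \<in> {1..K}" and F: "L2v F" and H: "L2v H"
  shows "a \<bullet> ((\<integral>x. outer (F x) (H x) - outer (kernel_op_vec (Q k) F x) (kernel_op_vec (Q k) H x) \<partial>\<pi>) *v c)
    = cond_cov k (\<lambda>x. a \<bullet> F x) (\<lambda>x. c \<bullet> H x)"
proof -
  note QF = L2v_kernel_op_vec[OF k F] and QH = L2v_kernel_op_vec[OF k H]
  have "(\<integral>x. kernel_op (Q k) (\<lambda>x. a \<bullet> F x) x * kernel_op (Q k) (\<lambda>x. c \<bullet> H x) x \<partial>\<pi>)
    = (\<integral>x. (a \<bullet> kernel_op_vec (Q k) F x) * (c \<bullet> kernel_op_vec (Q k) H x) \<partial>\<pi>)"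
    by (rule integral_L2_cong[OF inner_kernel_op_vec[OF k F] inner_kernel_op_vec[OF k H]
          L2_kernel_op[OF k L2v_inner[OF F]] L2v_inner[OF QF] L2_kernel_op[OF k L2v_inner[OF H]] L2v_inner[OF QH]])
  then show ?thesis
    using integrable_outer[OF F H] integrable_outer[OF QF QH]
    by (simp add: matrix_vector_mult_diff_rdistrib inner_diff_right integral_outer_form F H QF QH cond_cov_def)
qed

subsection \<open>The solution of the Poisson equation\<close>

abbreviation "Pg k t \<equiv> sweep_op_vec K Q k t g"
abbreviation "gh k \<equiv> g_hat K Q g k"

lemma Pg_measurable: "k \<in> {1..K} \<Longrightarrow> Pg k t \<in> borel_measurable borel"
proof (rule borel_measurable_vecI)
  fix i assume "k \<in> {1..K}"
  have "(\<lambda>y. g y $ i) \<in> borel_measurable borel" by measurable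
  from sweep_op_measurable[OF \<open>k \<in> {1..K}\<close> this] show "(\<lambda>x. Pg k t x $ i) \<in> borel_measurable borel"
    by (simp add: sweep_op_vec_nth)
qed

text \<open>The scalar bound is applied to the components of \<open>g\<close>, which
  \<open>g_bound\<close> controls by every \<open>W k\<close>; the constant and the dimension go
  into \<open>G\<close>.\<close>

lemma Pg_dominated:
  obtains r G where "0 < r" "r < 1" "\<And>k. k \<in> {1..K} \<Longrightarrow> L2 (G k)" "\<And>k x. k \<in> {1..K} \<Longrightarrow> 0 \<le> G k x"
    "\<And>k. k \<in> {1..K} \<Longrightarrow> AE x in \<pi>. \<forall>t. norm (Pg k t x) \<le> r ^ t * G k x"
proof -
  obtain C r G where Cr: "0 < r" "r < 1" "0 < C" "\<And>k. k \<in> {1..K} \<Longrightarrow> L2 (G k)" "\<And>k x. k \<in> {1..K} \<Longrightarrow> 0 \<le> G k x"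
    and dom: "\<And>k u. k \<in> {1..K} \<Longrightarrow> u \<in> borel_measurable borel \<Longrightarrow> (\<And>k y. k \<in> {1..K} \<Longrightarrow> \<bar>u y\<bar> \<le> W k y) \<Longrightarrow> (\<integral>x. u x \<partial>\<pi>) = 0 \<Longrightarrow>
      AE x in \<pi>. \<forall>t. \<bar>sweep_op K Q k t u x\<bar> \<le> C * r ^ t * G k x"
    by (rule geometric_domination) blast
  define G' where "G' k x = real CARD('d) * C * G k x" for k x
  have bound: "AE x in \<pi>. \<forall>t. norm (Pg k t x) \<le> r ^ t * G' k x" if k: "k \<in> {1..K}" for k
  proof -
    have "AE x in \<pi>. \<forall>i\<in>UNIV. \<forall>t. \<bar>sweep_op K Q k t (\<lambda>y. g y $ i) x\<bar> \<le> C * r ^ t * G k x"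
    proof (intro AE_finite_allI)
      fix i :: 'd
      show "AE x in \<pi>. \<forall>t. \<bar>sweep_op K Q k t (\<lambda>y. g y $ i) x\<bar> \<le> C * r ^ t * G k x"
        by (rule dom[OF k _ g_component_le g_mean_component]) measurable
    qed simp
    then show ?thesis
    proof eventually_elim
      case (elim x)
      show ?case
      proof
        fix t
        have "norm (Pg k t x) \<le> (\<Sum>i\<in>UNIV. \<bar>Pg k t x $ i\<bar>)" by (rule norm_le_l1_cart)
        also have "\<dots> \<le> (\<Sum>i\<in>(UNIV::'d set). C * r ^ t * G k x)"
          using elim by (intro sum_mono) (simp add: sweep_op_vec_nth)
        finally show "norm (Pg k t x) \<le> r ^ t * G' k x" by (simp add: G'_def mult_ac)
      qed
    qed
  qed
  have "L2 (G' k)" if "k \<in> {1..K}" for k unfolding G'_def[abs_def] by (rule L2_cmult[OF Cr(4)[OF that]])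
  moreover have "0 \<le> G' k x" if "k \<in> {1..K}" for k x using Cr(3) Cr(5)[OF that] by (simp add: G'_def)
  ultimately show thesis using that[of r G'] Cr(1,2) bound by blast
qed

lemma gh_measurable: "k \<in> {1..K} \<Longrightarrow> gh k \<in> borel_measurable borel"
  unfolding g_hat_def[abs_def] by (intro borel_measurable_suminf Pg_measurable)

lemma Pg_summable:
  assumes k: "k \<in> {1..K}"
  shows "AE x in \<pi>. summable (\<lambda>t. norm (Pg k t x))"
proof -
  obtain r G where r: "0 < r" "r < 1" and dom: "\<And>k. k \<in> {1..K} \<Longrightarrow> AE x in \<pi>. \<forall>t. norm (Pg k t x) \<le> r ^ t * G k x"
    by (rule Pg_dominated) blast
  show ?thesis
    using dom[OF k]
  proof eventually_elim
    case (elim x)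
    have "summable (\<lambda>t. r ^ t * G k x)" using r by (intro summable_mult2 summable_geometric) auto
    then show ?case by (rule summable_comparison_test_ev[rotated]) (use elim in auto)
  qed
qed

lemma L2v_gh:
  assumes k: "k \<in> {1..K}"
  shows "L2v (gh k)"
proof -
  obtain r G where r: "0 < r" "r < 1" and G: "\<And>k. k \<in> {1..K} \<Longrightarrow> L2 (G k)"
    and dom: "\<And>k. k \<in> {1..K} \<Longrightarrow> AE x in \<pi>. \<forall>t. norm (Pg k t x) \<le> r ^ t * G k x"
    by (rule Pg_dominated) blast
  have bound: "AE x in \<pi>. norm (gh k x) \<le> 1 / (1 - r) * G k x"
    using dom[OF k]
  proof eventually_elim
    case (elim x)
    have s: "summable (\<lambda>t. r ^ t * G k x)" using r by (intro summable_mult2 summable_geometric) auto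
    have "norm (gh k x) \<le> (\<Sum>t. r ^ t * G k x)"
      unfolding g_hat_def by (rule norm_suminf_le[OF _ s]) (use elim in auto)
    also have "\<dots> = 1 / (1 - r) * G k x"
      using r by (subst suminf_mult2[symmetric]) (auto simp: suminf_geometric intro!: summable_geometric)
    finally show ?case .
  qed
  have "L2 (\<lambda>x. gh k x $ i)" for i
  proof (rule L2_dominated[OF _ L2_cmult[OF G[OF k]]])
    show "(\<lambda>x. gh k x $ i) \<in> borel_measurable borel" using gh_measurable[OF k] by measurable
    show "AE x in \<pi>. \<bar>gh k x $ i\<bar> \<le> 1 / (1 - r) * G k x"
      using bound by eventually_elim (rule order_trans[OF component_le_norm_cart])
  qed
  then show ?thesis using gh_measurable[OF k] by (simp add: L2v_def)
qed

text \<open>Exchanging \<open>Q k\<close> with the series needs domination under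
  \<open>Q k x\<close>; it holds for almost every \<open>x\<close>, because a \<pi>-null set is null
  under almost every \<open>Q k x\<close>. The exchange yields the terms from time 1 on, whence the
  subtraction of \<open>g\<close>.\<close>

lemma poisson_equation:
  assumes k: "k \<in> {1..K}"
  shows "AE x in \<pi>. kernel_op_vec (Q k) (gh (cyc K k)) x = gh k x - g x"
proof -
  obtain r G where r: "0 < r" "r < 1" and G: "\<And>k. k \<in> {1..K} \<Longrightarrow> L2 (G k)" "\<And>k x. k \<in> {1..K} \<Longrightarrow> 0 \<le> G k x"
    and dom: "\<And>k. k \<in> {1..K} \<Longrightarrow> AE x in \<pi>. \<forall>t. norm (Pg k t x) \<le> r ^ t * G k x"
    by (rule Pg_dominated) blast
  have c: "cyc K k \<in> {1..K}" by (rule cycr[OF k])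
  interpret S: stationary_pair \<pi> "Q k" by (rule Q_stationary[OF k])
  show ?thesis
    using S.AE_stationary[OF dom[OF c]] S.AE_integrable_stationary[OF L2_integrable[OF G(1)[OF c]]] Pg_summable[OF k]
  proof eventually_elim
    case (elim x)
    have [measurable_cong]: "sets (Q k x) = sets borel" by (rule prob_kernelD(2)[OF kernel_Q[OF k]])
    have Pm[measurable]: "Pg (cyc K k) t \<in> borel_measurable borel" for t by (rule Pg_measurable[OF c])
    have comp: "kernel_op (Q k) (\<lambda>y. gh (cyc K k) y $ i) x = gh k x $ i - g x $ i" for i
    proof -
      let ?F = "\<lambda>t y. Pg (cyc K k) t y $ i"
      have le: "AE y in Q k x. \<forall>t. norm (?F t y) \<le> r ^ t * G (cyc K k) y"
        using elim(1) by eventually_elim (metis component_le_norm_cart order_trans real_norm_def)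
      have iG: "integrable (Q k x) (\<lambda>y. r ^ t * G (cyc K k) y)" for t using elim(2) by simp
      have iF: "integrable (Q k x) (?F t)" for t
      proof (rule Bochner_Integration.integrable_bound[OF iG])
        show "?F t \<in> borel_measurable (Q k x)" by measurable
        show "AE y in Q k x. norm (?F t y) \<le> norm (r ^ t * G (cyc K k) y)"
          using le by eventually_elim (metis abs_ge_self order_trans real_norm_def)
      qed
      have geo: "summable (\<lambda>t. r ^ t)" using r by (intro summable_geometric) auto
      have sum: "AE y in Q k x. summable (\<lambda>t. norm (?F t y))"
        using le
      proof eventually_elim
        case (elim y)
        show ?case by (rule summable_comparison_test_ev[OF _ summable_mult2[OF geo, of "G (cyc K k) y"]]) (use elim in auto)
      qed
      have sumI: "summable (\<lambda>t. \<integral>y. norm (?F t y) \<partial>Q k x)"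
      proof (rule summable_comparison_test_ev[OF _ summable_mult2[OF geo, of "\<integral>y. G (cyc K k) y \<partial>Q k x"]])
        have "(\<integral>y. norm (?F t y) \<partial>Q k x) \<le> (\<integral>y. r ^ t * G (cyc K k) y \<partial>Q k x)" for t
          by (rule integral_mono_AE) (use iF iG le in auto)
        then show "eventually (\<lambda>t. norm (\<integral>y. norm (?F t y) \<partial>Q k x) \<le> r ^ t * (\<integral>y. G (cyc K k) y \<partial>Q k x)) sequentially"
          by (intro always_eventually) simp
      qed
      have "kernel_op (Q k) (\<lambda>y. gh (cyc K k) y $ i) x = (\<integral>y. (\<Sum>t. ?F t y) \<partial>Q k x)"
        unfolding kernel_op_def
      proof (rule integral_cong_AE)
        show "(\<lambda>y. gh (cyc K k) y $ i) \<in> borel_measurable (Q k x)" using gh_measurable[OF c] by measurable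
        show "(\<lambda>y. \<Sum>t. ?F t y) \<in> borel_measurable (Q k x)" by measurable
        show "AE y in Q k x. gh (cyc K k) y $ i = (\<Sum>t. ?F t y)"
          using elim(1)
        proof eventually_elim
          case (elim y)
          have "summable (\<lambda>t. norm (Pg (cyc K k) t y))"
            by (rule summable_comparison_test_ev[OF _ summable_mult2[OF geo, of "G (cyc K k) y"]]) (use elim in auto)
          then have "summable (\<lambda>t. Pg (cyc K k) t y)" by (rule summable_norm_cancel)
          from bounded_linear.suminf[OF bounded_linear_vec_nth this] show ?case by (simp add: g_hat_def)
        qed
      qed
      also have "\<dots> = (\<Sum>t. \<integral>y. ?F t y \<partial>Q k x)" by (rule integral_suminf[OF iF sum sumI])
      also have "\<dots> = (\<Sum>t. Pg k (Suc t) x $ i)"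
        by (simp add: sweep_op_vec_nth sweep_op_Suc kernel_op_def)
      also have "\<dots> = gh k x $ i - g x $ i"
      proof -
        have s: "summable (\<lambda>t. Pg k t x)" using elim(3) by (rule summable_norm_cancel)
        have "gh k x $ i = (\<Sum>t. Pg k t x $ i)"
          unfolding g_hat_def by (rule bounded_linear.suminf[OF bounded_linear_vec_nth s])
        also have "\<dots> = (\<Sum>t. Pg k (Suc t) x $ i) + Pg k 0 x $ i"
          using suminf_split_head[OF bounded_linear.summable[OF bounded_linear_vec_nth s], of i] by simp
        finally show ?thesis by (simp add: sweep_op_vec_nth sweep_op_0)
      qed
      finally show ?thesis .
    qed
    show ?case by (simp add: vec_eq_iff kernel_op_vec_def comp)
  qed
qed

subsection \<open>The asymptotic variance as a quadratic form\<close>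

lemma L2_norm: "L2v F \<Longrightarrow> L2 (\<lambda>x. norm (F x))"
proof -
  assume F: "L2v F"
  have "integrable \<pi> (\<lambda>x. \<Sum>i\<in>UNIV. (F x $ i)\<^sup>2)" using F by (intro Bochner_Integration.integrable_sum) (auto simp: L2v_def L2_def)
  moreover have "(\<Sum>i\<in>UNIV. (F x $ i)\<^sup>2) = (norm (F x))\<^sup>2" for x
    unfolding power2_norm_eq_inner inner_vec_def by (simp add: power2_eq_square)
  ultimately show ?thesis using F by (auto simp: L2_def L2v_def)
qed

lemma L2v_Pg:
  assumes k: "k \<in> {1..K}"
  shows "L2v (Pg k t)"
proof -
  obtain r G where r: "0 < r" "r < 1" and G: "\<And>k. k \<in> {1..K} \<Longrightarrow> L2 (G k)"
    and dom: "\<And>k. k \<in> {1..K} \<Longrightarrow> AE x in \<pi>. \<forall>t. norm (Pg k t x) \<le> r ^ t * G k x"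
    by (rule Pg_dominated) blast
  have "L2 (\<lambda>x. Pg k t x $ i)" for i
  proof (rule L2_dominated[OF _ L2_cmult[OF G[OF k]]])
    show "(\<lambda>x. Pg k t x $ i) \<in> borel_measurable borel" using Pg_measurable[OF k] by measurable
    show "AE x in \<pi>. \<bar>Pg k t x $ i\<bar> \<le> r ^ t * G k x"
      using dom[OF k] by eventually_elim (metis component_le_norm_cart order_trans)
  qed
  then show ?thesis using Pg_measurable[OF k] by (simp add: L2v_def)
qed

lemma lag_cov_summable:
  assumes k: "k \<in> {1..K}"
  shows "summable (\<lambda>t. lag_cov \<pi> K Q g k (Suc t))"
proof -
  obtain r G where r: "0 < r" "r < 1" and G: "\<And>k. k \<in> {1..K} \<Longrightarrow> L2 (G k)"
    and dom: "\<And>k. k \<in> {1..K} \<Longrightarrow> AE x in \<pi>. \<forall>t. norm (Pg k t x) \<le> r ^ t * G k x"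
    by (rule Pg_dominated) blast
  let ?A = "\<integral>x. norm (g x) * G k x \<partial>\<pi>"
  have iA: "integrable \<pi> (\<lambda>x. norm (g x) * G k x)" by (rule L2_integrable_mult[OF L2_norm[OF L2v_g] G[OF k]])
  have le: "norm (lag_cov \<pi> K Q g k t) \<le> 2 * ?A * r ^ t" for t
  proof -
    have i: "integrable \<pi> (\<lambda>x. outer (g x) (Pg k t x) + outer (Pg k t x) (g x))"
      by (intro Bochner_Integration.integrable_add integrable_outer L2v_g L2v_Pg k)
    have "norm (lag_cov \<pi> K Q g k t) \<le> (\<integral>x. norm (outer (g x) (Pg k t x) + outer (Pg k t x) (g x)) \<partial>\<pi>)"
      unfolding lag_cov_def by (rule integral_norm_bound)
    also have "\<dots> \<le> (\<integral>x. 2 * r ^ t * (norm (g x) * G k x) \<partial>\<pi>)"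
    proof (rule integral_mono_AE)
      show "AE x in \<pi>. norm (outer (g x) (Pg k t x) + outer (Pg k t x) (g x)) \<le> 2 * r ^ t * (norm (g x) * G k x)"
        using dom[OF k]
      proof eventually_elim
        case (elim x)
        have "norm (outer (g x) (Pg k t x) + outer (Pg k t x) (g x)) \<le> 2 * (norm (g x) * norm (Pg k t x))"
          by (rule order_trans[OF norm_triangle_ineq]) (simp add: norm_outer mult.commute)
        also have "\<dots> \<le> 2 * (norm (g x) * (r ^ t * G k x))"
          using elim by (intro mult_left_mono) auto
        finally show ?case by (simp add: mult_ac)
      qed
    qed (use i iA in auto)
    also have "\<dots> = 2 * ?A * r ^ t" by simp
    finally show ?thesis .
  qed
  have "summable (\<lambda>t. 2 * ?A * r ^ t)" using r by (intro summable_mult summable_geometric) auto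
  then have "summable (\<lambda>t. norm (lag_cov \<pi> K Q g k t))"
    by (rule summable_comparison_test_ev[rotated]) (use le in auto)
  then have "summable (\<lambda>t. lag_cov \<pi> K Q g k t)" by (rule summable_norm_cancel)
  then show ?thesis by (subst summable_Suc_iff)
qed

text \<open>On equal arguments the two transposed terms agree, which gives the factor 2; summing
  from lag 1 on turns the series into \<open>gh k\<close> minus \<open>g\<close>.\<close>

lemma lag_cov_form:
  assumes k: "k \<in> {1..K}"
  shows "a \<bullet> ((\<Sum>t. lag_cov \<pi> K Q g k (Suc t)) *v a)
    = 2 * (\<integral>x. (a \<bullet> g x) * (a \<bullet> gh k x) \<partial>\<pi>) - 2 * (\<integral>x. (a \<bullet> g x) * (a \<bullet> g x) \<partial>\<pi>)"
proof -
  obtain r G where r: "0 < r" "r < 1" and G: "\<And>k. k \<in> {1..K} \<Longrightarrow> L2 (G k)"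
    and dom: "\<And>k. k \<in> {1..K} \<Longrightarrow> AE x in \<pi>. \<forall>t. norm (Pg k t x) \<le> r ^ t * G k x"
    by (rule Pg_dominated) blast
  let ?F = "\<lambda>t x. (a \<bullet> g x) * (a \<bullet> Pg k (Suc t) x)"
  have iF: "integrable \<pi> (?F t)" for t by (intro L2_integrable_mult L2v_inner L2v_g L2v_Pg k)
  have geo: "summable (\<lambda>t. r ^ Suc t)" using r by (subst summable_Suc_iff) (intro summable_geometric, auto)
  define B where "B x = \<bar>a \<bullet> g x\<bar> * (norm a * G k x)" for x
  have iB: "integrable \<pi> B"
  proof -
    have "L2 (\<lambda>x. \<bar>a \<bullet> g x\<bar>)" using L2v_inner[OF L2v_g, of a] by (auto simp: L2_def)
    then show ?thesis unfolding B_def[abs_def] by (intro L2_integrable_mult L2_cmult G k)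
  qed
  have le: "AE x in \<pi>. \<forall>t. norm (?F t x) \<le> r ^ Suc t * B x"
    using dom[OF k]
  proof eventually_elim
    case (elim x)
    show ?case
    proof
      fix t
      have "\<bar>a \<bullet> Pg k (Suc t) x\<bar> \<le> norm a * (r ^ Suc t * G k x)"
        by (intro order_trans[OF Cauchy_Schwarz_ineq2] mult_left_mono elim[rule_format]) simp
      then have "\<bar>a \<bullet> g x\<bar> * \<bar>a \<bullet> Pg k (Suc t) x\<bar> \<le> \<bar>a \<bullet> g x\<bar> * (norm a * (r ^ Suc t * G k x))"
        by (intro mult_left_mono) auto
      then show "norm (?F t x) \<le> r ^ Suc t * B x" by (simp add: B_def abs_mult mult_ac)
    qed
  qed
  have sum: "AE x in \<pi>. summable (\<lambda>t. norm (?F t x))"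
    using le
  proof eventually_elim
    case (elim x)
    show ?case by (rule summable_comparison_test_ev[OF _ summable_mult2[OF geo, of "B x"]]) (use elim in auto)
  qed
  have sumI: "summable (\<lambda>t. \<integral>x. norm (?F t x) \<partial>\<pi>)"
  proof (rule summable_comparison_test_ev[OF _ summable_mult2[OF geo, of "\<integral>x. B x \<partial>\<pi>"]])
    have "(\<integral>x. norm (?F t x) \<partial>\<pi>) \<le> (\<integral>x. r ^ Suc t * B x \<partial>\<pi>)" for t
    proof (rule integral_mono_AE)
      show "AE x in \<pi>. norm (?F t x) \<le> r ^ Suc t * B x" using le by eventually_elim blast
    qed (use iF[of t] iB in auto)
    then show "eventually (\<lambda>t. norm (\<integral>x. norm (?F t x) \<partial>\<pi>) \<le> r ^ Suc t * (\<integral>x. B x \<partial>\<pi>)) sequentially"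
      by (intro always_eventually) simp
  qed
  have lag: "a \<bullet> (lag_cov \<pi> K Q g k t *v a) = 2 * (\<integral>x. (a \<bullet> g x) * (a \<bullet> Pg k t x) \<partial>\<pi>)" for t
  proof -
    have i: "integrable \<pi> (\<lambda>x. outer (g x) (Pg k t x))" "integrable \<pi> (\<lambda>x. outer (Pg k t x) (g x))"
      by (intro integrable_outer L2v_g L2v_Pg k)+
    show ?thesis
      unfolding lag_cov_def Bochner_Integration.integral_add[OF i]
      by (simp add: matrix_vector_mult_add_rdistrib inner_add_right
          integral_outer_form[OF L2v_g L2v_Pg[OF k]] integral_outer_form[OF L2v_Pg[OF k] L2v_g] mult.commute)
  qed
  have "a \<bullet> ((\<Sum>t. lag_cov \<pi> K Q g k (Suc t)) *v a) = (\<Sum>t. a \<bullet> (lag_cov \<pi> K Q g k (Suc t) *v a))"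
    by (rule bounded_linear.suminf[OF bounded_linear_matrix_form lag_cov_summable[OF k]])
  also have "\<dots> = (\<Sum>t. 2 * (\<integral>x. ?F t x \<partial>\<pi>))" by (simp only: lag)
  also have "\<dots> = 2 * (\<Sum>t. \<integral>x. ?F t x \<partial>\<pi>)"
    by (rule suminf_mult[OF summable_rabs_cancel[OF summable_comparison_test_ev[OF _ sumI]]])
       (simp add: integral_abs_bound)
  also have "(\<Sum>t. \<integral>x. ?F t x \<partial>\<pi>) = (\<integral>x. (\<Sum>t. ?F t x) \<partial>\<pi>)"
    by (rule integral_suminf[OF iF sum sumI, symmetric])
  also have "\<dots> = (\<integral>x. (a \<bullet> g x) * (a \<bullet> gh k x) - (a \<bullet> g x) * (a \<bullet> g x) \<partial>\<pi>)"
  proof (rule integral_cong_AE)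
    show "(\<lambda>x. \<Sum>t. ?F t x) \<in> borel_measurable \<pi>"
      by (intro borel_measurable_suminf borel_measurable_integrable iF)
    show "(\<lambda>x. (a \<bullet> g x) * (a \<bullet> gh k x) - (a \<bullet> g x) * (a \<bullet> g x)) \<in> borel_measurable \<pi>"
      by (intro borel_measurable_integrable Bochner_Integration.integrable_diff L2_integrable_mult L2v_inner L2v_g L2v_gh k)
    show "AE x in \<pi>. (\<Sum>t. ?F t x) = (a \<bullet> g x) * (a \<bullet> gh k x) - (a \<bullet> g x) * (a \<bullet> g x)"
      using Pg_summable[OF k]
    proof eventually_elim
      case (elim x)
      have s: "summable (\<lambda>t. Pg k t x)" using elim by (rule summable_norm_cancel)
      have sa: "summable (\<lambda>t. a \<bullet> Pg k t x)" by (rule bounded_linear.summable[OF bounded_linear_inner_right s])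
      have "a \<bullet> gh k x = (\<Sum>t. a \<bullet> Pg k t x)"
        unfolding g_hat_def by (rule bounded_linear.suminf[OF bounded_linear_inner_right s])
      also have "\<dots> = (\<Sum>t. a \<bullet> Pg k (Suc t) x) + a \<bullet> g x"
        using suminf_split_head[OF sa] by (simp add: vec_eq_iff sweep_op_vec_def)
      finally have "(\<Sum>t. a \<bullet> Pg k (Suc t) x) = a \<bullet> gh k x - a \<bullet> g x" by simp
      moreover have "(\<Sum>t. ?F t x) = (a \<bullet> g x) * (\<Sum>t. a \<bullet> Pg k (Suc t) x)"
        by (intro suminf_mult) (simp only: summable_Suc_iff[of "\<lambda>t. a \<bullet> Pg k t x"] sa)
      ultimately show ?case by (simp add: right_diff_distrib)
    qed
  qed
  also have "\<dots> = (\<integral>x. (a \<bullet> g x) * (a \<bullet> gh k x) \<partial>\<pi>) - (\<integral>x. (a \<bullet> g x) * (a \<bullet> g x) \<partial>\<pi>)"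
    by (intro Bochner_Integration.integral_diff L2_integrable_mult L2v_inner L2v_g L2v_gh k)
  finally show ?thesis by simp
qed

section \<open>The matrices of the variance formula\<close>

abbreviation "U \<equiv> U_mat \<pi> K Q f"
abbreviation "V \<equiv> V_mat \<pi> K Q g f"

definition G0 :: "real^'d^'d" where
  "G0 = (\<integral>x. outer (g x) (g x) \<partial>\<pi>) + (1 / real K) *\<^sub>R (\<Sum>k=1..K. \<Sum>t. lag_cov \<pi> K Q g k (Suc t))"

definition asvar :: "real^'d^'p \<Rightarrow> real^'d^'d" where
  "asvar C = G0 + transpose C ** U ** C - transpose C ** V - transpose V ** C"

lemma sum_matrix_form: "a \<bullet> ((\<Sum>k\<in>I. M k) *v c) = (\<Sum>k\<in>I. a \<bullet> ((M k :: real^'n^'m) *v c))"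
  by (rule linear_sum[OF bounded_linear.linear[OF bounded_linear_matrix_form]])

lemma U_form: "c \<bullet> (U *v c') = (1 / real K) * (\<Sum>k=1..K. cond_cov k (\<lambda>x. c \<bullet> f x) (\<lambda>x. c' \<bullet> f x))"
proof -
  have "c \<bullet> (U *v c') = (1 / real K) * (\<Sum>k=1..K. c \<bullet> (U_comp \<pi> Q f k *v c'))"
    by (simp add: U_mat_def scaleR_matrix_vector_assoc[symmetric] sum_matrix_form)
  also have "(\<Sum>k=1..K. c \<bullet> (U_comp \<pi> Q f k *v c')) = (\<Sum>k=1..K. cond_cov k (\<lambda>x. c \<bullet> f x) (\<lambda>x. c' \<bullet> f x))"
    unfolding U_comp_def by (intro sum.cong refl covariance_form L2v_f)
  finally show ?thesis .
qed

lemma V_form: "c \<bullet> (V *v a) = (1 / real K) * (\<Sum>k=1..K. cond_cov k (\<lambda>x. c \<bullet> f x) (\<lambda>x. a \<bullet> gh (cyc K k) x))"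
proof -
  have "c \<bullet> (V *v a) = (1 / real K) * (\<Sum>k=1..K. c \<bullet> (V_comp \<pi> K Q g f k *v a))"
    by (simp add: V_mat_def scaleR_matrix_vector_assoc[symmetric] sum_matrix_form)
  also have "(\<Sum>k=1..K. c \<bullet> (V_comp \<pi> K Q g f k *v a)) = (\<Sum>k=1..K. cond_cov k (\<lambda>x. c \<bullet> f x) (\<lambda>x. a \<bullet> gh (cyc K k) x))"
    unfolding V_comp_def by (intro sum.cong refl covariance_form L2v_f L2v_gh cycr)
  finally show ?thesis .
qed

lemma poisson_inner:
  assumes k: "k \<in> {1..K}"
  shows "AE x in \<pi>. kernel_op (Q k) (\<lambda>y. a \<bullet> gh (cyc K k) y) x = a \<bullet> gh k x - a \<bullet> g x"
  using inner_kernel_op_vec[OF k L2v_gh[OF cycr[OF k]], of a] poisson_equation[OF k]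
  by eventually_elim (simp add: inner_diff_right)

text \<open>By the Poisson equation each conditional variance is a difference of second moments of
  \<open>gh\<close> at consecutive positions plus terms with \<open>g\<close>; the differences
  cancel around the cycle.\<close>

lemma G0_form: "a \<bullet> (G0 *v a) = (1 / real K) * (\<Sum>k=1..K. cond_cov k (\<lambda>x. a \<bullet> gh (cyc K k) x) (\<lambda>x. a \<bullet> gh (cyc K k) x))"
proof -
  let ?\<gamma> = "\<lambda>x. a \<bullet> g x" and ?p = "\<lambda>k x. a \<bullet> gh k x"
  let ?I = "\<lambda>u w. \<integral>x. u x * w x \<partial>\<pi>"
  have \<gamma>: "L2 ?\<gamma>" by (rule L2v_inner[OF L2v_g])
  have p: "L2 (?p k)" if "k \<in> {1..K}" for k by (rule L2v_inner[OF L2v_gh[OF that]])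
  have K0: "real K > 0" using K1 by simp
  have "(\<Sum>k=1..K. cond_cov k (?p (cyc K k)) (?p (cyc K k))) = (\<Sum>k=1..K. ?I (?p (cyc K k)) (?p (cyc K k)) - ?I (?p k) (?p k) + (2 * ?I ?\<gamma> (?p k) - ?I ?\<gamma> ?\<gamma>))"
  proof (intro sum.cong refl)
    fix k assume k: "k \<in> {1..K}"
    have "(\<integral>x. kernel_op (Q k) (?p (cyc K k)) x * kernel_op (Q k) (?p (cyc K k)) x \<partial>\<pi>)
      = (\<integral>x. (?p k x - ?\<gamma> x) * (?p k x - ?\<gamma> x) \<partial>\<pi>)"
      by (intro integral_L2_cong poisson_inner k L2_kernel_op L2_diff p \<gamma> cycr)
    also have "\<dots> = (\<integral>x. ?p k x * ?p k x - (2 * (?\<gamma> x * ?p k x) - ?\<gamma> x * ?\<gamma> x) \<partial>\<pi>)"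
      by (intro Bochner_Integration.integral_cong) (auto simp: algebra_simps)
    also have "\<dots> = ?I (?p k) (?p k) - (2 * ?I ?\<gamma> (?p k) - ?I ?\<gamma> ?\<gamma>)"
      using L2_integrable_mult[OF p[OF k] p[OF k]] L2_integrable_mult[OF \<gamma> p[OF k]] L2_integrable_mult[OF \<gamma> \<gamma>] by simp
    finally show "cond_cov k (?p (cyc K k)) (?p (cyc K k)) = ?I (?p (cyc K k)) (?p (cyc K k)) - ?I (?p k) (?p k) + (2 * ?I ?\<gamma> (?p k) - ?I ?\<gamma> ?\<gamma>)"
      by (simp add: cond_cov_def)
  qed
  also have "\<dots> = (\<Sum>k=1..K. 2 * ?I ?\<gamma> (?p k) - ?I ?\<gamma> ?\<gamma>)"
    using sum_cyc[OF K1, of "\<lambda>k. ?I (?p k) (?p k)"] by (simp add: sum.distrib sum_subtractf)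
  finally have cv_sum_eq: "(\<Sum>k=1..K. cond_cov k (?p (cyc K k)) (?p (cyc K k))) = (\<Sum>k=1..K. 2 * ?I ?\<gamma> (?p k) - ?I ?\<gamma> ?\<gamma>)" .
  have "(\<Sum>k=1..K. a \<bullet> ((\<Sum>t. lag_cov \<pi> K Q g k (Suc t)) *v a)) = (\<Sum>k=1..K. 2 * ?I ?\<gamma> (?p k) - 2 * ?I ?\<gamma> ?\<gamma>)"
    by (rule sum.cong[OF refl]) (rule lag_cov_form)
  then have "a \<bullet> (G0 *v a) = ?I ?\<gamma> ?\<gamma> + (1 / real K) * (\<Sum>k=1..K. 2 * ?I ?\<gamma> (?p k) - 2 * ?I ?\<gamma> ?\<gamma>)"
    by (simp only: G0_def matrix_vector_mult_add_rdistrib inner_add_right scaleR_matrix_vector_assoc[symmetric]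
        sum_matrix_form integral_outer_form[OF L2v_g L2v_g] inner_scaleR_right)
  also have "\<dots> = (1 / real K) * (\<Sum>k=1..K. 2 * ?I ?\<gamma> (?p k) - ?I ?\<gamma> ?\<gamma>)"
    using K0 by (simp add: sum_subtractf field_simps)
  finally show ?thesis by (simp only: cv_sum_eq)
qed

text \<open>Expanding the square identifies the quadratic in \<open>C\<close> with the average
  conditional variance of the increment function
  \<open>a \<bullet> gh (cyc K k) x - (C *v a) \<bullet> f x\<close>. Equal arguments on both sides
  suffice, as the matrix is symmetric.\<close>

lemma asvar_form:
  "a \<bullet> (asvar C *v a) = (1 / real K) * (\<Sum>k=1..K. cond_cov k (\<lambda>x. a \<bullet> gh (cyc K k) x - (C *v a) \<bullet> f x) (\<lambda>x. a \<bullet> gh (cyc K k) x - (C *v a) \<bullet> f x))"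
proof -
  let ?c = "C *v a"
  have "a \<bullet> (asvar C *v a) = a \<bullet> (G0 *v a) + ?c \<bullet> (U *v ?c) - 2 * (?c \<bullet> (V *v a))"
    by (simp add: asvar_def matrix_vector_mult_diff_rdistrib matrix_vector_mult_add_rdistrib
        inner_add_right inner_diff_right inner_transpose_mult inner_commute[of "V *v a"]
        del: transpose_matrix_vector flip: matrix_vector_mul_assoc)
  also have "\<dots> = (1 / real K) * (\<Sum>k=1..K. cond_cov k (\<lambda>x. a \<bullet> gh (cyc K k) x) (\<lambda>x. a \<bullet> gh (cyc K k) x)
      + cond_cov k (\<lambda>x. ?c \<bullet> f x) (\<lambda>x. ?c \<bullet> f x) - 2 * cond_cov k (\<lambda>x. ?c \<bullet> f x) (\<lambda>x. a \<bullet> gh (cyc K k) x))"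
    unfolding G0_form U_form V_form by (simp add: sum.distrib sum_subtractf sum_distrib_left algebra_simps)
  also have "(\<Sum>k=1..K. cond_cov k (\<lambda>x. a \<bullet> gh (cyc K k) x) (\<lambda>x. a \<bullet> gh (cyc K k) x)
      + cond_cov k (\<lambda>x. ?c \<bullet> f x) (\<lambda>x. ?c \<bullet> f x) - 2 * cond_cov k (\<lambda>x. ?c \<bullet> f x) (\<lambda>x. a \<bullet> gh (cyc K k) x))
    = (\<Sum>k=1..K. cond_cov k (\<lambda>x. a \<bullet> gh (cyc K k) x - ?c \<bullet> f x) (\<lambda>x. a \<bullet> gh (cyc K k) x - ?c \<bullet> f x))"
  proof (intro sum.cong refl)
    fix k assume k: "k \<in> {1..K}"
    show "cond_cov k (\<lambda>x. a \<bullet> gh (cyc K k) x) (\<lambda>x. a \<bullet> gh (cyc K k) x)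
      + cond_cov k (\<lambda>x. ?c \<bullet> f x) (\<lambda>x. ?c \<bullet> f x) - 2 * cond_cov k (\<lambda>x. ?c \<bullet> f x) (\<lambda>x. a \<bullet> gh (cyc K k) x)
      = cond_cov k (\<lambda>x. a \<bullet> gh (cyc K k) x - ?c \<bullet> f x) (\<lambda>x. a \<bullet> gh (cyc K k) x - ?c \<bullet> f x)"
      using cond_cov_diff_square[OF k L2v_inner[OF L2v_gh[OF cycr[OF k]], of a] L2v_inner[OF L2v_f, of ?c]] by simp
  qed
  finally show ?thesis .
qed

lemma symmetric_U: "transpose U = U"
proof -
  have "transpose (U_comp \<pi> Q f k) = U_comp \<pi> Q f k" for k
    unfolding U_comp_def
  proof (rule transpose_integral)
    fix x
    have "transpose (A - B) = transpose A - transpose B" for A B :: "real^'p^'p" by (simp add: vec_eq_iff transpose_def)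
    then show "transpose (outer (f x) (f x) - outer (kernel_op_vec (Q k) f x) (kernel_op_vec (Q k) f x))
      = outer (f x) (f x) - outer (kernel_op_vec (Q k) f x) (kernel_op_vec (Q k) f x)" by (simp add: transpose_outer)
  qed
  then show ?thesis
    unfolding U_mat_def
    by (simp add: linear_sum[OF bounded_linear.linear[OF bounded_linear_transpose]]
        linear_scale[OF bounded_linear.linear[OF bounded_linear_transpose]])
qed

lemma symmetric_G0: "transpose G0 = G0"
proof -
  note lin = bounded_linear.linear[OF bounded_linear_transpose]
  have "transpose (lag_cov \<pi> K Q g k t) = lag_cov \<pi> K Q g k t" for k t
    unfolding lag_cov_def
    by (rule transpose_integral) (simp add: linear_add[OF lin] transpose_outer add.commute)
  then have "transpose (\<Sum>t. lag_cov \<pi> K Q g k (Suc t)) = (\<Sum>t. lag_cov \<pi> K Q g k (Suc t))" if "k \<in> {1..K}" for k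
    using bounded_linear.suminf[OF bounded_linear_transpose lag_cov_summable[OF that]] by simp
  moreover have "transpose (\<integral>x. outer (g x) (g x) \<partial>\<pi>) = (\<integral>x. outer (g x) (g x) \<partial>\<pi>)"
    by (rule transpose_integral) (simp add: transpose_outer)
  ultimately show ?thesis
    unfolding G0_def by (simp add: linear_add[OF lin] linear_scale[OF lin] linear_sum[OF lin])
qed

lemma psd_U: "psd U"
  unfolding psd_def
proof (intro conjI symmetric_U allI)
  fix c
  show "0 \<le> c \<bullet> (U *v c)"
    unfolding U_form by (intro mult_nonneg_nonneg sum_nonneg cond_cov_nonneg L2v_inner L2v_f) auto
qed

lemma psd_asvar: "psd (asvar C)"
  unfolding psd_def
proof (intro conjI allI)
  note lin = bounded_linear.linear[OF bounded_linear_transpose]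
  show "transpose (asvar C) = asvar C"
    unfolding asvar_def
    by (simp add: linear_add[OF lin] linear_diff[OF lin] matrix_transpose_mul symmetric_U symmetric_G0 matrix_mul_assoc)
  fix a
  show "0 \<le> a \<bullet> (asvar C *v a)"
    unfolding asvar_form
    by (intro mult_nonneg_nonneg sum_nonneg cond_cov_nonneg L2_diff L2v_inner L2v_f L2v_gh cycr) auto
qed

lemma asvar_minimal: "psd (asvar C - asvar (pinv U ** V))"
  unfolding asvar_def by (rule psd_quadratic_minimizer[OF psd_U]) (rule psd_asvar[unfolded asvar_def])

end

context control_variates
begin

subsection \<open>The central limit theorem for the control variate sums\<close>

definition \<theta> :: "real^'d^'p \<Rightarrow> real^'d \<Rightarrow> nat \<Rightarrow> 'x \<Rightarrow> real" where
  "\<theta> C a t x = a \<bullet> g x - (C *v a) \<bullet> (f x - kernel_op_vec (Q (label t)) f x)"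

lemma \<theta>_measurable: "\<theta> C a t \<in> borel_measurable borel"
proof -
  have [measurable]: "kernel_op_vec (Q (label t)) f \<in> borel_measurable borel"
    using L2v_kernel_op_vec[OF label_range L2v_f] by (simp add: L2v_def)
  show ?thesis unfolding \<theta>_def[abs_def] by measurable
qed

lemma inner_cv_sum: "a \<bullet> cv_sum K Q g f C X n w = (\<Sum>t<n. \<theta> C a t (X t w))"
  unfolding cv_sum_def \<theta>_def inner_sum_right
  by (intro sum.cong refl) (simp only: label_def inner_diff_right[of a] inner_transpose_mult)

lemma cv_sum_measurable:
  assumes "\<And>t. X t \<in> M \<rightarrow>\<^sub>M borel"
  shows "cv_sum K Q g f C X n \<in> borel_measurable M"
proof (rule borel_measurable_vecI)
  fix i :: 'd
  note [measurable] = \<theta>_measurable assms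
  have "cv_sum K Q g f C X n w $ i = (\<Sum>t<n. \<theta> C (axis i 1) t (X t w))" for w
    using inner_cv_sum[of "axis i 1" C X n w] by (simp add: inner_axis')
  then show "(\<lambda>w. cv_sum K Q g f C X n w $ i) \<in> borel_measurable M" by simp measurable
qed

lemma cv_sum_char_tendsto:
  assumes chain: "sweep_chain K Q \<nu> M X"
  shows "(\<lambda>n. CLINT w|M. iexp (a \<bullet> ((1 / sqrt (real n)) *\<^sub>R cv_sum K Q g f C X n w)))
    \<longlonglongrightarrow> of_real (exp (- (a \<bullet> (asvar C *v a)) / 2))"
proof -
  let ?c = "C *v a"
  \<comment> \<open>The label is advanced by one because \<open>gh\<close> is evaluated at the state
    after step \<open>t\<close>, from which the next kernel is \<open>label (Suc t)\<close>.\<close>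
  define u where "u t x = a \<bullet> gh (label (Suc t)) x - ?c \<bullet> f x" for t x
  have u_L2: "L2 (u t)" for t
    unfolding u_def[abs_def] by (intro L2_diff L2v_inner L2v_gh L2v_f label_range)
  obtain \<tau> where "ergodic_periodic \<pi> (\<lambda>t. Q (label t)) K \<tau>" using ergodic_periodic_exists by blast
  then interpret E: ergodic_periodic \<pi> "\<lambda>t. Q (label t)" K \<tau> .
  interpret A: martingale_array \<pi> "\<lambda>t. Q (label t)" K u
  proof unfold_locales
    show "u t \<in> borel_measurable borel" "integrable \<pi> (\<lambda>x. (u t x)\<^sup>2)" for t using u_L2[of t] by (auto simp: L2_def)
    show "u (t + K) = u t" for t using label_period[of "Suc t"] by (simp add: u_def fun_eq_iff)
  qed (rule E.mixing)
  have cu: "A.cu t = kernel_op (Q (label t)) (u t)" for t by (simp add: A.cu_def fun_eq_iff kernel_op_def)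
  \<comment> \<open>The Poisson equation writes \<open>a \<bullet> g\<close> as \<open>gh\<close> at
    \<open>label t\<close> minus the conditional mean of the next \<open>gh\<close>; the control
    variate, \<open>f\<close> minus its conditional mean, already has this shape.\<close>
  have cob: "AE x in \<pi>. \<theta> C a t x = u (t + K - 1) x - A.cu t x" for t
  proof -
    have "label (Suc (t + K - 1)) = label t" using K1 label_period[of t] by simp
    then have u': "u (t + K - 1) x = a \<bullet> gh (label t) x - ?c \<bullet> f x" for x by (simp only: u_def)
    have diff: "AE x in \<pi>. A.cu t x = kernel_op (Q (label t)) (\<lambda>x. a \<bullet> gh (cyc K (label t)) x) x - kernel_op (Q (label t)) (\<lambda>x. ?c \<bullet> f x) x"
      unfolding cu u_def label_Suc by (intro kernel_op_diff_AE label_range L2v_inner L2v_gh L2v_f cycr)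
    show ?thesis
      using diff poisson_inner[OF label_range[of t], of a] inner_kernel_op_vec[OF label_range[of t] L2v_f, of ?c]
      by eventually_elim (simp only: u' \<theta>_def inner_diff_right)
  qed
  have "A.v t = cond_cov (label t) (u t) (u t)" for t
    unfolding A.v_eq cond_cov_def cu by (simp add: power2_eq_square)
  then have "(\<Sum>t<K. A.v t) = (\<Sum>t<K. (\<lambda>k. cond_cov k (\<lambda>x. a \<bullet> gh (cyc K k) x - ?c \<bullet> f x) (\<lambda>x. a \<bullet> gh (cyc K k) x - ?c \<bullet> f x)) (label t))"
    by (simp add: u_def[abs_def] label_Suc)
  also have "\<dots> = (\<Sum>k=1..K. cond_cov k (\<lambda>x. a \<bullet> gh (cyc K k) x - ?c \<bullet> f x) (\<lambda>x. a \<bullet> gh (cyc K k) x - ?c \<bullet> f x))"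
    unfolding label_def by (rule sum_cyc_funpow[OF K1])
  finally have var: "(\<Sum>t<K. A.v t) / real K = a \<bullet> (asvar C *v a)" by (simp add: asvar_form)
  let ?S = "\<lambda>n t. twisted (\<lambda>x. iexp (\<theta> C a t x / sqrt (real n))) (\<lambda>_. 1) (Q (label t))"
  interpret M: prob_space M using chain by (simp add: sweep_chain_def)
  have X[measurable]: "X t \<in> M \<rightarrow>\<^sub>M borel" for t using chain by (simp add: sweep_chain_def)
  have \<nu>: "\<nu> = distr M borel (X 0)" using chain by (simp add: sweep_chain_def)
  have "prob_space \<nu>" "sets \<nu> = sets borel" unfolding \<nu> by (auto intro!: M.prob_space_distr)
  \<comment> \<open>The limit under \<pi> and the vanishing difference of the two initial laws add
    up to the limit under \<nu>.\<close>
  from tendsto_add[OF E.initial_law_forgotten[where \<theta>="\<theta> C a", OF \<theta>_measurable this] A.additive_char_tendsto[where \<theta>="\<theta> C a", OF \<theta>_measurable cob]]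
  have "(\<lambda>n. CLINT x|\<nu>. op_prod (?S n) 0 n (\<lambda>_. 1) x) \<longlonglongrightarrow> of_real (exp (- (a \<bullet> (asvar C *v a)) / 2))"
    by (simp only: var diff_add_cancel add_0)
  moreover have "(CLINT x|\<nu>. op_prod (?S n) 0 n (\<lambda>_. 1) x) = (CLINT w|M. iexp (a \<bullet> ((1 / sqrt (real n)) *\<^sub>R cv_sum K Q g f C X n w)))" for n
  proof -
    have "a \<bullet> ((1 / sqrt (real n)) *\<^sub>R cv_sum K Q g f C X n w) = (\<Sum>t<n. \<theta> C a t (X t w) / sqrt (real n))" for w
      by (simp only: inner_scaleR_right inner_cv_sum sum_divide_distrib mult_1_left times_divide_eq_left)
    moreover have "(CLINT w|M. iexp (\<Sum>t<n. \<theta> C a t (X t w) / sqrt (real n)))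
      = (CLINT x|\<nu>. op_prod (?S n) 0 n (\<lambda>_. 1) x)"
      unfolding label_def
      by (rule sweep_chain_char[OF chain, of "\<lambda>t x. \<theta> C a t x / sqrt (real n)", unfolded label_def])
        (use kernel_Q[OF label_range] \<theta>_measurable in \<open>auto simp: label_def\<close>)
    ultimately show ?thesis by (simp only:)
  qed
  ultimately show ?thesis by (simp only:)
qed

theorem cv_sum_asymptotic_variance:
  assumes chain: "sweep_chain K Q \<nu> M X"
  shows "has_asymptotic_variance M (cv_sum K Q g f C X) (asvar C)"
proof -
  obtain \<mu> where \<mu>: "prob_space \<mu>" "sets \<mu> = sets borel"
    "\<And>t. (CLINT y|\<mu>. iexp (t \<bullet> y)) = exp (- complex_of_real (t \<bullet> (asvar C *v t)) / 2)"
    using gaussian_measure_exists[OF psd_asvar] by blast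
  have M: "prob_space M" and X: "\<And>t. X t \<in> M \<rightarrow>\<^sub>M borel" using chain by (auto simp: sweep_chain_def)
  have "converges_in_distribution M (\<lambda>n w. (1 / sqrt (real n)) *\<^sub>R cv_sum K Q g f C X n w) \<mu>"
  proof (rule vector_levy_continuity[OF M _ \<mu>(1,2)])
    show "(\<lambda>w. (1 / sqrt (real n)) *\<^sub>R cv_sum K Q g f C X n w) \<in> borel_measurable M" for n
      by (intro borel_measurable_scaleR borel_measurable_const cv_sum_measurable X)
    show "(\<lambda>n. CLINT w|M. iexp (a \<bullet> ((1 / sqrt (real n)) *\<^sub>R cv_sum K Q g f C X n w))) \<longlonglongrightarrow> (CLINT y|\<mu>. iexp (a \<bullet> y))" for a
      using cv_sum_char_tendsto[OF chain, of a C] unfolding \<mu>(3) by (simp only: exp_of_real[symmetric] of_real_divide of_real_minus of_real_numeral)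
  qed
  with \<mu> show ?thesis unfolding has_asymptotic_variance_def using psd_asvar by blast
qed

end

subsection \<open>Gibbs kernels\<close>

lemma (in sigma_finite_subalgebra) real_cond_exp_contraction:
  assumes w: "integrable M w"
  shows "(\<integral>x. \<bar>real_cond_exp M F w x\<bar> \<partial>M) \<le> (\<integral>x. \<bar>w x\<bar> \<partial>M)"
proof -
  have a: "integrable M (\<lambda>x. \<bar>w x\<bar>)" "integrable M (\<lambda>x. - 1 * \<bar>w x\<bar>)" using w by auto
  have "AE x in M. real_cond_exp M F w x \<le> real_cond_exp M F (\<lambda>x. \<bar>w x\<bar>) x"
    using w a by (intro real_cond_exp_mono) auto
  moreover have "AE x in M. real_cond_exp M F (\<lambda>x. - 1 * \<bar>w x\<bar>) x \<le> real_cond_exp M F w x"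
    using w a by (intro real_cond_exp_mono) auto
  moreover have "AE x in M. real_cond_exp M F (\<lambda>x. - 1 * \<bar>w x\<bar>) x = - 1 * real_cond_exp M F (\<lambda>x. \<bar>w x\<bar>) x"
    using a by (intro real_cond_exp_cmult) auto
  ultimately have "AE x in M. \<bar>real_cond_exp M F w x\<bar> \<le> real_cond_exp M F (\<lambda>x. \<bar>w x\<bar>) x"
    by eventually_elim auto
  then have "(\<integral>x. \<bar>real_cond_exp M F w x\<bar> \<partial>M) \<le> (\<integral>x. real_cond_exp M F (\<lambda>x. \<bar>w x\<bar>) x \<partial>M)"
    using w a real_cond_exp_int(1) by (intro integral_mono_AE) auto
  also have "\<dots> = (\<integral>x. \<bar>w x\<bar> \<partial>M)" by (rule real_cond_exp_int(2)[OF a(1)])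
  finally show ?thesis .
qed

lemma (in stationary_pair) kernel_contraction:
  fixes w :: "'x \<Rightarrow> real"
  assumes w: "integrable \<pi> w"
  shows "(\<integral>x. \<bar>\<integral>y. w y \<partial>P x\<bar> \<partial>\<pi>) \<le> (\<integral>x. \<bar>w x\<bar> \<partial>\<pi>)"
proof -
  have a: "integrable \<pi> (\<lambda>x. \<bar>w x\<bar>)" using w by simp
  have "(\<integral>x. \<bar>\<integral>y. w y \<partial>P x\<bar> \<partial>\<pi>) \<le> (\<integral>x. \<integral>y. \<bar>w y\<bar> \<partial>P x \<partial>\<pi>)"
    using integrable_stationary[OF w] integrable_stationary[OF a] by (intro integral_mono) (auto intro: integral_abs_bound)
  also have "\<dots> = (\<integral>x. \<bar>w x\<bar> \<partial>\<pi>)" by (rule integral_stationary[OF a])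
  finally show ?thesis .
qed

locale gibbs_pair = stationary_pair \<pi> P for \<pi> :: "'x::polish_space measure" and P +
  fixes N :: "'y measure" and h
  assumes h: "h \<in> borel \<rightarrow>\<^sub>M N" and gibbs: "gibbs_kernel \<pi> N h P"
begin

definition F :: "'x measure" where "F = vimage_algebra (space \<pi>) h N"

sublocale C: finite_measure_subalgebra \<pi> F
proof (intro finite_measure_subalgebra.intro finite_measure_subalgebra_axioms.intro)
  show "finite_measure \<pi>" using prob_\<pi> by (rule prob_space.finite_measure)
  have "h \<in> \<pi> \<rightarrow>\<^sub>M N" using h by (simp add: measurable_cong_sets[OF sets_\<pi> refl])
  then show "subalgebra \<pi> F" unfolding subalgebra_def F_def
    by (auto simp: sets_vimage_algebra2 measurable_space)
qed

text \<open>Both sides contract the L1 norm and agree on indicators by the Gibbs property, so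
  agreement passes to limits: the L1 distance is at most \<open>2 * d n\<close> for every
  \<open>n\<close>.\<close>

lemma kernel_eq_cond_exp:
  assumes "integrable \<pi> u"
  shows "AE x in \<pi>. (\<integral>y. u y \<partial>P x) = real_cond_exp \<pi> F u x"
  using assms
proof (induct rule: integrable_induct)
  case (base A c)
  have A: "A \<in> sets borel" using base sets_\<pi> by simp
  have "AE x in \<pi>. real_cond_exp \<pi> F (\<lambda>x. c * indicat_real A x) x = c * real_cond_exp \<pi> F (indicat_real A) x"
    using base by (intro C.real_cond_exp_cmult) auto
  moreover have "AE x in \<pi>. measure (P x) A = real_cond_exp \<pi> F (indicat_real A) x"
    using gibbs A by (simp add: gibbs_kernel_def F_def)
  ultimately show ?case
  proof eventually_elim
    case (elim x)
    have "A \<in> sets (P x)" using A prob_kernelD(2)[OF kernel_P] by simp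
    then show ?case using elim by (simp add: mult.commute)
  qed
next
  case (add u w)
  show ?case
    using AE_integrable_stationary[OF add(1)] AE_integrable_stationary[OF add(3)] C.real_cond_exp_add[OF add(1,3)] add(2,4)
    by eventually_elim simp
next
  case (lim u s)
  let ?E = "real_cond_exp \<pi> F"
  define d where "d n = (\<integral>x. \<bar>u x - s n x\<bar> \<partial>\<pi>)" for n
  have i: "integrable \<pi> (\<lambda>x. u x - s n x)" for n using lim by simp
  have um: "u \<in> borel_measurable \<pi>" "s n \<in> borel_measurable \<pi>" for n using lim by auto
  have "(\<lambda>n. d n) \<longlonglongrightarrow> (\<integral>x. 0 \<partial>\<pi>)"
    unfolding d_def
  proof (rule integral_dominated_convergence[where w="\<lambda>x. 3 * \<bar>u x\<bar>"])
    show "integrable \<pi> (\<lambda>x. 3 * \<bar>u x\<bar>)" using lim by simp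
    show "AE x in \<pi>. (\<lambda>n. \<bar>u x - s n x\<bar>) \<longlonglongrightarrow> 0"
    proof (intro AE_I2)
      fix x assume "x \<in> space \<pi>"
      then have "(\<lambda>n. s n x) \<longlonglongrightarrow> u x" by (rule lim)
      from tendsto_rabs[OF tendsto_diff[OF tendsto_const[of "u x"] this]] show "(\<lambda>n. \<bar>u x - s n x\<bar>) \<longlonglongrightarrow> 0" by simp
    qed
    show "AE x in \<pi>. norm \<bar>u x - s n x\<bar> \<le> 3 * \<bar>u x\<bar>" for n
      using lim(4)[of _ n] by (intro AE_I2) (force simp: abs_if split: if_splits)
  qed (use um in measurable)
  then have d0: "d \<longlonglongrightarrow> 0" by simp
  have iQ: "integrable \<pi> (\<lambda>x. \<integral>y. u y \<partial>P x)" and iE: "integrable \<pi> (?E u)"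
    using lim integrable_stationary C.real_cond_exp_int(1) by auto
  have "(\<integral>x. \<bar>(\<integral>y. u y \<partial>P x) - ?E u x\<bar> \<partial>\<pi>) \<le> 2 * d n" for n
  proof -
    have "AE x in \<pi>. \<bar>(\<integral>y. u y \<partial>P x) - ?E u x\<bar> \<le> \<bar>\<integral>y. u y - s n y \<partial>P x\<bar> + \<bar>?E (\<lambda>x. u x - s n x) x\<bar>"
      using AE_integrable_stationary[OF lim(5)] AE_integrable_stationary[OF lim(1)[of n]]
        C.real_cond_exp_diff[OF lim(5) lim(1)[of n]] lim(2)[of n]
      by eventually_elim simp
    then have "(\<integral>x. \<bar>(\<integral>y. u y \<partial>P x) - ?E u x\<bar> \<partial>\<pi>) \<le> (\<integral>x. \<bar>\<integral>y. u y - s n y \<partial>P x\<bar> + \<bar>?E (\<lambda>x. u x - s n x) x\<bar> \<partial>\<pi>)"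
      using iQ iE integrable_stationary[OF i] C.real_cond_exp_int(1)[OF i] by (intro integral_mono_AE) auto
    also have "\<dots> = (\<integral>x. \<bar>\<integral>y. u y - s n y \<partial>P x\<bar> \<partial>\<pi>) + (\<integral>x. \<bar>?E (\<lambda>x. u x - s n x) x\<bar> \<partial>\<pi>)"
      using integrable_stationary[OF i] C.real_cond_exp_int(1)[OF i] by (intro Bochner_Integration.integral_add) auto
    also have "\<dots> \<le> d n + d n"
      unfolding d_def by (intro add_mono kernel_contraction C.real_cond_exp_contraction i)
    finally show ?thesis by simp
  qed
  then have "(\<integral>x. \<bar>(\<integral>y. u y \<partial>P x) - ?E u x\<bar> \<partial>\<pi>) \<le> 2 * 0"
    by (intro LIMSEQ_le_const[OF tendsto_mult_left[OF d0]]) auto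
  moreover have "0 \<le> (\<integral>x. \<bar>(\<integral>y. u y \<partial>P x) - ?E u x\<bar> \<partial>\<pi>)" by simp
  ultimately have "(\<integral>x. \<bar>(\<integral>y. u y \<partial>P x) - ?E u x\<bar> \<partial>\<pi>) = 0" by linarith
  then have "AE x in \<pi>. \<bar>(\<integral>y. u y \<partial>P x) - ?E u x\<bar> = 0"
    using iQ iE by (subst (asm) integral_nonneg_eq_0_iff_AE) auto
  then show ?case by eventually_elim simp
qed

lemma kernel_self_adjoint_projection:
  fixes u w :: "'x \<Rightarrow> real"
  assumes u: "integrable \<pi> u" and w: "integrable \<pi> w" and uw: "integrable \<pi> (\<lambda>x. u x * (\<integral>y. w y \<partial>P x))"
  shows "(\<integral>x. (\<integral>y. u y \<partial>P x) * (\<integral>y. w y \<partial>P x) \<partial>\<pi>) = (\<integral>x. u x * (\<integral>y. w y \<partial>P x) \<partial>\<pi>)"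
proof -
  let ?E = "real_cond_exp \<pi> F"
  note eq = kernel_eq_cond_exp[OF u] kernel_eq_cond_exp[OF w]
  have [measurable]: "u \<in> borel_measurable \<pi>" "(\<lambda>x. \<integral>y. u y \<partial>P x) \<in> borel_measurable \<pi>" "(\<lambda>x. \<integral>y. w y \<partial>P x) \<in> borel_measurable \<pi>"
    using u integrable_stationary[OF u] integrable_stationary[OF w] by auto
  have [measurable]: "?E u \<in> borel_measurable \<pi>" "?E w \<in> borel_measurable \<pi>" by auto
  have eq': "AE x in \<pi>. u x * (\<integral>y. w y \<partial>P x) = ?E w x * u x" using eq(2) by eventually_elim simp
  have i: "integrable \<pi> (\<lambda>x. ?E w x * u x)"
    using uw by (subst (asm) integrable_cong_AE[OF _ _ eq']) measurable
  have "(\<integral>x. (\<integral>y. u y \<partial>P x) * (\<integral>y. w y \<partial>P x) \<partial>\<pi>) = (\<integral>x. ?E w x * ?E u x \<partial>\<pi>)"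
  proof (rule integral_cong_AE)
    show "AE x in \<pi>. (\<integral>y. u y \<partial>P x) * (\<integral>y. w y \<partial>P x) = ?E w x * ?E u x"
      using eq by eventually_elim simp
  qed measurable
  also have "\<dots> = (\<integral>x. ?E w x * u x \<partial>\<pi>)" by (rule C.real_cond_exp_intg(2)[OF i]) auto
  also have "\<dots> = (\<integral>x. u x * (\<integral>y. w y \<partial>P x) \<partial>\<pi>)"
  proof (rule integral_cong_AE)
    show "AE x in \<pi>. ?E w x * u x = u x * (\<integral>y. w y \<partial>P x)" using eq' by eventually_elim (rule sym)
  qed measurable
  finally show ?thesis .
qed

end

context control_variates
begin

lemma V_gibbs:
  assumes h: "\<And>k. k \<in> {1..K} \<Longrightarrow> h k \<in> borel \<rightarrow>\<^sub>M N k" and gibbs: "\<And>k. k \<in> {1..K} \<Longrightarrow> gibbs_kernel \<pi> (N k) (h k) (Q k)"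
  shows "V = (\<integral>x. outer (f x) (g x) \<partial>\<pi>)"
proof (rule matrix_eqI_form)
  fix c a
  let ?p = "\<lambda>k x. a \<bullet> gh k x" and ?\<phi> = "\<lambda>x. c \<bullet> f x"
  let ?I = "\<lambda>w. \<integral>x. ?\<phi> x * w x \<partial>\<pi>"
  have \<phi>: "L2 ?\<phi>" and \<gamma>: "L2 (\<lambda>x. a \<bullet> g x)" by (intro L2v_inner L2v_f L2v_g)+
  have p: "L2 (?p k)" if "k \<in> {1..K}" for k by (rule L2v_inner[OF L2v_gh[OF that]])
  have "cond_cov k ?\<phi> (?p (cyc K k)) = ?I (?p (cyc K k)) - ?I (?p k) + ?I (\<lambda>x. a \<bullet> g x)" if k: "k \<in> {1..K}" for k
  proof -
    interpret gibbs_pair \<pi> "Q k" "N k" "h k"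
      using Q_stationary[OF k] h[OF k] gibbs[OF k] by (intro gibbs_pair.intro gibbs_pair_axioms.intro)
    note pc = p[OF cycr[OF k]]
    have "(\<integral>x. kernel_op (Q k) ?\<phi> x * kernel_op (Q k) (?p (cyc K k)) x \<partial>\<pi>) = (\<integral>x. ?\<phi> x * kernel_op (Q k) (?p (cyc K k)) x \<partial>\<pi>)"
      unfolding kernel_op_def
      by (rule kernel_self_adjoint_projection[OF L2_integrable[OF \<phi>] L2_integrable[OF pc]
            L2_integrable_mult[OF \<phi> L2_kernel_op[OF k pc, unfolded kernel_op_def[abs_def]]]])
    also have "\<dots> = (\<integral>x. ?\<phi> x * (?p k x - a \<bullet> g x) \<partial>\<pi>)"
      by (rule integral_L2_cong[OF _ poisson_inner[OF k] \<phi> \<phi> L2_kernel_op[OF k pc] L2_diff[OF p[OF k] \<gamma>]]) simp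
    also have "\<dots> = ?I (?p k) - ?I (\<lambda>x. a \<bullet> g x)"
      using L2_integrable_mult[OF \<phi> p[OF k]] L2_integrable_mult[OF \<phi> \<gamma>] by (simp add: right_diff_distrib)
    finally show ?thesis by (simp add: cond_cov_def)
  qed
  then have "(\<Sum>k=1..K. cond_cov k ?\<phi> (?p (cyc K k))) = (\<Sum>k=1..K. ?I (?p (cyc K k)) - ?I (?p k) + ?I (\<lambda>x. a \<bullet> g x))"
    by (intro sum.cong refl)
  also have "\<dots> = real K * ?I (\<lambda>x. a \<bullet> g x)"
    using sum_cyc[OF K1, of "\<lambda>k. ?I (?p k)"] by (simp add: sum.distrib sum_subtractf)
  finally show "c \<bullet> (V *v a) = c \<bullet> ((\<integral>x. outer (f x) (g x) \<partial>\<pi>) *v a)"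
    using K1 by (simp add: V_form integral_outer_form[OF L2v_f L2v_g])
qed

end

text \<open>Summability is asserted along with the formula, because a divergent series would have a
  default value. A single matrix function \<Sigma> serves all chains and initial laws, so that the
  minimality compares genuine asymptotic variances.\<close>

theorem corollary1:
  fixes \<pi> \<psi> :: "'x::polish_space measure"
    and K :: nat
    and Q :: "nat \<Rightarrow> 'x \<Rightarrow> 'x measure"
    and g :: "'x \<Rightarrow> real^'d"
    and f :: "'x \<Rightarrow> real^'p"
    and D :: "nat \<Rightarrow> 'x set"
    and lam b :: "nat \<Rightarrow> real"
    and W :: "nat \<Rightarrow> 'x \<Rightarrow> real"
  assumes "prob_space \<pi>" and "sets \<pi> = sets borel"
    and "K \<ge> 1"
    and "\<And>k. k \<in> {1..K} \<Longrightarrow> prob_kernel (Q k)"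
    and "g \<in> borel_measurable borel" and "f \<in> borel_measurable borel"
    and i: "\<And>k. k \<in> {1..K} \<Longrightarrow> stationary_kernel \<pi> (Q k)"
    and ii: "prob_space \<psi>" "sets \<psi> = sets borel"
      "\<And>k A x. k \<in> {1..K} \<Longrightarrow> A \<in> sets borel \<Longrightarrow> emeasure \<psi> A > 0 \<Longrightarrow>
         \<exists>t>0. emeasure (sweep_kernel K Q k (K * t) x) A > 0"
    and iii: "\<And>k. k \<in> {1..K} \<Longrightarrow> small_set (sweep_kernel K Q k K) (D k)"
      "\<And>k. k \<in> {1..K} \<Longrightarrow> lam k < 1"
      "\<And>k. k \<in> {1..K} \<Longrightarrow> W k \<in> borel_measurable borel"
      "\<And>k x. k \<in> {1..K} \<Longrightarrow> W k x \<ge> 1"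
      "\<And>k x. k \<in> {1..K} \<Longrightarrow>
         (\<integral>\<^sup>+ y. ennreal (W k y) \<partial>sweep_kernel K Q k K x)
           \<le> ennreal (lam k * W k x + b k * indicat_real (D k) x)"
    and iv: "\<And>k. k \<in> {1..K} \<Longrightarrow> aperiodic_kernel \<psi> (sweep_kernel K Q k K)"
    and v: "\<And>k. k \<in> {1..K} \<Longrightarrow> integrable \<pi> (\<lambda>x. (W k x)\<^sup>2)"
    and vi: "\<And>k x a. k \<in> {1..K} \<Longrightarrow> norm a \<le> 1 \<Longrightarrow> \<bar>a \<bullet> g x\<bar> \<le> W k x"
    and vii: "(\<integral>x. g x \<partial>\<pi>) = 0"
    and viii: "integrable \<pi> (\<lambda>x. f x \<bullet> f x)"
  shows
    "(\<forall>k\<in>{1..K}. summable (\<lambda>t. lag_cov \<pi> K Q g k (Suc t))) \<and>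
     (\<exists>\<Sigma> :: real^'d^'p \<Rightarrow> real^'d^'d.
        (\<forall>C \<nu> (M :: 'w measure) X. sweep_chain K Q \<nu> M X \<longrightarrow>
           has_asymptotic_variance M (cv_sum K Q g f C X) (\<Sigma> C)) \<and>
        (\<forall>C. \<Sigma> C =
           (\<integral>x. outer (g x) (g x) \<partial>\<pi>)
           + (1 / real K) *\<^sub>R (\<Sum>k=1..K. \<Sum>t. lag_cov \<pi> K Q g k (Suc t))
           + transpose C ** U_mat \<pi> K Q f ** C
           - transpose C ** V_mat \<pi> K Q g f
           - transpose (V_mat \<pi> K Q g f) ** C) \<and>
        (\<forall>C. psd (\<Sigma> C - \<Sigma> (pinv (U_mat \<pi> K Q f) ** V_mat \<pi> K Q g f)))) \<and>
     ((\<exists>(m :: nat \<Rightarrow> nat) (h :: nat \<Rightarrow> 'x \<Rightarrow> nat \<Rightarrow> real). \<forall>k\<in>{1..K}.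
         m k \<ge> 1 \<and> h k \<in> borel \<rightarrow>\<^sub>M (\<Pi>\<^sub>M i\<in>{..<m k}. borel) \<and>
         gibbs_kernel \<pi> (\<Pi>\<^sub>M i\<in>{..<m k}. borel) (h k) (Q k))
      \<longrightarrow> V_mat \<pi> K Q g f = (\<integral>x. outer (f x) (g x) \<partial>\<pi>))"
proof -
  interpret control_variates \<pi> K Q \<psi> D lam b W g f
    by (intro control_variates.intro sweep_ergodic.intro kernel_sweep.intro sweep_ergodic_axioms.intro
        control_variates_axioms.intro) (fact assms)+
  have "\<forall>k\<in>{1..K}. summable (\<lambda>t. lag_cov \<pi> K Q g k (Suc t))"
    using lag_cov_summable by blast
  moreover have "\<forall>C \<nu> (M :: 'w measure) X. sweep_chain K Q \<nu> M X \<longrightarrow>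
      has_asymptotic_variance M (cv_sum K Q g f C X) (asvar C)"
    using cv_sum_asymptotic_variance by blast
  moreover have "\<forall>C. psd (asvar C - asvar (pinv U ** V))"
    using asvar_minimal by blast
  moreover have "V = (\<integral>x. outer (f x) (g x) \<partial>\<pi>)"
    if "\<forall>k\<in>{1..K}. m k \<ge> 1 \<and> h k \<in> borel \<rightarrow>\<^sub>M (\<Pi>\<^sub>M i\<in>{..<m k}. borel) \<and>
      gibbs_kernel \<pi> (\<Pi>\<^sub>M i\<in>{..<m k}. borel) (h k) (Q k)"
    for m :: "nat \<Rightarrow> nat" and h :: "nat \<Rightarrow> 'x \<Rightarrow> nat \<Rightarrow> real"
    by (rule V_gibbs[of h "\<lambda>k. \<Pi>\<^sub>M i\<in>{..<m k}. borel"]) (use that in blast)+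
  ultimately show ?thesis
    using asvar_def[unfolded G0_def] by blast
qed

end
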